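(* The restriction map $$I\colon\mathfrak{F}\mathcal{G}(\overline{\mathbb{R}})/\mathfrak{F}\mathcal{G}(\{\pm\infty\})\to\mathcal{O}^{exp}(\overline{\mathbb{C}}\setminus\overline{\mathbb{R}})/\bigl(\mathcal{O}^{exp}(\overline{\mathbb{C}})\oplus\mathcal{FO}_{\{\pm\infty\}}\bigr),\quad[F]\mapsto[F_+],$$ where $F_+:=F$ on $\mathbb{H}$ and $F_+:=0$ on $-\mathbb{H}$, is a linear isomorphism and $I\circ\mathfrak{F}_{\mathcal{B}}=\mathcal{F}^{\mathcal{B}}$ on $\mathcal{B}(\mathbb{R})$.
   Context: All spaces are spaces of $\mathbb{C}$-valued functions. $\mathbb{N}=\{1,2,\dots\}$, $\overline{\mathbb{R}}:=\mathbb{R}\cup\{\pm\infty\}$, $\overline{\mathbb{C}}:=\overline{\mathbb{R}}+i\mathbb{R}$, $\mathbb{H}:=\{z\mid\operatorname{Im}z>0\}$. Put $d(z,M):=\inf_{w\in M}|z-w|$, $d(z,\emptyset):=\infty$. For compact $K\subset\overline{\mathbb{R}}$ and $c>0$, $U_{1/c}(K)$ is the union of $\{z\in\mathbb{C}\mid d(z,K\cap\mathbb{C})<c\}$ with the strip $]1/c,\infty[\,+\,i\,]-c,c[$ if $\infty\in K$ and with the strip $]-\infty,-1/c[\,+\,i\,]-c,c[$ if $-\infty\in K$. For $n\in\mathbb{N}$, $S_n(K):=(\mathbb{C}\setminus\overline{U_n(K)})\cap\{z\mid|\operatorname{Im}z|<n\}$ ($U_n(K)$ is $U_{1/c}(K)$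 with $c=1/n$). $\mathcal{O}(\Omega)$: holomorphic functions on $\Omega$. $\mathcal{B}(\mathbb{R}):=\mathcal{O}(\mathbb{C}\setminus\mathbb{R})/\mathcal{O}(\mathbb{C})$. $\mathcal{O}^{exp}(\overline{\mathbb{C}}\setminus K)$: all $f\in\mathcal{O}(\mathbb{C}\setminus K)$ with $\sup_{S_n(K)}|f(z)|e^{-\frac1n|\operatorname{Re}z|}<\infty$ for all $n\in\mathbb{N}$; $bv_K:=\mathcal{O}^{exp}(\overline{\mathbb{C}}\setminus K)/\mathcal{O}^{exp}(\overline{\mathbb{C}})$. $\mathcal{FO}_{\{\infty\}}$: all $f\in\mathcal{O}(-\mathbb{H})$ with $\sup_{\operatorname{Im}z\le-\frac1k}|f(z)|e^{-\frac1k|z|+k|\operatorname{Im}z|}<\infty$ for all $k\in\mathbb{N}$. $\mathcal{FO}_{\{-\infty\}}$: all $f\in\mathcal{O}(\mathbb{H})$ with $\sup_{\operatorname{Im}z\ge\frac1k}|f(z)|e^{-\frac1k|z|+k|\operatorname{Im}z|}<\infty$ for all $k$. $\mathcal{FO}_{\{\pm\infty\}}:=\mathcal{FO}_{\{-\infty\}}\oplus\mathcal{FO}_{\{\infty\}}$, where $f+g$ equals $f$ on $\mathbb{H}$ and $g$ on $-\mathbb{H}$; it is regarded as a subspace of $\mathcal{O}^{exp}(\overline{\mathbb{C}}\setminus\overline{\mathbb{R}})$. The transform $\mathcal{F}^{\mathcal{B}}=\mathcal{F}^{\mathcal{B}}_{\mathbb{R}}$: $\mathcal{P}_*(\overline{\mathbb{R}})$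 is the inductive limit over $n\in\mathbb{N}$ of the Banach spaces of functions $\varphi$ holomorphic on $\{|\operatorname{Im}z|<\frac1n\}$, continuous on the closure, with $\sup|\varphi(z)|e^{\frac1n|\operatorname{Re}z|}<\infty$. $\mathcal{F}\varphi(\zeta):=\int_{\mathbb{R}}\varphi(x)e^{-ix\zeta}dx$ is a topological automorphism of it, and $\mathcal{F}_\star(T):=T\circ\mathcal{F}$ for $T\in\mathcal{P}_*(\overline{\mathbb{R}})'$. The map $\mathscr{H}_{\overline{\mathbb{R}}}\colon bv_{\overline{\mathbb{R}}}\to\mathcal{P}_*(\overline{\mathbb{R}})'$, $\mathscr{H}_{\overline{\mathbb{R}}}([F])(\varphi):=\int_{\gamma}F(\zeta)\varphi(\zeta)d\zeta$, with $\gamma$ the clockwise oriented boundary of $\{|\operatorname{Im}z|<c\}$ ($\operatorname{Im}=c$ from left to right, $\operatorname{Im}=-c$ from right to left), $0<c<\frac1n$ for $\varphi$ in the $n$-th step, is an isomorphism with inverse $T\mapsto[z\mapsto\frac{i}{2\pi}\langle T,\frac{e^{-(z-\cdot)^2}}{z-\cdot}\rangle]$; $\mathcal{F}_{\overline{\mathbb{R}}}:=\mathscr{H}_{\overline{\mathbb{R}}}^{-1}\circ\mathcal{F}_\star\circ\mathscr{H}_{\overline{\mathbb{R}}}$. The canonical map $\mathcal{R}_{\mathbb{R}}\colon\mathcal{O}^{exp}(\overline{\mathbb{C}}\setminus\overline{\mathbb{R}})/\mathcal{O}^{exp}(\overline{\mathbb{C}}\setminus\{\pm\infty\})\to\mathcal{B}(\mathbb{R})$,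 $[F]\mapsto[F]$, is a linear isomorphism. $\mathcal{F}^{\mathcal{B}}(f):=[(\mathcal{F}_{\overline{\mathbb{R}}}\circ\mathcal{R}_{\mathbb{R}}^{-1})(f)]\in\mathcal{O}^{exp}(\overline{\mathbb{C}}\setminus\overline{\mathbb{R}})/(\mathcal{O}^{exp}(\overline{\mathbb{C}})\oplus\mathcal{FO}_{\{\pm\infty\}})$. Langenbruch's transform $\mathfrak{F}_{\mathcal{B}}$: $\mathcal{H}_{-\infty}(\overline{\mathbb{C}}\setminus K)$ is the space of all $f\in\mathcal{O}(\mathbb{C}\setminus K)$ with $\sup_{S_n(K)}|f(z)|e^{n|\operatorname{Re}z|}<\infty$ for all $n\in\mathbb{N}$; $\mathcal{G}(K):=\mathcal{H}_{-\infty}(\overline{\mathbb{C}}\setminus K)/\mathcal{H}_{-\infty}(\overline{\mathbb{C}})$. $\mathcal{H}_1^{\pm}$ is the space of all $f\in\mathcal{O}(\mathbb{C})$ with $\sup_{\pm\operatorname{Im}z\le j}|f(z)|e^{-\frac1j|\operatorname{Re}z|+j|\operatorname{Im}z|}<\infty$ for all $j\in\mathbb{N}$. $\mathfrak{F}\mathcal{G}(\overline{\mathbb{R}}):=\mathcal{O}^{exp}(\overline{\mathbb{C}})$ and $\mathfrak{F}\mathcal{G}(\{\pm\infty\}):=\mathcal{H}_1^-\oplus\mathcal{H}_1^+$. The Fourier transform $\mathfrak{F}\colon\mathcal{G}(\overline{\mathbb{R}})\to\mathfrak{F}\mathcal{G}(\overline{\mathbb{R}})$, $\mathfrak{F}([g])(z):=\int_{\gamma_{\overline{\mathbb{R}}}}e^{-iz\zeta}g(\zeta)d\zeta$,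 $z\in\mathbb{C}$, with $\gamma_{\overline{\mathbb{R}}}$ the clockwise oriented boundary of $\{|\operatorname{Im}\zeta|<c\}$, $c>0$, is an isomorphism which also maps $\mathcal{G}(\{\pm\infty\})$ isomorphically onto $\mathfrak{F}\mathcal{G}(\{\pm\infty\})$; the canonical map $R\colon\mathcal{H}_{-\infty}(\overline{\mathbb{C}}\setminus\overline{\mathbb{R}})/\mathcal{H}_{-\infty}(\overline{\mathbb{C}}\setminus\{\pm\infty\})\to\mathcal{B}(\mathbb{R})$, $[F]\mapsto[F]$, is a linear isomorphism; and $\mathfrak{F}_{\mathcal{B}}\colon\mathcal{B}(\mathbb{R})\to\mathfrak{F}\mathcal{G}(\overline{\mathbb{R}})/\mathfrak{F}\mathcal{G}(\{\pm\infty\})$, $\mathfrak{F}_{\mathcal{B}}(f):=[(\mathfrak{F}\circ R^{-1})(f)]$, is a linear isomorphism. *)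

theory Defs
  imports "HOL-Complex_Analysis.Complex_Analysis"
begin

(* A function on an open set W is represented by the total function that is 0 off W. So function
   spaces are genuine linear subspaces of complex => complex, restriction is restr, and a function
   on the upper half-plane plus a function on the lower half-plane is their pointwise sum. *)

definition restr :: "complex set \<Rightarrow> (complex \<Rightarrow> complex) \<Rightarrow> complex \<Rightarrow> complex" where
  "restr W f = (\<lambda>z. if z \<in> W then f z else 0)"

definition hol :: "complex set \<Rightarrow> (complex \<Rightarrow> complex) set" where
  "hol W = {f. f holomorphic_on W \<and> (\<forall>z. z \<notin> W \<longrightarrow> f z = 0)}"

definition upper :: "complex set" where
  "upper = {z. Im z > 0}"

definition lower :: "complex set" where
  "lower = {z. Im z < 0}"

definition fsum_space ::
  "(complex \<Rightarrow> complex) set \<Rightarrow> (complex \<Rightarrow> complex) set \<Rightarrow> (complex \<Rightarrow> complex) set" where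
  "fsum_space A B = {\<lambda>z. f z + g z | f g. f \<in> A \<and> g \<in> B}"


section \<open>Quotients of function spaces\<close>

definition modrel ::
  "(complex \<Rightarrow> complex) set \<Rightarrow> (complex \<Rightarrow> complex) set \<Rightarrow> ((complex \<Rightarrow> complex) \<times> (complex \<Rightarrow> complex)) set" where
  "modrel A B = {(f, g). f \<in> A \<and> g \<in> A \<and> (\<lambda>z. f z - g z) \<in> B}"

definition quot :: "(complex \<Rightarrow> complex) set \<Rightarrow> (complex \<Rightarrow> complex) set \<Rightarrow> (complex \<Rightarrow> complex) set set" where
  "quot A B = A // modrel A B"

definition cls ::
  "(complex \<Rightarrow> complex) set \<Rightarrow> (complex \<Rightarrow> complex) set \<Rightarrow> (complex \<Rightarrow> complex) \<Rightarrow> (complex \<Rightarrow> complex) set" where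
  "cls A B f = modrel A B `` {f}"

definition qadd ::
  "(complex \<Rightarrow> complex) set \<Rightarrow> (complex \<Rightarrow> complex) set \<Rightarrow>
   (complex \<Rightarrow> complex) set \<Rightarrow> (complex \<Rightarrow> complex) set \<Rightarrow> (complex \<Rightarrow> complex) set" where
  "qadd A B X Y = (\<Union>f\<in>X. \<Union>g\<in>Y. cls A B (\<lambda>z. f z + g z))"

definition qscale ::
  "(complex \<Rightarrow> complex) set \<Rightarrow> (complex \<Rightarrow> complex) set \<Rightarrow>
   complex \<Rightarrow> (complex \<Rightarrow> complex) set \<Rightarrow> (complex \<Rightarrow> complex) set" where
  "qscale A B a X = (\<Union>f\<in>X. cls A B (\<lambda>z. a * f z))"

definition quot_linear_iso ::
  "(complex \<Rightarrow> complex) set \<Rightarrow> (complex \<Rightarrow> complex) set \<Rightarrow>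
   (complex \<Rightarrow> complex) set \<Rightarrow> (complex \<Rightarrow> complex) set \<Rightarrow>
   ((complex \<Rightarrow> complex) set \<Rightarrow> (complex \<Rightarrow> complex) set) \<Rightarrow> bool" where
  "quot_linear_iso A B A' B' L \<longleftrightarrow>
     bij_betw L (quot A B) (quot A' B') \<and>
     (\<forall>X\<in>quot A B. \<forall>Y\<in>quot A B. L (qadd A B X Y) = qadd A' B' (L X) (L Y)) \<and>
     (\<forall>a. \<forall>X\<in>quot A B. L (qscale A B a X) = qscale A' B' a (L X))"

(* Maps prescribed on representatives are written with the_elem: the value is the one common
   element of the set of all values obtained from the admissible representatives (and parameters). *)


section \<open>Neighbourhoods of subsets of the extended real line\<close>

(* Values in ereal, so that the distance to the empty set is infinity. *)
definition ext_dist :: "complex \<Rightarrow> complex set \<Rightarrow> ereal" where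
  "ext_dist z M = (INF w\<in>M. ereal (cmod (z - w)))"

definition fin_part :: "ereal set \<Rightarrow> complex set" where
  "fin_part K = complex_of_real ` {x. ereal x \<in> K}"

lemma fin_part_simps:
  "fin_part UNIV = \<real>" "fin_part {} = {}" "fin_part {\<infinity>, -\<infinity>} = {}"
  by (auto simp: fin_part_def Reals_def)

(* nbhd c K is U_(1/c)(K). *)
definition nbhd :: "real \<Rightarrow> ereal set \<Rightarrow> complex set" where
  "nbhd c K = {z. ext_dist z (fin_part K) < ereal c}
     \<union> (if \<infinity> \<in> K then {z. Re z > 1 / c \<and> \<bar>Im z\<bar> < c} else {})
     \<union> (if -\<infinity> \<in> K then {z. Re z < - 1 / c \<and> \<bar>Im z\<bar> < c} else {})"

definition Sset :: "nat \<Rightarrow> ereal set \<Rightarrow> complex set" where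
  "Sset n K = (- closure (nbhd (1 / real n) K)) \<inter> {z. \<bar>Im z\<bar> < real n}"


section \<open>Spaces of holomorphic functions\<close>

definition Oexp :: "ereal set \<Rightarrow> (complex \<Rightarrow> complex) set" where
  "Oexp K = {f \<in> hol (- fin_part K).
     \<forall>n::nat\<ge>1. bdd_above ((\<lambda>z. cmod (f z) * exp (- (1 / real n) * \<bar>Re z\<bar>)) ` Sset n K)}"

definition Hminf :: "ereal set \<Rightarrow> (complex \<Rightarrow> complex) set" where
  "Hminf K = {f \<in> hol (- fin_part K).
     \<forall>n::nat\<ge>1. bdd_above ((\<lambda>z. cmod (f z) * exp (real n * \<bar>Re z\<bar>)) ` Sset n K)}"

definition FO_pinf :: "(complex \<Rightarrow> complex) set" where
  "FO_pinf = {f \<in> hol lower. \<forall>k::nat\<ge>1.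
     bdd_above ((\<lambda>z. cmod (f z) * exp (- (1 / real k) * cmod z + real k * \<bar>Im z\<bar>)) `
       {z. Im z \<le> - 1 / real k})}"

definition FO_minf :: "(complex \<Rightarrow> complex) set" where
  "FO_minf = {f \<in> hol upper. \<forall>k::nat\<ge>1.
     bdd_above ((\<lambda>z. cmod (f z) * exp (- (1 / real k) * cmod z + real k * \<bar>Im z\<bar>)) `
       {z. Im z \<ge> 1 / real k})}"

definition FO_pm :: "(complex \<Rightarrow> complex) set" where
  "FO_pm = fsum_space FO_minf FO_pinf"

(* The sign s is 1 or -1. *)
definition H1 :: "real \<Rightarrow> (complex \<Rightarrow> complex) set" where
  "H1 s = {f \<in> hol UNIV. \<forall>j::nat\<ge>1.
     bdd_above ((\<lambda>z. cmod (f z) * exp (- (1 / real j) * \<bar>Re z\<bar> + real j * \<bar>Im z\<bar>)) `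
       {z. s * Im z \<le> real j})}"

definition FG_Rbar :: "(complex \<Rightarrow> complex) set" where
  "FG_Rbar = Oexp {}"

definition FG_pm :: "(complex \<Rightarrow> complex) set" where
  "FG_pm = fsum_space (H1 (-1)) (H1 1)"

(* Spaces that are factored out. UNIV :: ereal set is the extended real line; fin_part UNIV is the
   set of real numbers. The larger domains are cut down to the complement of the real line. *)

definition Oexp_entire :: "(complex \<Rightarrow> complex) set" where
  "Oexp_entire = restr (- \<real>) ` Oexp {}"

definition Oexp_pm :: "(complex \<Rightarrow> complex) set" where
  "Oexp_pm = restr (- \<real>) ` Oexp {\<infinity>, -\<infinity>}"

definition Hminf_entire :: "(complex \<Rightarrow> complex) set" where
  "Hminf_entire = restr (- \<real>) ` Hminf {}"

definition Hminf_pm :: "(complex \<Rightarrow> complex) set" where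
  "Hminf_pm = restr (- \<real>) ` Hminf {\<infinity>, -\<infinity>}"

definition Oexp_FO :: "(complex \<Rightarrow> complex) set" where
  "Oexp_FO = fsum_space Oexp_entire FO_pm"

definition hol_entire :: "(complex \<Rightarrow> complex) set" where
  "hol_entire = restr (- \<real>) ` hol UNIV"

definition hyperfunctions :: "(complex \<Rightarrow> complex) set set" where
  "hyperfunctions = quot (hol (- \<real>)) hol_entire"


section \<open>Integration along the boundary of a strip\<close>

definition ostrip :: "real \<Rightarrow> complex set" where
  "ostrip c = {z. \<bar>Im z\<bar> < c}"

(* Clockwise: Im = c from left to right, Im = -c from right to left. *)
definition strip_integral :: "real \<Rightarrow> (complex \<Rightarrow> complex) \<Rightarrow> complex" where
  "strip_integral c h = (LINT x|lborel. h (Complex x c)) - (LINT x|lborel. h (Complex x (- c)))"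


section \<open>The test function space and its dual\<close>

(* The n-th step. Values off the closed strip are unconstrained; they disappear in Pstar. *)
definition Pstep :: "nat \<Rightarrow> (complex \<Rightarrow> complex) set" where
  "Pstep n = {\<phi>. \<phi> holomorphic_on ostrip (1 / real n) \<and>
     continuous_on (closure (ostrip (1 / real n))) \<phi> \<and>
     bdd_above ((\<lambda>z. cmod (\<phi> z) * exp ((1 / real n) * \<bar>Re z\<bar>)) ` closure (ostrip (1 / real n)))}"

definition Pnorm :: "nat \<Rightarrow> (complex \<Rightarrow> complex) \<Rightarrow> real" where
  "Pnorm n \<phi> = (SUP z\<in>closure (ostrip (1 / real n)). cmod (\<phi> z) * exp ((1 / real n) * \<bar>Re z\<bar>))"

definition Pall :: "(complex \<Rightarrow> complex) set" where
  "Pall = (\<Union>n\<in>{1..}. Pstep n)"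

definition Pnull :: "(complex \<Rightarrow> complex) set" where
  "Pnull = {\<phi> \<in> Pall. \<exists>m::nat\<ge>1. \<forall>z\<in>closure (ostrip (1 / real m)). \<phi> z = 0}"

(* The direct limit with respect to restriction to smaller strips: two functions are identified
   iff they agree in some later step. *)
definition Pstar :: "(complex \<Rightarrow> complex) set set" where
  "Pstar = quot Pall Pnull"

(* A linear functional on a locally convex inductive limit is continuous iff it is continuous on
   every step. *)
definition Pdual :: "((complex \<Rightarrow> complex) set \<Rightarrow> complex) set" where
  "Pdual = {T \<in> extensional Pstar.
     (\<forall>\<Phi>\<in>Pstar. \<forall>\<Psi>\<in>Pstar. T (qadd Pall Pnull \<Phi> \<Psi>) = T \<Phi> + T \<Psi>) \<and>
     (\<forall>a. \<forall>\<Phi>\<in>Pstar. T (qscale Pall Pnull a \<Phi>) = a * T \<Phi>) \<and>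
     (\<forall>n::nat\<ge>1. \<exists>C. \<forall>\<phi>\<in>Pstep n. cmod (T (cls Pall Pnull \<phi>)) \<le> C * Pnorm n \<phi>)}"

(* The integral converges for \<zeta> in a strip around the real line, which is all that matters for the class. *)
definition Pfourier_fun :: "(complex \<Rightarrow> complex) \<Rightarrow> complex \<Rightarrow> complex" where
  "Pfourier_fun \<phi> \<zeta> = (LINT x|lborel. \<phi> (complex_of_real x) * exp (- \<i> * complex_of_real x * \<zeta>))"

definition Pfourier :: "(complex \<Rightarrow> complex) set \<Rightarrow> (complex \<Rightarrow> complex) set" where
  "Pfourier \<Phi> = the_elem ((\<lambda>\<phi>. cls Pall Pnull (Pfourier_fun \<phi>)) ` \<Phi>)"

definition Fstar :: "((complex \<Rightarrow> complex) set \<Rightarrow> complex) \<Rightarrow> (complex \<Rightarrow> complex) set \<Rightarrow> complex" where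
  "Fstar = (\<lambda>T\<in>Pdual. \<lambda>\<Phi>\<in>Pstar. T (Pfourier \<Phi>))"


section \<open>The transform obtained by duality\<close>

definition bv_Rbar :: "(complex \<Rightarrow> complex) set set" where
  "bv_Rbar = quot (Oexp UNIV) Oexp_entire"

definition bv_dual :: "(complex \<Rightarrow> complex) set \<Rightarrow> (complex \<Rightarrow> complex) set \<Rightarrow> complex" where
  "bv_dual X = (\<lambda>\<Phi>\<in>Pstar. the_elem {strip_integral c (\<lambda>\<zeta>. F \<zeta> * \<phi> \<zeta>) | F \<phi> c n.
      F \<in> X \<and> 1 \<le> n \<and> \<phi> \<in> \<Phi> \<inter> Pstep n \<and> 0 < c \<and> c < 1 / real n})"

definition F_Rbar :: "(complex \<Rightarrow> complex) set \<Rightarrow> (complex \<Rightarrow> complex) set" where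
  "F_Rbar X = the_inv_into bv_Rbar bv_dual (Fstar (bv_dual X))"

(* The canonical map [F] -> [F] to the hyperfunctions, used for both growth conditions. *)
definition to_hyp :: "(complex \<Rightarrow> complex) set \<Rightarrow> (complex \<Rightarrow> complex) set" where
  "to_hyp X = the_elem (cls (hol (- \<real>)) hol_entire ` X)"

definition R_R_inv :: "(complex \<Rightarrow> complex) set \<Rightarrow> (complex \<Rightarrow> complex) set" where
  "R_R_inv = the_inv_into (quot (Oexp UNIV) Oexp_pm) to_hyp"

definition F_hyp :: "(complex \<Rightarrow> complex) set \<Rightarrow> (complex \<Rightarrow> complex) set" where
  "F_hyp f = the_elem {cls (Oexp UNIV) Oexp_FO G | F G.
      F \<in> R_R_inv f \<and> G \<in> F_Rbar (cls (Oexp UNIV) Oexp_entire F)}"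


section \<open>Langenbruch's transform\<close>

definition L_fourier :: "(complex \<Rightarrow> complex) set \<Rightarrow> complex \<Rightarrow> complex" where
  "L_fourier X z = the_elem {strip_integral c (\<lambda>\<zeta>. exp (- \<i> * z * \<zeta>) * g \<zeta>) | g c. g \<in> X \<and> 0 < c}"

definition R_L_inv :: "(complex \<Rightarrow> complex) set \<Rightarrow> (complex \<Rightarrow> complex) set" where
  "R_L_inv = the_inv_into (quot (Hminf UNIV) Hminf_pm) to_hyp"

definition L_hyp :: "(complex \<Rightarrow> complex) set \<Rightarrow> (complex \<Rightarrow> complex) set" where
  "L_hyp f = the_elem ((\<lambda>g. cls FG_Rbar FG_pm (L_fourier (cls (Hminf UNIV) Hminf_entire g))) ` R_L_inv f)"


section \<open>The restriction map\<close>

definition plus_part :: "(complex \<Rightarrow> complex) \<Rightarrow> complex \<Rightarrow> complex" where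
  "plus_part F = restr upper F"

definition I_map :: "(complex \<Rightarrow> complex) set \<Rightarrow> (complex \<Rightarrow> complex) set" where
  "I_map X = the_elem ((\<lambda>F. cls (Oexp UNIV) Oexp_FO (plus_part F)) ` X)"

end

theory Submission imports Defs begin

text \<open>Every hyperfunction has a representative in \<open>Hminf UNIV\<close>: on either half-plane, pole pushing
  yields an entire function that differs boundedly from \<open>exp (z\<^sup>2) F\<close> and is itself bounded on the
  other side; dividing by \<open>exp (z\<^sup>2)\<close> makes the difference decay faster than every exponential. For such
  \<open>F\<close> both transforms are integrals of \<open>F\<close> against \<open>exp (- \<i> z \<zeta>)\<close>, and Fubini's theorem shows
  that the plus part of Langenbruch's transform of \<open>F\<close> represents \<open>F_Rbar [F]\<close>. Changing the
  representative adds a boundary value supported at \<open>\<plusminus>\<infinity>\<close>, whose transform lies in \<open>FO_pm\<close>.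

  \<open>I_map\<close> is injective because the decompositions of a plus part over the two half-planes glue to
  entire functions. It is surjective since, by Fourier inversion, every element of \<open>Oexp UNIV\<close> is the
  transform of another one, which has the same boundary value on \<open>\<real>\<close> as some rapidly
  decreasing function.\<close>

section \<open>Integration along horizontal lines\<close>

text \<open>A function in \<open>Oexp UNIV\<close> may grow, so its integral against exp(-i z
  \<zeta>) over the strip contour diverges in general. \<open>F_Rbar\<close> is therefore reached
  only by duality: it is defined through \<open>the_inv_into\<close>, hence it is evaluated by
  exhibiting an image, which the adjoint identity \<open>Ftrans\<close> certifies, and by the
  injectivity of \<open>bv_dual\<close>. The kernel exp(-(z-\<zeta>)^2)/(z-\<zeta>) of the inverse
  boundary value map enters only in the proof of that injectivity.

  The plus part appears because it vanishes on the lower line of the contour, while the upper line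
  can be moved to the real axis, the transform being entire. For a boundary value supported at
  infinity each half of the contour converges on one half-plane only; this is the origin of the two
  summands of \<open>FO_pm\<close>.

  exp(z^2) is chosen because it is even, so that it serves both half-planes, and because its
  reciprocal beats every exponential on horizontal strips. A Fourier transform halves the width of
  the strip of a test function: one half pays for the decay of the transform, the other for the
  convergence of the integral.\<close>

lemma set_integrable_exp_atLeast:
  fixes d :: real assumes "d > 0" shows "set_integrable lborel {a..} (\<lambda>x. exp (- d * x))"
proof -
  have lim: "((\<lambda>x. - exp (- d * x) / d) \<longlongrightarrow> 0) at_top"
    using assms by real_asymp
  have "(\<integral>\<^sup>+x. ennreal (exp (- d * x)) * indicator {a..} x \<partial>lborel) = ennreal (0 - (- exp (- d * a) / d))"
    by (rule nn_integral_FTC_atLeast[OF _ _ _ lim])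
       (use assms in \<open>auto intro!: derivative_eq_intros\<close>)
  moreover have "\<And>x::real. ennreal (norm (indicat_real {a..} x *\<^sub>R exp (- d * x))) = ennreal (exp (- d * x)) * indicator {a..} x"
    by (auto simp: indicator_def)
  ultimately show ?thesis
    unfolding set_integrable_def by (intro integrableI_bounded) (auto simp: top_unique)
qed

lemma integrable_exp_abs:
  fixes d a :: real assumes "d > 0" shows "integrable lborel (\<lambda>x. exp (- d * \<bar>x - a\<bar>))"
proof -
  define g where "g = (\<lambda>x::real. indicat_real {0..} x *\<^sub>R exp (- d * x))"
  have "integrable lborel g"
    using set_integrable_exp_atLeast[OF assms, of 0] by (simp add: g_def set_integrable_def)
  then have "integrable lborel (\<lambda>x. g x + g (0 + (-1) * x))"
    by (intro Bochner_Integration.integrable_add lborel_integrable_real_affine) auto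
  then have "integrable lborel (\<lambda>x. exp (- d * \<bar>x\<bar>))"
    by (rule Bochner_Integration.integrable_bound) (auto simp: g_def indicator_def)
  from lborel_integrable_real_affine[OF this, of 1 "-a"] show ?thesis by (simp add: algebra_simps)
qed

lemma lborel_integral_shift:
  fixes f :: "real \<Rightarrow> 'a::{banach, second_countable_topology}"
  shows "(LINT x|lborel. f (x - a)) = (LINT x|lborel. f x)"
  using lborel_integral_real_affine[of 1 f "-a"] by (simp add: algebra_simps)

lemma lborel_integral_reflect:
  fixes f :: "real \<Rightarrow> 'a::{banach, second_countable_topology}"
  shows "(LINT x|lborel. f (- x)) = (LINT x|lborel. f x)"
  using lborel_integral_real_affine[of "-1" f 0] by simp

text \<open>Only x < 0 needs the first factor: there |x| \<le> |a|, so the exponents -d x and -d |x|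
  differ by at most 2 d |a|.\<close>

lemma exp_neg_le_exp_abs:
  fixes d a x :: real assumes "a \<le> x" "d > 0" shows "exp (- d * x) \<le> exp (2 * d * \<bar>a\<bar>) * exp (- d * \<bar>x\<bar>)"
proof -
  have "- d * x \<le> 2 * d * \<bar>a\<bar> + - d * \<bar>x\<bar>"
  proof (cases "x \<ge> 0")
    case False
    with assms(1) have "\<bar>x\<bar> \<le> \<bar>a\<bar>" by auto
    with False have "d * (\<bar>x\<bar> - x) \<le> d * (2 * \<bar>a\<bar>)" using assms(2) by (intro mult_left_mono) auto
    then show ?thesis by (simp add: algebra_simps)
  qed (use assms in auto)
  then show ?thesis by (simp flip: exp_add)
qed

lemma set_integrable_line:
  fixes g :: "real \<Rightarrow> complex"
  assumes "A \<in> sets borel" "continuous_on A g" "\<And>x. x \<in> A \<Longrightarrow> norm (g x) \<le> C * exp (- d * \<bar>x\<bar>)" "d > 0"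
  shows "set_integrable lborel A g"
  unfolding set_integrable_def
proof (rule Bochner_Integration.integrable_bound)
  show "integrable lborel (\<lambda>x. \<bar>C\<bar> * exp (- d * \<bar>x - 0\<bar>))"
    by (intro integrable_mult_right integrable_exp_abs assms)
  show "(\<lambda>x. indicator A x *\<^sub>R g x) \<in> borel_measurable lborel"
    using borel_measurable_continuous_on_indicator[OF assms(1,2)] by simp
  have "norm (indicator A x *\<^sub>R g x) \<le> norm (\<bar>C\<bar> * exp (- d * \<bar>x - 0\<bar>))" for x
  proof (cases "x \<in> A")
    case True
    have "C * exp (- d * \<bar>x\<bar>) \<le> \<bar>C\<bar> * exp (- d * \<bar>x\<bar>)" by (intro mult_right_mono) auto
    with assms(3)[OF True] have "norm (g x) \<le> \<bar>C\<bar> * exp (- d * \<bar>x\<bar>)" by (rule order_trans)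
    with True show ?thesis by (simp add: abs_mult)
  qed auto
  then show "AE x in lborel. norm (indicator A x *\<^sub>R g x) \<le> norm (\<bar>C\<bar> * exp (- d * \<bar>x - 0\<bar>))" by auto
qed

lemma integrable_line:
  fixes g :: "real \<Rightarrow> complex"
  assumes "continuous_on UNIV g" "\<And>x. norm (g x) \<le> C * exp (- d * \<bar>x\<bar>)" "d > 0"
  shows "integrable lborel g"
  using set_integrable_line[of UNIV g C d] assms by (simp add: set_integrable_def)

lemma linepath_horizontal:
  fixes f :: "complex \<Rightarrow> complex"
  assumes "a < b" "continuous_on {a..b} (\<lambda>x. f (Complex x c))"
  shows "contour_integral (linepath (Complex a c) (Complex b c)) f = (LINT x:{a..b}|lborel. f (Complex x c))"
proof -
  have "contour_integral (linepath (Complex a c) (Complex b c)) f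
      = contour_integral (linepath (of_real a) (of_real b)) (\<lambda>z. f (z + Complex 0 c))"
  proof -
    have "linepath (Complex a c) (Complex b c) x = linepath (of_real a) (of_real b) x + Complex 0 c" for x
      by (simp add: linepath_def complex_eq_iff algebra_simps)
    moreover have "Complex b c - Complex a c = of_real b - of_real a" by (simp add: complex_eq_iff)
    ultimately show ?thesis by (simp add: contour_integral_integral)
  qed
  also have "\<dots> = integral {a..b} (\<lambda>x. f (Complex x c))"
    using assms(1) by (subst contour_integral_linepath_Reals_eq) (auto simp: complex_eq_iff Complex_eq)
  also have "\<dots> = (LINT x:{a..b}|lborel. f (Complex x c))"
    by (rule set_borel_integral_eq_integral(2)[symmetric])
       (simp add: set_integrable_def borel_integrable_atLeastAtMost' assms(2) borel_integrable_compact)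
  finally show ?thesis .
qed

lemma contour_integral_linepath_bound:
  assumes "f contour_integrable_on linepath a b" "\<And>x. x \<in> closed_segment a b \<Longrightarrow> norm (f x) \<le> B" "B \<ge> 0"
  shows "norm (contour_integral (linepath a b) f) \<le> B * norm (b - a)"
  using contour_integral_bound_linepath[OF assms(1) assms(3) assms(2)] by auto

lemma closed_segment_vertical:
  "z \<in> closed_segment (Complex a c) (Complex a c') \<longleftrightarrow> Re z = a \<and> Im z \<in> closed_segment c c'"
  by (cases z) (auto simp: in_segment complex_eq_iff algebra_simps)

lemma closed_segment_horizontal:
  "z \<in> closed_segment (Complex a c) (Complex a' c) \<longleftrightarrow> Im z = c \<and> Re z \<in> closed_segment a a'"
  by (cases z) (auto simp: in_segment complex_eq_iff algebra_simps)

section \<open>Cauchy's theorem and integral formula on rectangles\<close>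

text \<open>This is the counterclockwise boundary integral. All horizontal sides run to the right
  and all vertical sides upwards, so that the former turn into Lebesgue integrals over intervals and
  the latter can be estimated separately.\<close>

definition rect_int :: "real \<Rightarrow> real \<Rightarrow> real \<Rightarrow> real \<Rightarrow> (complex \<Rightarrow> complex) \<Rightarrow> complex" where
  "rect_int a b c d f = contour_integral (linepath (Complex a c) (Complex b c)) f
     + contour_integral (linepath (Complex b c) (Complex b d)) f
     - contour_integral (linepath (Complex a d) (Complex b d)) f
     - contour_integral (linepath (Complex a c) (Complex a d)) f"

text \<open>One primitive serves all segments in S at once, so identities between polygonal contours
  become telescoping sums of endpoint values.\<close>

lemma contour_integral_linepath_primitive:
  assumes "convex S" "open S" "f holomorphic_on S"
  obtains g where "\<And>a b. a \<in> S \<Longrightarrow> b \<in> S \<Longrightarrow> (f has_contour_integral (g b - g a)) (linepath a b)"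
proof -
  obtain g where g: "\<And>x. x \<in> S \<Longrightarrow> (g has_field_derivative f x) (at x within S)"
    using holomorphic_convex_primitive'[OF assms] by blast
  show ?thesis
  proof (rule that)
    fix a b assume "a \<in> S" "b \<in> S"
    then have "closed_segment a b \<subseteq> S" using assms(1) by (simp add: closed_segment_subset)
    then show "(f has_contour_integral (g b - g a)) (linepath a b)"
      using contour_integral_primitive[of S g f "linepath a b"] g by auto
  qed
qed

lemma rect_int_holomorphic:
  assumes "convex S" "open S" "f holomorphic_on S"
    "Complex a c \<in> S" "Complex b c \<in> S" "Complex a d \<in> S" "Complex b d \<in> S"
  shows "rect_int a b c d f = 0"
proof -
  obtain g where g: "\<And>a b. a \<in> S \<Longrightarrow> b \<in> S \<Longrightarrow> (f has_contour_integral (g b - g a)) (linepath a b)"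
    using contour_integral_linepath_primitive[OF assms(1-3)] by blast
  show ?thesis unfolding rect_int_def
    using g[THEN contour_integral_unique] assms by simp
qed

lemma rect_int_pole:
  assumes "convex S" "open S" "f holomorphic_on S"
    "Complex a c \<in> S" "Complex b c \<in> S" "Complex a d \<in> S" "Complex b d \<in> S"
    "a < Re w" "Re w < b" "c < Im w" "Im w < d"
  shows "rect_int a b c d (\<lambda>z. f z / (z - w)) = 2 * of_real pi * \<i> * f w"
proof -
  let ?h = "\<lambda>z. f z / (z - w)"
  let ?A = "Complex a c" and ?C = "Complex b d"
  let ?B = "Complex b c" and ?D = "Complex a d"
  let ?p = "rectpath ?A ?C"
  have wbox: "w \<in> box ?A ?C" using assms by (auto simp: in_box_complex_iff)
  \<comment> \<open>Convexity is applied twice: along the two horizontal sides, then along the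
    vertical segment through z.\<close>
  have sub: "cbox ?A ?C \<subseteq> S"
  proof
    fix z assume "z \<in> cbox ?A ?C"
    then have *: "a \<le> Re z" "Re z \<le> b" "c \<le> Im z" "Im z \<le> d" by (auto simp: in_cbox_complex_iff)
    have 1: "Complex (Re z) c \<in> S" "Complex (Re z) d \<in> S"
      using closed_segment_subset[OF assms(4,5,1)] closed_segment_subset[OF assms(6,7,1)] *
      by (auto simp: closed_segment_horizontal closed_segment_eq_real_ivl subset_iff)
    then show "z \<in> S"
      using closed_segment_subset[OF 1 assms(1)] *
      by (auto simp: closed_segment_vertical closed_segment_eq_real_ivl subset_iff)
  qed
  have pim: "path_image ?p = cbox ?A ?C - box ?A ?C"
    using assms by (intro path_image_rectpath_cbox_minus_box) auto
  have winS: "w \<in> interior S"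
    using wbox sub assms(2) box_subset_cbox[of ?A ?C] by (auto simp: interior_open)
  have "(?h has_contour_integral (2*pi * \<i> * winding_number ?p w * f w)) ?p"
    using pim wbox sub
    by (intro Cauchy_integral_formula_convex_simple[OF assms(1,3) winS]) auto
  then have 1: "(?h has_contour_integral (2 * of_real pi * \<i> * f w)) ?p"
    using winding_number_rectpath[OF wbox] by simp
  have seg: "continuous_on (closed_segment p q) ?h" if "closed_segment p q \<subseteq> path_image ?p" for p q
  proof -
    have "closed_segment p q \<subseteq> S - {w}" using that pim sub wbox by auto
    then show ?thesis
      by (intro continuous_intros continuous_on_subset[OF holomorphic_on_imp_continuous_on[OF assms(3)]]) auto
  qed
  have lt: "a < b" "c < d" using assms by auto
  have sides: "closed_segment ?A ?B \<subseteq> path_image ?p" "closed_segment ?B ?C \<subseteq> path_image ?p"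
    "closed_segment ?D ?C \<subseteq> path_image ?p" "closed_segment ?A ?D \<subseteq> path_image ?p"
    using lt unfolding pim
    by (auto simp: closed_segment_horizontal closed_segment_vertical closed_segment_eq_real_ivl
        in_box_complex_iff in_cbox_complex_iff)
  have ci: "?h contour_integrable_on linepath p q" if "closed_segment p q \<subseteq> path_image ?p" for p q
    using seg[OF that] by (rule contour_integrable_continuous_linepath)
  have ci': "?h contour_integrable_on linepath ?C ?D" "?h contour_integrable_on linepath ?D ?A"
    using ci[of ?C ?D] ci[of ?D ?A] sides by (auto simp: closed_segment_commute)
  have "contour_integral ?p ?h = contour_integral (linepath ?A ?B) ?h + (contour_integral (linepath ?B ?C) ?h
     + (contour_integral (linepath ?C ?D) ?h + contour_integral (linepath ?D ?A) ?h))"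
    unfolding rectpath_def Let_def
    using ci sides ci' by (simp add: contour_integrable_joinI)
  also have "contour_integral (linepath ?C ?D) ?h = - contour_integral (linepath ?D ?C) ?h"
    using contour_integral_reverse_linepath[OF seg[OF sides(3)]] by simp
  also have "contour_integral (linepath ?D ?A) ?h = - contour_integral (linepath ?A ?D) ?h"
    using contour_integral_reverse_linepath[OF seg[OF sides(4)]] by simp
  finally show ?thesis using contour_integral_unique[OF 1] by (simp add: rect_int_def)
qed

lemma symmetric_interval_limit:
  fixes f :: "real \<Rightarrow> complex" assumes "integrable lborel f"
  shows "((\<lambda>X. LINT x:{-X..X}|lborel. f x) \<longlongrightarrow> (LINT x|lborel. f x)) at_top"
  unfolding set_lebesgue_integral_def
proof (rule integral_dominated_convergence_at_top)
  show "integrable lborel (\<lambda>x. norm (f x))" using assms by (rule integrable_norm)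
  show "AE x in lborel. ((\<lambda>X. indicat_real {- X..X} x *\<^sub>R f x) \<longlongrightarrow> f x) at_top"
  proof (intro AE_I2 tendsto_eventually)
    fix x :: real
    show "\<forall>\<^sub>F X in at_top. indicat_real {- X..X} x *\<^sub>R f x = f x"
      using eventually_ge_at_top[of "\<bar>x\<bar>"] by eventually_elim (auto simp: indicator_def)
  qed
qed (use assms in \<open>auto simp: indicator_def\<close>)

section \<open>Passage from rectangles to infinite strips and half-strips\<close>

definition line_int :: "real \<Rightarrow> (complex \<Rightarrow> complex) \<Rightarrow> complex" where
  "line_int c h = (LINT x|lborel. h (Complex x c))"

lemma strip_integral_eq: "strip_integral c h = line_int c h - line_int (- c) h"
  by (simp add: strip_integral_def line_int_def)

lemma exp_neg_tendsto_0:
  fixes d C K :: real assumes "d > 0" shows "((\<lambda>X. C * exp (- d * X) * K) \<longlongrightarrow> 0) at_top"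
  using assms by real_asymp

lemma vertical_norm_le:
  assumes "c \<le> d" "continuous_on {c..d} (\<lambda>y. f (Complex a y))"
    "\<And>y. c \<le> y \<Longrightarrow> y \<le> d \<Longrightarrow> norm (f (Complex a y)) \<le> B"
  shows "norm (contour_integral (linepath (Complex a c) (Complex a d)) f) \<le> B * (d - c)"
proof -
  have B: "B \<ge> 0" using assms(3)[of c] assms(1) norm_ge_zero order_trans by blast
  have "norm (contour_integral (linepath (Complex a c) (Complex a d)) f) \<le> B * norm (Complex a d - Complex a c)"
  proof (rule contour_integral_linepath_bound[OF _ _ B])
    have "continuous_on (closed_segment (Complex a c) (Complex a d)) (\<lambda>z. f (Complex a (Im z)))"
      by (rule continuous_on_compose2[OF assms(2)])
         (use assms(1) in \<open>auto intro!: continuous_intros simp: closed_segment_vertical closed_segment_eq_real_ivl\<close>)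
    then have "continuous_on (closed_segment (Complex a c) (Complex a d)) f"
      by (rule continuous_on_eq) (auto simp: closed_segment_vertical)
    then show "f contour_integrable_on linepath (Complex a c) (Complex a d)"
      by (rule contour_integrable_continuous_linepath)
    fix z assume "z \<in> closed_segment (Complex a c) (Complex a d)"
    then show "norm (f z) \<le> B" using assms(3)[of "Im z"] assms(1)
      by (auto simp: closed_segment_vertical closed_segment_eq_real_ivl)
  qed
  also have "norm (Complex a d - Complex a c) = d - c"
    using assms(1) by (simp add: cmod_def)
  finally show ?thesis .
qed

text \<open>The vertical sides keep the length d - c while the integrand decays exponentially, so
  they vanish as X grows. The value V is left open to cover both Cauchy's theorem and Cauchy's
  formula. The conditions inside the strip start at \<open>X0\<close>, which admits a pole between
  the two lines.\<close>

lemma strip_rect_limit: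
  assumes "c \<le> d" "\<delta> > 0"
    and hor: "\<And>y. y \<in> {c, d} \<Longrightarrow> continuous_on UNIV (\<lambda>x. h (Complex x y))"
      "\<And>x y. y \<in> {c, d} \<Longrightarrow> norm (h (Complex x y)) \<le> C * exp (- \<delta> * \<bar>x\<bar>)"
    and ver: "\<And>x. \<bar>x\<bar> \<ge> X0 \<Longrightarrow> continuous_on {c..d} (\<lambda>y. h (Complex x y))"
      "\<And>x y. \<bar>x\<bar> \<ge> X0 \<Longrightarrow> c \<le> y \<Longrightarrow> y \<le> d \<Longrightarrow> norm (h (Complex x y)) \<le> C * exp (- \<delta> * \<bar>x\<bar>)"
    and rect: "\<And>X. X \<ge> X0 \<Longrightarrow> X > 0 \<Longrightarrow> rect_int (-X) X c d h = V"
  shows "line_int c h - line_int d h = V"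
proof -
  define v where "v X = contour_integral (linepath (Complex X c) (Complex X d)) h" for X
  have v: "norm (v x) \<le> C * exp (- \<delta> * \<bar>x\<bar>) * (d - c)" if "\<bar>x\<bar> \<ge> X0" for x
    unfolding v_def by (rule vertical_norm_le[OF assms(1) ver(1) ver(2)]) (use that in auto)
  have v1: "(v \<longlongrightarrow> 0) at_top"
  proof (rule Lim_null_comparison[OF _ exp_neg_tendsto_0[OF assms(2), of C "d - c"]])
    show "\<forall>\<^sub>F x in at_top. norm (v x) \<le> C * exp (- \<delta> * x) * (d - c)"
      using eventually_ge_at_top[of "max X0 0"]
    proof eventually_elim
      case (elim x) then show ?case using v[of x] by simp
    qed
  qed
  have v2: "((\<lambda>x. v (- x)) \<longlongrightarrow> 0) at_top"
  proof (rule Lim_null_comparison[OF _ exp_neg_tendsto_0[OF assms(2), of C "d - c"]])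
    show "\<forall>\<^sub>F x in at_top. norm (v (- x)) \<le> C * exp (- \<delta> * x) * (d - c)"
      using eventually_ge_at_top[of "max X0 0"]
    proof eventually_elim
      case (elim x) then show ?case using v[of "-x"] by simp
    qed
  qed
  have int: "integrable lborel (\<lambda>x. h (Complex x y))" if "y \<in> {c, d}" for y
    by (rule integrable_line[OF hor(1)[OF that] hor(2)[OF that] assms(2)])
  have "((\<lambda>X. (LINT x:{-X..X}|lborel. h (Complex x c)) + v X - (LINT x:{-X..X}|lborel. h (Complex x d)) - v (-X))
     \<longlongrightarrow> line_int c h + 0 - line_int d h - 0) at_top"
    unfolding line_int_def by (intro tendsto_intros symmetric_interval_limit int v1 v2) auto
  moreover have "\<forall>\<^sub>F X in at_top. (LINT x:{-X..X}|lborel. h (Complex x c)) + v X - (LINT x:{-X..X}|lborel. h (Complex x d)) - v (-X) = V"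
    using eventually_ge_at_top[of X0] eventually_gt_at_top[of 0]
  proof eventually_elim
    case (elim X)
    then have "rect_int (-X) X c d h = V" using rect by blast
    moreover have "contour_integral (linepath (Complex (-X) y) (Complex X y)) h = (LINT x:{-X..X}|lborel. h (Complex x y))"
      if "y \<in> {c,d}" for y
      using elim that by (intro linepath_horizontal continuous_on_subset[OF hor(1)]) auto
    ultimately show ?case by (simp add: rect_int_def v_def)
  qed
  ultimately have "((\<lambda>X::real. V) \<longlongrightarrow> line_int c h + 0 - line_int d h - 0) at_top"
    by (rule Lim_transform_eventually)
  then show ?thesis by (simp add: tendsto_const_iff)
qed

lemma continuous_on_horizontal:
  assumes "continuous_on S f" "\<And>x. x \<in> A \<Longrightarrow> Complex x c \<in> S"
  shows "continuous_on A (\<lambda>x. f (Complex x c))"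
  by (rule continuous_on_compose2[OF assms(1)]) (use assms(2) in \<open>auto simp: Complex_eq intro!: continuous_intros\<close>)

lemma continuous_on_vertical:
  assumes "continuous_on S f" "\<And>y. y \<in> A \<Longrightarrow> Complex a y \<in> S"
  shows "continuous_on A (\<lambda>y. f (Complex a y))"
  by (rule continuous_on_compose2[OF assms(1)]) (use assms(2) in \<open>auto simp: Complex_eq intro!: continuous_intros\<close>)

lemma line_int_shift:
  assumes "convex S" "open S" "f holomorphic_on S" "c \<le> d"
    and sub: "\<And>z. c \<le> Im z \<Longrightarrow> Im z \<le> d \<Longrightarrow> z \<in> S"
    and bd: "\<And>z. c \<le> Im z \<Longrightarrow> Im z \<le> d \<Longrightarrow> norm (f z) \<le> C * exp (- \<delta> * \<bar>Re z\<bar>)" and "\<delta> > 0"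
  shows "line_int c f = line_int d f"
proof -
  note cont = holomorphic_on_imp_continuous_on[OF assms(3)]
  have "line_int c f - line_int d f = 0"
  proof (rule strip_rect_limit[OF assms(4) assms(7), where C=C and ?X0.0=0])
    show "continuous_on UNIV (\<lambda>x. f (Complex x y))" if "y \<in> {c,d}" for y
      using that assms(4) by (intro continuous_on_horizontal[OF cont] sub) auto
    show "continuous_on {c..d} (\<lambda>y. f (Complex x y))" for x
      by (intro continuous_on_vertical[OF cont] sub) auto
    show "norm (f (Complex x y)) \<le> C * exp (- \<delta> * \<bar>x\<bar>)" if "y \<in> {c,d}" for x y
      using bd[of "Complex x y"] that assms(4) by auto
    show "norm (f (Complex x y)) \<le> C * exp (- \<delta> * \<bar>x\<bar>)" if "c \<le> y" "y \<le> d" for x y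
      using bd[of "Complex x y"] that by auto
    show "rect_int (-X) X c d f = 0" for X
      by (rule rect_int_holomorphic[OF assms(1-3)]) (use assms(4) in \<open>auto intro!: sub\<close>)
  qed
  then show ?thesis by simp
qed

lemma line_int_cauchy:
  assumes "convex S" "open S" "f holomorphic_on S" "c < Im w" "Im w < d"
    and sub: "\<And>z. c \<le> Im z \<Longrightarrow> Im z \<le> d \<Longrightarrow> z \<in> S"
    and bd: "\<And>z. c \<le> Im z \<Longrightarrow> Im z \<le> d \<Longrightarrow> norm (f z) \<le> C * exp (- \<delta> * \<bar>Re z\<bar>)" and "\<delta> > 0"
  shows "line_int c (\<lambda>z. f z / (z - w)) - line_int d (\<lambda>z. f z / (z - w)) = 2 * of_real pi * \<i> * f w"
proof -
  note cont = holomorphic_on_imp_continuous_on[OF assms(3)]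
  \<comment> \<open>A lower bound for |z - w| on the two lines and wherever |Re z| \<ge> |Re w| + 1;
    off the pole the Cauchy kernel thus costs only the factor 1/\<mu>.\<close>
  define \<mu> where "\<mu> = min 1 (min (Im w - c) (d - Im w))"
  have \<mu>: "\<mu> > 0" using assms(4,5) by (simp add: \<mu>_def)
  have cd: "c \<le> d" using assms by simp
  have q: "norm (f z / (z - w)) \<le> C / \<mu> * exp (- \<delta> * \<bar>Re z\<bar>)"
    if "norm (z - w) \<ge> \<mu>" "c \<le> Im z" "Im z \<le> d" for z
  proof -
    have "norm (f z) / norm (z - w) \<le> (C * exp (- \<delta> * \<bar>Re z\<bar>)) / \<mu>"
      using that \<mu> bd[of z] by (intro frac_le) (auto intro: order_trans[OF norm_ge_zero])
    then show ?thesis by (simp add: norm_divide)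
  qed
  have far1: "norm (Complex x y - w) \<ge> \<mu>" if "y \<in> {c,d}" for x y
    using abs_Im_le_cmod[of "Complex x y - w"] that by (auto simp: \<mu>_def)
  have far2: "norm (Complex x y - w) \<ge> \<mu>" if "\<bar>x\<bar> \<ge> \<bar>Re w\<bar> + 1" for x y
    using abs_Re_le_cmod[of "Complex x y - w"] that by (auto simp: \<mu>_def)
  have ne: "x \<noteq> w" if "norm (x - w) \<ge> \<mu>" for x using that \<mu> by auto
  show ?thesis
  proof (rule strip_rect_limit[OF cd assms(8), where C="C / \<mu>" and ?X0.0="\<bar>Re w\<bar> + 1"])
    show "continuous_on UNIV (\<lambda>x. f (Complex x y) / (Complex x y - w))" if y: "y \<in> {c,d}" for y
    proof (rule continuous_on_horizontal[where f="\<lambda>z. f z / (z - w)" and S="S - {w}"])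
      show "continuous_on (S - {w}) (\<lambda>z. f z / (z - w))"
        by (intro continuous_intros continuous_on_subset[OF cont]) auto
      show "Complex x y \<in> S - {w}" for x using ne[OF far1[OF y]] sub y cd by auto
    qed
    show "continuous_on {c..d} (\<lambda>y. f (Complex x y) / (Complex x y - w))" if x: "\<bar>Re w\<bar> + 1 \<le> \<bar>x\<bar>" for x
    proof (rule continuous_on_vertical[where f="\<lambda>z. f z / (z - w)" and S="S - {w}"])
      show "continuous_on (S - {w}) (\<lambda>z. f z / (z - w))"
        by (intro continuous_intros continuous_on_subset[OF cont]) auto
      show "Complex x y \<in> S - {w}" if "y \<in> {c..d}" for y using ne[OF far2[OF x]] sub that by auto
    qed
    show "norm (f (Complex x y) / (Complex x y - w)) \<le> C / \<mu> * exp (- \<delta> * \<bar>x\<bar>)" if "y \<in> {c,d}" for x y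
      using q[OF far1[OF that]] that cd by auto
    show "norm (f (Complex x y) / (Complex x y - w)) \<le> C / \<mu> * exp (- \<delta> * \<bar>x\<bar>)"
      if "\<bar>Re w\<bar> + 1 \<le> \<bar>x\<bar>" "c \<le> y" "y \<le> d" for x y
      using q[OF far2[OF that(1)]] that by auto
    show "rect_int (-X) X c d (\<lambda>z. f z / (z - w)) = 2 * of_real pi * \<i> * f w" if "X \<ge> \<bar>Re w\<bar> + 1" for X
      by (rule rect_int_pole[OF assms(1-3)]) (use that assms(4,5) in \<open>auto intro!: sub\<close>)
  qed
qed

text \<open>Only the vertical side that moves to the right disappears in the limit; the one at
  abscissa a survives as the difference of the two half-line integrals.\<close>

lemma half_strip_shift:
  assumes "convex S" "open S" "f holomorphic_on S" "c \<le> d"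
    and sub: "\<And>z. a \<le> Re z \<Longrightarrow> c \<le> Im z \<Longrightarrow> Im z \<le> d \<Longrightarrow> z \<in> S"
    and bd: "\<And>z. a \<le> Re z \<Longrightarrow> c \<le> Im z \<Longrightarrow> Im z \<le> d \<Longrightarrow> norm (f z) \<le> C * exp (- \<delta> * Re z)" and \<delta>: "\<delta> > 0"
  shows "(LINT x:{a..}|lborel. f (Complex x c)) - (LINT x:{a..}|lborel. f (Complex x d))
       = contour_integral (linepath (Complex a c) (Complex a d)) f" (is "_ = ?v")
proof -
  note cont = holomorphic_on_imp_continuous_on[OF assms(3)]
  define v where "v X = contour_integral (linepath (Complex X c) (Complex X d)) f" for X
  have v1: "(v \<longlongrightarrow> 0) at_top"
  proof (rule Lim_null_comparison[OF _ exp_neg_tendsto_0[OF \<delta>, of C "d - c"]])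
    show "\<forall>\<^sub>F x in at_top. norm (v x) \<le> C * exp (- \<delta> * x) * (d - c)"
      using eventually_ge_at_top[of a] unfolding v_def
    proof eventually_elim
      case (elim x)
      show ?case
      proof (rule vertical_norm_le[OF assms(4)])
        show "continuous_on {c..d} (\<lambda>y. f (Complex x y))"
          using elim by (intro continuous_on_vertical[OF cont] sub) auto
        show "norm (f (Complex x y)) \<le> C * exp (- \<delta> * x)" if "c \<le> y" "y \<le> d" for y
          using bd[of "Complex x y"] that elim by simp
      qed
    qed
  qed
  have contH: "continuous_on {a..} (\<lambda>x. f (Complex x y))" if "y \<in> {c,d}" for y
    using that assms(4) by (intro continuous_on_horizontal[OF cont] sub) auto
  have int: "set_integrable lborel {a..} (\<lambda>x. f (Complex x y))" if "y \<in> {c,d}" for y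
  proof (rule set_integrable_line[OF _ contH[OF that] _ \<delta>])
    fix x assume x: "x \<in> {a..}"
    \<comment> \<open>The sign of C is read off from the bound at the corner a + i c.\<close>
    have C: "C \<ge> 0"
      using bd[of "Complex a c"] assms(4) by (auto simp: zero_le_mult_iff dest: order_trans[OF norm_ge_zero])
    have "norm (f (Complex x y)) \<le> C * exp (- \<delta> * x)"
      using bd[of "Complex x y"] that x assms(4) by auto
    also have "\<dots> \<le> C * (exp (2 * \<delta> * \<bar>a\<bar>) * exp (- \<delta> * \<bar>x\<bar>))"
      by (rule mult_left_mono[OF exp_neg_le_exp_abs C]) (use x \<delta> in auto)
    finally show "norm (f (Complex x y)) \<le> (C * exp (2 * \<delta> * \<bar>a\<bar>)) * exp (- \<delta> * \<bar>x\<bar>)" by (simp add: mult_ac)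
  qed auto
  have "((\<lambda>X. (LINT x:{a..X}|lborel. f (Complex x c)) + v X - (LINT x:{a..X}|lborel. f (Complex x d)) - ?v)
     \<longlongrightarrow> (LINT x:{a..}|lborel. f (Complex x c)) + 0 - (LINT x:{a..}|lborel. f (Complex x d)) - ?v) at_top"
    by (intro tendsto_intros tendsto_set_lebesgue_integral_at_top int v1) auto
  moreover have "\<forall>\<^sub>F X in at_top. (LINT x:{a..X}|lborel. f (Complex x c)) + v X - (LINT x:{a..X}|lborel. f (Complex x d)) - ?v = 0"
    using eventually_gt_at_top[of a]
  proof eventually_elim
    case (elim X)
    have "rect_int a X c d f = 0"
      by (rule rect_int_holomorphic[OF assms(1-3)]) (use assms(4) elim in \<open>auto intro!: sub\<close>)
    moreover have "contour_integral (linepath (Complex a y) (Complex X y)) f = (LINT x:{a..X}|lborel. f (Complex x y))"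
      if "y \<in> {c,d}" for y
      using elim that by (intro linepath_horizontal continuous_on_subset[OF contH]) auto
    ultimately show ?case by (simp add: rect_int_def v_def)
  qed
  ultimately have "((\<lambda>X::real. 0::complex) \<longlongrightarrow> (LINT x:{a..}|lborel. f (Complex x c)) + 0 - (LINT x:{a..}|lborel. f (Complex x d)) - ?v) at_top"
    by (rule Lim_transform_eventually)
  from tendsto_unique[OF _ tendsto_const this] show ?thesis by simp
qed

text \<open>Differentiation under the integral sign; Cauchy's inequality turns the dominating function
  into one for the difference quotients.\<close>

lemma holomorphic_integral:
  fixes f :: "complex \<Rightarrow> 'a \<Rightarrow> complex"
  assumes "open S" "\<And>z. z \<in> S \<Longrightarrow> f z \<in> borel_measurable M"
    and hol: "\<And>u. u \<in> space M \<Longrightarrow> (\<lambda>z. f z u) holomorphic_on S"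
    and dom: "\<And>z0. z0 \<in> S \<Longrightarrow> \<exists>r>0. \<exists>g. integrable M g \<and> (\<forall>z\<in>ball z0 r. \<forall>u\<in>space M. norm (f z u) \<le> g u)"
  shows "(\<lambda>z. LINT u|M. f z u) holomorphic_on S"
  unfolding holomorphic_on_open[OF assms(1)]
proof
  fix z0 assume z0: "z0 \<in> S"
  obtain r0 g where r0: "r0 > 0" and g: "integrable M g" "\<And>z u. z \<in> ball z0 r0 \<Longrightarrow> u \<in> space M \<Longrightarrow> norm (f z u) \<le> g u"
    using dom[OF z0] by blast
  obtain r1 where r1: "r1 > 0" "ball z0 r1 \<subseteq> S" using z0 assms(1) open_contains_ball by blast
  define r where "r = min r0 r1 / 2"
  have r: "r > 0" using r0 r1 by (simp add: r_def)
  have rS: "cball z0 r \<subseteq> S" "cball z0 r \<subseteq> ball z0 r0"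
    using r0 r1 by (auto simp: r_def)
  define D where "D u = deriv (\<lambda>z. f z u) z0" for u
  have fint: "integrable M (f z)" if "z \<in> ball z0 r" for z
  proof (rule Bochner_Integration.integrable_bound[OF g(1)])
    show "f z \<in> borel_measurable M" using that rS by (intro assms(2)) auto
    show "AE u in M. norm (f z u) \<le> norm (g u)"
    proof (rule AE_I2)
      fix u assume "u \<in> space M"
      moreover have "z \<in> ball z0 r0" using that rS(2) ball_subset_cball[of z0 r] by blast
      ultimately show "norm (f z u) \<le> norm (g u)"
        using g(2)[of z u] unfolding real_norm_def by linarith
    qed
  qed
  have lip: "norm (f z u - f z0 u) \<le> 2 * g u / r * norm (z - z0)" if u: "u \<in> space M" and z: "z \<in> ball z0 (r/2)" for u z
  proof (rule field_differentiable_bound[of "ball z0 (r/2)" "\<lambda>z. f z u" "\<lambda>z. deriv (\<lambda>z. f z u) z"])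
    fix w assume w: "w \<in> ball z0 (r/2)"
    have cb: "cball w (r/2) \<subseteq> cball z0 r"
    proof
      fix y assume "y \<in> cball w (r/2)"
      then show "y \<in> cball z0 r" using w dist_triangle[of z0 y w] by simp
    qed
    have wS: "w \<in> S" using cb rS(1) r by (auto simp: subset_iff)
    have h: "(\<lambda>z. f z u) holomorphic_on S" using hol u by auto
    then show "((\<lambda>z. f z u) has_field_derivative deriv (\<lambda>z. f z u) w) (at w within ball z0 (r / 2))"
      by (intro has_field_derivative_at_within[OF holomorphic_derivI[OF h assms(1) wS]])
    have "norm ((deriv ^^ 1) (\<lambda>z. f z u) w) \<le> fact 1 * g u / (r/2) ^ 1"
    proof (rule Cauchy_inequality)
      show "(\<lambda>z. f z u) holomorphic_on ball w (r / 2)"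
        using cb rS(1) ball_subset_cball[of w "r/2"] by (intro holomorphic_on_subset[OF h]) blast
      show "continuous_on (cball w (r / 2)) (\<lambda>z. f z u)"
        using cb rS(1) by (intro holomorphic_on_imp_continuous_on holomorphic_on_subset[OF h]) blast
      show "norm (f x u) \<le> g u" if "norm (w - x) = r / 2" for x
      proof -
        have "x \<in> cball w (r/2)" using that by (simp add: dist_norm)
        then show ?thesis using cb rS u by (intro g(2)) blast+
      qed
    qed (use r in auto)
    then show "norm (deriv (\<lambda>z. f z u) w) \<le> 2 * g u / r" using r by (simp add: mult.commute)
  qed (use z r in auto)
  have Dlim: "((\<lambda>z. (f z u - f z0 u) / (z - z0)) \<longlongrightarrow> D u) (at z0)" if "u \<in> space M" for u
    using holomorphic_derivI[OF hol[OF that] assms(1) z0] unfolding D_def has_field_derivative_iff .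
  have "((\<lambda>z. LINT u|M. f z u) has_field_derivative (LINT u|M. D u)) (at z0)"
    unfolding has_field_derivative_iff tendsto_at_iff_sequentially
  proof (intro allI impI)
    fix X :: "nat \<Rightarrow> complex" assume X: "\<forall>i. X i \<in> UNIV - {z0}" "X \<longlonglongrightarrow> z0"
    have ev: "\<forall>\<^sub>F i in sequentially. X i \<in> ball z0 (r/2)"
      using tendstoD[OF X(2), of "r/2"] r by (simp add: dist_commute)
    then obtain N where N: "\<And>i. i \<ge> N \<Longrightarrow> X i \<in> ball z0 (r/2)" by (auto simp: eventually_sequentially)
    have sub: "ball z0 (r/2) \<subseteq> ball z0 r" "ball z0 r \<subseteq> S" using r rS ball_subset_cball[of z0 r] by auto
    have z0b: "z0 \<in> ball z0 r" using r by simp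
    have "(\<lambda>i. LINT u|M. (f (X (i + N)) u - f z0 u) / (X (i + N) - z0)) \<longlonglongrightarrow> (LINT u|M. D u)"
    proof (rule integral_dominated_convergence[where w="\<lambda>u. 2 * g u / r"])
      show m: "(\<lambda>u. (f (X (i + N)) u - f z0 u) / (X (i + N) - z0)) \<in> borel_measurable M" for i
        using N[of "i+N"] sub z0 by (intro borel_measurable_divide borel_measurable_diff assms(2)) auto
      have lim: "(\<lambda>i. (f (X (i + N)) u - f z0 u) / (X (i + N) - z0)) \<longlonglongrightarrow> D u" if u: "u \<in> space M" for u
      proof -
        have "(\<lambda>i. (f (X i) u - f z0 u) / (X i - z0)) \<longlonglongrightarrow> D u"
          using Dlim[OF u] X unfolding tendsto_at_iff_sequentially comp_def by blast
        then show ?thesis by (rule LIMSEQ_ignore_initial_segment)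
      qed
      show "D \<in> borel_measurable M"
        by (rule borel_measurable_LIMSEQ_metric[OF m]) (rule lim)
      show "AE x in M. (\<lambda>i. (f (X (i + N)) x - f z0 x) / (X (i + N) - z0)) \<longlonglongrightarrow> D x"
        using lim by auto
      show "integrable M (\<lambda>u. 2 * g u / r)" using g(1) by auto
      show "AE u in M. norm ((f (X (i + N)) u - f z0 u) / (X (i + N) - z0)) \<le> 2 * g u / r" for i
      proof (rule AE_I2)
        fix u assume u: "u \<in> space M"
        have "X (i + N) - z0 \<noteq> 0" using X(1) by auto
        then show "norm ((f (X (i + N)) u - f z0 u) / (X (i + N) - z0)) \<le> 2 * g u / r"
          using lip[OF u N[of "i+N"]] by (simp add: norm_divide pos_divide_le_eq)
      qed
    qed
    also have "(\<lambda>i. LINT u|M. (f (X (i + N)) u - f z0 u) / (X (i + N) - z0))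
        = (\<lambda>i. ((LINT u|M. f (X (i + N)) u) - (LINT u|M. f z0 u)) / (X (i + N) - z0))"
    proof
      fix i
      have "X (i + N) \<in> ball z0 r" using N[of "i+N"] sub by auto
      then show "(LINT u|M. (f (X (i + N)) u - f z0 u) / (X (i + N) - z0))
        = ((LINT u|M. f (X (i + N)) u) - (LINT u|M. f z0 u)) / (X (i + N) - z0)"
        using fint fint[OF z0b] by (simp add: Bochner_Integration.integral_diff)
    qed
    finally have "(\<lambda>i. ((LINT u|M. f (X (i + N)) u) - (LINT u|M. f z0 u)) / (X (i + N) - z0)) \<longlonglongrightarrow> (LINT u|M. D u)" .
    then show "((\<lambda>z. ((LINT u|M. f z u) - (LINT u|M. f z0 u)) / (z - z0)) \<circ> X) \<longlonglongrightarrow> (LINT u|M. D u)"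
      unfolding comp_def by (rule LIMSEQ_offset)
  qed
  then show "\<exists>f'. ((\<lambda>z. LINT u|M. f z u) has_field_derivative f') (at z0)" by blast
qed

section \<open>Pole pushing\<close>

text \<open>The polynomial is a Taylor section. Convergence at a radius strictly between s and r
  gives absolute convergence at s, and the tail at s dominates the tail on the whole closed disc.
  That c 0 vanishes is recorded because it makes the polynomial in 1/(z - a) built from it tend to 0
  at infinity.\<close>

lemma taylor_approx:
  fixes f :: "complex \<Rightarrow> complex"
  assumes "f holomorphic_on ball 0 r" "0 < s" "s < r" "f 0 = 0" "\<epsilon> > 0"
  obtains c :: "nat \<Rightarrow> complex" and N where "c 0 = 0"
    "\<And>u. norm u \<le> s \<Longrightarrow> norm (f u - (\<Sum>n<N. c n * u ^ n)) \<le> \<epsilon>"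
proof -
  define c where "c n = (deriv ^^ n) f 0 / fact n" for n
  have sums: "(\<lambda>n. c n * u ^ n) sums f u" if "norm u < r" for u
    using holomorphic_power_series[OF assms(1), of u] that by (simp add: c_def)
  define t where "t = (s + r) / 2"
  have t: "s < t" "t < r" using assms by (auto simp: t_def)
  have "summable (\<lambda>n. c n * of_real t ^ n)"
    using sums[of "of_real t"] t assms(2) by (intro sums_summable) auto
  then have sm: "summable (\<lambda>n. norm (c n * of_real s ^ n))"
    by (rule powser_insidea) (use t assms(2) in auto)
  obtain N where N: "norm (\<Sum>n. norm (c (n + N) * of_real s ^ (n + N))) < \<epsilon>"
    using suminf_exist_split[OF assms(5) sm] by blast
  have sN: "summable (\<lambda>n. norm (c (n + N) * of_real s ^ (n + N)))"
    using sm by (rule summable_ignore_initial_segment)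
  show thesis
  proof (rule that)
    show "c 0 = 0" by (simp add: c_def assms(4))
    fix u :: complex assume u: "norm u \<le> s"
    have le: "norm (c (n + N) * u ^ (n + N)) \<le> norm (c (n + N) * of_real s ^ (n + N))" for n
      using u assms(2) by (simp add: norm_mult norm_power mult_left_mono power_mono)
    have su: "summable (\<lambda>n. norm (c (n + N) * u ^ (n + N)))"
      by (rule summable_comparison_test'[OF sN]) (use le in simp)
    have "f u - (\<Sum>n<N. c n * u ^ n) = (\<Sum>n. c (n + N) * u ^ (n + N))"
      using suminf_minus_initial_segment[of "\<lambda>n. c n * u ^ n" N] sums[of u] u assms(3)
      by (simp add: sums_iff)
    also have "norm \<dots> \<le> (\<Sum>n. norm (c (n + N) * u ^ (n + N)))"
      by (rule summable_norm[OF su])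
    also have "\<dots> \<le> (\<Sum>n. norm (c (n + N) * of_real s ^ (n + N)))"
      by (rule suminf_le[OF le su sN])
    also have "\<dots> \<le> \<epsilon>" using N by simp
    finally show "norm (f u - (\<Sum>n<N. c n * u ^ n)) \<le> \<epsilon>" .
  qed
qed

lemma inverse_shift_tendsto_0: "((\<lambda>z::complex. inverse (z - a)) \<longlongrightarrow> 0) at_infinity"
proof (rule filterlim_compose[OF tendsto_inverse_0])
  show "filterlim (\<lambda>z. z - a) at_infinity at_infinity"
    using tendsto_add_filterlim_at_infinity[OF tendsto_const[of "-a"] filterlim_ident] by simp
qed

text \<open>The inversion u = 1/(z - a) turns the exterior of the disc into a punctured disc, and
  the limit 0 at infinity removes the singularity at u = 0. A Taylor section in u is a polynomial in
  1/(z - a), so its only pole is a. The region |z - a| \<ge> 2\<delta> corresponds to a closed disc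
  of half the radius, where the approximation is uniform.\<close>

lemma pole_push_step:
  assumes hol: "f holomorphic_on {z. \<delta> < norm (z - a)}" and lim: "(f \<longlongrightarrow> 0) at_infinity"
    and "\<epsilon> > 0" "\<delta> > 0"
  obtains g where "g holomorphic_on - {a}" "(g \<longlongrightarrow> 0) at_infinity"
    "\<And>z. norm (z - a) \<ge> 2 * \<delta> \<Longrightarrow> norm (f z - g z) \<le> \<epsilon>"
proof -
  define h where "h u = (if u = 0 then 0 else f (a + inverse u))" for u
  have "h holomorphic_on ball 0 (1 / \<delta>)"
  proof (rule no_isolated_singularity'[where K="{0}"])
    have "filterlim (\<lambda>u::complex. a + inverse u) at_infinity (at 0)"
      by (intro tendsto_add_filterlim_at_infinity[OF tendsto_const] filterlim_inverse_at_infinity)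
    from filterlim_compose[OF lim this] have "((\<lambda>u. f (a + inverse u)) \<longlongrightarrow> 0) (at 0)" .
    then have "(h \<longlongrightarrow> 0) (at 0)"
      by (rule Lim_transform_eventually) (auto simp: h_def eventually_at_filter)
    then show "(h \<longlongrightarrow> h z) (at z within ball 0 (1 / \<delta>))" if "z \<in> {0}" for z
      using that by (auto simp: h_def intro: tendsto_within_subset)
    have "(\<lambda>u. f (a + inverse u)) holomorphic_on ball 0 (1 / \<delta>) - {0}"
    proof (rule holomorphic_on_compose_gen[of "\<lambda>u. a + inverse u" _ f, unfolded comp_def, OF _ hol])
      show "(\<lambda>u. a + inverse u) holomorphic_on ball 0 (1 / \<delta>) - {0}"
        by (intro holomorphic_intros) auto
      show "(\<lambda>u. a + inverse u) ` (ball 0 (1 / \<delta>) - {0}) \<subseteq> {z. \<delta> < norm (z - a)}"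
        using assms(4) by (auto simp: norm_inverse norm_divide field_simps)
    qed
    then show "h holomorphic_on ball 0 (1 / \<delta>) - {0}"
      by (rule holomorphic_transform) (auto simp: h_def)
  qed auto
  then obtain c N where c: "c 0 = 0" "\<And>u. norm u \<le> 1 / (2 * \<delta>) \<Longrightarrow> norm (h u - (\<Sum>n<N. c n * u ^ n)) \<le> \<epsilon>"
    by (rule taylor_approx[where s="1 / (2 * \<delta>)" and \<epsilon>=\<epsilon>]) (use assms in \<open>auto simp: h_def field_simps\<close>)
  show thesis
  proof (rule that)
    show "(\<lambda>z. \<Sum>n<N. c n * inverse (z - a) ^ n) holomorphic_on - {a}"
      by (intro holomorphic_intros) auto
    have "((\<lambda>z. \<Sum>n<N. c n * inverse (z - a) ^ n) \<longlongrightarrow> (\<Sum>n<N. c n * 0 ^ n)) at_infinity"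
      by (intro tendsto_intros inverse_shift_tendsto_0)
    moreover have "c n * 0 ^ n = 0" for n using c(1) by (cases n) auto
    ultimately show "((\<lambda>z. \<Sum>n<N. c n * inverse (z - a) ^ n) \<longlongrightarrow> 0) at_infinity" by simp
    fix z assume z: "2 * \<delta> \<le> norm (z - a)"
    then have "z \<noteq> a" using assms(4) by auto
    then have "h (inverse (z - a)) = f z" by (simp add: h_def)
    moreover have "norm (inverse (z - a)) \<le> 1 / (2 * \<delta>)"
      using z assms(4) by (simp add: norm_inverse norm_divide inverse_eq_divide frac_le)
    ultimately show "norm (f z - (\<Sum>n<N. c n * inverse (z - a) ^ n)) \<le> \<epsilon>"
      using c(2)[of "inverse (z - a)"] by simp
  qed
qed

lemma geometric_limit:
  fixes x :: "nat \<Rightarrow> complex"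
  assumes "\<And>j. j \<ge> J \<Longrightarrow> norm (x j - x (Suc j)) \<le> \<epsilon> * (1/2) ^ Suc j" "j \<ge> J" "\<epsilon> \<ge> 0"
  shows "x \<longlonglongrightarrow> lim x" "norm (x j - lim x) \<le> \<epsilon> * (1/2) ^ j"
proof -
  \<comment> \<open>The bound is kept in telescoped form, since (1/2)^k - (1/2)^(k+1) = (1/2)^(k+1)
    is exactly what the induction step adds.\<close>
  have est: "norm (x j - x k) \<le> \<epsilon> * ((1/2) ^ j - (1/2) ^ k)" if "j \<ge> J" "j \<le> k" for j k
    using that(2)
  proof (induction k rule: dec_induct)
    case (step k)
    have "norm (x j - x (Suc k)) \<le> norm (x j - x k) + norm (x k - x (Suc k))"
      using norm_triangle_ineq[of "x j - x k" "x k - x (Suc k)"] by simp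
    also have "\<dots> \<le> \<epsilon> * ((1/2) ^ j - (1/2) ^ k) + \<epsilon> * (1/2) ^ Suc k"
      using step that by (intro add_mono assms(1)) auto
    finally show ?case by (simp add: algebra_simps)
  qed simp
  have est': "norm (x j - x k) \<le> \<epsilon> * (1/2) ^ j" if "j \<ge> J" "j \<le> k" for j k
  proof -
    have "\<epsilon> * (1/2) ^ k \<ge> 0" using assms(3) by simp
    with est[OF that] show ?thesis by (simp add: right_diff_distrib)
  qed
  have "Cauchy x"
  proof (rule metric_CauchyI)
    fix e :: real assume "e > 0"
    have "(\<lambda>n. \<epsilon> * (1/2) ^ n) \<longlonglongrightarrow> \<epsilon> * 0" by (intro tendsto_intros LIMSEQ_power_zero) auto
    then have "\<forall>\<^sub>F n in sequentially. \<epsilon> * (1/2) ^ n < e / 2"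
      using \<open>e > 0\<close> by (intro order_tendstoD(2)) auto
    then obtain M where M: "\<epsilon> * (1/2) ^ max M J < e / 2" unfolding eventually_sequentially by (meson max.cobounded1)
    have "dist (x m) (x n) < e" if "m \<ge> max M J" "n \<ge> max M J" for m n
    proof -
      have "norm (x (max M J) - x m) < e / 2" "norm (x (max M J) - x n) < e / 2"
        using est'[OF _ that(1)] est'[OF _ that(2)] M by force+
      then show ?thesis by (metis dist_commute dist_norm dist_triangle_half_r)
    qed
    then show "\<exists>M. \<forall>m\<ge>M. \<forall>n\<ge>M. dist (x m) (x n) < e" by blast
  qed
  then show lim: "x \<longlonglongrightarrow> lim x" by (simp add: Cauchy_convergent_iff convergent_LIMSEQ_iff)
  have "(\<lambda>k. norm (x j - x k)) \<longlonglongrightarrow> norm (x j - lim x)" by (intro tendsto_intros lim)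
  then show "norm (x j - lim x) \<le> \<epsilon> * (1/2) ^ j"
    by (rule tendsto_upperbound)
       (auto simp: eventually_sequentially intro!: exI[of _ j] est' assms(2))
qed

text \<open>Runge's pole pushing: the singular set of \<open>f\<close> is moved to infinity through the discs
  around the centres \<open>a j\<close>.\<close>

lemma pole_push:
  fixes a :: "nat \<Rightarrow> complex"
  fixes \<rho> :: "nat \<Rightarrow> real"
  assumes \<rho>: "\<And>j. \<rho> j > 0" and step: "\<And>j. norm (a (Suc j) - a j) \<le> \<rho> (Suc j)"
    and far: "\<And>R. \<exists>J. \<forall>j\<ge>J. \<forall>z\<in>ball 0 R. norm (z - a j) \<ge> 2 * \<rho> j"
    and hol: "f holomorphic_on {z. \<rho> 0 < norm (z - a 0)}" and lim: "(f \<longlongrightarrow> 0) at_infinity"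
    and \<epsilon>: "\<epsilon> > 0"
  obtains e where "e holomorphic_on UNIV"
    "\<And>z. (\<And>j. norm (z - a j) \<ge> 2 * \<rho> j) \<Longrightarrow> norm (f z - e z) \<le> \<epsilon>"
proof -
  \<comment> \<open>The clause for n = 0 forces the sequence obtained by dependent choice to start
    with f itself.\<close>
  define P where "P n g \<longleftrightarrow> (n = 0 \<longrightarrow> g = f) \<and> g holomorphic_on {z. \<rho> n < norm (z - a n)} \<and> (g \<longlongrightarrow> 0) at_infinity"
    for n :: nat and g :: "complex \<Rightarrow> complex"
  define Q where "Q n g h \<longleftrightarrow> (\<forall>z. norm (z - a n) \<ge> 2 * \<rho> n \<longrightarrow> norm (g z - h z) \<le> \<epsilon> * (1/2) ^ Suc n)"
    for n :: nat and g h :: "complex \<Rightarrow> complex"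
  have "\<exists>F. \<forall>n. P n (F n) \<and> Q n (F n) (F (Suc n))"
  proof (rule dependent_nat_choice)
    show "\<exists>g. P 0 g" using hol lim by (auto simp: P_def)
    fix g n assume "P n g"
    then obtain h where h: "h holomorphic_on - {a n}" "(h \<longlongrightarrow> 0) at_infinity"
      "\<And>z. norm (z - a n) \<ge> 2 * \<rho> n \<Longrightarrow> norm (g z - h z) \<le> \<epsilon> * (1/2) ^ Suc n"
      using pole_push_step[where f=g and \<delta>="\<rho> n" and a="a n" and \<epsilon>="\<epsilon> * (1/2) ^ Suc n"] \<epsilon> \<rho>[of n] unfolding P_def by auto
    \<comment> \<open>The new pole a n lies in the closed disc of radius \<rho> (n+1) about a (n+1),
      so the invariant holds with the next disc.\<close>
    have sub: "{z. \<rho> (Suc n) < norm (z - a (Suc n))} \<subseteq> - {a n}"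
      using step[of n] by (auto simp: norm_minus_commute)
    with h show "\<exists>h. P (Suc n) h \<and> Q n g h"
      unfolding P_def Q_def by (intro exI[of _ h]) (auto intro: holomorphic_on_subset)
  qed
  then obtain F where F: "\<And>n. P n (F n)" "\<And>n. Q n (F n) (F (Suc n))" by blast
  have F0: "F 0 = f" using F(1)[of 0] by (simp add: P_def)
  define e where "e z = lim (\<lambda>n. F n z)" for z
  have conv: "norm (F j z - e z) \<le> \<epsilon> * (1/2) ^ j"
    if "\<And>j. j \<ge> J \<Longrightarrow> norm (z - a j) \<ge> 2 * \<rho> j" "j \<ge> J" for z j J
    unfolding e_def
    by (rule geometric_limit(2)[where J=J and x="\<lambda>n. F n z"])
       (use F(2) that \<epsilon> in \<open>auto simp: Q_def\<close>)
  show thesis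
  proof (rule that)
    have "e holomorphic_on ball 0 R" for R
    proof -
      \<comment> \<open>The functions with index below J may still be singular inside the ball; from
        J on they are holomorphic there and converge uniformly.\<close>
      obtain J where J: "\<And>j z. j \<ge> J \<Longrightarrow> z \<in> ball 0 R \<Longrightarrow> norm (z - a j) \<ge> 2 * \<rho> j"
        using far[of R] by blast
      show ?thesis
      proof (rule holomorphic_uniform_sequence[where f="\<lambda>n. F (n + J)"])
        show "F (n + J) holomorphic_on ball 0 R" for n
        proof (rule holomorphic_on_subset)
          show "F (n + J) holomorphic_on {z. \<rho> (n + J) < norm (z - a (n + J))}"
            using F(1)[of "n + J"] by (simp add: P_def)
          show "ball 0 R \<subseteq> {z. \<rho> (n + J) < norm (z - a (n + J))}"
            using J[of "n + J"] \<rho>[of "n + J"] by force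
        qed
        fix x :: complex assume x: "x \<in> ball 0 R"
        then obtain d where d: "d > 0" "cball x d \<subseteq> ball 0 R"
          using open_contains_cball[of "ball (0::complex) R"] by blast
        have "uniform_limit (cball x d) (\<lambda>n. F (n + J)) e sequentially"
        proof (rule uniform_limitI)
          fix r :: real assume "r > 0"
          have "(\<lambda>n. \<epsilon> * (1/2) ^ (n + J)) \<longlonglongrightarrow> \<epsilon> * 0"
            by (intro tendsto_intros LIMSEQ_ignore_initial_segment LIMSEQ_power_zero) auto
          then have "\<forall>\<^sub>F n in sequentially. \<epsilon> * (1/2) ^ (n + J) < r"
            using \<open>r > 0\<close> by (intro order_tendstoD(2)) auto
          then show "\<forall>\<^sub>F n in sequentially. \<forall>x\<in>cball x d. dist (F (n + J) x) (e x) < r"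
          proof eventually_elim
            case (elim n)
            show ?case
            proof
              fix y assume "y \<in> cball x d"
              then have "y \<in> ball 0 R" using d by blast
              then have "norm (F (n + J) y - e y) \<le> \<epsilon> * (1/2) ^ (n + J)"
                by (intro conv[where J=J] J) auto
              with elim show "dist (F (n + J) y) (e y) < r" by (simp add: dist_norm)
            qed
          qed
        qed
        with d show "\<exists>d>0. cball x d \<subseteq> ball 0 R \<and> uniform_limit (cball x d) (\<lambda>n. F (n + J)) e sequentially"
          by blast
      qed auto
    qed
    then have "e holomorphic_on (\<Union>R. ball 0 R)" by (intro holomorphic_on_UN_open) auto
    moreover have "(\<Union>R. ball (0::complex) R) = UNIV"
      using gt_ex by (auto simp: dist_norm)
    ultimately show "e holomorphic_on UNIV" by simp
    show "norm (f z - e z) \<le> \<epsilon>" if "\<And>j. norm (z - a j) \<ge> 2 * \<rho> j" for z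
      using conv[of 0 z 0] that F0 by simp
  qed
qed

lemma holomorphic_suminf:
  fixes f :: "nat \<Rightarrow> complex \<Rightarrow> complex"
  assumes "open S" "\<And>n. f n holomorphic_on S" "summable M" "\<And>n z. z \<in> S \<Longrightarrow> norm (f n z) \<le> M n"
  shows "(\<lambda>z. \<Sum>n. f n z) holomorphic_on S"
proof (rule holomorphic_uniform_sequence[OF assms(1)])
  show "(\<lambda>z. \<Sum>i<n. f i z) holomorphic_on S" for n by (intro holomorphic_intros assms)
  fix x assume "x \<in> S"
  then obtain d where d: "d > 0" "cball x d \<subseteq> S" using assms(1) open_contains_cball by blast
  have "uniform_limit (cball x d) (\<lambda>n z. \<Sum>i<n. f i z) (\<lambda>z. \<Sum>n. f n z) sequentially"
    by (rule Weierstrass_m_test[OF assms(4,3)]) (use d in auto)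
  with d show "\<exists>d>0. cball x d \<subseteq> S \<and> uniform_limit (cball x d) (\<lambda>n z. \<Sum>i<n. f i z) (\<lambda>z. \<Sum>n. f n z) sequentially"
    by blast
qed

text \<open>Off the segment the kernel may be differentiated under the integral, and at infinity it
  is O(1/|z|) because the segment is bounded. These are the two hypotheses under which a pole can be
  pushed.\<close>

lemma cauchy_transform:
  assumes "continuous_on (closed_segment p q) g"
  shows "(\<lambda>z. contour_integral (linepath p q) (\<lambda>w. g w / (w - z))) holomorphic_on - closed_segment p q"
    "((\<lambda>z. contour_integral (linepath p q) (\<lambda>w. g w / (w - z))) \<longlongrightarrow> 0) at_infinity"
proof -
  let ?F = "\<lambda>z. contour_integral (linepath p q) (\<lambda>w. g w / (w - z))"
  have ci: "(\<lambda>w. g w / (w - z)) contour_integrable_on linepath p q" if "z \<notin> closed_segment p q" for z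
    using that by (intro contour_integrable_continuous_linepath continuous_intros assms) auto
  have "(?F has_field_derivative (of_nat 1 * contour_integral (linepath p q) (\<lambda>u. g u / (u - z) ^ Suc 1))) (at z)"
    if "z \<notin> closed_segment p q" for z
  proof (rule Cauchy_next_derivative(2)[where S=UNIV and k=1 and B="norm (q - p)"])
    show "((\<lambda>u. g u / (u - w) ^ 1) has_contour_integral contour_integral (linepath p q) (\<lambda>w'. g w' / (w' - w))) (linepath p q)"
      if "w \<in> UNIV - path_image (linepath p q)" for w
      using has_contour_integral_integral[OF ci[of w]] that by simp
  qed (use assms that in auto)
  then show "?F holomorphic_on - closed_segment p q"
    by (intro holomorphic_onI) (auto simp: field_differentiable_def intro: has_field_derivative_at_within)
  have "compact (g ` closed_segment p q)" by (intro compact_continuous_image assms compact_segment)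
  then obtain B where B: "\<And>w. w \<in> closed_segment p q \<Longrightarrow> norm (g w) \<le> B"
    unfolding bounded_iff compact_eq_bounded_closed by auto
  obtain R where R: "\<And>w. w \<in> closed_segment p q \<Longrightarrow> norm w \<le> R"
    using compact_segment[of p q] unfolding compact_eq_bounded_closed bounded_iff by auto
  have B0: "B \<ge> 0" using B[of p] norm_ge_zero[of "g p"] by (simp del: norm_ge_zero)
  show "(?F \<longlongrightarrow> 0) at_infinity"
  proof (rule Lim_null_comparison)
    have "((\<lambda>x. B / (x - R) * norm (q - p)) \<longlongrightarrow> 0) at_top" by real_asymp
    then show "((\<lambda>z::complex. B / (norm z - R) * norm (q - p)) \<longlongrightarrow> 0) at_infinity"
      by (rule filterlim_compose) (rule filterlim_at_infinity_imp_norm_at_top[OF filterlim_ident])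
    have "\<forall>\<^sub>F z::complex in at_infinity. norm z > R"
      by (simp add: eventually_at_infinity) (metis less_add_one order_less_le_trans)
    then show "\<forall>\<^sub>F z in at_infinity. norm (?F z) \<le> B / (norm z - R) * norm (q - p)"
    proof eventually_elim
      case (elim z)
      have z: "z \<notin> closed_segment p q" using R[of z] elim by auto
      show ?case
      proof (rule contour_integral_linepath_bound[OF ci[OF z]])
        fix w assume w: "w \<in> closed_segment p q"
        have "norm z - R \<le> norm (w - z)" using R[OF w] norm_triangle_ineq2[of z w] by (simp add: norm_minus_commute)
        then show "norm (g w / (w - z)) \<le> B / (norm z - R)"
          using B[OF w] elim B0 by (simp add: norm_divide frac_le)
      qed (use elim B0 in auto)
    qed
  qed
qed

section \<open>Entire approximation of functions on the upper half-plane\<close>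

lemma bounded_on_rectangle:
  assumes "continuous_on {z. x0 \<le> Re z \<and> Re z \<le> x1 \<and> y0 \<le> Im z \<and> Im z \<le> y1} f"
  obtains C :: real where "\<And>z. x0 \<le> Re z \<Longrightarrow> Re z \<le> x1 \<Longrightarrow> y0 \<le> Im z \<Longrightarrow> Im z \<le> y1 \<Longrightarrow> norm (f z :: complex) \<le> C"
proof -
  have "{z. x0 \<le> Re z \<and> Re z \<le> x1 \<and> y0 \<le> Im z \<and> Im z \<le> y1} = cbox (Complex x0 y0) (Complex x1 y1)"
    by (auto simp: in_cbox_complex_iff)
  with assms have "compact (f ` {z. x0 \<le> Re z \<and> Re z \<le> x1 \<and> y0 \<le> Im z \<and> Im z \<le> y1})"
    by (intro compact_continuous_image) auto
  then show thesis using that unfolding compact_eq_bounded_closed bounded_iff by auto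
qed

lemma open_convex_halfplane_regions:
  "open {z. a < s * Re z \<and> b < Im z}" "convex {z. a < s * Re z \<and> b < Im z}"
proof -
  show "open {z. a < s * Re z \<and> b < Im z}"
    by (intro open_Collect_conj open_Collect_less continuous_intros)
  have "{z. a < s * Re z \<and> b < Im z} = {z. a < Complex s 0 \<bullet> z} \<inter> {z. b < \<i> \<bullet> z}"
    by (auto simp: inner_complex_def)
  then show "convex {z. a < s * Re z \<and> b < Im z}"
    by (simp only: convex_Int convex_halfspace_gt)
qed

lemma open_convex_strip:
  "open {z. a < Im z \<and> Im z < b}" "convex {z. a < Im z \<and> Im z < b}"
proof -
  show "open {z. a < Im z \<and> Im z < b}"
    by (intro open_Collect_conj open_Collect_less continuous_intros)
  have "{z. a < Im z \<and> Im z < b} = {z. a < \<i> \<bullet> z} \<inter> {z. \<i> \<bullet> z < b}"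
    by (auto simp: inner_complex_def)
  then show "convex {z. a < Im z \<and> Im z < b}"
    by (simp only: convex_Int convex_halfspace_gt convex_halfspace_lt)
qed

lemma open_convex_box:
  "open {z. \<bar>Re z\<bar> < a \<and> \<bar>Im z\<bar> < b}" "convex {z. \<bar>Re z\<bar> < a \<and> \<bar>Im z\<bar> < b}"
proof -
  have "{z. \<bar>Re z\<bar> < a \<and> \<bar>Im z\<bar> < b} = box (Complex (-a) (-b)) (Complex a b)"
    by (auto simp: in_box_complex_iff)
  then show "open {z. \<bar>Re z\<bar> < a \<and> \<bar>Im z\<bar> < b}" "convex {z. \<bar>Re z\<bar> < a \<and> \<bar>Im z\<bar> < b}"
    by (simp_all add: open_box convex_box)
qed

lemma open_convex_upper: "open upper" "convex upper"
proof -
  have "upper = {z. -1 < 0 * Re z \<and> 0 < Im z}" by (simp add: upper_def)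
  then show "open upper" "convex upper" using open_convex_halfplane_regions by metis+
qed

locale upper_holomorphic =
  fixes G :: "complex \<Rightarrow> complex" assumes G: "G holomorphic_on upper"
begin

text \<open>Let \<open>\<Gamma>\<close> be the infinite polygon with the vertices \<open>vtx s k\<close>, \<open>s = \<plusminus>1\<close>. Its Cauchy transform
  jumps by \<open>2\<pi>\<i> G\<close> across \<open>\<Gamma>\<close>. The integral over each edge is corrected by an entire function, obtained
  by pushing its poles along the real axis to infinity. The abscissae are harmonic numbers, so that the
  discs used for pole pushing can shrink to radius \<open>0\<close> while their centres still escape to infinity;
  hence \<open>\<bar>Im z\<bar> \<ge> b > 0\<close> avoids all of them as soon as \<open>\<bar>Re z\<bar>\<close> is large.\<close>

definition vtx :: "real \<Rightarrow> nat \<Rightarrow> complex" where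
  "vtx s k = Complex (s * harm k) (1 / real (Suc k))"

definition ctr :: "real \<Rightarrow> nat \<Rightarrow> complex" where
  "ctr s k = Complex (s * harm k) 0"

definition piece :: "real \<Rightarrow> nat \<Rightarrow> complex \<Rightarrow> complex" where
  "piece s k z = contour_integral (linepath (vtx s k) (vtx s (Suc k))) (\<lambda>w. G w / (w - z))"

text \<open>The radius 4/(j+1) is twice the radius 2/(j+1) of the discs that carry the
  singularities. The condition singles out the points at which all edges with index at least k have
  a controlled correction, on both sides s = 1 and s = -1.\<close>

definition far :: "nat \<Rightarrow> complex \<Rightarrow> bool" where
  "far k z \<longleftrightarrow> (\<forall>s\<in>{1,-1}. \<forall>j\<ge>k. 4 / real (Suc j) \<le> norm (z - ctr s j))"

lemma vtx_upper: "vtx s k \<in> upper" by (simp add: vtx_def upper_def)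

lemma segment_upper: "p \<in> upper \<Longrightarrow> q \<in> upper \<Longrightarrow> closed_segment p q \<subseteq> upper"
  using open_convex_upper by (simp add: closed_segment_subset)

lemma G_cont: "A \<subseteq> upper \<Longrightarrow> continuous_on A G"
  using G holomorphic_on_imp_continuous_on continuous_on_subset by blast

lemma ctr_step: "s \<in> {1,-1} \<Longrightarrow> norm (ctr s (Suc j) - ctr s j) = 1 / real (Suc j)"
proof -
  assume "s \<in> {1,-1}"
  moreover have "ctr s (Suc j) - ctr s j = of_real (s / real (Suc j))"
    by (simp add: ctr_def harm_Suc complex_eq_iff field_simps)
  ultimately show ?thesis by (auto simp: norm_divide simp del: of_nat_Suc)
qed

text \<open>A vertex lies 1/(j+1) above its centre and the centres with indices k and k+1 are
  1/(k+1) apart; this gives the radius 2/(k+1).\<close>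

lemma segment_near:
  assumes s: "s \<in> {1,-1}"
  shows "closed_segment (vtx s k) (vtx s (Suc k)) \<subseteq> cball (ctr s k) (2 / real (Suc k))"
proof -
  have v: "norm (vtx s j - ctr s j) = 1 / real (Suc j)" for j
    by (simp add: vtx_def ctr_def cmod_def)
  have "norm (vtx s (Suc k) - ctr s k) \<le> norm (vtx s (Suc k) - ctr s (Suc k)) + norm (ctr s (Suc k) - ctr s k)"
    using norm_triangle_ineq[of "vtx s (Suc k) - ctr s (Suc k)" "ctr s (Suc k) - ctr s k"] by simp
  also have "\<dots> \<le> 1 / real (Suc k) + 1 / real (Suc k)"
    unfolding v ctr_step[OF s] by (intro add_mono frac_le) auto
  finally have "vtx s (Suc k) \<in> cball (ctr s k) (2 / real (Suc k))"
    by (simp add: dist_norm norm_minus_commute)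
  moreover have "vtx s k \<in> cball (ctr s k) (2 / real (Suc k))"
    using v[of k] by (simp add: dist_norm norm_minus_commute divide_right_mono)
  ultimately show ?thesis by (intro closed_segment_subset convex_cball)
qed

lemma piece_holomorphic:
  "s \<in> {1,-1} \<Longrightarrow> piece s k holomorphic_on {z. 2 / real (Suc k) < norm (z - ctr s k)}"
  unfolding piece_def
  by (rule holomorphic_on_subset[OF cauchy_transform(1)[OF G_cont[OF segment_upper[OF vtx_upper vtx_upper]]]])
     (use segment_near in \<open>fastforce simp: dist_norm norm_minus_commute\<close>)

text \<open>All the radii are at most 4, and the centres with index at least k have real part of
  modulus at least \<open>harm k\<close>.\<close>

lemma far_if_Re: assumes "\<bar>Re z\<bar> \<le> harm k - 4" shows "far k z"
  unfolding far_def
proof (intro ballI allI impI)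
  fix s :: real and j assume s: "s \<in> {1,-1}" and j: "j \<ge> k"
  have "4 / real (Suc j) \<le> 4 / 1" by (intro frac_le) auto
  also have "4 \<le> harm j - \<bar>Re z\<bar>" using assms harm_mono[OF j, where 'a=real] by simp
  also have "\<dots> \<le> \<bar>Re (z - ctr s j)\<bar>"
    using s harm_nonneg[of j, where 'a=real] by (auto simp: ctr_def)
  also have "\<dots> \<le> norm (z - ctr s j)" by (rule abs_Re_le_cmod)
  finally show "4 / real (Suc j) \<le> norm (z - ctr s j)" by simp
qed

text \<open>The finitely many centres with index up to k are avoided horizontally. The later ones
  are avoided vertically, because there 4/(j+1) \<le> b.\<close>

lemma far_if_Im:
  assumes "b > 0"
  obtains X where "X \<ge> 0" "\<And>z. X \<le> \<bar>Re z\<bar> \<Longrightarrow> b \<le> \<bar>Im z\<bar> \<Longrightarrow> far 0 z"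
proof -
  obtain k where k: "4 / b < real k" using reals_Archimedean2 by blast
  show thesis
  proof (rule that[of "harm k + 4"])
    fix z assume z: "harm k + 4 \<le> \<bar>Re z\<bar>" "b \<le> \<bar>Im z\<bar>"
    show "far 0 z" unfolding far_def
    proof (intro ballI allI impI)
      fix s :: real and j assume s: "s \<in> {1,-1}"
      show "4 / real (Suc j) \<le> norm (z - ctr s j)"
      proof (cases "j \<le> k")
        case True
        have "4 / real (Suc j) \<le> 4 / 1" by (intro frac_le) auto
        also have "4 \<le> \<bar>Re z\<bar> - harm j" using z harm_mono[OF True, where 'a=real] by simp
        also have "\<dots> \<le> \<bar>Re (z - ctr s j)\<bar>"
          using s harm_nonneg[of j, where 'a=real] by (auto simp: ctr_def)
        also have "\<dots> \<le> norm (z - ctr s j)" by (rule abs_Re_le_cmod)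
        finally show ?thesis by simp
      next
        case False
        then have "4 / b \<le> real (Suc j)" using k by simp
        then have "4 / real (Suc j) \<le> b" using assms by (simp add: field_simps)
        also have "\<dots> \<le> \<bar>Im (z - ctr s j)\<bar>" using z by (simp add: ctr_def)
        also have "\<dots> \<le> norm (z - ctr s j)" by (rule abs_Im_le_cmod)
        finally show ?thesis .
      qed
    qed
  qed (simp add: harm_nonneg)
qed

lemma ex_push:
  assumes s: "s \<in> {1,-1}"
  shows "\<exists>e. e holomorphic_on UNIV \<and> (\<forall>z. far k z \<longrightarrow> norm (piece s k z - e z) \<le> (1/2) ^ k)"
proof -
  obtain e where "e holomorphic_on UNIV"
    "\<And>z. (\<And>j. norm (z - ctr s (k + j)) \<ge> 2 * (2 / real (Suc (k + j)))) \<Longrightarrow> norm (piece s k z - e z) \<le> (1/2) ^ k"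
  proof (rule pole_push[where \<rho>="\<lambda>j. 2 / real (Suc (k + j))" and a="\<lambda>j. ctr s (k + j)" and f="piece s k" and \<epsilon>="(1/2)^k"])
    show "norm (ctr s (k + Suc j) - ctr s (k + j)) \<le> 2 / real (Suc (k + Suc j))" for j
    proof -
      \<comment> \<open>Consecutive centres must be no further apart than the next radius; with m =
        k + j this reads 1/(m+1) \<le> 2/(m+2).\<close>
      have "1 / real (Suc (k + j)) \<le> 2 / real (Suc (k + Suc j))" by (simp add: field_simps)
      then show ?thesis using ctr_step[OF s, of "k + j"] by simp
    qed
    show "\<exists>J. \<forall>j\<ge>J. \<forall>z\<in>ball 0 R. 2 * (2 / real (Suc (k + j))) \<le> norm (z - ctr s (k + j))" for R
    proof -
      have "\<forall>\<^sub>F j in sequentially. R + 4 \<le> harm j"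
        using harm_at_top unfolding filterlim_at_top by blast
      then obtain J where J: "\<And>j. j \<ge> J \<Longrightarrow> R + 4 \<le> harm j" by (auto simp: eventually_sequentially)
      have "2 * (2 / real (Suc (k + j))) \<le> norm (z - ctr s (k + j))" if "j \<ge> J" "z \<in> ball 0 R" for j z
      proof -
        have "\<bar>Re z\<bar> \<le> harm (k + j) - 4" using J[of "k+j"] that abs_Re_le_cmod[of z] by simp
        then show ?thesis using far_if_Re[of z "k+j"] s unfolding far_def by force
      qed
      then show ?thesis by blast
    qed
    show "(piece s k \<longlongrightarrow> 0) at_infinity"
      using cauchy_transform(2)[OF G_cont[OF segment_upper[OF vtx_upper vtx_upper]]] unfolding piece_def .
    show "piece s k holomorphic_on {z. 2 / real (Suc (k + 0)) < norm (z - ctr s (k + 0))}"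
      using piece_holomorphic[OF s, of k] by simp
  qed auto
  moreover have "norm (z - ctr s (k + j)) \<ge> 2 * (2 / real (Suc (k + j)))" if "far k z" for z j
  proof -
    have "4 / real (Suc (k + j)) \<le> norm (z - ctr s (k + j))"
      using that s le_add1 unfolding far_def by blast
    then show ?thesis by simp
  qed
  ultimately show ?thesis by blast
qed

definition corr :: "real \<Rightarrow> nat \<Rightarrow> complex \<Rightarrow> complex" where
  "corr s k = (SOME e. e holomorphic_on UNIV \<and> (\<forall>z. far k z \<longrightarrow> norm (piece s k z - e z) \<le> (1/2) ^ k))"

lemma corr:
  assumes "s \<in> {1,-1}"
  shows "corr s k holomorphic_on UNIV" "far k z \<Longrightarrow> norm (piece s k z - corr s k z) \<le> (1/2) ^ k"
  using someI_ex[OF ex_push[OF assms, of k]] unfolding corr_def by auto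

text \<open>The polygon runs from left to right, whereas the vertices on the left are numbered
  outwards; hence the minus sign in front of the contribution of the left edge.\<close>

definition rem :: "nat \<Rightarrow> complex \<Rightarrow> complex" where
  "rem k z = (piece 1 k z - corr 1 k z) - (piece (-1) k z - corr (-1) k z)"

lemma rem_bound: "far k z \<Longrightarrow> norm (rem k z) \<le> 2 * (1/2) ^ k"
  using norm_triangle_ineq4[of "piece 1 k z - corr 1 k z" "piece (-1) k z - corr (-1) k z"]
    corr(2)[of 1 k z] corr(2)[of "-1" k z] unfolding rem_def by auto

lemma rem_holomorphic:
  assumes "\<And>z. z \<in> S \<Longrightarrow> far k z" shows "rem k holomorphic_on S"
proof -
  have "piece s k holomorphic_on S" if s: "s \<in> {1,-1}" for s
  proof (rule holomorphic_on_subset[OF piece_holomorphic[OF s]])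
    have "2 / real (Suc k) < norm (z - ctr s k)" if "z \<in> S" for z
    proof -
      have "2 / real (Suc k) < 4 / real (Suc k)" by (simp add: divide_strict_right_mono del: of_nat_Suc)
      then show ?thesis using assms[OF that] s unfolding far_def by force
    qed
    then show "S \<subseteq> {z. 2 / real (Suc k) < norm (z - ctr s k)}" by auto
  qed
  then show ?thesis unfolding rem_def
    by (intro holomorphic_intros holomorphic_on_subset[OF corr(1)]) auto
qed

lemma far_mono: "far k z \<Longrightarrow> k \<le> k' \<Longrightarrow> far k' z" unfolding far_def by auto

lemma summable_bound: "summable (\<lambda>k. 2 * (1/2) ^ k :: real)" by (intro summable_mult summable_geometric) auto

lemma rem_summable: assumes "far m z" shows "summable (\<lambda>k. rem k z)"
proof (rule summable_comparison_test'[OF summable_bound, where N=m])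
  show "norm (rem n z) \<le> 2 * (1/2) ^ n" if "n \<ge> m" for n
    using rem_bound[OF far_mono[OF assms that]] .
qed

definition total :: "complex \<Rightarrow> complex" where "total z = (\<Sum>k. rem k z)"

lemma total_bound: assumes "far 0 z" shows "norm (total z) \<le> 4"
proof -
  have *: "norm (rem k z) \<le> 2 * (1/2) ^ k" for k using rem_bound[OF far_mono[OF assms]] by auto
  have "norm (total z) \<le> (\<Sum>k. 2 * (1/2) ^ k :: real)"
    unfolding total_def by (rule norm_suminf_le[OF * summable_bound])
  also have "\<dots> = 4" by (subst suminf_mult) (auto simp: suminf_geometric summable_geometric)
  finally show ?thesis .
qed

section \<open>Closing the truncated polygon and gluing an entire function\<close>

text \<open>The right, top and left sides of a rectangle, traversed counterclockwise. They close the
  part of the polygon between the two vertices with index m.\<close>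

definition closing :: "nat \<Rightarrow> complex \<Rightarrow> complex" where
  "closing m z = (let P = Complex (harm m) (real m + 1); Q = Complex (- harm m) (real m + 1); f = (\<lambda>w. G w / (w - z))
     in contour_integral (linepath (vtx 1 m) P) f - contour_integral (linepath Q P) f
       - contour_integral (linepath (vtx (-1) m) Q) f)"

text \<open>The margin 4 makes every edge with index at least m far from the region, and the region
  misses the closing sides, which lie at abscissae \<open>harm m\<close>, \<open>- harm m\<close>
  and at height m + 1.\<close>

definition region :: "nat \<Rightarrow> complex set" where
  "region m = {z. \<bar>Re z\<bar> < harm m - 4 \<and> \<bar>Im z\<bar> < real m}"

lemma closing_holomorphic: "closing m holomorphic_on region m"
proof -
  let ?P = "Complex (harm m) (real m + 1)" and ?Q = "Complex (- harm m) (real m + 1)"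
  have up: "?P \<in> upper" "?Q \<in> upper" by (auto simp: upper_def)
  have *: "(\<lambda>z. contour_integral (linepath p q) (\<lambda>w. G w / (w - z))) holomorphic_on region m"
    if "p \<in> upper" "q \<in> upper" "\<And>z. z \<in> closed_segment p q \<Longrightarrow> z \<notin> region m" for p q
    using that by (intro holomorphic_on_subset[OF cauchy_transform(1)] G_cont segment_upper) auto
  show ?thesis unfolding closing_def Let_def
    by (intro holomorphic_intros *)
       (auto simp: up vtx_upper upper_def closed_segment_vertical closed_segment_horizontal region_def vtx_def)
qed

text \<open>With a primitive the edges telescope to the chord between the outermost vertices. The
  two halves fit together because \<open>harm 0\<close> = 0, so both start at the same
  vertex.\<close>

lemma telescope_pieces:
  assumes "convex S" "open S" "(\<lambda>w. G w / (w - z)) holomorphic_on S" "\<And>s k. vtx s k \<in> S"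
  shows "(\<Sum>k<m. piece 1 k z - piece (-1) k z) = contour_integral (linepath (vtx (-1) m) (vtx 1 m)) (\<lambda>w. G w / (w - z))"
proof -
  obtain g where g: "\<And>a b. a \<in> S \<Longrightarrow> b \<in> S \<Longrightarrow> ((\<lambda>w. G w / (w - z)) has_contour_integral (g b - g a)) (linepath a b)"
    using contour_integral_linepath_primitive[OF assms(1-3)] by blast
  have "(\<Sum>k<m. piece 1 k z - piece (-1) k z) = (g (vtx 1 m) - g (vtx 1 0)) - (g (vtx (-1) m) - g (vtx (-1) 0))"
  proof -
    have "(\<Sum>k<m. piece s k z) = g (vtx s m) - g (vtx s 0)" for s
      unfolding piece_def g[OF assms(4) assms(4), THEN contour_integral_unique] by (rule sum_lessThan_telescope)
    then show ?thesis by (simp only: sum_subtractf)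
  qed
  moreover have "vtx (-1) 0 = vtx 1 0" by (simp add: vtx_def harm_def)
  ultimately show ?thesis using g[OF assms(4) assms(4), THEN contour_integral_unique] by simp
qed

lemma closing_rect:
  "closing m z + contour_integral (linepath (vtx (-1) m) (vtx 1 m)) (\<lambda>w. G w / (w - z))
    = rect_int (- harm m) (harm m) (1 / real (Suc m)) (real m + 1) (\<lambda>w. G w / (w - z))"
  by (simp add: closing_def Let_def rect_int_def vtx_def)

text \<open>Below the real axis the Cauchy integrand has no pole in the upper half-plane, so
  replacing the polygon by its chord closes a rectangle with integral 0.\<close>

lemma low:
  assumes "Im z < 0" shows "closing m z + (\<Sum>k<m. piece 1 k z - piece (-1) k z) = 0"
proof -
  have h: "(\<lambda>w. G w / (w - z)) holomorphic_on upper"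
    by (intro holomorphic_intros G) (use assms in \<open>auto simp: upper_def\<close>)
  have "rect_int (- harm m) (harm m) (1 / real (Suc m)) (real m + 1) (\<lambda>w. G w / (w - z)) = 0"
    by (rule rect_int_holomorphic[OF open_convex_upper(2,1) h]) (auto simp: upper_def)
  then show ?thesis
    unfolding telescope_pieces[OF open_convex_upper(2,1) h vtx_upper] closing_rect .
qed

text \<open>The vertices have height at most 1, so for Im z > 1 the polygon can be replaced by its
  chord inside the strip 0 < Im w < Im z, which does not contain the pole. The resulting rectangle
  encloses z. Lower points of the upper half-plane are reached later by analytic
  continuation.\<close>

lemma high:
  assumes "Im z > 1" "z \<in> region m"
  shows "closing m z + (\<Sum>k<m. piece 1 k z - piece (-1) k z) = 2 * of_real pi * \<i> * G z"
proof -
  let ?S = "{w. 0 < Im w \<and> Im w < Im z}"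
  have h: "(\<lambda>w. G w / (w - z)) holomorphic_on ?S"
    by (intro holomorphic_intros holomorphic_on_subset[OF G]) (auto simp: upper_def)
  have v: "vtx s k \<in> ?S" for s k
  proof -
    have "1 / real (Suc k) \<le> 1" by simp
    then have "1 / real (Suc k) < Im z" using assms(1) by linarith
    then show ?thesis by (simp add: vtx_def)
  qed
  have "1 / real (Suc m) \<le> 1" by simp
  then have less: "1 / real (Suc m) < Im z" using assms(1) by linarith
  have "rect_int (- harm m) (harm m) (1 / real (Suc m)) (real m + 1) (\<lambda>w. G w / (w - z)) = 2 * of_real pi * \<i> * G z"
    by (rule rect_int_pole[OF open_convex_upper(2,1) G])
       (use assms less in \<open>auto simp: upper_def region_def\<close>)
  then show ?thesis
    unfolding telescope_pieces[OF open_convex_strip(2,1) h v] closing_rect by simp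
qed

text \<open>On \<open>region m\<close> this equals closed contour minus \<open>total\<close>,
  written so that the edges with index below m have cancelled. Those are the only terms that may be
  singular in the region.\<close>

definition loc :: "nat \<Rightarrow> complex \<Rightarrow> complex" where
  "loc m z = closing m z + (\<Sum>k<m. corr 1 k z - corr (-1) k z) - (\<Sum>k. rem (k + m) z)"

lemma region_far: "z \<in> region m \<Longrightarrow> k \<ge> m \<Longrightarrow> far k z"
  by (rule far_mono[OF far_if_Re]) (auto simp: region_def)

lemma loc_eq:
  assumes "z \<in> region m"
  shows "loc m z = closing m z + (\<Sum>k<m. piece 1 k z - piece (-1) k z) - total z"
proof -
  have "total z = (\<Sum>k. rem (k + m) z) + (\<Sum>k<m. rem k z)"
    unfolding total_def using suminf_split_initial_segment[OF rem_summable[OF region_far[OF assms order_refl]]] .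
  moreover have "(\<Sum>k<m. rem k z) = (\<Sum>k<m. piece 1 k z - piece (-1) k z) - (\<Sum>k<m. corr 1 k z - corr (-1) k z)"
    by (simp add: rem_def sum_subtractf)
  ultimately show ?thesis by (simp add: loc_def)
qed

lemma region_open_convex: "open (region m)" "convex (region m)"
  unfolding region_def using open_convex_box by auto

lemma loc_holomorphic: "loc m holomorphic_on region m"
proof -
  have "(\<lambda>z. \<Sum>k. rem (k + m) z) holomorphic_on region m"
  proof (rule holomorphic_suminf[OF region_open_convex(1)])
    show "summable (\<lambda>k. 2 * (1/2) ^ (k + m) :: real)"
      using summable_ignore_initial_segment[OF summable_bound] .
  qed (auto intro!: rem_holomorphic rem_bound region_far)
  then show ?thesis unfolding loc_def
    by (intro holomorphic_intros closing_holomorphic holomorphic_on_subset[OF corr(1)]) auto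
qed

lemma region_mono: "m \<le> m' \<Longrightarrow> region m \<subseteq> region m'"
  unfolding region_def using harm_mono[of m m', where 'a=real] by auto

lemma loc_low: "z \<in> region m \<Longrightarrow> Im z < 0 \<Longrightarrow> loc m z = - total z"
  by (simp add: loc_eq low)

text \<open>Identity theorem: in the lower half of the smaller region both functions are the
  negative of \<open>total\<close>, which does not depend on m.\<close>

lemma loc_agree:
  assumes "m \<le> m'" "z \<in> region m" shows "loc m z = loc m' z"
proof (rule analytic_continuation_open[where f="loc m" and g="loc m'" and s="region m \<inter> {z. Im z < 0}" and s'="region m"])
  show "open (region m \<inter> {z. Im z < 0})"
    by (intro open_Int region_open_convex open_Collect_less continuous_intros)
  have "Complex (Re z) (- real m / 2) \<in> region m \<inter> {z. Im z < 0}"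
    using assms(2) by (auto simp: region_def)
  then show "region m \<inter> {z. Im z < 0} \<noteq> {}" by blast
  show "connected (region m)" using region_open_convex(2) by (rule convex_connected)
  show "loc m' holomorphic_on region m"
    using region_mono[OF assms(1)] by (rule holomorphic_on_subset[OF loc_holomorphic])
  show "loc m w = loc m' w" if "w \<in> region m \<inter> {z. Im z < 0}" for w
    using that region_mono[OF assms(1)] by (auto simp: loc_low)
qed (use assms in \<open>auto intro: region_open_convex loc_holomorphic\<close>)

lemma ex_region: "\<exists>m. z \<in> region m"
proof -
  have "\<forall>\<^sub>F m in sequentially. harm m > \<bar>Re z\<bar> + 4"
    using harm_at_top unfolding filterlim_at_top_dense by blast
  moreover have "\<forall>\<^sub>F m in sequentially. real m > \<bar>Im z\<bar>"
    using filterlim_real_sequentially unfolding filterlim_at_top_dense by blast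
  ultimately have "\<forall>\<^sub>F m in sequentially. z \<in> region m"
    by eventually_elim (auto simp: region_def)
  then show ?thesis by (auto simp: eventually_sequentially)
qed

definition glob :: "complex \<Rightarrow> complex" where
  "glob z = loc (LEAST m. z \<in> region m) z"

lemma glob_eq: assumes "z \<in> region m" shows "glob z = loc m z"
  unfolding glob_def by (rule loc_agree[OF Least_le[of "\<lambda>m. z \<in> region m", OF assms]]) (rule LeastI[of "\<lambda>m. z \<in> region m", OF assms])

lemma glob_holomorphic: "glob holomorphic_on UNIV"
proof -
  have "glob holomorphic_on region m" for m
    using loc_holomorphic by (rule holomorphic_transform) (simp add: glob_eq)
  then have "glob holomorphic_on (\<Union>m. region m)" by (intro holomorphic_on_UN_open region_open_convex)
  moreover have "(\<Union>m. region m) = UNIV" using ex_region by blast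
  ultimately show ?thesis by simp
qed

lemma glob_low: "Im z < 0 \<Longrightarrow> glob z = - total z"
  using ex_region[of z] by (auto simp: glob_eq loc_low)

lemma glob_high: "Im z > 1 \<Longrightarrow> glob z = 2 * of_real pi * \<i> * G z - total z"
  using ex_region[of z] by (auto simp: glob_eq loc_eq high)

text \<open>The jump relation known for Im z > 1 continues down to height b on the far right or the
  far left, where all edges are far and \<open>total\<close> is holomorphic. This covers points of
  the upper half-plane near the height of the polygon itself.\<close>

lemma glob_side:
  assumes b: "b > 0" and X: "\<And>z. X \<le> \<bar>Re z\<bar> \<Longrightarrow> b \<le> \<bar>Im z\<bar> \<Longrightarrow> far 0 z" and s: "s \<in> {1,-1}"
    and z: "X < s * Re z" "b < Im z"
  shows "2 * of_real pi * \<i> * G z - glob z = total z"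
proof (rule analytic_continuation_open[where f="\<lambda>z. 2 * of_real pi * \<i> * G z - glob z" and g=total and s="{z. X < s * Re z \<and> max 1 b < Im z}" and s'="{z. X < s * Re z \<and> b < Im z}"])
  let ?W = "{z. X < s * Re z \<and> b < Im z}"
  have W: "far k z" if "z \<in> ?W" for k z
  proof (rule far_mono[OF X])
    have "X < s * Re z" using that by simp
    also have "s * Re z \<le> \<bar>Re z\<bar>" using s by auto
    finally show "X \<le> \<bar>Re z\<bar>" by simp
  qed (use that b in auto)
  show "(\<lambda>z. 2 * of_real pi * \<i> * G z - glob z) holomorphic_on ?W"
    by (intro holomorphic_intros holomorphic_on_subset[OF G] holomorphic_on_subset[OF glob_holomorphic])
       (use b in \<open>auto simp: upper_def\<close>)
  show "total holomorphic_on ?W"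
    unfolding total_def
    by (rule holomorphic_suminf[OF open_convex_halfplane_regions(1) _ summable_bound])
       (auto intro!: rem_holomorphic rem_bound W)
  have "Complex (s * (\<bar>X\<bar> + 1)) (max 1 b + 1) \<in> {z. X < s * Re z \<and> max 1 b < Im z}"
    using s by auto
  then show "{z. X < s * Re z \<and> max 1 b < Im z} \<noteq> {}" by blast
  show "connected ?W" by (rule convex_connected[OF open_convex_halfplane_regions(2)])
  show "2 * of_real pi * \<i> * G w - glob w = total w" if "w \<in> {z. X < s * Re z \<and> max 1 b < Im z}" for w
    using that glob_high[of w] by simp
  show "open {z. X < s * Re z \<and> max 1 b < Im z}" "open ?W"
    by (rule open_convex_halfplane_regions(1))+
  show "{z. X < s * Re z \<and> max 1 b < Im z} \<subseteq> ?W" by auto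
qed (use z in auto)

text \<open>For large |Re z| the error above the axis, and the function itself below it, equal
  \<open>total\<close> up to sign and the factor 1/(2\<pi>i), hence are bounded. What is left over
  is a compact rectangle on either side of the axis.\<close>

lemma upper_approx:
  obtains h where "h holomorphic_on UNIV"
    "\<And>b c. 0 < b \<Longrightarrow> \<exists>C. \<forall>z. (b \<le> Im z \<and> Im z \<le> c \<longrightarrow> norm (G z - h z) \<le> C) \<and> (- c \<le> Im z \<and> Im z \<le> - b \<longrightarrow> norm (h z) \<le> C)"
proof (rule that[of "\<lambda>z. glob z / (2 * of_real pi * \<i>)"])
  show "(\<lambda>z. glob z / (2 * of_real pi * \<i>)) holomorphic_on UNIV"
    by (intro holomorphic_intros glob_holomorphic) auto
  fix b c :: real assume b: "0 < b"
  \<comment> \<open>The height b/2 is taken because the continuation requires the strict inequality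
    b/2 < Im z, while the claim includes Im z = b.\<close>
  obtain X where X: "X \<ge> 0" "\<And>z. X \<le> \<bar>Re z\<bar> \<Longrightarrow> b / 2 \<le> \<bar>Im z\<bar> \<Longrightarrow> far 0 z" using far_if_Im[of "b/2"] b by auto
  define Y where "Y = X + 1"
  define U where "U z = 2 * of_real pi * \<i> * G z - glob z" for z
  note gc = holomorphic_on_imp_continuous_on[OF glob_holomorphic]
  have "continuous_on {z. - Y \<le> Re z \<and> Re z \<le> Y \<and> b \<le> Im z \<and> Im z \<le> c} U"
    unfolding U_def
    by (intro continuous_intros G_cont continuous_on_subset[OF gc]) (use b in \<open>auto simp: upper_def\<close>)
  then obtain C1 where C1: "\<And>z. - Y \<le> Re z \<Longrightarrow> Re z \<le> Y \<Longrightarrow> b \<le> Im z \<Longrightarrow> Im z \<le> c \<Longrightarrow> norm (U z) \<le> C1"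
    using bounded_on_rectangle by blast
  have "continuous_on {z. - Y \<le> Re z \<and> Re z \<le> Y \<and> -c \<le> Im z \<and> Im z \<le> -b} glob"
    by (intro continuous_on_subset[OF gc]) auto
  then obtain C2 where C2: "\<And>z. - Y \<le> Re z \<Longrightarrow> Re z \<le> Y \<Longrightarrow> -c \<le> Im z \<Longrightarrow> Im z \<le> -b \<Longrightarrow> norm (glob z) \<le> C2"
    using bounded_on_rectangle by blast
  define C where "C = max 4 (max C1 C2)"
  have up: "norm (U z) \<le> C" if "b \<le> Im z" "Im z \<le> c" for z
  proof (cases "\<bar>Re z\<bar> \<le> Y")
    case True then show ?thesis using C1[of z] that by (simp add: C_def abs_le_iff le_max_iff_disj)
  next
    case False
    have "U z = total z" unfolding U_def
      by (rule glob_side[where b="b/2" and X=X and s="if Re z > 0 then 1 else -1"])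
         (use b X False that in \<open>auto simp: Y_def\<close>)
    moreover have "far 0 z" using X(2)[of z] False that b by (auto simp: Y_def)
    ultimately show ?thesis using total_bound[of z] by (simp add: C_def le_max_iff_disj)
  qed
  have dn: "norm (glob z) \<le> C" if "- c \<le> Im z" "Im z \<le> - b" for z
  proof (cases "\<bar>Re z\<bar> \<le> Y")
    case True then show ?thesis using C2[of z] that by (simp add: C_def abs_le_iff le_max_iff_disj)
  next
    case False
    have "far 0 z" using X(2)[of z] False that b by (auto simp: Y_def)
    then show ?thesis using total_bound[of z] glob_low[of z] that b by (simp add: C_def le_max_iff_disj)
  qed
  have "norm (G z - glob z / (2 * of_real pi * \<i>)) = norm (U z) / (2 * pi)" for z
  proof -
    have "G z - glob z / (2 * of_real pi * \<i>) = U z / (2 * of_real pi * \<i>)"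
      by (simp add: U_def diff_divide_distrib)
    then show ?thesis by (simp add: norm_divide norm_mult)
  qed
  then show "\<exists>C. \<forall>z. (b \<le> Im z \<and> Im z \<le> c \<longrightarrow> norm (G z - glob z / (2 * of_real pi * \<i>)) \<le> C)
     \<and> (- c \<le> Im z \<and> Im z \<le> - b \<longrightarrow> norm (glob z / (2 * of_real pi * \<i>)) \<le> C)"
    using up dn by (intro exI[of _ "C / (2 * pi)"]) (auto simp: norm_divide norm_mult divide_right_mono)
qed

end

section \<open>Growth conditions\<close>

text \<open>The case c = 0 describes a full strip across the real axis, the case c > 0 two strips
  that avoid it. A negative s expresses exponential decay, so the spaces of growing and of decaying
  functions share all the lemmas.\<close>

definition grow_on :: "real \<Rightarrow> real \<Rightarrow> real \<Rightarrow> (complex \<Rightarrow> complex) \<Rightarrow> bool" where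
  "grow_on c d s P \<longleftrightarrow> (\<exists>C. \<forall>z. c \<le> \<bar>Im z\<bar> \<and> \<bar>Im z\<bar> \<le> d \<longrightarrow> norm (P z) \<le> C * exp (s * \<bar>Re z\<bar>))"

definition grow :: "real \<Rightarrow> (complex \<Rightarrow> complex) \<Rightarrow> bool" where
  "grow s P \<longleftrightarrow> (\<forall>c d. 0 < c \<longrightarrow> grow_on c d s P)"

lemma grow_onD:
  assumes "grow_on c d s P"
  obtains C where "C \<ge> 0" "\<And>z. c \<le> \<bar>Im z\<bar> \<Longrightarrow> \<bar>Im z\<bar> \<le> d \<Longrightarrow> norm (P z) \<le> C * exp (s * \<bar>Re z\<bar>)"
proof -
  obtain C where C: "\<And>z. c \<le> \<bar>Im z\<bar> \<Longrightarrow> \<bar>Im z\<bar> \<le> d \<Longrightarrow> norm (P z) \<le> C * exp (s * \<bar>Re z\<bar>)"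
    using assms unfolding grow_on_def by blast
  have "norm (P z) \<le> max C 0 * exp (s * \<bar>Re z\<bar>)" if "c \<le> \<bar>Im z\<bar>" "\<bar>Im z\<bar> \<le> d" for z
    using C[OF that] by (rule order_trans) (auto intro: mult_right_mono)
  then show thesis using that[of "max C 0"] by auto
qed

lemma grow_onI:
  "(\<And>z. c \<le> \<bar>Im z\<bar> \<Longrightarrow> \<bar>Im z\<bar> \<le> d \<Longrightarrow> norm (P z) \<le> C * exp (s * \<bar>Re z\<bar>)) \<Longrightarrow> grow_on c d s P"
  unfolding grow_on_def by blast

lemma grow_on_mono:
  assumes "grow_on c d s P" "s \<le> s'" "c \<le> c'" "d' \<le> d" shows "grow_on c' d' s' P"
proof -
  obtain C where C: "C \<ge> 0" "\<And>z. c \<le> \<bar>Im z\<bar> \<Longrightarrow> \<bar>Im z\<bar> \<le> d \<Longrightarrow> norm (P z) \<le> C * exp (s * \<bar>Re z\<bar>)"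
    using grow_onD[OF assms(1)] by blast
  show ?thesis
  proof (rule grow_onI)
    fix z assume "c' \<le> \<bar>Im z\<bar>" "\<bar>Im z\<bar> \<le> d'"
    then have "norm (P z) \<le> C * exp (s * \<bar>Re z\<bar>)" using assms by (intro C) auto
    also have "\<dots> \<le> C * exp (s' * \<bar>Re z\<bar>)" using C assms by (intro mult_left_mono) (auto intro: mult_right_mono)
    finally show "norm (P z) \<le> C * exp (s' * \<bar>Re z\<bar>)" .
  qed
qed

lemma grow_on_add:
  assumes "grow_on c d s P" "grow_on c d s Q" shows "grow_on c d s (\<lambda>z. P z + Q z)"
proof -
  obtain C where C: "\<And>z. c \<le> \<bar>Im z\<bar> \<Longrightarrow> \<bar>Im z\<bar> \<le> d \<Longrightarrow> norm (P z) \<le> C * exp (s * \<bar>Re z\<bar>)"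
    using grow_onD[OF assms(1)] by blast
  obtain D where D: "\<And>z. c \<le> \<bar>Im z\<bar> \<Longrightarrow> \<bar>Im z\<bar> \<le> d \<Longrightarrow> norm (Q z) \<le> D * exp (s * \<bar>Re z\<bar>)"
    using grow_onD[OF assms(2)] by blast
  show ?thesis
  proof (rule grow_onI)
    fix z assume z: "c \<le> \<bar>Im z\<bar>" "\<bar>Im z\<bar> \<le> d"
    show "norm (P z + Q z) \<le> (C + D) * exp (s * \<bar>Re z\<bar>)"
      using norm_triangle_ineq[of "P z" "Q z"] C[OF z] D[OF z] by (simp add: ring_distribs)
  qed
qed

lemma grow_on_cmult:
  assumes "grow_on c d s P" shows "grow_on c d s (\<lambda>z. a * P z)"
proof -
  obtain C where C: "\<And>z. c \<le> \<bar>Im z\<bar> \<Longrightarrow> \<bar>Im z\<bar> \<le> d \<Longrightarrow> norm (P z) \<le> C * exp (s * \<bar>Re z\<bar>)"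
    using grow_onD[OF assms(1)] by blast
  show ?thesis
    by (rule grow_onI[where C="norm a * C"]) (use C in \<open>simp add: norm_mult mult_left_mono mult.assoc\<close>)
qed

lemma grow_on_reflect: "grow_on c d s P \<Longrightarrow> grow_on c d s (\<lambda>z. P (- z))"
  unfolding grow_on_def by (metis abs_minus_cancel uminus_complex.simps)

lemma grow_on_cong:
  "grow_on c d s P \<Longrightarrow> (\<And>z. c \<le> \<bar>Im z\<bar> \<Longrightarrow> P z = Q z) \<Longrightarrow> grow_on c d s Q"
  unfolding grow_on_def by metis

lemma grow_add: "grow s P \<Longrightarrow> grow s Q \<Longrightarrow> grow s (\<lambda>z. P z + Q z)"
  unfolding grow_def using grow_on_add by blast

lemma grow_cmult: "grow s P \<Longrightarrow> grow s (\<lambda>z. a * P z)"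
  unfolding grow_def using grow_on_cmult by blast

lemma grow_reflect: "grow s P \<Longrightarrow> grow s (\<lambda>z. P (- z))"
  unfolding grow_def using grow_on_reflect by blast

lemma grow_cong: "grow s P \<Longrightarrow> (\<And>z. z \<notin> \<real> \<Longrightarrow> P z = Q z) \<Longrightarrow> grow s Q"
  unfolding grow_def by (auto simp: complex_is_Real_iff intro: grow_on_cong[where P=P])

lemma bdd_above_weight:
  "bdd_above ((\<lambda>z. norm (f z) * exp (w z)) ` S) \<longleftrightarrow> (\<exists>C. \<forall>z\<in>S. norm (f z :: complex) \<le> C * exp (- w z))"
proof -
  have "norm (f z) * exp (w z) \<le> C \<longleftrightarrow> norm (f z) \<le> C * exp (- w z)" for z C
    by (simp add: exp_minus field_simps)
  then show ?thesis unfolding bdd_above_def by auto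
qed

section \<open>The sets S_n and the weighted conditions in terms of growth rates\<close>

lemma ereal_abs_Im_less: "ext_dist z \<real> < ereal c \<longleftrightarrow> \<bar>Im z\<bar> < c"
proof
  assume "ext_dist z \<real> < ereal c"
  then obtain w where w: "w \<in> \<real>" "norm (z - w) < c" by (auto simp: ext_dist_def INF_less_iff)
  have "\<bar>Im (z - w)\<bar> \<le> norm (z - w)" by (rule abs_Im_le_cmod)
  with w show "\<bar>Im z\<bar> < c" by (simp add: complex_is_Real_iff)
next
  assume "\<bar>Im z\<bar> < c"
  moreover have "norm (z - of_real (Re z)) = \<bar>Im z\<bar>" by (simp add: cmod_def)
  ultimately show "ext_dist z \<real> < ereal c"
    unfolding ext_dist_def INF_less_iff by (intro bexI[of _ "of_real (Re z)"]) auto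
qed

lemma closure_strip_subset: "A \<subseteq> {z. \<bar>Im z\<bar> \<le> c} \<Longrightarrow> closure A \<subseteq> {z. \<bar>Im z\<bar> \<le> c}"
  by (rule closure_minimal) (auto intro!: closed_Collect_le continuous_intros)

lemma Sset_empty: "Sset n {} = {z. \<bar>Im z\<bar> < real n}"
  by (auto simp: Sset_def nbhd_def fin_part_simps ext_dist_def)

text \<open>A sandwich between strips with strict and with weak inequalities is enough, because the
  growth conditions range over all n; the closure of the neighbourhood therefore only has to be
  estimated.\<close>

lemma Sset_UNIV:
  assumes "n \<ge> 1"
  shows "{z. 1 / real n < \<bar>Im z\<bar> \<and> \<bar>Im z\<bar> < real n} \<subseteq> Sset n UNIV"
    "Sset n UNIV \<subseteq> {z. 1 / real n \<le> \<bar>Im z\<bar> \<and> \<bar>Im z\<bar> \<le> real n}"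
proof -
  have eq: "nbhd (1 / real n) UNIV = {z. \<bar>Im z\<bar> < 1 / real n}"
    by (auto simp: nbhd_def fin_part_simps ereal_abs_Im_less)
  then show "{z. 1 / real n < \<bar>Im z\<bar> \<and> \<bar>Im z\<bar> < real n} \<subseteq> Sset n UNIV"
    using closure_strip_subset[of "nbhd (1 / real n) UNIV" "1 / real n"] by (force simp: Sset_def)
  show "Sset n UNIV \<subseteq> {z. 1 / real n \<le> \<bar>Im z\<bar> \<and> \<bar>Im z\<bar> \<le> real n}"
    using closure_subset[of "nbhd (1 / real n) UNIV"] eq by (force simp: Sset_def)
qed

lemma Sset_pm:
  assumes "n \<ge> 1"
  shows "{z. 1 / real n < \<bar>Im z\<bar> \<and> \<bar>Im z\<bar> < real n} \<subseteq> Sset n {\<infinity>, -\<infinity>}"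
    "Sset n {\<infinity>, -\<infinity>} \<subseteq> {z. 1 / real n \<le> \<bar>Im z\<bar> \<and> \<bar>Im z\<bar> \<le> real n} \<union> {z. \<bar>Re z\<bar> \<le> real n \<and> \<bar>Im z\<bar> \<le> real n}"
proof -
  have eq: "nbhd (1 / real n) {\<infinity>, -\<infinity>} = {z. \<bar>Re z\<bar> > real n \<and> \<bar>Im z\<bar> < 1 / real n}"
    by (auto simp: nbhd_def fin_part_simps ext_dist_def)
  then show "{z. 1 / real n < \<bar>Im z\<bar> \<and> \<bar>Im z\<bar> < real n} \<subseteq> Sset n {\<infinity>, -\<infinity>}"
    using closure_strip_subset[of "nbhd (1 / real n) {\<infinity>, -\<infinity>}" "1 / real n"] by (force simp: Sset_def)
  show "Sset n {\<infinity>, -\<infinity>} \<subseteq> {z. 1 / real n \<le> \<bar>Im z\<bar> \<and> \<bar>Im z\<bar> \<le> real n} \<union> {z. \<bar>Re z\<bar> \<le> real n \<and> \<bar>Im z\<bar> \<le> real n}"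
    using closure_subset[of "nbhd (1 / real n) {\<infinity>, -\<infinity>}"] eq by (force simp: Sset_def)
qed

lemma ex_large_nat:
  fixes c d s :: real
  assumes "0 < c" "0 < s" obtains n :: nat where "n \<ge> 1" "1 / real n < c" "d < real n" "1 / real n \<le> s"
proof -
  obtain n :: nat where n: "max (max (1 / c) (1 / s)) (max d 1) < real n" using reals_Archimedean2 by blast
  show thesis
  proof (rule that)
    show "1 \<le> n" "d < real n" using n by auto
    have "1 / c < real n" "1 / s < real n" "real n > 0" using n by auto
    then show "1 / real n < c" "1 / real n \<le> s" using assms by (simp_all add: field_simps)
  qed
qed

lemma Oexp_empty_iff: "f \<in> Oexp {} \<longleftrightarrow> f holomorphic_on UNIV \<and> (\<forall>s>0. \<forall>d. grow_on 0 d s f)"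
proof -
  have "(\<forall>n::nat\<ge>1. bdd_above ((\<lambda>z. cmod (f z) * exp (- (1 / real n) * \<bar>Re z\<bar>)) ` Sset n {})) \<longleftrightarrow> (\<forall>s>0. \<forall>d. grow_on 0 d s f)"
    unfolding bdd_above_weight Sset_empty
  proof safe
    fix s d :: real assume *: "\<forall>n\<ge>1. \<exists>C. \<forall>z\<in>{z. \<bar>Im z\<bar> < real n}. cmod (f z) \<le> C * exp (- (- (1 / real n) * \<bar>Re z\<bar>))" and s: "s > 0"
    obtain n :: nat where n: "n \<ge> 1" "d < real n" "1 / real n \<le> s" using ex_large_nat[of 1 s d] s by (metis zero_less_one)
    obtain C where C: "\<And>z. \<bar>Im z\<bar> < real n \<Longrightarrow> cmod (f z) \<le> C * exp (1 / real n * \<bar>Re z\<bar>)" using * n(1) by fastforce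
    have "grow_on 0 d (1 / real n) f" using C n by (intro grow_onI[where C=C]) auto
    then show "grow_on 0 d s f" by (rule grow_on_mono) (use n in auto)
  next
    fix n :: nat assume *: "\<forall>s>0. \<forall>d. grow_on 0 d s f" and n: "1 \<le> n"
    then have "grow_on 0 (real n) (1 / real n) f" by simp
    then show "\<exists>C. \<forall>z\<in>{z. \<bar>Im z\<bar> < real n}. cmod (f z) \<le> C * exp (- (- (1 / real n) * \<bar>Re z\<bar>))"
      unfolding grow_on_def by force
  qed
  then show ?thesis by (auto simp: Oexp_def hol_def fin_part_simps)
qed

text \<open>In the definitions the index n governs the domain and the rate at the same time. Taking
  n large for both purposes separates the two. T is the set of rates in question: the positive ones
  for \<open>Oexp\<close>, all of them for \<open>Hminf\<close>.\<close>

lemma grow_family_UNIV: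
  fixes a :: "nat \<Rightarrow> real"
  assumes "\<And>n. n \<ge> 1 \<Longrightarrow> - a n \<in> T" "\<And>s c d. s \<in> T \<Longrightarrow> 0 < c \<Longrightarrow> \<exists>n\<ge>1. 1 / real n < c \<and> d < real n \<and> - a n \<le> s"
  shows "(\<forall>n::nat\<ge>1. bdd_above ((\<lambda>z. cmod (f z) * exp (a n * \<bar>Re z\<bar>)) ` Sset n UNIV)) \<longleftrightarrow> (\<forall>s\<in>T. grow s f)"
  unfolding bdd_above_weight
proof safe
  fix s :: real assume *: "\<forall>n\<ge>1. \<exists>C. \<forall>z\<in>Sset n UNIV. cmod (f z) \<le> C * exp (- (a n * \<bar>Re z\<bar>))" and s: "s \<in> T"
  show "grow s f" unfolding grow_def
  proof (intro allI impI)
    fix c d :: real assume "0 < c"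
    obtain n :: nat where n: "n \<ge> 1" "1 / real n < c" "d < real n" "- a n \<le> s" using assms(2)[OF s \<open>0 < c\<close>] by blast
    obtain C where C: "\<And>z. z \<in> Sset n UNIV \<Longrightarrow> cmod (f z) \<le> C * exp (- (a n * \<bar>Re z\<bar>))" using * n(1) by blast
    have "grow_on c d (- a n) f"
    proof (rule grow_onI[where C=C])
      fix z assume "c \<le> \<bar>Im z\<bar>" "\<bar>Im z\<bar> \<le> d"
      then have "z \<in> Sset n UNIV" using Sset_UNIV(1)[OF n(1)] n by auto
      then show "cmod (f z) \<le> C * exp (- a n * \<bar>Re z\<bar>)" using C by simp
    qed
    then show "grow_on c d s f" by (rule grow_on_mono) (use n in auto)
  qed
next
  fix n :: nat assume *: "\<forall>s\<in>T. grow s f" and n: "1 \<le> n"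
  have "grow_on (1 / real n) (real n) (- a n) f" using * assms(1)[OF n] n by (simp add: grow_def)
  then show "\<exists>C. \<forall>z\<in>Sset n UNIV. cmod (f z) \<le> C * exp (- (a n * \<bar>Re z\<bar>))"
    unfolding grow_on_def using Sset_UNIV(2)[OF n] by auto
qed

text \<open>The part of S_n that comes close to the real axis lies in a bounded box, where an entire
  function is bounded by continuity. Hence the condition is the same as for the whole extended
  line.\<close>

lemma grow_family_pm:
  fixes a :: "nat \<Rightarrow> real"
  assumes "f holomorphic_on UNIV"
    "\<And>n. n \<ge> 1 \<Longrightarrow> - a n \<in> T" "\<And>s c d. s \<in> T \<Longrightarrow> 0 < c \<Longrightarrow> \<exists>n\<ge>1. 1 / real n < c \<and> d < real n \<and> - a n \<le> s"
  shows "(\<forall>n::nat\<ge>1. bdd_above ((\<lambda>z. cmod (f z) * exp (a n * \<bar>Re z\<bar>)) ` Sset n {\<infinity>, -\<infinity>})) \<longleftrightarrow> (\<forall>s\<in>T. grow s f)"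
  unfolding bdd_above_weight
proof safe
  fix s :: real assume *: "\<forall>n\<ge>1. \<exists>C. \<forall>z\<in>Sset n {\<infinity>, -\<infinity>}. cmod (f z) \<le> C * exp (- (a n * \<bar>Re z\<bar>))" and s: "s \<in> T"
  show "grow s f" unfolding grow_def
  proof (intro allI impI)
    fix c d :: real assume "0 < c"
    obtain n :: nat where n: "n \<ge> 1" "1 / real n < c" "d < real n" "- a n \<le> s" using assms(3)[OF s \<open>0 < c\<close>] by blast
    obtain C where C: "\<And>z. z \<in> Sset n {\<infinity>, -\<infinity>} \<Longrightarrow> cmod (f z) \<le> C * exp (- (a n * \<bar>Re z\<bar>))" using * n(1) by blast
    have "grow_on c d (- a n) f"
    proof (rule grow_onI[where C=C])
      fix z assume "c \<le> \<bar>Im z\<bar>" "\<bar>Im z\<bar> \<le> d"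
      then have "z \<in> Sset n {\<infinity>, -\<infinity>}" using Sset_pm(1)[OF n(1)] n by auto
      then show "cmod (f z) \<le> C * exp (- a n * \<bar>Re z\<bar>)" using C by simp
    qed
    then show "grow_on c d s f" by (rule grow_on_mono) (use n in auto)
  qed
next
  fix n :: nat assume *: "\<forall>s\<in>T. grow s f" and n: "1 \<le> n"
  have "grow_on (1 / real n) (real n) (- a n) f" using * assms(2)[OF n] n by (simp add: grow_def)
  then obtain C where C: "\<And>z. 1 / real n \<le> \<bar>Im z\<bar> \<Longrightarrow> \<bar>Im z\<bar> \<le> real n \<Longrightarrow> norm (f z) \<le> C * exp (- a n * \<bar>Re z\<bar>)"
    using grow_onD by blast
  \<comment> \<open>The weight is multiplied in before compactness is used, so the bound on the box
    already has the weighted form.\<close>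
  have "continuous_on {z. - real n \<le> Re z \<and> Re z \<le> real n \<and> - real n \<le> Im z \<and> Im z \<le> real n} (\<lambda>z. f z * exp (of_real (a n * \<bar>Re z\<bar>)))"
    using holomorphic_on_imp_continuous_on[OF assms(1)] by (intro continuous_intros) (auto intro: continuous_on_subset)
  then obtain D where D: "\<And>z. - real n \<le> Re z \<Longrightarrow> Re z \<le> real n \<Longrightarrow> - real n \<le> Im z \<Longrightarrow> Im z \<le> real n
      \<Longrightarrow> norm (f z * exp (of_real (a n * \<bar>Re z\<bar>))) \<le> D"
    using bounded_on_rectangle by blast
  have "cmod (f z) \<le> max C D * exp (- (a n * \<bar>Re z\<bar>))" if "z \<in> Sset n {\<infinity>, -\<infinity>}" for z
  proof (cases "1 / real n \<le> \<bar>Im z\<bar> \<and> \<bar>Im z\<bar> \<le> real n")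
    case True
    then have "cmod (f z) \<le> C * exp (- (a n * \<bar>Re z\<bar>))" using C[of z] by simp
    then show ?thesis by (rule order_trans) (auto intro: mult_right_mono)
  next
    case False
    then have "\<bar>Re z\<bar> \<le> real n" "\<bar>Im z\<bar> \<le> real n" using that Sset_pm(2)[OF n] by auto
    then have "cmod (f z) * exp (a n * \<bar>Re z\<bar>) \<le> D" using D[of z] by (simp add: norm_mult abs_le_iff)
    then have "cmod (f z) \<le> D * exp (- (a n * \<bar>Re z\<bar>))" by (simp add: exp_minus field_simps)
    then show ?thesis by (rule order_trans) (auto intro: mult_right_mono)
  qed
  then show "\<exists>C. \<forall>z\<in>Sset n {\<infinity>, -\<infinity>}. cmod (f z) \<le> C * exp (- (a n * \<bar>Re z\<bar>))" by blast
qed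

lemma ex_nat_exp_weight:
  fixes c d s :: real assumes "s \<in> {0<..}" "0 < c" shows "\<exists>n\<ge>1. 1 / real n < c \<and> d < real n \<and> - (- (1 / real n)) \<le> s"
  using ex_large_nat[of c s d] assms by auto

lemma ex_nat_decay_weight:
  fixes c d s :: real assumes "s \<in> UNIV" "0 < c" shows "\<exists>n\<ge>1. 1 / real n < c \<and> d < real n \<and> - real n \<le> s"
proof -
  obtain n :: nat where "n \<ge> 1" "1 / real n < c" "max d (- s) < real n" using ex_large_nat[of c 1 "max d (- s)"] assms by auto
  then show ?thesis by (intro exI[of _ n]) auto
qed

lemma Oexp_UNIV_iff: "f \<in> Oexp UNIV \<longleftrightarrow> f \<in> hol (- \<real>) \<and> (\<forall>s>0. grow s f)"
  using grow_family_UNIV[of "\<lambda>n. - (1 / real n)" "{0<..}" f] ex_nat_exp_weight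
  by (auto simp: Oexp_def fin_part_simps)

lemma Hminf_UNIV_iff: "f \<in> Hminf UNIV \<longleftrightarrow> f \<in> hol (- \<real>) \<and> (\<forall>s. grow s f)"
  using grow_family_UNIV[of real UNIV f] ex_nat_decay_weight
  by (auto simp: Hminf_def fin_part_simps)

lemma Oexp_pm_iff: "f \<in> Oexp {\<infinity>, -\<infinity>} \<longleftrightarrow> f holomorphic_on UNIV \<and> (\<forall>s>0. grow s f)"
  using grow_family_pm[of f "\<lambda>n. - (1 / real n)" "{0<..}"] ex_nat_exp_weight
  by (auto simp: Oexp_def hol_def fin_part_simps)

lemma Hminf_pm_iff: "f \<in> Hminf {\<infinity>, -\<infinity>} \<longleftrightarrow> f holomorphic_on UNIV \<and> (\<forall>s. grow s f)"
  using grow_family_pm[of f real UNIV] ex_nat_decay_weight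
  by (auto simp: Hminf_def hol_def fin_part_simps)

lemma hol_reflect: "f \<in> hol W \<Longrightarrow> (\<lambda>z. f (- z)) \<in> hol (uminus ` W)"
proof -
  assume f: "f \<in> hol W"
  have "(\<lambda>z. f (- z)) holomorphic_on uminus ` W"
    using f by (intro holomorphic_on_compose_gen[of uminus _ f W, unfolded comp_def] holomorphic_intros) (auto simp: hol_def)
  moreover have "f (- z) = 0" if "z \<notin> uminus ` W" for z
  proof -
    have "- z \<notin> W" using that by (metis imageI minus_minus)
    then show ?thesis using f by (simp add: hol_def)
  qed
  ultimately show ?thesis by (simp add: hol_def)
qed

text \<open>The single index k is separated into the three independent parameters s, K and b, and
  the weight in |z| is replaced by one in |Re z|.\<close>

lemma FO_pinf_iff:
  "f \<in> FO_pinf \<longleftrightarrow> f \<in> hol lower \<and>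
    (\<forall>s>0. \<forall>K. \<forall>b>0. \<exists>C. \<forall>z. Im z \<le> - b \<longrightarrow> norm (f z) \<le> C * exp (s * \<bar>Re z\<bar> - K * \<bar>Im z\<bar>))"
proof -
  have "(\<forall>k::nat\<ge>1. bdd_above ((\<lambda>z. cmod (f z) * exp (- (1 / real k) * cmod z + real k * \<bar>Im z\<bar>)) ` {z. Im z \<le> - 1 / real k}))
    \<longleftrightarrow> (\<forall>s>0. \<forall>K. \<forall>b>0. \<exists>C. \<forall>z. Im z \<le> - b \<longrightarrow> norm (f z) \<le> C * exp (s * \<bar>Re z\<bar> - K * \<bar>Im z\<bar>))"
    unfolding bdd_above_weight
  proof (intro iffI allI impI)
    fix s K b :: real
    assume *: "\<forall>k\<ge>1. \<exists>C. \<forall>z\<in>{z. Im z \<le> - 1 / real k}. cmod (f z) \<le> C * exp (- (- (1 / real k) * cmod z + real k * \<bar>Im z\<bar>))"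
      and s: "s > 0" and b: "b > 0"
    \<comment> \<open>K + 1 instead of K: by |z| \<le> |Re z| + |Im z|, dropping the imaginary part
      from the weight costs at most one unit of the rate in |Im z|.\<close>
    obtain k :: nat where k: "k \<ge> 1" "1 / real k < b" "K + 1 < real k" "1 / real k \<le> s" using ex_large_nat[OF b s] by blast
    obtain C where C: "\<And>z. Im z \<le> - 1 / real k \<Longrightarrow> cmod (f z) \<le> C * exp (- (- (1 / real k) * cmod z + real k * \<bar>Im z\<bar>))"
      using * k(1) by blast
    have "norm (f z) \<le> max C 0 * exp (s * \<bar>Re z\<bar> - K * \<bar>Im z\<bar>)" if z: "Im z \<le> - b" for z
    proof -
      have "1 / real k * cmod z \<le> 1 / real k * \<bar>Re z\<bar> + 1 / real k * \<bar>Im z\<bar>"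
        using mult_left_mono[OF cmod_le[of z], of "1 / real k"] by (simp add: ring_distribs)
      also have "\<dots> \<le> s * \<bar>Re z\<bar> + 1 * \<bar>Im z\<bar>"
        using k by (intro add_mono mult_right_mono) auto
      finally have 1: "1 / real k * cmod z \<le> s * \<bar>Re z\<bar> + \<bar>Im z\<bar>" by simp
      have "(K + 1) * \<bar>Im z\<bar> \<le> real k * \<bar>Im z\<bar>" using k by (intro mult_right_mono) auto
      with 1 have e: "- (- (1 / real k) * cmod z + real k * \<bar>Im z\<bar>) \<le> s * \<bar>Re z\<bar> - K * \<bar>Im z\<bar>"
        by (simp add: ring_distribs)
      have "norm (f z) \<le> C * exp (- (- (1 / real k) * cmod z + real k * \<bar>Im z\<bar>))"
        using C[of z] z k(2) by simp
      also have "\<dots> \<le> max C 0 * exp (s * \<bar>Re z\<bar> - K * \<bar>Im z\<bar>)"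
        using e by (intro mult_mono) auto
      finally show ?thesis .
    qed
    then show "\<exists>C. \<forall>z. Im z \<le> - b \<longrightarrow> norm (f z) \<le> C * exp (s * \<bar>Re z\<bar> - K * \<bar>Im z\<bar>)" by blast
  next
    fix k :: nat
    assume *: "\<forall>s>0. \<forall>K. \<forall>b>0. \<exists>C. \<forall>z. Im z \<le> - b \<longrightarrow> norm (f z) \<le> C * exp (s * \<bar>Re z\<bar> - K * \<bar>Im z\<bar>)" and k: "1 \<le> k"
    have "1 / real k > 0" using k by simp
    then obtain C where C: "\<And>z. Im z \<le> - (1 / real k) \<Longrightarrow> norm (f z) \<le> C * exp (1 / real k * \<bar>Re z\<bar> - real k * \<bar>Im z\<bar>)"
      using * by blast
    have "norm (f z) \<le> max C 0 * exp (- (- (1 / real k) * cmod z + real k * \<bar>Im z\<bar>))" if "Im z \<le> - 1 / real k" for z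
    proof -
      have "norm (f z) \<le> C * exp (1 / real k * \<bar>Re z\<bar> - real k * \<bar>Im z\<bar>)" using C that by simp
      also have "\<dots> \<le> max C 0 * exp (- (- (1 / real k) * cmod z + real k * \<bar>Im z\<bar>))"
        using mult_left_mono[OF abs_Re_le_cmod[of z], of "1 / real k"] by (intro mult_mono) auto
      finally show ?thesis .
    qed
    then show "\<exists>C. \<forall>z\<in>{z. Im z \<le> - 1 / real k}. cmod (f z) \<le> C * exp (- (- (1 / real k) * cmod z + real k * \<bar>Im z\<bar>))"
      by blast
  qed
  then show ?thesis by (simp add: FO_pinf_def)
qed

text \<open>Reflection reduces every statement about the upper half-plane to one about the
  lower.\<close>

lemma FO_minf_iff: "f \<in> FO_minf \<longleftrightarrow> (\<lambda>z. f (- z)) \<in> FO_pinf"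
proof -
  have ul: "uminus ` upper = lower" "uminus ` lower = upper"
    by (auto simp: upper_def lower_def image_iff intro!: exI[of _ "- x" for x])
  have "f \<in> hol upper \<longleftrightarrow> (\<lambda>z. f (- z)) \<in> hol lower"
    using hol_reflect[of f upper] hol_reflect[of "\<lambda>z. f (- z)" lower] by (auto simp: ul)
  moreover have "(\<lambda>z. cmod (f z) * exp (- (1 / real k) * cmod z + real k * \<bar>Im z\<bar>)) ` {z. Im z \<ge> 1 / real k}
     = (\<lambda>z. cmod (f (- z)) * exp (- (1 / real k) * cmod z + real k * \<bar>Im z\<bar>)) ` {z. Im z \<le> - 1 / real k}" for k
  proof -
    have "{z. Im z \<ge> 1 / real k} = uminus ` {z. Im z \<le> - 1 / real k}"
      by (auto simp: image_iff intro!: exI[of _ "- _"])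
    then show ?thesis by (simp add: image_image)
  qed
  ultimately show ?thesis by (simp add: FO_minf_def FO_pinf_def)
qed

lemma H1_iff:
  assumes s1: "s \<in> {1, -1}"
  shows "f \<in> H1 s \<longleftrightarrow> f holomorphic_on UNIV \<and>
    (\<forall>\<epsilon>>0. \<forall>K b. \<exists>C. \<forall>z. s * Im z \<le> b \<longrightarrow> norm (f z) \<le> C * exp (\<epsilon> * \<bar>Re z\<bar> - K * \<bar>Im z\<bar>))"
proof -
  have "(\<forall>j::nat\<ge>1. bdd_above ((\<lambda>z. cmod (f z) * exp (- (1 / real j) * \<bar>Re z\<bar> + real j * \<bar>Im z\<bar>)) ` {z. s * Im z \<le> real j}))
    \<longleftrightarrow> (\<forall>\<epsilon>>0. \<forall>K b. \<exists>C. \<forall>z. s * Im z \<le> b \<longrightarrow> norm (f z) \<le> C * exp (\<epsilon> * \<bar>Re z\<bar> - K * \<bar>Im z\<bar>))"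
    unfolding bdd_above_weight
  proof (intro iffI allI impI)
    fix \<epsilon> K b :: real
    assume *: "\<forall>j\<ge>1. \<exists>C. \<forall>z\<in>{z. s * Im z \<le> real j}. cmod (f z) \<le> C * exp (- (- (1 / real j) * \<bar>Re z\<bar> + real j * \<bar>Im z\<bar>))"
      and \<epsilon>: "\<epsilon> > 0"
    obtain k :: nat where k: "k \<ge> 1" "max K b < real k" "1 / real k \<le> \<epsilon>" using ex_large_nat[OF zero_less_one \<epsilon>] by metis
    obtain C where C: "\<And>z. s * Im z \<le> real k \<Longrightarrow> cmod (f z) \<le> C * exp (- (- (1 / real k) * \<bar>Re z\<bar> + real k * \<bar>Im z\<bar>))"
      using * k(1) by blast
    have "norm (f z) \<le> max C 0 * exp (\<epsilon> * \<bar>Re z\<bar> - K * \<bar>Im z\<bar>)" if z: "s * Im z \<le> b" for z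
    proof -
      have "1 / real k * \<bar>Re z\<bar> \<le> \<epsilon> * \<bar>Re z\<bar>" "K * \<bar>Im z\<bar> \<le> real k * \<bar>Im z\<bar>"
        using k by (intro mult_right_mono; auto)+
      then have e: "- (- (1 / real k) * \<bar>Re z\<bar> + real k * \<bar>Im z\<bar>) \<le> \<epsilon> * \<bar>Re z\<bar> - K * \<bar>Im z\<bar>" by simp
      have "norm (f z) \<le> C * exp (- (- (1 / real k) * \<bar>Re z\<bar> + real k * \<bar>Im z\<bar>))"
        using C[of z] z k(2) by simp
      also have "\<dots> \<le> max C 0 * exp (\<epsilon> * \<bar>Re z\<bar> - K * \<bar>Im z\<bar>)"
        using e by (intro mult_mono) auto
      finally show ?thesis .
    qed
    then show "\<exists>C. \<forall>z. s * Im z \<le> b \<longrightarrow> norm (f z) \<le> C * exp (\<epsilon> * \<bar>Re z\<bar> - K * \<bar>Im z\<bar>)" by blast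
  next
    fix k :: nat
    assume *: "\<forall>\<epsilon>>0. \<forall>K b. \<exists>C. \<forall>z. s * Im z \<le> b \<longrightarrow> norm (f z) \<le> C * exp (\<epsilon> * \<bar>Re z\<bar> - K * \<bar>Im z\<bar>)" and k: "1 \<le> k"
    have "1 / real k > 0" using k by simp
    then obtain C where "\<And>z. s * Im z \<le> real k \<Longrightarrow> norm (f z) \<le> C * exp (1 / real k * \<bar>Re z\<bar> - real k * \<bar>Im z\<bar>)"
      using * by blast
    then show "\<exists>C. \<forall>z\<in>{z. s * Im z \<le> real k}. cmod (f z) \<le> C * exp (- (- (1 / real k) * \<bar>Re z\<bar> + real k * \<bar>Im z\<bar>))"
      by (intro exI[of _ C]) simp
  qed
  then show ?thesis by (simp add: H1_def hol_def)
qed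

section \<open>Rapidly decreasing representatives modulo entire functions\<close>

lemma open_nonreal: "open (- \<real> :: complex set)"
  using closed_complex_Reals by (rule open_Compl)

text \<open>Each of h1(z) and h2(-z) approximates G(z) exp(z^2) boundedly on one half-plane and is
  bounded on the other, so their sum is boundedly close on both. The second comes from the reflected
  function, for which the same multiplier works because exp(z^2) is even.\<close>

lemma rapid_approx:
  assumes "G holomorphic_on - \<real>"
  obtains h where "h holomorphic_on UNIV" "\<And>s. grow s (\<lambda>z. G z - h z)"
proof -
  define E where "E z = exp (z ^ 2)" for z :: complex
  have Eh: "E holomorphic_on A" for A unfolding E_def by (intro holomorphic_intros)
  have "(\<lambda>z. G z * E z) holomorphic_on upper"
    using assms by (intro holomorphic_intros Eh) (auto intro: holomorphic_on_subset simp: upper_def complex_is_Real_iff)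
  then interpret u: upper_holomorphic "\<lambda>z. G z * E z" by unfold_locales
  obtain h1 where h1: "h1 holomorphic_on UNIV"
    "\<And>b c. 0 < b \<Longrightarrow> \<exists>C. \<forall>z. (b \<le> Im z \<and> Im z \<le> c \<longrightarrow> norm (G z * E z - h1 z) \<le> C) \<and> (- c \<le> Im z \<and> Im z \<le> - b \<longrightarrow> norm (h1 z) \<le> C)"
    using u.upper_approx by blast
  have "(\<lambda>z. G (- z) * E z) holomorphic_on upper"
    by (intro holomorphic_intros Eh holomorphic_on_compose_gen[of uminus _ G "- \<real>", unfolded comp_def] assms)
       (auto simp: upper_def complex_is_Real_iff)
  then interpret l: upper_holomorphic "\<lambda>z. G (- z) * E z" by unfold_locales
  obtain h2 where h2: "h2 holomorphic_on UNIV"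
    "\<And>b c. 0 < b \<Longrightarrow> \<exists>C. \<forall>z. (b \<le> Im z \<and> Im z \<le> c \<longrightarrow> norm (G (- z) * E z - h2 z) \<le> C) \<and> (- c \<le> Im z \<and> Im z \<le> - b \<longrightarrow> norm (h2 z) \<le> C)"
    using l.upper_approx by blast
  have h2': "(\<lambda>z. h2 (- z)) holomorphic_on UNIV"
    by (rule holomorphic_on_compose_gen[of uminus _ h2 UNIV, unfolded comp_def]) (auto intro!: holomorphic_intros h2(1))
  show thesis
  proof (rule that)
    show "(\<lambda>z. (h1 z + h2 (- z)) * exp (- (z ^ 2))) holomorphic_on UNIV"
      by (intro holomorphic_intros h1(1) h2')
    fix s :: real
    show "grow s (\<lambda>z. G z - (h1 z + h2 (- z)) * exp (- (z ^ 2)))"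
      unfolding grow_def
    proof (intro allI impI)
      fix b c :: real assume b: "0 < b"
      obtain C1 where C1: "\<And>z. b \<le> Im z \<Longrightarrow> Im z \<le> c \<Longrightarrow> norm (G z * E z - h1 z) \<le> C1" "\<And>z. - c \<le> Im z \<Longrightarrow> Im z \<le> - b \<Longrightarrow> norm (h1 z) \<le> C1"
        using h1(2)[OF b, of c] by blast
      obtain C2 where C2: "\<And>z. b \<le> Im z \<Longrightarrow> Im z \<le> c \<Longrightarrow> norm (G (- z) * E z - h2 z) \<le> C2" "\<And>z. - c \<le> Im z \<Longrightarrow> Im z \<le> - b \<Longrightarrow> norm (h2 z) \<le> C2"
        using h2(2)[OF b, of c] by blast
      have bd: "norm (G z * E z - (h1 z + h2 (- z))) \<le> C1 + C2" if z: "b \<le> \<bar>Im z\<bar>" "\<bar>Im z\<bar> \<le> c" for z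
      proof (cases "Im z > 0")
        case True
        then have "norm (G z * E z - h1 z) \<le> C1" "norm (h2 (- z)) \<le> C2" using C1(1)[of z] C2(2)[of "- z"] z by auto
        then show ?thesis using norm_triangle_ineq4[of "G z * E z - h1 z" "h2 (- z)"] by (simp add: diff_diff_eq)
      next
        case False
        have "E (- z) = E z" by (simp add: E_def)
        then have "norm (G z * E z - h2 (- z)) \<le> C2" "norm (h1 z) \<le> C1" using C2(1)[of "- z"] C1(2)[of z] z b False by auto
        then show ?thesis using norm_triangle_ineq4[of "G z * E z - h2 (- z)" "h1 z"] by (simp add: algebra_simps)
      qed
      show "grow_on b c s (\<lambda>z. G z - (h1 z + h2 (- z)) * exp (- (z ^ 2)))"
      \<comment> \<open>Re(-z^2) = (Im z)^2 - (Re z)^2. The first term is at most c^2, and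
        completing the square gives -(Re z)^2 \<le> s |Re z| + s^2/4 for s of either sign.\<close>
      proof (rule grow_onI[where C="(C1 + C2) * exp (c ^ 2 + s ^ 2 / 4)"])
        fix z assume z: "b \<le> \<bar>Im z\<bar>" "\<bar>Im z\<bar> \<le> c"
        have C0: "C1 + C2 \<ge> 0" using bd[OF z] norm_ge_zero order_trans by blast
        have "(Im z)\<^sup>2 \<le> c\<^sup>2" using z(2) by (rule power2_le_iff_abs_le[THEN iffD2, rotated]) (use z in auto)
        moreover have "0 \<le> (\<bar>Re z\<bar> + s / 2)\<^sup>2" by simp
        then have "- (Re z)\<^sup>2 \<le> s * \<bar>Re z\<bar> + s\<^sup>2 / 4" by (simp add: power2_sum power_divide mult.commute[of s])
        ultimately have e: "Re (- (z ^ 2)) \<le> (c ^ 2 + s ^ 2 / 4) + s * \<bar>Re z\<bar>" by (simp add: Re_power2)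
        have "E z * exp (- (z ^ 2)) = 1" by (simp add: E_def flip: exp_add)
        then have "G z - (h1 z + h2 (- z)) * exp (- (z ^ 2)) = (G z * E z - (h1 z + h2 (- z))) * exp (- (z ^ 2))"
          by (simp add: left_diff_distrib mult.assoc)
        then have "norm (G z - (h1 z + h2 (- z)) * exp (- (z ^ 2))) = norm (G z * E z - (h1 z + h2 (- z))) * exp (Re (- (z ^ 2)))"
          by (simp add: norm_mult)
        also have "\<dots> \<le> (C1 + C2) * exp ((c ^ 2 + s ^ 2 / 4) + s * \<bar>Re z\<bar>)"
          using bd[OF z] e C0 by (intro mult_mono) auto
        finally show "norm (G z - (h1 z + h2 (- z)) * exp (- (z ^ 2))) \<le> (C1 + C2) * exp (c ^ 2 + s ^ 2 / 4) * exp (s * \<bar>Re z\<bar>)"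
          by (simp add: exp_add mult.assoc)
      qed
    qed
  qed
qed

section \<open>Subspaces and quotients\<close>

definition fsubspace :: "(complex \<Rightarrow> complex) set \<Rightarrow> bool" where
  "fsubspace A \<longleftrightarrow> (\<lambda>z. 0) \<in> A \<and> (\<forall>f\<in>A. \<forall>g\<in>A. (\<lambda>z. f z + g z) \<in> A) \<and> (\<forall>a. \<forall>f\<in>A. (\<lambda>z. a * f z) \<in> A)"

lemma fsubspaceD:
  assumes "fsubspace A"
  shows "(\<lambda>z. 0) \<in> A" "f \<in> A \<Longrightarrow> g \<in> A \<Longrightarrow> (\<lambda>z. f z + g z) \<in> A" "f \<in> A \<Longrightarrow> (\<lambda>z. a * f z) \<in> A"
    "f \<in> A \<Longrightarrow> g \<in> A \<Longrightarrow> (\<lambda>z. f z - g z) \<in> A" "f \<in> A \<Longrightarrow> (\<lambda>z. - f z) \<in> A"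
proof -
  show 1: "(\<lambda>z. 0) \<in> A" "f \<in> A \<Longrightarrow> g \<in> A \<Longrightarrow> (\<lambda>z. f z + g z) \<in> A" "f \<in> A \<Longrightarrow> (\<lambda>z. a * f z) \<in> A" for f g a
    using assms unfolding fsubspace_def by auto
  show 2: "f \<in> A \<Longrightarrow> (\<lambda>z. - f z) \<in> A" for f using 1(3)[of f "-1"] by simp
  show "f \<in> A \<Longrightarrow> g \<in> A \<Longrightarrow> (\<lambda>z. f z - g z) \<in> A" using 1(2)[of f "\<lambda>z. - g z"] 2[of g] by simp
qed

lemma cls_iff: "g \<in> cls A B f \<longleftrightarrow> f \<in> A \<and> g \<in> A \<and> (\<lambda>z. f z - g z) \<in> B"
  by (auto simp: cls_def modrel_def)

lemma cls_self: "fsubspace B \<Longrightarrow> f \<in> A \<Longrightarrow> f \<in> cls A B f"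
  by (simp add: cls_iff fsubspaceD)

lemma cls_eq_iff:
  assumes B: "fsubspace B" and "f \<in> A" "g \<in> A"
  shows "cls A B f = cls A B g \<longleftrightarrow> (\<lambda>z. f z - g z) \<in> B"
proof
  assume "cls A B f = cls A B g"
  then have "g \<in> cls A B f" using cls_self[OF B assms(3)] by simp
  then show "(\<lambda>z. f z - g z) \<in> B" by (simp add: cls_iff)
next
  assume fg: "(\<lambda>z. f z - g z) \<in> B"
  have "(\<lambda>z. f z - h z) \<in> B \<longleftrightarrow> (\<lambda>z. g z - h z) \<in> B" for h
    using fsubspaceD(4)[OF B, of "\<lambda>z. f z - h z" "\<lambda>z. f z - g z"] fsubspaceD(2)[OF B, of "\<lambda>z. g z - h z" "\<lambda>z. f z - g z"] fg
    by auto
  then show "cls A B f = cls A B g" using assms(2,3) by (auto simp: cls_iff)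
qed

lemma cls_eq_of_mem: "fsubspace B \<Longrightarrow> g \<in> cls A B f \<Longrightarrow> cls A B g = cls A B f"
  using cls_eq_iff[of B f A g] by (auto simp: cls_iff)

lemma quot_iff: "X \<in> quot A B \<longleftrightarrow> (\<exists>f\<in>A. X = cls A B f)"
  by (auto simp: quot_def quotient_def cls_def)

lemma cls_quot: "f \<in> A \<Longrightarrow> cls A B f \<in> quot A B" by (auto simp: quot_iff)

lemma the_elem_unique: "S \<noteq> {} \<Longrightarrow> (\<And>x. x \<in> S \<Longrightarrow> x = c) \<Longrightarrow> the_elem S = c"
  by (metis empty_iff insertI1 is_singletonI' is_singleton_the_elem)

lemma the_elem_image:
  assumes "x \<in> S" "\<And>y. y \<in> S \<Longrightarrow> f y = c" shows "the_elem (f ` S) = c"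
  using assms by (intro the_elem_unique) auto

lemma qadd_cls:
  assumes A: "fsubspace A" and B: "fsubspace B" and f: "f \<in> A" and g: "g \<in> A"
  shows "qadd A B (cls A B f) (cls A B g) = cls A B (\<lambda>z. f z + g z)"
proof -
  have *: "cls A B (\<lambda>z. f' z + g' z) = cls A B (\<lambda>z. f z + g z)" if "f' \<in> cls A B f" "g' \<in> cls A B g" for f' g'
  proof -
    have "(\<lambda>z. f' z + g' z - (f z + g z)) = (\<lambda>z. - ((f z - f' z) + (g z - g' z)))" by auto
    moreover have "\<dots> \<in> B" using that by (intro fsubspaceD(5)[OF B] fsubspaceD(2)[OF B]) (auto simp: cls_iff)
    ultimately show ?thesis
      using that f g by (subst cls_eq_iff[OF B]) (auto simp: cls_iff intro: fsubspaceD(2)[OF A])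
  qed
  show ?thesis unfolding qadd_def
    using cls_self[OF B f] cls_self[OF B g] * by blast
qed

lemma qscale_cls:
  assumes A: "fsubspace A" and B: "fsubspace B" and f: "f \<in> A"
  shows "qscale A B a (cls A B f) = cls A B (\<lambda>z. a * f z)"
proof -
  have *: "cls A B (\<lambda>z. a * f' z) = cls A B (\<lambda>z. a * f z)" if "f' \<in> cls A B f" for f'
  proof -
    have "(\<lambda>z. a * f' z - a * f z) = (\<lambda>z. (- a) * (f z - f' z))" by (auto simp: algebra_simps)
    moreover have "\<dots> \<in> B" using that by (intro fsubspaceD(3)[OF B]) (auto simp: cls_iff)
    ultimately show ?thesis
      using that f by (subst cls_eq_iff[OF B]) (auto simp: cls_iff intro: fsubspaceD(3)[OF A])
  qed
  show ?thesis unfolding qscale_def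
    using cls_self[OF B f] * by blast
qed

section \<open>The function spaces as subspaces, and their inclusions\<close>

lemma fsubspace_hol: "fsubspace (hol W)"
  unfolding fsubspace_def hol_def by (auto intro!: holomorphic_intros)

text \<open>With arbitrary weights and sets this is the common shape of \<open>Oexp\<close>,
  \<open>Hminf\<close>, \<open>FO_pinf\<close>, \<open>FO_minf\<close> and
  \<open>H1\<close>.\<close>

lemma fsubspace_weighted:
  "fsubspace {f \<in> hol W. \<forall>n::nat\<ge>1. bdd_above ((\<lambda>z. cmod (f z) * exp (w n z)) ` S n)}"
proof -
  let ?b = "\<lambda>f n. \<exists>C. \<forall>z\<in>S n. norm (f z :: complex) \<le> C * exp (- w n z)"
  have "?b (\<lambda>z. f z + g z) n" if f: "?b f n" and g: "?b g n" for f g n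
  proof -
    obtain C where C: "\<And>z. z \<in> S n \<Longrightarrow> norm (f z) \<le> C * exp (- w n z)" using f by blast
    obtain D where D: "\<And>z. z \<in> S n \<Longrightarrow> norm (g z) \<le> D * exp (- w n z)" using g by blast
    have "norm (f z + g z) \<le> (C + D) * exp (- w n z)" if "z \<in> S n" for z
      using norm_triangle_ineq[of "f z" "g z"] C[OF that] D[OF that] by (simp add: ring_distribs)
    then show ?thesis by blast
  qed
  moreover have "?b (\<lambda>z. a * f z) n" if f: "?b f n" for a f n
  proof -
    obtain C where C: "\<And>z. z \<in> S n \<Longrightarrow> norm (f z) \<le> C * exp (- w n z)" using f by blast
    have "norm (a * f z) \<le> (norm a * C) * exp (- w n z)" if "z \<in> S n" for z
      using mult_left_mono[OF C[OF that], of "norm a"] by (simp add: norm_mult mult.assoc)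
    then show ?thesis by blast
  qed
  moreover have "?b (\<lambda>z. 0) n" for n by (intro exI[of _ 0]) simp
  ultimately show ?thesis
    using fsubspaceD[OF fsubspace_hol[of W]] unfolding bdd_above_weight
    by (subst fsubspace_def) blast
qed

lemma fsubspace_image_restr: assumes "fsubspace A" shows "fsubspace (restr W ` A)"
proof -
  have 1: "(\<lambda>z. restr W f z + restr W g z) = restr W (\<lambda>z. f z + g z)" for f g by (auto simp: restr_def)
  have 2: "(\<lambda>z. a * restr W f z) = restr W (\<lambda>z. a * f z)" for f a by (auto simp: restr_def)
  have 3: "(\<lambda>z. 0) = restr W (\<lambda>z. 0)" by (auto simp: restr_def)
  show ?thesis unfolding fsubspace_def
    using fsubspaceD[OF assms] by (auto simp: 1 2) (subst 3, blast)
qed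

lemma fsum_spaceI: "f \<in> A \<Longrightarrow> g \<in> B \<Longrightarrow> (\<lambda>z. f z + g z) \<in> fsum_space A B"
  unfolding fsum_space_def by blast

lemma fsubspace_fsum: assumes A: "fsubspace A" and B: "fsubspace B" shows "fsubspace (fsum_space A B)"
  unfolding fsubspace_def
proof (intro conjI ballI allI)
  show "(\<lambda>z. 0) \<in> fsum_space A B" unfolding fsum_space_def
    using fsubspaceD(1)[OF A] fsubspaceD(1)[OF B] by force
  fix f assume "f \<in> fsum_space A B"
  then obtain f1 f2 where f: "f1 \<in> A" "f2 \<in> B" "f = (\<lambda>z. f1 z + f2 z)" by (auto simp: fsum_space_def)
  show "(\<lambda>z. a * f z) \<in> fsum_space A B" for a
  proof -
    have "(\<lambda>z. a * f z) = (\<lambda>z. a * f1 z + a * f2 z)" by (simp add: f(3) ring_distribs)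
    then show ?thesis
      using fsum_spaceI[OF fsubspaceD(3)[OF A f(1), of a] fsubspaceD(3)[OF B f(2), of a]] by simp
  qed
  fix g assume "g \<in> fsum_space A B"
  then obtain g1 g2 where g: "g1 \<in> A" "g2 \<in> B" "g = (\<lambda>z. g1 z + g2 z)" by (auto simp: fsum_space_def)
  show "(\<lambda>z. f z + g z) \<in> fsum_space A B"
  proof -
    have "(\<lambda>z. f z + g z) = (\<lambda>z. (f1 z + g1 z) + (f2 z + g2 z))" by (simp add: f(3) g(3) add_ac)
    then show ?thesis
      using fsum_spaceI[OF fsubspaceD(2)[OF A f(1) g(1)] fsubspaceD(2)[OF B f(2) g(2)]] by simp
  qed
qed

lemma fsubspaces:
  "fsubspace (Oexp K)" "fsubspace (Hminf K)" "fsubspace FO_pinf" "fsubspace FO_minf" "fsubspace (H1 s)"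
  unfolding Oexp_def Hminf_def FO_pinf_def FO_minf_def H1_def by (rule fsubspace_weighted)+

lemma fsubspaces':
  "fsubspace Oexp_entire" "fsubspace Oexp_pm" "fsubspace Hminf_entire" "fsubspace Hminf_pm" "fsubspace hol_entire"
  "fsubspace FO_pm" "fsubspace FG_pm" "fsubspace Oexp_FO" "fsubspace FG_Rbar"
  unfolding Oexp_entire_def Oexp_pm_def Hminf_entire_def Hminf_pm_def hol_entire_def FO_pm_def FG_pm_def Oexp_FO_def FG_Rbar_def
  by (intro fsubspace_image_restr fsubspace_fsum fsubspaces fsubspace_hol)+

lemma Hminf_emptyD:
  assumes "f \<in> Hminf {}" shows "f holomorphic_on UNIV" "grow_on 0 d s f"
proof -
  show "f holomorphic_on UNIV" using assms by (simp add: Hminf_def hol_def fin_part_simps)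
  obtain n :: nat where n: "n \<ge> 1" "max d (- s) < real n"
    by (rule ex_large_nat[OF zero_less_one zero_less_one])
  have "\<exists>C. \<forall>z\<in>Sset n {}. cmod (f z) \<le> C * exp (- (real n * \<bar>Re z\<bar>))"
    using assms n(1) by (simp add: Hminf_def bdd_above_weight)
  then obtain C where C: "\<And>z. \<bar>Im z\<bar> < real n \<Longrightarrow> cmod (f z) \<le> C * exp (- (real n * \<bar>Re z\<bar>))"
    by (auto simp: Sset_empty)
  have "grow_on 0 d (- real n) f" by (rule grow_onI[where C=C]) (use C n in auto)
  then show "grow_on 0 d s f" by (rule grow_on_mono) (use n in auto)
qed

lemma grow_on_zero_grow: assumes "\<And>d. grow_on 0 d s f" shows "grow s f"
  unfolding grow_def
proof (intro allI impI)
  show "grow_on c d s f" if "0 < c" for c d by (rule grow_on_mono[OF assms]) (use that in auto)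
qed

lemma restr_hol: "f holomorphic_on W \<Longrightarrow> restr W f \<in> hol W"
  using holomorphic_transform[of f W "restr W f"] by (simp add: hol_def restr_def)

lemma grow_restr: "grow s f \<Longrightarrow> grow s (restr (- \<real>) f)"
  by (erule grow_cong) (auto simp: restr_def)

lemma restr_nonreal_hol: "f holomorphic_on UNIV \<Longrightarrow> restr (- \<real>) f \<in> hol (- \<real>)"
  by (rule restr_hol[OF holomorphic_on_subset]) auto

lemma Oexp_pm_subset: "Oexp_pm \<subseteq> Oexp UNIV"
  unfolding Oexp_pm_def using restr_nonreal_hol grow_restr by (auto simp: Oexp_pm_iff Oexp_UNIV_iff)

lemma Oexp_empty_subset_pm: "Oexp {} \<subseteq> Oexp {\<infinity>, -\<infinity>}"
  using grow_on_zero_grow by (auto simp: Oexp_empty_iff Oexp_pm_iff)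

lemma Oexp_entire_subset: "Oexp_entire \<subseteq> Oexp_pm" "Oexp_entire \<subseteq> Oexp UNIV"
  using Oexp_empty_subset_pm Oexp_pm_subset unfolding Oexp_entire_def Oexp_pm_def by blast+

lemma Hminf_subset_Oexp: "Hminf UNIV \<subseteq> Oexp UNIV"
  by (auto simp: Hminf_UNIV_iff Oexp_UNIV_iff)

text \<open>W and V - W are both open, so extension by 0 cannot break holomorphy. Applied to a
  half-plane inside the nonreal numbers, it turns functions on one half-plane into functions off the
  real line.\<close>

lemma hol_extend_zero:
  assumes "f \<in> hol W" "W \<subseteq> V" "open W" "open (V - W)"
  shows "f \<in> hol V"
proof -
  have "f holomorphic_on V - W"
    by (rule holomorphic_transform[of "\<lambda>z. 0"]) (use assms(1) in \<open>auto simp: hol_def\<close>)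
  then have "f holomorphic_on W \<union> (V - W)"
    using assms by (intro holomorphic_on_Un) (auto simp: hol_def)
  moreover have "W \<union> (V - W) = V" using assms(2) by blast
  ultimately show ?thesis using assms(1,2) by (auto simp: hol_def)
qed

lemma nonreal_split: "- \<real> - upper = lower" "- \<real> - lower = upper" "upper \<subseteq> - \<real>" "lower \<subseteq> - \<real>"
  by (auto simp: upper_def lower_def complex_is_Real_iff)

lemma open_lower: "open lower"
  unfolding lower_def by (intro open_Collect_less continuous_intros)

lemma hol_upper_subset: "hol upper \<subseteq> hol (- \<real>)" and hol_lower_subset: "hol lower \<subseteq> hol (- \<real>)"
  using hol_extend_zero[of _ upper "- \<real>"] hol_extend_zero[of _ lower "- \<real>"] nonreal_split open_lower open_convex_upper(1)
  by auto

lemma FO_pinf_subset: "FO_pinf \<subseteq> Oexp UNIV"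
proof
  fix f assume f: "f \<in> FO_pinf"
  then have fh: "f \<in> hol lower" and fb: "\<And>s K b. s > 0 \<Longrightarrow> b > 0 \<Longrightarrow> \<exists>C. \<forall>z. Im z \<le> - b \<longrightarrow> norm (f z) \<le> C * exp (s * \<bar>Re z\<bar> - K * \<bar>Im z\<bar>)"
    by (auto simp: FO_pinf_iff)
  have "grow_on c d s f" if sc: "s > 0" "c > 0" for s c d
  proof -
    obtain C where C: "\<And>z. Im z \<le> - c \<Longrightarrow> norm (f z) \<le> C * exp (s * \<bar>Re z\<bar> - 0 * \<bar>Im z\<bar>)" using fb[OF sc, of 0] by blast
    show ?thesis
    proof (rule grow_onI[where C="max C 0"])
      fix z assume z: "c \<le> \<bar>Im z\<bar>"
      show "norm (f z) \<le> max C 0 * exp (s * \<bar>Re z\<bar>)"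
      proof (cases "Im z < 0")
        case True
        then have "norm (f z) \<le> C * exp (s * \<bar>Re z\<bar>)" using C[of z] z by simp
        then show ?thesis by (rule order_trans) (auto intro: mult_right_mono)
      next
        case False then show ?thesis using fh by (simp add: hol_def lower_def)
      qed
    qed
  qed
  then show "f \<in> Oexp UNIV" using fh hol_lower_subset by (auto simp: Oexp_UNIV_iff grow_def)
qed

lemma FO_minf_subset: "FO_minf \<subseteq> Oexp UNIV"
proof
  fix f assume "f \<in> FO_minf"
  then have "(\<lambda>z. f (- z)) \<in> Oexp UNIV" using FO_pinf_subset FO_minf_iff by blast
  then have h: "(\<lambda>z. f (- z)) \<in> hol (- \<real>)" and g: "\<And>s. s > 0 \<Longrightarrow> grow s (\<lambda>z. f (- z))" by (auto simp: Oexp_UNIV_iff)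
  have "uminus ` (- \<real>) = (- \<real> :: complex set)"
    by (auto simp: image_iff intro!: bexI[of _ "- x" for x])
  then show "f \<in> Oexp UNIV" using hol_reflect[OF h] grow_reflect[OF g] by (simp add: Oexp_UNIV_iff)
qed

lemma fsum_subset: "fsubspace C \<Longrightarrow> A \<subseteq> C \<Longrightarrow> B \<subseteq> C \<Longrightarrow> fsum_space A B \<subseteq> C"
  unfolding fsum_space_def using fsubspaceD(2)[of C] by blast

lemma FO_pm_subset: "FO_pm \<subseteq> Oexp UNIV" and Oexp_FO_subset: "Oexp_FO \<subseteq> Oexp UNIV"
  unfolding Oexp_FO_def FO_pm_def
  by (intro fsum_subset fsubspaces FO_minf_subset FO_pinf_subset Oexp_entire_subset)+

lemma H1_subset: "s \<in> {1,-1} \<Longrightarrow> H1 s \<subseteq> FG_Rbar"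
proof
  fix f assume s: "s \<in> {1,-1}" and f: "f \<in> H1 s"
  have fh: "f holomorphic_on UNIV" and fb: "\<And>\<epsilon> K b. \<epsilon> > 0 \<Longrightarrow> \<exists>C. \<forall>z. s * Im z \<le> b \<longrightarrow> norm (f z) \<le> C * exp (\<epsilon> * \<bar>Re z\<bar> - K * \<bar>Im z\<bar>)"
    using f by (auto simp: H1_iff[OF s])
  have "grow_on 0 d \<epsilon> f" if e: "\<epsilon> > 0" for \<epsilon> d
  proof -
    obtain C where C: "\<And>z. s * Im z \<le> d \<Longrightarrow> norm (f z) \<le> C * exp (\<epsilon> * \<bar>Re z\<bar> - 0 * \<bar>Im z\<bar>)" using fb[OF e, of d 0] by blast
    show ?thesis using C s by (intro grow_onI[where C=C]) auto
  qed
  then show "f \<in> FG_Rbar" using fh by (auto simp: FG_Rbar_def Oexp_empty_iff)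
qed

lemma plus_part_Oexp: assumes "F \<in> FG_Rbar" shows "plus_part F \<in> Oexp UNIV"
proof -
  have h: "F holomorphic_on UNIV" and g: "\<And>s. s > 0 \<Longrightarrow> grow s F"
    using assms grow_on_zero_grow by (auto simp: FG_Rbar_def Oexp_empty_iff)
  have "plus_part F \<in> hol (- \<real>)"
    unfolding plus_part_def using hol_upper_subset restr_hol[OF holomorphic_on_subset[OF h], of upper] by auto
  moreover have "grow s (plus_part F)" if "s > 0" for s
  proof -
    have "norm (plus_part F z) \<le> norm (F z)" for z by (auto simp: plus_part_def restr_def)
    then show ?thesis using g[OF that] unfolding grow_def grow_on_def by (meson order_trans)
  qed
  ultimately show ?thesis by (simp add: Oexp_UNIV_iff)
qed

lemma restr_upper_H1: assumes "f \<in> H1 (-1)" shows "restr upper f \<in> FO_minf"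
proof -
  have fh: "f holomorphic_on UNIV" and fb: "\<And>\<epsilon> K b. \<epsilon> > 0 \<Longrightarrow> \<exists>C. \<forall>z. (-1) * Im z \<le> b \<longrightarrow> norm (f z) \<le> C * exp (\<epsilon> * \<bar>Re z\<bar> - K * \<bar>Im z\<bar>)"
    using assms H1_iff[of "-1"] by auto
  have "uminus ` upper = lower" by (auto simp: upper_def lower_def image_iff intro!: exI[of _ "- x" for x])
  then have "(\<lambda>z. restr upper f (- z)) \<in> hol lower"
    using hol_reflect[OF restr_hol[OF holomorphic_on_subset[OF fh]], of upper] by simp
  moreover have "\<exists>C. \<forall>z. Im z \<le> - b \<longrightarrow> norm (restr upper f (- z)) \<le> C * exp (s * \<bar>Re z\<bar> - K * \<bar>Im z\<bar>)" if sb: "s > 0" "b > 0" for s K b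
  proof -
    obtain C where C: "\<And>z. (-1) * Im z \<le> 0 \<Longrightarrow> norm (f z) \<le> C * exp (s * \<bar>Re z\<bar> - K * \<bar>Im z\<bar>)" using fb[OF sb(1), of 0] by blast
    have "norm (restr upper f (- z)) \<le> C * exp (s * \<bar>Re z\<bar> - K * \<bar>Im z\<bar>)" if "Im z \<le> - b" for z
      using C[of "- z"] that sb(2) by (auto simp: restr_def upper_def)
    then show ?thesis by blast
  qed
  ultimately show ?thesis by (auto simp: FO_minf_iff FO_pinf_iff)
qed

lemma restr_lower_H1: assumes "f \<in> H1 1" shows "restr lower f \<in> FO_pinf"
proof -
  have fh: "f holomorphic_on UNIV" and fb: "\<And>\<epsilon> K b. \<epsilon> > 0 \<Longrightarrow> \<exists>C. \<forall>z. 1 * Im z \<le> b \<longrightarrow> norm (f z) \<le> C * exp (\<epsilon> * \<bar>Re z\<bar> - K * \<bar>Im z\<bar>)"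
    using assms H1_iff[of 1] by auto
  have "\<exists>C. \<forall>z. Im z \<le> - b \<longrightarrow> norm (restr lower f z) \<le> C * exp (s * \<bar>Re z\<bar> - K * \<bar>Im z\<bar>)" if sb: "s > 0" "b > 0" for s K b
  proof -
    obtain C where C: "\<And>z. 1 * Im z \<le> 0 \<Longrightarrow> norm (f z) \<le> C * exp (s * \<bar>Re z\<bar> - K * \<bar>Im z\<bar>)" using fb[OF sb(1), of 0] by blast
    have "norm (restr lower f z) \<le> C * exp (s * \<bar>Re z\<bar> - K * \<bar>Im z\<bar>)" if "Im z \<le> - b" for z
      using C[of z] that sb(2) by (auto simp: restr_def lower_def)
    then show ?thesis by blast
  qed
  then show ?thesis using restr_hol[OF holomorphic_on_subset[OF fh]] by (auto simp: FO_pinf_iff)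
qed

text \<open>For F = f + g with f in \<open>H1 (-1)\<close> and g in \<open>H1 1\<close>, off the
  real line the plus part is g, plus f on the upper half-plane, minus g on the lower one. The first
  term lies in \<open>Oexp_entire\<close>, the other two in \<open>FO_pm\<close>.\<close>

lemma plus_part_FG_pm: assumes "F \<in> FG_pm" shows "plus_part F \<in> Oexp_FO"
proof -
  obtain f g where fg: "f \<in> H1 (-1)" "g \<in> H1 1" "F = (\<lambda>z. f z + g z)" using assms by (auto simp: FG_pm_def fsum_space_def)
  have "g \<in> Oexp {}" using H1_subset[of 1] fg(2) by (auto simp: FG_Rbar_def)
  then have "restr (- \<real>) g \<in> Oexp_entire" by (simp add: Oexp_entire_def)
  moreover have "(\<lambda>z. restr upper f z + - restr lower g z) \<in> FO_pm"
    unfolding FO_pm_def by (intro fsum_spaceI restr_upper_H1 fsubspaceD(5)[OF fsubspaces(3)] restr_lower_H1 fg)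
  ultimately have "(\<lambda>z. restr (- \<real>) g z + (restr upper f z + - restr lower g z)) \<in> Oexp_FO"
    unfolding Oexp_FO_def by (rule fsum_spaceI)
  also have "(\<lambda>z. restr (- \<real>) g z + (restr upper f z + - restr lower g z)) = plus_part F"
    by (auto simp: plus_part_def restr_def fg(3) upper_def lower_def complex_is_Real_iff)
  finally show ?thesis .
qed

text \<open>From a decomposition of the plus part into G, f and g one reads off F - G = f above the
  real axis and G = -g below it. The entire functions F - G and G thus inherit the decay of f and of
  g, and F = (F - G) + G.\<close>

lemma FG_pm_of_plus_part:
  assumes F: "F \<in> FG_Rbar" and p: "plus_part F \<in> Oexp_FO" shows "F \<in> FG_pm"
proof -
  obtain G f g where G: "G \<in> Oexp {}" and f: "f \<in> FO_minf" and g: "g \<in> FO_pinf"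
    and eq: "plus_part F = (\<lambda>z. restr (- \<real>) G z + (f z + g z))"
    using p by (auto simp: Oexp_FO_def FO_pm_def fsum_space_def Oexp_entire_def)
  have fz: "f z = 0" if "\<not> Im z > 0" for z
    using f that hol_reflect by (auto simp: FO_minf_def hol_def upper_def)
  have gz: "g z = 0" if "\<not> Im z < 0" for z using g that by (auto simp: FO_pinf_def hol_def lower_def)
  have up: "F z - G z = f z" if "Im z > 0" for z
    using fun_cong[OF eq, of z] gz[of z] that by (simp add: plus_part_def restr_def upper_def complex_is_Real_iff)
  have lo: "G z = - g z" if "Im z < 0" for z
    using fun_cong[OF eq, of z] fz[of z] that by (simp add: plus_part_def restr_def upper_def complex_is_Real_iff eq_neg_iff_add_eq_0)
  have gb: "\<And>s K b. s > 0 \<Longrightarrow> b > 0 \<Longrightarrow> \<exists>C. \<forall>z. Im z \<le> - b \<longrightarrow> norm (g z) \<le> C * exp (s * \<bar>Re z\<bar> - K * \<bar>Im z\<bar>)"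
    using g by (auto simp: FO_pinf_iff)
  have fb: "\<And>s K b. s > 0 \<Longrightarrow> b > 0 \<Longrightarrow> \<exists>C. \<forall>z. Im z \<le> - b \<longrightarrow> norm (f (- z)) \<le> C * exp (s * \<bar>Re z\<bar> - K * \<bar>Im z\<bar>)"
    using f by (auto simp: FO_minf_iff FO_pinf_iff)
  \<comment> \<open>Decay on s Im z \<le> -1 is enough: between this half-plane and s Im z \<le> b
    there is only a strip, where the growth condition of \<open>Oexp {}\<close> holds and the factor
    exp(-K |Im z|) costs a constant.\<close>
  have key: "h \<in> H1 s" if s: "s \<in> {1,-1}" and h: "h \<in> Oexp {}"
    and hb: "\<And>\<epsilon> K. \<epsilon> > 0 \<Longrightarrow> \<exists>C. \<forall>z. s * Im z \<le> - 1 \<longrightarrow> norm (h z) \<le> C * exp (\<epsilon> * \<bar>Re z\<bar> - K * \<bar>Im z\<bar>)" for h s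
    unfolding H1_iff[OF s]
  proof (intro conjI allI impI)
    show "h holomorphic_on UNIV" using h by (simp add: Oexp_empty_iff)
    fix \<epsilon> K b :: real assume \<epsilon>: "\<epsilon> > 0"
    obtain C where C: "\<And>z. s * Im z \<le> - 1 \<Longrightarrow> norm (h z) \<le> C * exp (\<epsilon> * \<bar>Re z\<bar> - K * \<bar>Im z\<bar>)" using hb[OF \<epsilon>] by blast
    define d where "d = max 1 \<bar>b\<bar>"
    have "grow_on 0 d \<epsilon> h" using h \<epsilon> by (simp add: Oexp_empty_iff)
    then obtain D where D: "D \<ge> 0" "\<And>z. \<bar>Im z\<bar> \<le> d \<Longrightarrow> norm (h z) \<le> D * exp (\<epsilon> * \<bar>Re z\<bar>)"
      using grow_onD by (metis abs_ge_zero)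
    have "norm (h z) \<le> max C (D * exp (\<bar>K\<bar> * d)) * exp (\<epsilon> * \<bar>Re z\<bar> - K * \<bar>Im z\<bar>)" if z: "s * Im z \<le> b" for z
    proof (cases "s * Im z \<le> - 1")
      case True
      show ?thesis by (rule order_trans[OF C[OF True]]) (auto intro: mult_right_mono)
    next
      case False
      then have z': "\<bar>Im z\<bar> \<le> d" using z s by (auto simp: d_def)
      have "K * \<bar>Im z\<bar> \<le> \<bar>K\<bar> * d" using z' by (intro mult_mono) auto
      then have "D * exp (\<epsilon> * \<bar>Re z\<bar>) \<le> D * exp (\<bar>K\<bar> * d + (\<epsilon> * \<bar>Re z\<bar> - K * \<bar>Im z\<bar>))"
        using D(1) by (intro mult_left_mono) auto
      also have "\<dots> = D * exp (\<bar>K\<bar> * d) * exp (\<epsilon> * \<bar>Re z\<bar> - K * \<bar>Im z\<bar>)" by (simp add: exp_add)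
      also have "\<dots> \<le> max C (D * exp (\<bar>K\<bar> * d)) * exp (\<epsilon> * \<bar>Re z\<bar> - K * \<bar>Im z\<bar>)" by (intro mult_right_mono) auto
      finally show ?thesis using D(2)[OF z'] by linarith
    qed
    then show "\<exists>C. \<forall>z. s * Im z \<le> b \<longrightarrow> norm (h z) \<le> C * exp (\<epsilon> * \<bar>Re z\<bar> - K * \<bar>Im z\<bar>)" by blast
  qed
  have "G \<in> H1 1"
  proof (rule key[OF _ G])
    fix \<epsilon> K :: real assume "\<epsilon> > 0"
    then obtain C where "\<And>z. Im z \<le> - 1 \<Longrightarrow> norm (g z) \<le> C * exp (\<epsilon> * \<bar>Re z\<bar> - K * \<bar>Im z\<bar>)" using gb[of \<epsilon> 1 K] by auto
    then show "\<exists>C. \<forall>z. 1 * Im z \<le> - 1 \<longrightarrow> norm (G z) \<le> C * exp (\<epsilon> * \<bar>Re z\<bar> - K * \<bar>Im z\<bar>)"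
      using lo by (intro exI[of _ C]) auto
  qed auto
  moreover have "(\<lambda>z. F z - G z) \<in> H1 (-1)"
  proof (rule key)
    show "(\<lambda>z. F z - G z) \<in> Oexp {}" using F G fsubspaceD(4)[OF fsubspaces(1)] by (auto simp: FG_Rbar_def)
    fix \<epsilon> K :: real assume "\<epsilon> > 0"
    then obtain C where C: "\<And>z. Im z \<le> - 1 \<Longrightarrow> norm (f (- z)) \<le> C * exp (\<epsilon> * \<bar>Re z\<bar> - K * \<bar>Im z\<bar>)" using fb[of \<epsilon> 1 K] by auto
    have "norm (F z - G z) \<le> C * exp (\<epsilon> * \<bar>Re z\<bar> - K * \<bar>Im z\<bar>)" if "(-1) * Im z \<le> - 1" for z
      using C[of "- z"] up[of z] that by simp
    then show "\<exists>C. \<forall>z. (-1) * Im z \<le> - 1 \<longrightarrow> norm (F z - G z) \<le> C * exp (\<epsilon> * \<bar>Re z\<bar> - K * \<bar>Im z\<bar>)" by blast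
  qed auto
  ultimately show ?thesis using fsum_spaceI[of "\<lambda>z. F z - G z" "H1 (-1)" G "H1 1"] by (simp add: FG_pm_def)
qed

section \<open>The Fourier transform of test functions\<close>

lemma norm_exp_kernel: "norm (exp (- \<i> * z * \<zeta>)) = exp (Re z * Im \<zeta> + Im z * Re \<zeta>)"
  by (simp add: norm_exp_eq_Re mult.assoc)

lemma norm_exp_kernel_le:
  assumes "\<bar>Im \<zeta>\<bar> \<le> c" shows "norm (exp (- \<i> * z * \<zeta>)) \<le> exp (c * \<bar>Re z\<bar> + Im z * Re \<zeta>)"
proof -
  have "Re z * Im \<zeta> \<le> \<bar>Re z\<bar> * \<bar>Im \<zeta>\<bar>" by (metis abs_ge_self abs_mult)
  also have "\<dots> \<le> \<bar>Re z\<bar> * c" using assms by (intro mult_left_mono) auto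
  finally show ?thesis by (simp add: norm_exp_kernel mult.commute)
qed

text \<open>The kernel has modulus exp(x Im \<zeta> + t Re \<zeta>). The first part is absorbed by
  the decay of g, since c < d, the second by the weighted integrability of p, so a product A(x) B(u)
  dominates. The bound on Im \<zeta> is asked only where p does not vanish, which allows densities
  cut off by an indicator.\<close>

lemma fubini_exp:
  fixes g p \<zeta> :: "real \<Rightarrow> complex"
  assumes g[measurable]: "g \<in> borel_measurable borel" and p[measurable]: "p \<in> borel_measurable borel"
    and \<zeta>[measurable]: "\<zeta> \<in> borel_measurable borel"
    and gb: "\<And>x. norm (g x) \<le> C * exp (- d * \<bar>x\<bar>)" and im: "\<And>u. p u \<noteq> 0 \<Longrightarrow> \<bar>Im (\<zeta> u)\<bar> \<le> c" and cd: "c < d"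
    and int: "integrable lborel (\<lambda>u. norm (p u) * exp (t * Re (\<zeta> u)))"
  shows "(LINT x|lborel. g x * (LINT u|lborel. p u * exp (- \<i> * Complex x t * \<zeta> u)))
       = (LINT u|lborel. p u * (LINT x|lborel. g x * exp (- \<i> * Complex x t * \<zeta> u)))"
proof -
  define A where "A x = C * exp (- (d - c) * \<bar>x\<bar>)" for x :: real
  define B where "B u = norm (p u) * exp (t * Re (\<zeta> u))" for u
  define f where "f = (\<lambda>x u. g x * (p u * exp (- \<i> * Complex x t * \<zeta> u)))"
  have fm: "case_prod f \<in> borel_measurable (lborel \<Otimes>\<^sub>M lborel)"
    unfolding f_def Complex_eq by measurable
  have A: "integrable lborel A" unfolding A_def
    using integrable_exp_abs[of "d - c" 0] cd by simp
  have B: "integrable lborel B" using int by (simp add: B_def[abs_def])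
  have AB: "integrable (lborel \<Otimes>\<^sub>M lborel) (\<lambda>(x, u). A x * B u)"
  proof (rule lborel_pair.Fubini_integrable)
    show "(\<lambda>(x, u). A x * B u) \<in> borel_measurable (lborel \<Otimes>\<^sub>M lborel)"
      using borel_measurable_integrable[OF A] borel_measurable_integrable[OF B] by measurable
    have "(\<lambda>x. LINT u|lborel. norm (case (x, u) of (x, u) \<Rightarrow> A x * B u)) = (\<lambda>x. norm (A x) * (LINT u|lborel. norm (B u)))"
      by (auto simp: abs_mult)
    then show "integrable lborel (\<lambda>x. LINT u|lborel. norm (case (x, u) of (x, u) \<Rightarrow> A x * B u))"
      using A by simp
  qed (use B in auto)
  have le: "norm (f x u) \<le> A x * B u" for x u
  proof (cases "p u = 0")
    case False
    have "norm (f x u) = norm (g x) * (norm (p u) * norm (exp (- \<i> * Complex x t * \<zeta> u)))" by (simp add: f_def norm_mult)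
    also have "\<dots> \<le> (C * exp (- d * \<bar>x\<bar>)) * (norm (p u) * exp (c * \<bar>x\<bar> + t * Re (\<zeta> u)))"
      using norm_exp_kernel_le[OF im[OF False], of "Complex x t"] order_trans[OF norm_ge_zero gb]
      by (intro mult_mono gb mult_left_mono) auto
    also have "\<dots> = A x * B u" by (simp add: A_def B_def exp_add exp_diff exp_minus left_diff_distrib field_simps)
    finally show ?thesis .
  qed (simp add: f_def B_def)
  have "integrable (lborel \<Otimes>\<^sub>M lborel) (case_prod f)"
    by (rule Bochner_Integration.integrable_bound[OF AB fm])
       (auto intro!: order_trans[OF le] abs_ge_self)
  from lborel_pair.Fubini_integral[OF this]
  have "(LINT u|lborel. LINT x|lborel. f x u) = (LINT x|lborel. LINT u|lborel. f x u)" .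
  moreover have "(LINT x|lborel. f x u) = p u * (LINT x|lborel. g x * exp (- \<i> * Complex x t * \<zeta> u))" for u
    unfolding f_def by (subst integral_mult_right_zero[symmetric]) (simp add: mult_ac)
  moreover have "(LINT u|lborel. f x u) = g x * (LINT u|lborel. p u * exp (- \<i> * Complex x t * \<zeta> u))" for x
    unfolding f_def by (rule integral_mult_right_zero)
  ultimately show ?thesis by simp
qed

section \<open>Steps of the test function space\<close>

lemma ostrip_open_convex: "open (ostrip c)" "convex (ostrip c)"
  using open_convex_strip[of "-c" c] by (simp_all add: ostrip_def abs_less_iff conj_commute minus_less_iff)

lemma closure_ostrip_subset: "closure (ostrip c) \<subseteq> {z. \<bar>Im z\<bar> \<le> c}"
  by (rule closure_strip_subset) (auto simp: ostrip_def)

lemma ostrip_mono: "c \<le> d \<Longrightarrow> ostrip c \<subseteq> ostrip d" by (auto simp: ostrip_def)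

lemma ostrip_subset_closure: "z \<in> ostrip c \<Longrightarrow> z \<in> closure (ostrip c)" using closure_subset by blast

lemma Pstep_bound:
  assumes "\<phi> \<in> Pstep n" "z \<in> closure (ostrip (1 / real n))"
  shows "norm (\<phi> z) \<le> Pnorm n \<phi> * exp (- (1 / real n) * \<bar>Re z\<bar>)"
proof -
  have "cmod (\<phi> z) * exp ((1 / real n) * \<bar>Re z\<bar>) \<le> Pnorm n \<phi>"
    unfolding Pnorm_def by (rule cSUP_upper[OF assms(2)]) (use assms(1) in \<open>simp add: Pstep_def\<close>)
  then show ?thesis by (simp add: exp_minus field_simps)
qed

lemma Pstep_bound':
  assumes "\<phi> \<in> Pstep n" "\<bar>Im z\<bar> < 1 / real n"
  shows "norm (\<phi> z) \<le> Pnorm n \<phi> * exp (- (1 / real n) * \<bar>Re z\<bar>)"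
  by (rule Pstep_bound[OF assms(1) ostrip_subset_closure]) (use assms(2) in \<open>simp add: ostrip_def\<close>)

lemma Pnorm_nonneg: assumes "\<phi> \<in> Pstep n" "n \<ge> 1" shows "Pnorm n \<phi> \<ge> 0"
  using order_trans[OF norm_ge_zero Pstep_bound'[OF assms(1), of 0]] assms(2) by simp

lemma Pstep_hol: "\<phi> \<in> Pstep n \<Longrightarrow> \<phi> holomorphic_on ostrip (1 / real n)" by (simp add: Pstep_def)

text \<open>Holomorphy on a strictly larger strip supplies the continuity on the closed one.\<close>

lemma PstepI:
  assumes "\<phi> holomorphic_on ostrip d" "1 / real n < d"
    "\<And>z. \<bar>Im z\<bar> \<le> 1 / real n \<Longrightarrow> norm (\<phi> z) \<le> C * exp (- (1 / real n) * \<bar>Re z\<bar>)"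
  shows "\<phi> \<in> Pstep n"
  unfolding Pstep_def
proof (intro CollectI conjI)
  have cl: "closure (ostrip (1 / real n)) \<subseteq> ostrip d"
    using closure_ostrip_subset[of "1 / real n"] assms(2) by (auto simp: ostrip_def)
  show "\<phi> holomorphic_on ostrip (1 / real n)" using assms(1) ostrip_mono[of "1 / real n" d] assms(2) by (auto intro: holomorphic_on_subset)
  show "continuous_on (closure (ostrip (1 / real n))) \<phi>"
    using holomorphic_on_imp_continuous_on[OF assms(1)] cl by (rule continuous_on_subset)
  show "bdd_above ((\<lambda>z. cmod (\<phi> z) * exp (1 / real n * \<bar>Re z\<bar>)) ` closure (ostrip (1 / real n)))"
    unfolding bdd_above_weight using closure_ostrip_subset[of "1 / real n"] assms(3) by (intro exI[of _ C]) auto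
qed

lemma Pstep_mono: assumes "1 \<le> n" "n \<le> m" "\<phi> \<in> Pstep n" shows "\<phi> \<in> Pstep m"
proof -
  have le: "1 / real m \<le> 1 / real n" using assms by (intro frac_le) auto
  note cl = closure_mono[OF ostrip_mono[OF le]]
  have "cmod (\<phi> z) \<le> Pnorm n \<phi> * exp (- (1 / real m * \<bar>Re z\<bar>))" if "z \<in> closure (ostrip (1 / real m))" for z
  proof -
    have "cmod (\<phi> z) \<le> Pnorm n \<phi> * exp (- (1 / real n) * \<bar>Re z\<bar>)" using Pstep_bound[OF assms(3)] that cl by blast
    also have "\<dots> \<le> Pnorm n \<phi> * exp (- (1 / real m * \<bar>Re z\<bar>))"
      using mult_right_mono[OF le, of "\<bar>Re z\<bar>"] Pnorm_nonneg[OF assms(3,1)] by (intro mult_left_mono) auto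
    finally show ?thesis .
  qed
  then show ?thesis using assms(3) cl ostrip_mono[OF le] unfolding Pstep_def bdd_above_weight
    by (auto intro: holomorphic_on_subset continuous_on_subset)
qed

lemma Pall_obtain_two:
  assumes "\<phi> \<in> Pall" "\<psi> \<in> Pall" obtains n where "n \<ge> 1" "\<phi> \<in> Pstep n" "\<psi> \<in> Pstep n"
proof -
  obtain n m where "n \<ge> 1" "m \<ge> 1" "\<phi> \<in> Pstep n" "\<psi> \<in> Pstep m" using assms by (auto simp: Pall_def)
  then show thesis using that[of "max n m"] Pstep_mono[of n "max n m"] Pstep_mono[of m "max n m"] by auto
qed

lemma Pstep_add: assumes "\<phi> \<in> Pstep n" "\<psi> \<in> Pstep n" shows "(\<lambda>z. \<phi> z + \<psi> z) \<in> Pstep n"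
proof -
  have "cmod (\<phi> z + \<psi> z) \<le> (Pnorm n \<phi> + Pnorm n \<psi>) * exp (- (1 / real n * \<bar>Re z\<bar>))" if "z \<in> closure (ostrip (1 / real n))" for z
    using norm_triangle_ineq[of "\<phi> z" "\<psi> z"] Pstep_bound[OF assms(1) that] Pstep_bound[OF assms(2) that] by (simp add: ring_distribs)
  then show ?thesis using assms unfolding Pstep_def bdd_above_weight by (auto intro!: holomorphic_intros continuous_intros)
qed

lemma Pstep_cmult: assumes "\<phi> \<in> Pstep n" shows "(\<lambda>z. a * \<phi> z) \<in> Pstep n"
proof -
  have "cmod (a * \<phi> z) \<le> (norm a * Pnorm n \<phi>) * exp (- (1 / real n * \<bar>Re z\<bar>))" if "z \<in> closure (ostrip (1 / real n))" for z
    using mult_left_mono[OF Pstep_bound[OF assms(1) that], of "norm a"] by (simp add: norm_mult mult.assoc)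
  then show ?thesis using assms unfolding Pstep_def bdd_above_weight by (auto intro!: holomorphic_intros continuous_intros)
qed

lemma Pstep_Pall: "1 \<le> n \<Longrightarrow> \<phi> \<in> Pstep n \<Longrightarrow> \<phi> \<in> Pall" by (auto simp: Pall_def)

lemma zero_Pstep: "(\<lambda>z. 0) \<in> Pstep n"
  by (auto simp: Pstep_def bdd_above_weight intro!: exI[of _ 0])

lemma fsubspace_Pall: "fsubspace Pall"
  unfolding fsubspace_def
proof (intro conjI ballI allI)
  show "(\<lambda>z. 0) \<in> Pall" using Pstep_Pall[OF _ zero_Pstep, of 1] by simp
  show "(\<lambda>z. f z + g z) \<in> Pall" if fg: "f \<in> Pall" "g \<in> Pall" for f g
  proof -
    obtain n where n: "n \<ge> 1" "f \<in> Pstep n" "g \<in> Pstep n" using Pall_obtain_two[OF fg] .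
    show ?thesis by (rule Pstep_Pall[OF n(1) Pstep_add[OF n(2,3)]])
  qed
  show "(\<lambda>z. a * f z) \<in> Pall" if "f \<in> Pall" for a f
  proof -
    obtain n where n: "n \<ge> 1" "f \<in> Pstep n" using \<open>f \<in> Pall\<close> by (auto simp: Pall_def)
    show ?thesis by (rule Pstep_Pall[OF n(1) Pstep_cmult[OF n(2)]])
  qed
qed

lemma Pnull_iff: "\<phi> \<in> Pnull \<longleftrightarrow> \<phi> \<in> Pall \<and> (\<exists>d>0. \<forall>z\<in>ostrip d. \<phi> z = 0)"
proof
  assume "\<phi> \<in> Pnull"
  then obtain m :: nat where "\<phi> \<in> Pall" "m \<ge> 1" "\<forall>z\<in>closure (ostrip (1 / real m)). \<phi> z = 0" by (auto simp: Pnull_def)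
  then show "\<phi> \<in> Pall \<and> (\<exists>d>0. \<forall>z\<in>ostrip d. \<phi> z = 0)"
    by (intro conjI exI[of _ "1 / real m"]) (auto simp: ostrip_subset_closure)
next
  assume "\<phi> \<in> Pall \<and> (\<exists>d>0. \<forall>z\<in>ostrip d. \<phi> z = 0)"
  then obtain d where d: "\<phi> \<in> Pall" "d > 0" "\<And>z. z \<in> ostrip d \<Longrightarrow> \<phi> z = 0" by auto
  obtain m :: nat where m: "m \<ge> 1" "1 / real m < d" by (rule ex_large_nat[OF d(2) zero_less_one])
  have "\<phi> z = 0" if "z \<in> closure (ostrip (1 / real m))" for z
    using closure_ostrip_subset[of "1 / real m"] that m(2) by (intro d(3)) (auto simp: ostrip_def)
  then show "\<phi> \<in> Pnull" using d(1) m(1) by (auto simp: Pnull_def)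
qed

lemma fsubspace_Pnull: "fsubspace Pnull"
proof -
  have "(\<lambda>z. f z + g z) \<in> Pnull" if fg: "f \<in> Pnull" "g \<in> Pnull" for f g
  proof -
    obtain d e where de: "d > 0" "e > 0" "\<And>z. z \<in> ostrip d \<Longrightarrow> f z = 0" "\<And>z. z \<in> ostrip e \<Longrightarrow> g z = 0"
      using fg unfolding Pnull_iff by blast
    have "f z + g z = 0" if "z \<in> ostrip (min d e)" for z
      using that de(3)[of z] de(4)[of z] by (simp add: ostrip_def)
    then show ?thesis unfolding Pnull_iff
      using fg de(1,2) fsubspaceD(2)[OF fsubspace_Pall, of f g] by (auto simp: Pnull_iff intro!: exI[of _ "min d e"])
  qed
  moreover have "(\<lambda>z. 0) \<in> Pnull" unfolding Pnull_iff
    using fsubspaceD(1)[OF fsubspace_Pall] by (auto intro!: exI[of _ 1])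
  moreover have "(\<lambda>z. a * f z) \<in> Pnull" if "f \<in> Pnull" for a f
    using that fsubspaceD(3)[OF fsubspace_Pall, of f a] unfolding Pnull_iff by force
  ultimately show ?thesis unfolding fsubspace_def by blast
qed

section \<open>Fourier transforms of test functions on a strip\<close>

text \<open>In |Re z| the kernel grows at most at the rate |Im \<zeta>| < 1/n, so the product with
  \<phi> still decays and the line can be moved within the strip of \<phi>.\<close>

lemma line_int_exp_shift:
  assumes \<phi>: "\<phi> \<in> Pstep n" and n: "1 \<le> n" and t: "\<bar>t\<bar> < 1 / real n" and \<zeta>: "\<bar>Im \<zeta>\<bar> < 1 / real n"
  shows "line_int t (\<lambda>z. \<phi> z * exp (- \<i> * z * \<zeta>)) = Pfourier_fun \<phi> \<zeta>"
proof -
  let ?f = "\<lambda>z. \<phi> z * exp (- \<i> * z * \<zeta>)"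
  have hol: "?f holomorphic_on ostrip (1 / real n)" by (intro holomorphic_intros Pstep_hol \<phi>)
  have bd: "norm (?f z) \<le> (Pnorm n \<phi> * exp (\<bar>t\<bar> * \<bar>Re \<zeta>\<bar>)) * exp (- (1 / real n - \<bar>Im \<zeta>\<bar>) * \<bar>Re z\<bar>)" if z: "\<bar>Im z\<bar> \<le> \<bar>t\<bar>" for z
  proof -
    have "Im z * Re \<zeta> \<le> \<bar>Im z\<bar> * \<bar>Re \<zeta>\<bar>" by (simp flip: abs_mult)
    also have "\<dots> \<le> \<bar>t\<bar> * \<bar>Re \<zeta>\<bar>" using z by (intro mult_right_mono) auto
    finally have "Im z * Re \<zeta> \<le> \<bar>t\<bar> * \<bar>Re \<zeta>\<bar>" .
    then have "norm (exp (- \<i> * z * \<zeta>)) \<le> exp (\<bar>Im \<zeta>\<bar> * \<bar>Re z\<bar> + \<bar>t\<bar> * \<bar>Re \<zeta>\<bar>)"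
      by (intro order_trans[OF norm_exp_kernel_le[OF order_refl]]) auto
    then have "norm (?f z) \<le> (Pnorm n \<phi> * exp (- (1 / real n) * \<bar>Re z\<bar>)) * exp (\<bar>Im \<zeta>\<bar> * \<bar>Re z\<bar> + \<bar>t\<bar> * \<bar>Re \<zeta>\<bar>)"
      unfolding norm_mult using Pstep_bound'[OF \<phi>] z t Pnorm_nonneg[OF \<phi> n] by (intro mult_mono) auto
    also have "\<dots> = (Pnorm n \<phi> * exp (\<bar>t\<bar> * \<bar>Re \<zeta>\<bar>)) * exp (- (1 / real n - \<bar>Im \<zeta>\<bar>) * \<bar>Re z\<bar>)"
      by (simp add: exp_add exp_diff exp_minus left_diff_distrib field_simps)
    finally show ?thesis .
  qed
  have sh: "line_int c ?f = line_int d ?f" if "c \<le> d" "\<bar>c\<bar> \<le> \<bar>t\<bar>" "\<bar>d\<bar> \<le> \<bar>t\<bar>" for c d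
  proof (rule line_int_shift[OF ostrip_open_convex(2,1) hol that(1)])
    fix z assume "c \<le> Im z" "Im z \<le> d"
    then have z: "\<bar>Im z\<bar> \<le> \<bar>t\<bar>" using that by auto
    then show "z \<in> ostrip (1 / real n)" using t by (simp add: ostrip_def)
    show "norm (?f z) \<le> (Pnorm n \<phi> * exp (\<bar>t\<bar> * \<bar>Re \<zeta>\<bar>)) * exp (- (1 / real n - \<bar>Im \<zeta>\<bar>) * \<bar>Re z\<bar>)" by (rule bd[OF z])
  qed (use \<zeta> in auto)
  have "line_int t ?f = line_int 0 ?f" using sh[of t 0] sh[of 0 t] by (cases "t \<le> 0") auto
  also have "\<dots> = Pfourier_fun \<phi> \<zeta>" by (simp add: line_int_def Pfourier_fun_def complex_of_real_def)
  finally show ?thesis .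
qed

lemma Pstep_line_measurable:
  assumes "\<phi> \<in> Pstep n" "\<bar>t\<bar> < 1 / real n"
  shows "continuous_on UNIV (\<lambda>x. \<phi> (Complex x t))" "(\<lambda>x. \<phi> (Complex x t)) \<in> borel_measurable borel"
proof -
  show "continuous_on UNIV (\<lambda>x. \<phi> (Complex x t))"
    by (rule continuous_on_horizontal[OF holomorphic_on_imp_continuous_on[OF Pstep_hol[OF assms(1)]]])
       (use assms(2) in \<open>simp add: ostrip_def\<close>)
  then show "(\<lambda>x. \<phi> (Complex x t)) \<in> borel_measurable borel" by (rule borel_measurable_continuous_onI)
qed

lemma line_int_mult_right: "line_int t (\<lambda>w. f w * c) = line_int t f * c"
  unfolding line_int_def by (rule integral_mult_left_zero)

text \<open>The pairing formula behind all transforms: integrating \<open>\<phi>\<close> against a superposition of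
  exponentials amounts to integrating its Fourier transform against the coefficients.\<close>

lemma fubini_line:
  fixes p \<zeta> :: "real \<Rightarrow> complex"
  assumes \<phi>: "\<phi> \<in> Pstep n" and n: "1 \<le> n" and t: "\<bar>t\<bar> < 1 / real n"
    and p: "p \<in> borel_measurable borel" and \<zeta>: "\<zeta> \<in> borel_measurable borel"
    and im: "\<And>u. p u \<noteq> 0 \<Longrightarrow> \<bar>Im (\<zeta> u)\<bar> \<le> c" and c: "c < 1 / real n"
    and int: "integrable lborel (\<lambda>u. norm (p u) * exp (t * Re (\<zeta> u)))"
  shows "line_int t (\<lambda>z. \<phi> z * (LINT u|lborel. p u * exp (- \<i> * z * \<zeta> u))) = (LINT u|lborel. p u * Pfourier_fun \<phi> (\<zeta> u))"
proof -
  have "line_int t (\<lambda>z. \<phi> z * (LINT u|lborel. p u * exp (- \<i> * z * \<zeta> u)))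
      = (LINT u|lborel. p u * (LINT x|lborel. \<phi> (Complex x t) * exp (- \<i> * Complex x t * \<zeta> u)))"
    unfolding line_int_def
  proof (rule fubini_exp[OF Pstep_line_measurable(2)[OF \<phi> t] p \<zeta>])
    show "norm (\<phi> (Complex x t)) \<le> Pnorm n \<phi> * exp (- (1 / real n) * \<bar>x\<bar>)" for x
      using Pstep_bound'[OF \<phi>, of "Complex x t"] t by simp
  qed (use im c int in auto)
  also have "\<dots> = (LINT u|lborel. p u * Pfourier_fun \<phi> (\<zeta> u))"
  proof (rule Bochner_Integration.integral_cong[OF refl])
    fix u show "p u * (LINT x|lborel. \<phi> (Complex x t) * exp (- \<i> * Complex x t * \<zeta> u)) = p u * Pfourier_fun \<phi> (\<zeta> u)"
      using line_int_exp_shift[OF \<phi> n t, of "\<zeta> u"] im[of u] c by (cases "p u = 0") (auto simp: line_int_def)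
  qed
  finally show ?thesis .
qed

lemma Pfourier_holomorphic:
  assumes \<phi>: "\<phi> \<in> Pstep n" and n: "1 \<le> n" shows "Pfourier_fun \<phi> holomorphic_on ostrip (1 / real n)"
proof -
  have "(\<lambda>\<zeta>. LINT x|lborel. \<phi> (Complex x 0) * exp (- \<i> * Complex x 0 * \<zeta>)) holomorphic_on ostrip (1 / real n)"
  proof (rule holomorphic_integral[OF ostrip_open_convex(1)])
    have [measurable]: "(\<lambda>x. \<phi> (Complex x 0)) \<in> borel_measurable borel"
      using Pstep_line_measurable(2)[OF \<phi>, of 0] n by simp
    show "(\<lambda>x. \<phi> (Complex x 0) * exp (- \<i> * Complex x 0 * z)) \<in> borel_measurable lborel" for z
      by (subst (2) Complex_eq) measurable
    show "(\<lambda>\<zeta>. \<phi> (Complex x 0) * exp (- \<i> * Complex x 0 * \<zeta>)) holomorphic_on ostrip (1 / real n)" for x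
      by (intro holomorphic_intros)
    fix z0 assume "z0 \<in> ostrip (1 / real n)"
    then have z0: "\<bar>Im z0\<bar> < 1 / real n" by (simp add: ostrip_def)
    \<comment> \<open>Half the distance from z0 to the boundary of the strip: on the ball |Im z|
      \<le> 1/n - r, which leaves the decay rate r for the dominating function.\<close>
    define r where "r = (1 / real n - \<bar>Im z0\<bar>) / 2"
    have r: "r > 0" using z0 by (simp add: r_def)
    define g where "g = (\<lambda>x. Pnorm n \<phi> * exp (- r * \<bar>x\<bar>))"
    have "norm (\<phi> (Complex x 0) * exp (- \<i> * Complex x 0 * z)) \<le> g x" if z: "z \<in> ball z0 r" for z x
    proof -
      have "\<bar>Im z - Im z0\<bar> \<le> norm (z - z0)" using abs_Im_le_cmod[of "z - z0"] by simp
      then have "\<bar>Im z\<bar> \<le> 1 / real n - r" using z by (simp add: r_def dist_norm norm_minus_commute field_simps)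
      then have "norm (\<phi> (Complex x 0) * exp (- \<i> * Complex x 0 * z)) \<le> (Pnorm n \<phi> * exp (- (1 / real n) * \<bar>x\<bar>)) * exp ((1 / real n - r) * \<bar>x\<bar>)"
        unfolding norm_mult using norm_exp_kernel_le[of z "1 / real n - r" "Complex x 0"] Pstep_bound'[OF \<phi>, of "Complex x 0"] Pnorm_nonneg[OF \<phi> n] n
        by (intro mult_mono) auto
      also have "\<dots> = g x" by (simp add: g_def mult.assoc algebra_simps flip: exp_add)
      finally show ?thesis .
    qed
    moreover have "integrable lborel g" unfolding g_def using integrable_exp_abs[OF r, of 0] by simp
    ultimately show "\<exists>r>0. \<exists>g. integrable lborel g \<and> (\<forall>z\<in>ball z0 r. \<forall>x\<in>space lborel. norm (\<phi> (Complex x 0) * exp (- \<i> * Complex x 0 * z)) \<le> g x)"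
      using r by blast
  qed
  then show ?thesis by (simp add: Pfourier_fun_def[abs_def] complex_of_real_def)
qed

lemma norm_line_int_le:
  assumes "\<And>x. norm (f (Complex x t)) \<le> C * exp (- d * \<bar>x\<bar>)" "d > 0"
  shows "norm (line_int t f) \<le> C * (LINT x|lborel. exp (- d * \<bar>x\<bar>))"
proof (cases "integrable lborel (\<lambda>x. f (Complex x t))")
  case True
  have "norm (line_int t f) \<le> (LINT x|lborel. norm (f (Complex x t)))" unfolding line_int_def by (rule integral_norm_bound)
  also have "\<dots> \<le> (LINT x|lborel. C * exp (- d * \<bar>x\<bar>))"
    using integrable_exp_abs[OF assms(2), of 0] True assms(1) by (intro integral_mono) auto
  finally show ?thesis by simp
next
  case False
  \<comment> \<open>A function that is not integrable has integral 0 by convention, so only the sign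
    of the bound remains to be checked.\<close>
  have "C \<ge> 0" using assms(1)[of 0] order_trans[OF norm_ge_zero] by force
  then have "C * (LINT x|lborel. exp (- d * \<bar>x\<bar>)) \<ge> 0" by (intro mult_nonneg_nonneg integral_nonneg_AE) auto
  then show ?thesis using False by (simp add: line_int_def not_integrable_integral_eq)
qed

text \<open>With 1/n = 2h, moving the line to height h or -h gains the factor exp(-h |Re \<zeta>|),
  and |Im \<zeta>| \<le> h leaves the decay rate h for the integral. Splitting the width into these
  two halves is the reason for the step 2n.\<close>

lemma Pfourier_Pstep:
  assumes \<phi>: "\<phi> \<in> Pstep n" and n: "1 \<le> n" shows "Pfourier_fun \<phi> \<in> Pstep (2 * n)"
proof -
  define h where "h = 1 / real (2 * n)"
  have h: "h > 0" "1 / real n = 2 * h" using n by (auto simp: h_def)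
  have main: "norm (Pfourier_fun \<phi> \<zeta>) \<le> (Pnorm n \<phi> * (LINT x|lborel. exp (- h * \<bar>x\<bar>))) * exp (- h * \<bar>Re \<zeta>\<bar>)"
    if \<zeta>: "\<bar>Im \<zeta>\<bar> \<le> h" for \<zeta>
  proof -
    \<comment> \<open>The line is moved to the side opposite to the sign of Re \<zeta>, so that the
      kernel decays in |Re \<zeta>|.\<close>
    define t where "t = (if Re \<zeta> \<ge> 0 then - h else h)"
    have t: "\<bar>t\<bar> < 1 / real n" "t * Re \<zeta> = - h * \<bar>Re \<zeta>\<bar>" unfolding h(2) using h(1) by (auto simp: t_def)
    have "\<bar>Im \<zeta>\<bar> < 1 / real n" unfolding h(2) using \<zeta> h(1) by linarith
    then have "Pfourier_fun \<phi> \<zeta> = line_int t (\<lambda>z. \<phi> z * exp (- \<i> * z * \<zeta>))"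
      using line_int_exp_shift[OF \<phi> n t(1)] by simp
    also have "norm \<dots> \<le> (Pnorm n \<phi> * exp (- h * \<bar>Re \<zeta>\<bar>)) * (LINT x|lborel. exp (- h * \<bar>x\<bar>))"
    proof (rule norm_line_int_le[OF _ h(1)])
      fix x
      have "norm (\<phi> (Complex x t)) \<le> Pnorm n \<phi> * exp (- (2 * h) * \<bar>x\<bar>)"
        using Pstep_bound'[OF \<phi>, of "Complex x t"] t(1) unfolding h(2) by simp
      moreover have "norm (exp (- \<i> * Complex x t * \<zeta>)) \<le> exp (h * \<bar>x\<bar> + t * Re \<zeta>)"
        using norm_exp_kernel_le[OF \<zeta>, of "Complex x t"] by simp
      ultimately have "norm (\<phi> (Complex x t) * exp (- \<i> * Complex x t * \<zeta>))
          \<le> (Pnorm n \<phi> * exp (- (2 * h) * \<bar>x\<bar>)) * exp (h * \<bar>x\<bar> + t * Re \<zeta>)"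
        unfolding norm_mult using Pnorm_nonneg[OF \<phi> n] by (intro mult_mono) auto
      also have "exp (h * \<bar>x\<bar> + t * Re \<zeta>) = exp (h * \<bar>x\<bar>) * exp (- h * \<bar>Re \<zeta>\<bar>)"
        unfolding t(2) by (rule exp_add)
      also have "exp (- (2 * h) * \<bar>x\<bar>) = exp (- h * \<bar>x\<bar>) * exp (- h * \<bar>x\<bar>)" by (simp flip: exp_add)
      also have "Pnorm n \<phi> * (exp (- h * \<bar>x\<bar>) * exp (- h * \<bar>x\<bar>)) * (exp (h * \<bar>x\<bar>) * exp (- h * \<bar>Re \<zeta>\<bar>))
          = Pnorm n \<phi> * exp (- h * \<bar>Re \<zeta>\<bar>) * exp (- h * \<bar>x\<bar>) * (exp (- h * \<bar>x\<bar>) * exp (h * \<bar>x\<bar>))" by (simp only: mult_ac)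
      also have "exp (- h * \<bar>x\<bar>) * exp (h * \<bar>x\<bar>) = 1" by (simp flip: exp_add)
      finally show "norm (\<phi> (Complex x t) * exp (- \<i> * Complex x t * \<zeta>)) \<le> Pnorm n \<phi> * exp (- h * \<bar>Re \<zeta>\<bar>) * exp (- h * \<bar>x\<bar>)" by simp
    qed
    finally show ?thesis by (simp only: mult_ac)
  qed
  show ?thesis
  proof (rule PstepI[OF Pfourier_holomorphic[OF assms]])
    show "1 / real (2 * n) < 1 / real n" using h unfolding h_def by linarith
    show "norm (Pfourier_fun \<phi> z) \<le> (Pnorm n \<phi> * (LINT x|lborel. exp (- h * \<bar>x\<bar>))) * exp (- (1 / real (2 * n)) * \<bar>Re z\<bar>)"
      if "\<bar>Im z\<bar> \<le> 1 / real (2 * n)" for z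
      using main[of z] that unfolding h_def .
  qed
qed

section \<open>Fourier inversion\<close>

lemma set_integral_exp_atLeast:
  fixes s :: complex assumes s: "Re s > 0"
  shows "(LINT u:{0..}|lborel. exp (- (s * of_real u))) = 1 / s"
proof -
  have int: "set_integrable lborel {0..} (\<lambda>u. exp (- (s * of_real u)))"
    by (rule set_integrable_line[where C=1 and d="Re s"]) (auto intro!: continuous_intros simp: norm_exp_eq_Re s)
  have s0: "s \<noteq> 0" using s by auto
  have "((\<lambda>X. LINT u:{0..X}|lborel. exp (- (s * of_real u))) \<longlongrightarrow> (LINT u:{0..}|lborel. exp (- (s * of_real u)))) at_top"
    using int by (intro tendsto_set_lebesgue_integral_at_top) auto
  moreover have "\<forall>\<^sub>F X in at_top. (LINT u:{0..X}|lborel. exp (- (s * of_real u))) = (1 - exp (- (s * of_real X))) / s"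
    using eventually_ge_at_top[of 0]
  proof eventually_elim
    case (elim X)
    have "((\<lambda>u. - exp (- (s * of_real u)) / s) has_vector_derivative exp (- (s * of_real u))) (at u within {0..X})" if "0 \<le> u" "u \<le> X" for u
      using s0 by (auto intro!: derivative_eq_intros has_vector_derivative_real_field)
    from integral_FTC_atLeastAtMost[OF elim this] show ?case
      by (simp add: set_lebesgue_integral_def diff_divide_distrib continuous_intros)
  qed
  ultimately have "((\<lambda>X. (1 - exp (- (s * of_real X))) / s) \<longlongrightarrow> (LINT u:{0..}|lborel. exp (- (s * of_real u)))) at_top"
    by (rule Lim_transform_eventually)
  moreover have "((\<lambda>X. exp (- (s * of_real X))) \<longlongrightarrow> 0) at_top"
  proof (rule Lim_null_comparison)
    show "((\<lambda>X. exp (- Re s * X)) \<longlongrightarrow> 0) at_top" using s by real_asymp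
  qed (simp add: norm_exp_eq_Re)
  then have "((\<lambda>X. (1 - exp (- (s * of_real X))) / s) \<longlongrightarrow> (1 - 0) / s) at_top"
    by (intro tendsto_intros s0)
  ultimately show ?thesis using tendsto_unique[OF trivial_limit_at_top_linorder] by force
qed

lemma lborel_integral_split:
  fixes f :: "real \<Rightarrow> complex" assumes "integrable lborel f"
  shows "(LINT x|lborel. f x) = (LINT x:{a..}|lborel. f x) + (LINT x:{..a}|lborel. f x)"
proof -
  have si: "set_integrable lborel A f" if "A \<in> sets borel" for A
    using assms that unfolding set_integrable_def by (auto intro: integrable_mult_indicator)
  have "AE x in lborel. x \<noteq> a" by (rule AE_lborel_singleton)
  then have "AE x in lborel. \<not> (x \<in> {a..} \<and> x \<in> {..a})" by eventually_elim auto
  then have "(LINT x:{a..} \<union> {..a}|lborel. f x) = (LINT x:{a..}|lborel. f x) + (LINT x:{..a}|lborel. f x)"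
    by (rule set_integral_Un_AE) (auto intro: si)
  moreover have "{a..} \<union> {..a} = UNIV" by auto
  ultimately show ?thesis by (simp add: set_lebesgue_integral_def)
qed

text \<open>The outer integral is cut at u = 0. For u \<ge> 0 the inner line is lowered to height
  -t, for u \<le> 0 it is raised to t, so that after Fubini the u-integral converges to 1/(i(w+z))
  and to its negative. The two line integrals together form the Cauchy integral of \<phi> at
  -z.\<close>

lemma fourier_inversion:
  assumes \<phi>: "\<phi> \<in> Pstep n" and n: "1 \<le> n" and z: "\<bar>Im z\<bar> < 1 / real (2 * n)"
  shows "Pfourier_fun (Pfourier_fun \<phi>) z = 2 * of_real pi * \<phi> (- z)"
proof -
  let ?\<psi> = "Pfourier_fun \<phi>"
  \<comment> \<open>This height lies strictly between |Im z| and 1/n, as both the convergence in u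
    and the shift within the strip of \<phi> demand.\<close>
  define t where "t = 1 / real (2 * n)"
  have t: "\<bar>t\<bar> < 1 / real n" "\<bar>- t\<bar> < 1 / real n" "t > 0" "\<bar>Im z\<bar> < t" using n z by (auto simp: t_def field_simps)
  have \<psi>: "?\<psi> \<in> Pstep (2 * n)" by (rule Pfourier_Pstep[OF \<phi> n])
  define e where "e u = exp (- \<i> * of_real u * z)" for u :: real
  have em[measurable]: "e \<in> borel_measurable borel" unfolding e_def by measurable
  have ne: "norm (e u) = exp (u * Im z)" for u by (simp add: e_def norm_exp_kernel del: mult_minus_left)
  have int: "integrable lborel (\<lambda>u. ?\<psi> (of_real u) * e u)"
  proof (rule integrable_line[where C="Pnorm (2 * n) ?\<psi>" and d="t - \<bar>Im z\<bar>"])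
    have "continuous_on UNIV (\<lambda>u. ?\<psi> (Complex u 0))" using Pstep_line_measurable(1)[OF \<psi>, of 0] n by simp
    then show "continuous_on UNIV (\<lambda>u. ?\<psi> (of_real u) * e u)"
      unfolding e_def by (intro continuous_intros) (simp add: complex_of_real_def)
    fix u :: real
    have "u * Im z \<le> \<bar>Im z\<bar> * \<bar>u\<bar>" by (metis abs_ge_self abs_mult mult.commute)
    then have "norm (?\<psi> (of_real u) * e u) \<le> (Pnorm (2 * n) ?\<psi> * exp (- (1 / real (2 * n)) * \<bar>u\<bar>)) * exp (\<bar>Im z\<bar> * \<bar>u\<bar>)"
      unfolding norm_mult ne using Pstep_bound'[OF \<psi>, of "of_real u"] Pnorm_nonneg[OF \<psi>] n by (intro mult_mono) auto
    also have "\<dots> = Pnorm (2 * n) ?\<psi> * exp (- (t - \<bar>Im z\<bar>) * \<bar>u\<bar>)"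
      by (simp add: t_def mult.assoc algebra_simps flip: exp_add)
    finally show "norm (?\<psi> (of_real u) * e u) \<le> Pnorm (2 * n) ?\<psi> * exp (- (t - \<bar>Im z\<bar>) * \<bar>u\<bar>)" .
  qed (use t in auto)
  have side: "(LINT u:A|lborel. ?\<psi> (of_real u) * e u) = line_int \<tau> (\<lambda>w. \<phi> w * (LINT u:A|lborel. exp (- \<i> * of_real u * (w + z))))"
    if A: "A \<in> sets borel" and \<tau>: "\<bar>\<tau>\<bar> < 1 / real n"
      and ai: "set_integrable lborel A (\<lambda>u. exp (u * Im z + \<tau> * u))" for A \<tau>
  proof -
    define p where "p u = indicator A u * e u" for u
    have pm: "p \<in> borel_measurable borel" unfolding p_def using A by measurable
    have "line_int \<tau> (\<lambda>w. \<phi> w * (LINT u|lborel. p u * exp (- \<i> * w * of_real u))) = (LINT u|lborel. p u * ?\<psi> (of_real u))"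
    proof (rule fubini_line[OF \<phi> n \<tau> pm])
      have "(\<lambda>u. norm (p u) * exp (\<tau> * Re (complex_of_real u))) = (\<lambda>u. indicator A u *\<^sub>R exp (u * Im z + \<tau> * u))"
        by (auto simp: p_def norm_mult ne exp_add indicator_def)
      then show "integrable lborel (\<lambda>u. norm (p u) * exp (\<tau> * Re (complex_of_real u)))"
        using ai by (simp add: set_integrable_def)
      show "0 < 1 / real n" using n by simp
    qed auto
    moreover have "p u * ?\<psi> (of_real u) = indicator A u *\<^sub>R (?\<psi> (of_real u) * e u)" for u by (simp add: p_def indicator_def)
    moreover have "p u * exp (- \<i> * w * of_real u) = indicator A u *\<^sub>R exp (- \<i> * of_real u * (w + z))" for u w
      by (simp add: p_def e_def indicator_def algebra_simps flip: exp_add)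
    ultimately show ?thesis by (simp add: set_lebesgue_integral_def)
  qed
  have w0: "\<phi> holomorphic_on ostrip (1 / real n)" by (rule Pstep_hol[OF \<phi>])
  have R: "(LINT u:{0..}|lborel. ?\<psi> (of_real u) * e u) = line_int (- t) (\<lambda>w. \<phi> w / (w - (- z))) / \<i>"
  proof -
    have "set_integrable lborel {0..} (\<lambda>u. exp (- (t - Im z) * u))" using t by (intro set_integrable_exp_atLeast) auto
    then have "set_integrable lborel {0..} (\<lambda>u. exp (u * Im z + (- t) * u))" by (simp add: algebra_simps)
    from side[OF _ t(2) this]
    have "(LINT u:{0..}|lborel. ?\<psi> (of_real u) * e u) = line_int (- t) (\<lambda>w. \<phi> w * (LINT u:{0..}|lborel. exp (- \<i> * of_real u * (w + z))))" by simp
    also have "\<dots> = line_int (- t) (\<lambda>w. (\<phi> w / (w - (- z))) * (1 / \<i>))"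
      unfolding line_int_def
    proof (rule Bochner_Integration.integral_cong[OF refl])
      fix x :: real
      let ?w = "Complex x (- t)"
      have "(LINT u:{0..}|lborel. exp (- \<i> * of_real u * (?w + z))) = (LINT u:{0..}|lborel. exp (- ((\<i> * (?w + z)) * of_real u)))"
        by (simp add: mult_ac)
      also have "\<dots> = 1 / (\<i> * (?w + z))" using t by (intro set_integral_exp_atLeast) auto
      finally show "\<phi> ?w * (LINT u:{0..}|lborel. exp (- \<i> * of_real u * (?w + z))) = \<phi> ?w / (?w - (- z)) * (1 / \<i>)"
        by (simp add: divide_inverse mult_ac)
    qed
    finally show ?thesis unfolding line_int_mult_right by simp
  qed
  have L: "(LINT u:{..0}|lborel. ?\<psi> (of_real u) * e u) = - line_int t (\<lambda>w. \<phi> w / (w - (- z))) / \<i>"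
  proof -
    have "set_integrable lborel {0..} (\<lambda>u. exp (- (t + Im z) * u))" using t by (intro set_integrable_exp_atLeast) auto
    from lborel_integrable_real_affine[OF this[unfolded set_integrable_def], of "-1" 0]
    have "set_integrable lborel {..0} (\<lambda>u. exp (u * Im z + t * u))"
      by (simp add: set_integrable_def indicator_def algebra_simps)
    from side[OF _ t(1) this]
    have "(LINT u:{..0}|lborel. ?\<psi> (of_real u) * e u) = line_int t (\<lambda>w. \<phi> w * (LINT u:{..0}|lborel. exp (- \<i> * of_real u * (w + z))))" by simp
    also have "\<dots> = line_int t (\<lambda>w. (\<phi> w / (w - (- z))) * (- 1 / \<i>))"
      unfolding line_int_def
    proof (rule Bochner_Integration.integral_cong[OF refl])
      fix x :: real
      let ?w = "Complex x t"
      have "(LINT u:{..0}|lborel. exp (- \<i> * of_real u * (?w + z))) = (LINT u:{0..}|lborel. exp (- ((- \<i> * (?w + z)) * of_real u)))"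
        by (subst set_integral_reflect) (simp add: mult_ac atLeast_def)
      also have "\<dots> = 1 / (- \<i> * (?w + z))" using t by (intro set_integral_exp_atLeast) auto
      finally show "\<phi> ?w * (LINT u:{..0}|lborel. exp (- \<i> * of_real u * (?w + z))) = \<phi> ?w / (?w - (- z)) * (- 1 / \<i>)"
        by (simp add: divide_inverse mult_ac)
    qed
    finally show ?thesis unfolding line_int_mult_right by simp
  qed
  have C: "line_int (- t) (\<lambda>w. \<phi> w / (w - (- z))) - line_int t (\<lambda>w. \<phi> w / (w - (- z))) = 2 * of_real pi * \<i> * \<phi> (- z)"
  proof (rule line_int_cauchy[OF ostrip_open_convex(2,1) w0])
    fix w assume "- t \<le> Im w" "Im w \<le> t"
    then have w: "\<bar>Im w\<bar> < 1 / real n" using t by auto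
    then show "w \<in> ostrip (1 / real n)" by (simp add: ostrip_def)
    show "norm (\<phi> w) \<le> Pnorm n \<phi> * exp (- (1 / real n) * \<bar>Re w\<bar>)" by (rule Pstep_bound'[OF \<phi> w])
  qed (use t n in auto)
  have "Pfourier_fun ?\<psi> z = (LINT u|lborel. ?\<psi> (of_real u) * e u)" by (simp add: Pfourier_fun_def e_def)
  also have "\<dots> = (line_int (- t) (\<lambda>w. \<phi> w / (w - (- z))) - line_int t (\<lambda>w. \<phi> w / (w - (- z)))) / \<i>"
    unfolding lborel_integral_split[OF int, of 0] R L by (simp add: right_diff_distrib)
  also have "\<dots> = 2 * of_real pi * \<phi> (- z)" unfolding C by simp
  finally show ?thesis .
qed

section \<open>Boundary values as functionals\<close>

text \<open>Growth of F at rate 1/(2n) against decay of \<phi> at rate 1/n leaves decay at rate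
  1/(2n). K is found before \<phi>; this uniformity becomes the continuity of the functional on the
  n-th step.\<close>

lemma Oexp_times_Pstep_bound:
  assumes F: "F \<in> Oexp UNIV" and n: "1 \<le> n" and c: "0 < c" and d: "d < 1 / real n"
  obtains K where "K \<ge> 0" "\<And>\<phi> z. \<phi> \<in> Pstep n \<Longrightarrow> c \<le> \<bar>Im z\<bar> \<Longrightarrow> \<bar>Im z\<bar> \<le> d \<Longrightarrow>
    norm (F z * \<phi> z) \<le> (K * Pnorm n \<phi>) * exp (- (1 / (2 * real n)) * \<bar>Re z\<bar>)"
proof -
  define h where "h = 1 / (2 * real n)"
  have h: "h > 0" "1 / real n = 2 * h" using n by (auto simp: h_def)
  have "grow_on c d h F" using F c h by (auto simp: Oexp_UNIV_iff grow_def)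
  then obtain K where K: "K \<ge> 0" "\<And>z. c \<le> \<bar>Im z\<bar> \<Longrightarrow> \<bar>Im z\<bar> \<le> d \<Longrightarrow> norm (F z) \<le> K * exp (h * \<bar>Re z\<bar>)"
    using grow_onD by blast
  show thesis
  proof (rule that[OF K(1)])
    fix \<phi> z assume \<phi>: "\<phi> \<in> Pstep n" and z: "c \<le> \<bar>Im z\<bar>" "\<bar>Im z\<bar> \<le> d"
    have "norm (\<phi> z) \<le> Pnorm n \<phi> * exp (- (2 * h) * \<bar>Re z\<bar>)"
      using Pstep_bound'[OF \<phi>, of z] z d unfolding h(2) by simp
    then have "norm (F z * \<phi> z) \<le> (K * exp (h * \<bar>Re z\<bar>)) * (Pnorm n \<phi> * exp (- (2 * h) * \<bar>Re z\<bar>))"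
      unfolding norm_mult using K(1) by (intro mult_mono K(2) z) auto
    also have "\<dots> = (K * Pnorm n \<phi>) * (exp (h * \<bar>Re z\<bar>) * exp (- (2 * h) * \<bar>Re z\<bar>))" by (simp only: mult_ac)
    also have "exp (h * \<bar>Re z\<bar>) * exp (- (2 * h) * \<bar>Re z\<bar>) = exp (- h * \<bar>Re z\<bar>)" by (simp flip: exp_add)
    finally show "norm (F z * \<phi> z) \<le> (K * Pnorm n \<phi>) * exp (- (1 / (2 * real n)) * \<bar>Re z\<bar>)" by (simp only: h_def)
  qed
qed

lemma half_rate_pos: "1 \<le> n \<Longrightarrow> 1 / (2 * real n) > 0" by simp

lemma Oexp_holD: "F \<in> Oexp UNIV \<Longrightarrow> F holomorphic_on - \<real>"
  by (simp add: Oexp_UNIV_iff hol_def)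

lemma Oexp_line_integrable:
  assumes F: "F \<in> Oexp UNIV" and \<phi>: "\<phi> \<in> Pstep n" and n: "1 \<le> n" and c: "c \<noteq> 0" "\<bar>c\<bar> < 1 / real n"
  shows "integrable lborel (\<lambda>x. F (Complex x c) * \<phi> (Complex x c))"
proof -
  have c0: "0 < \<bar>c\<bar>" using c by simp
  obtain K where "K \<ge> 0" and K: "\<And>\<phi> z. \<phi> \<in> Pstep n \<Longrightarrow> \<bar>c\<bar> \<le> \<bar>Im z\<bar> \<Longrightarrow> \<bar>Im z\<bar> \<le> \<bar>c\<bar> \<Longrightarrow>
    norm (F z * \<phi> z) \<le> (K * Pnorm n \<phi>) * exp (- (1 / (2 * real n)) * \<bar>Re z\<bar>)"
    using Oexp_times_Pstep_bound[OF F n c0 c(2)] by blast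
  show ?thesis
  proof (rule integrable_line[OF _ _ half_rate_pos[OF n]])
    show "continuous_on UNIV (\<lambda>x. F (Complex x c) * \<phi> (Complex x c))"
      by (intro continuous_on_mult Pstep_line_measurable(1)[OF \<phi> c(2)]
          continuous_on_horizontal[OF holomorphic_on_imp_continuous_on[OF Oexp_holD[OF F]]])
         (use c in \<open>auto simp: complex_is_Real_iff\<close>)
    show "norm (F (Complex x c) * \<phi> (Complex x c)) \<le> (K * Pnorm n \<phi>) * exp (- (1 / (2 * real n)) * \<bar>x\<bar>)" for x
      using K[OF \<phi>, of "Complex x c"] by simp
  qed
qed

lemma Oexp_strip_shift:
  assumes F: "F \<in> Oexp UNIV" and \<phi>: "\<phi> \<in> Pstep n" and n: "1 \<le> n" and c: "0 < c" "c \<le> d" "d < 1 / real n"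
  shows "strip_integral c (\<lambda>\<zeta>. F \<zeta> * \<phi> \<zeta>) = strip_integral d (\<lambda>\<zeta>. F \<zeta> * \<phi> \<zeta>)"
proof -
  let ?f = "\<lambda>\<zeta>. F \<zeta> * \<phi> \<zeta>"
  obtain K where "K \<ge> 0" and K: "\<And>\<phi> z. \<phi> \<in> Pstep n \<Longrightarrow> c \<le> \<bar>Im z\<bar> \<Longrightarrow> \<bar>Im z\<bar> \<le> d \<Longrightarrow>
    norm (F z * \<phi> z) \<le> (K * Pnorm n \<phi>) * exp (- (1 / (2 * real n)) * \<bar>Re z\<bar>)"
    using Oexp_times_Pstep_bound[OF F n c(1,3)] by blast
  have hol: "?f holomorphic_on A" if "A \<subseteq> - \<real>" "A \<subseteq> ostrip (1 / real n)" for A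
    by (intro holomorphic_intros holomorphic_on_subset[OF Oexp_holD[OF F]] holomorphic_on_subset[OF Pstep_hol[OF \<phi>]] that)
  have "line_int c ?f = line_int d ?f"
  proof (rule line_int_shift[OF open_convex_strip(2,1)[of 0 "1 / real n"] _ c(2) _ _ half_rate_pos[OF n], where C="K * Pnorm n \<phi>"])
    show "?f holomorphic_on {z. 0 < Im z \<and> Im z < 1 / real n}"
      by (rule hol) (auto simp: complex_is_Real_iff ostrip_def)
  qed (use c K[OF \<phi>] in auto)
  moreover have "line_int (- d) ?f = line_int (- c) ?f"
  proof (rule line_int_shift[OF open_convex_strip(2,1)[of "- (1 / real n)" 0] _ _ _ _ half_rate_pos[OF n], where C="K * Pnorm n \<phi>"])
    show "?f holomorphic_on {z. - (1 / real n) < Im z \<and> Im z < 0}"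
      by (rule hol) (auto simp: complex_is_Real_iff ostrip_def)
  qed (use c K[OF \<phi>] in auto)
  ultimately show ?thesis by (simp add: strip_integral_eq)
qed

lemma strip_integral_cong:
  "(\<And>z. \<bar>Im z\<bar> = \<bar>c\<bar> \<Longrightarrow> f z = g z) \<Longrightarrow> strip_integral c f = strip_integral c g"
  by (simp add: strip_integral_def)

lemma strip_integral_diff:
  assumes "\<And>e. e \<in> {c, -c} \<Longrightarrow> integrable lborel (\<lambda>x. f (Complex x e))" "\<And>e. e \<in> {c, -c} \<Longrightarrow> integrable lborel (\<lambda>x. g (Complex x e))"
  shows "strip_integral c (\<lambda>z. f z - g z) = strip_integral c f - strip_integral c g"
    "strip_integral c (\<lambda>z. f z + g z) = strip_integral c f + strip_integral c g"
  using assms[of c] assms[of "-c"]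
  by (simp_all add: strip_integral_def Bochner_Integration.integral_diff Bochner_Integration.integral_add)

lemma strip_integral_cmult: "strip_integral c (\<lambda>z. a * f z) = a * strip_integral c f"
  by (simp add: strip_integral_def right_diff_distrib)

text \<open>For an entire H with growth control on full strips the line may also cross the real
  axis. This makes elements of \<open>Oexp_entire\<close> invisible to strip integrals, and it moves
  the line under a plus part down to the real axis.\<close>

lemma entire_line_int_shift:
  assumes H: "H \<in> Oexp {}" and \<phi>: "\<phi> \<in> Pstep n" and n: "1 \<le> n" and c: "\<bar>a\<bar> \<le> c" "\<bar>b\<bar> \<le> c" "c < 1 / real n" "a \<le> b"
  shows "line_int a (\<lambda>\<zeta>. H \<zeta> * \<phi> \<zeta>) = line_int b (\<lambda>\<zeta>. H \<zeta> * \<phi> \<zeta>)"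
proof -
  define h where "h = 1 / (2 * real n)"
  have h: "h > 0" "1 / real n = 2 * h" using n by (auto simp: h_def)
  have Hh: "H holomorphic_on UNIV" and "grow_on 0 c h H" using H h by (auto simp: Oexp_empty_iff)
  then obtain K where K: "K \<ge> 0" "\<And>z. 0 \<le> \<bar>Im z\<bar> \<Longrightarrow> \<bar>Im z\<bar> \<le> c \<Longrightarrow> norm (H z) \<le> K * exp (h * \<bar>Re z\<bar>)"
    using grow_onD by blast
  show ?thesis
  proof (rule line_int_shift[OF ostrip_open_convex(2,1)[of "1 / real n"], where C="K * Pnorm n \<phi>" and \<delta>=h])
    show "(\<lambda>\<zeta>. H \<zeta> * \<phi> \<zeta>) holomorphic_on ostrip (1 / real n)"
      by (intro holomorphic_intros Pstep_hol \<phi> holomorphic_on_subset[OF Hh]) auto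
    fix z assume "a \<le> Im z" "Im z \<le> b"
    then have z: "\<bar>Im z\<bar> \<le> c" using c by auto
    then show "z \<in> ostrip (1 / real n)" using c by (simp add: ostrip_def)
    have "norm (\<phi> z) \<le> Pnorm n \<phi> * exp (- (2 * h) * \<bar>Re z\<bar>)"
      using Pstep_bound'[OF \<phi>, of z] z c unfolding h(2) by simp
    then have "norm (H z * \<phi> z) \<le> (K * exp (h * \<bar>Re z\<bar>)) * (Pnorm n \<phi> * exp (- (2 * h) * \<bar>Re z\<bar>))"
      unfolding norm_mult using K(1) z by (intro mult_mono K(2)) auto
    also have "\<dots> = (K * Pnorm n \<phi>) * (exp (h * \<bar>Re z\<bar>) * exp (- (2 * h) * \<bar>Re z\<bar>))" by (simp only: mult_ac)
    also have "exp (h * \<bar>Re z\<bar>) * exp (- (2 * h) * \<bar>Re z\<bar>) = exp (- h * \<bar>Re z\<bar>)" by (simp flip: exp_add)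
    finally show "norm (H z * \<phi> z) \<le> (K * Pnorm n \<phi>) * exp (- h * \<bar>Re z\<bar>)" .
  qed (use c h in auto)
qed

lemma entire_strip_integral_zero:
  assumes "H \<in> Oexp {}" "\<phi> \<in> Pstep n" "1 \<le> n" "0 < c" "c < 1 / real n"
  shows "strip_integral c (\<lambda>\<zeta>. H \<zeta> * \<phi> \<zeta>) = 0"
  using entire_line_int_shift[OF assms(1-3), of "- c" c c] assms(4,5) by (simp add: strip_integral_eq)

section \<open>Well-definedness and continuity of boundary values\<close>

text \<open>The representative of the boundary value, that of the test function, the step and the
  height may all vary. At a small common height the two test functions coincide, and the integrands
  differ by an entire function times a test function, whose strip integral vanishes.\<close>

lemma bv_dual_eq:
  assumes F: "F \<in> Oexp UNIV" and \<phi>: "\<phi> \<in> Pstep n" and n: "1 \<le> n" and c: "0 < c" "c < 1 / real n"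
  shows "bv_dual (cls (Oexp UNIV) Oexp_entire F) (cls Pall Pnull \<phi>) = strip_integral c (\<lambda>\<zeta>. F \<zeta> * \<phi> \<zeta>)"
proof -
  let ?X = "cls (Oexp UNIV) Oexp_entire F" and ?\<Phi> = "cls Pall Pnull \<phi>"
  have P: "?\<Phi> \<in> Pstar" unfolding Pstar_def by (rule cls_quot[OF Pstep_Pall[OF n \<phi>]])
  have "the_elem {strip_integral c (\<lambda>\<zeta>. F \<zeta> * \<phi> \<zeta>) | F \<phi> c n. F \<in> ?X \<and> 1 \<le> n \<and> \<phi> \<in> ?\<Phi> \<inter> Pstep n \<and> 0 < c \<and> c < 1 / real n}
      = strip_integral c (\<lambda>\<zeta>. F \<zeta> * \<phi> \<zeta>)"
  proof (rule the_elem_unique)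
    have "F \<in> ?X" "\<phi> \<in> ?\<Phi> \<inter> Pstep n"
      using F \<phi> n cls_self[OF fsubspaces'(1)] cls_self[OF fsubspace_Pnull] Pstep_Pall by auto
    then show "{strip_integral c (\<lambda>\<zeta>. F \<zeta> * \<phi> \<zeta>) | F \<phi> c n. F \<in> ?X \<and> 1 \<le> n \<and> \<phi> \<in> ?\<Phi> \<inter> Pstep n \<and> 0 < c \<and> c < 1 / real n} \<noteq> {}"
      using n c by blast
  next
    fix x assume "x \<in> {strip_integral c (\<lambda>\<zeta>. F \<zeta> * \<phi> \<zeta>) | F \<phi> c n. F \<in> ?X \<and> 1 \<le> n \<and> \<phi> \<in> ?\<Phi> \<inter> Pstep n \<and> 0 < c \<and> c < 1 / real n}"
    then obtain F' \<phi>' c' m where x: "x = strip_integral c' (\<lambda>\<zeta>. F' \<zeta> * \<phi>' \<zeta>)" and F': "F' \<in> ?X" and m: "1 \<le> m"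
      and \<phi>': "\<phi>' \<in> ?\<Phi>" "\<phi>' \<in> Pstep m" and c': "0 < c'" "c' < 1 / real m" by blast
    have F'O: "F' \<in> Oexp UNIV" and "(\<lambda>z. F z - F' z) \<in> Oexp_entire" using F' by (auto simp: cls_iff)
    then obtain H where H: "H \<in> Oexp {}" "(\<lambda>z. F z - F' z) = restr (- \<real>) H" by (auto simp: Oexp_entire_def)
    obtain d where d: "d > 0" "\<And>z. z \<in> ostrip d \<Longrightarrow> \<phi> z - \<phi>' z = 0" using \<phi>'(1) by (auto simp: cls_iff Pnull_iff)
    \<comment> \<open>Below both heights, so both integrals can be moved there, and strictly below
      d, so that \<phi> and \<open>\<phi>'\<close> agree on the two lines.\<close>
    define e where "e = min (min c c') (d / 2)"
    have e: "0 < e" "e \<le> c" "e \<le> c'" "e < d" using c c' d(1) by (auto simp: e_def)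
    have en: "e < 1 / real n" using e c by simp
    have "x = strip_integral e (\<lambda>\<zeta>. F' \<zeta> * \<phi>' \<zeta>)"
      unfolding x using Oexp_strip_shift[OF F'O \<phi>'(2) m e(1,3) c'(2)] by simp
    also have "\<dots> = strip_integral e (\<lambda>\<zeta>. F \<zeta> * \<phi> \<zeta> - H \<zeta> * \<phi> \<zeta>)"
    proof (rule strip_integral_cong)
      fix z assume z: "\<bar>Im z\<bar> = \<bar>e\<bar>"
      have "\<phi>' z = \<phi> z" using d(2)[of z] z e by (simp add: ostrip_def)
      moreover have "F z - F' z = H z" using fun_cong[OF H(2), of z] z e by (auto simp: restr_def complex_is_Real_iff)
      ultimately show "F' z * \<phi>' z = F z * \<phi> z - H z * \<phi> z" by (metis diff_diff_eq2 left_diff_distrib add_diff_cancel_left' diff_add_cancel)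
    qed
    also have "\<dots> = strip_integral e (\<lambda>\<zeta>. F \<zeta> * \<phi> \<zeta>) - strip_integral e (\<lambda>\<zeta>. H \<zeta> * \<phi> \<zeta>)"
    proof (rule strip_integral_diff)
      show "integrable lborel (\<lambda>x. F (Complex x a) * \<phi> (Complex x a))" if "a \<in> {e, -e}" for a
        using that e en by (intro Oexp_line_integrable[OF F \<phi> n]) auto
      have HO: "restr (- \<real>) H \<in> Oexp UNIV" using Oexp_entire_subset H(1) by (auto simp: Oexp_entire_def)
      show "integrable lborel (\<lambda>x. H (Complex x a) * \<phi> (Complex x a))" if "a \<in> {e, -e}" for a
        using Oexp_line_integrable[OF HO \<phi> n, of a] that e en by (auto simp: restr_def complex_is_Real_iff)
    qed
    also have "strip_integral e (\<lambda>\<zeta>. H \<zeta> * \<phi> \<zeta>) = 0" by (rule entire_strip_integral_zero[OF H(1) \<phi> n e(1) en])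
    also have "strip_integral e (\<lambda>\<zeta>. F \<zeta> * \<phi> \<zeta>) = strip_integral c (\<lambda>\<zeta>. F \<zeta> * \<phi> \<zeta>)"
      by (rule Oexp_strip_shift[OF F \<phi> n e(1,2) c(2)])
    finally show "x = strip_integral c (\<lambda>\<zeta>. F \<zeta> * \<phi> \<zeta>)" by simp
  qed
  then show ?thesis using P by (simp add: bv_dual_def)
qed

lemma Pstar_cases:
  assumes "\<Phi> \<in> Pstar" obtains n \<phi> where "1 \<le> n" "\<phi> \<in> Pstep n" "\<Phi> = cls Pall Pnull \<phi>"
  using assms by (auto simp: Pstar_def quot_iff Pall_def)

text \<open>The bound does not depend on the centre a; this keeps estimates uniform when a is the
  real part of a moving point.\<close>

lemma norm_integral_exp_le:
  fixes g :: "real \<Rightarrow> complex"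
  assumes "\<And>x. norm (g x) \<le> C * exp (- d * \<bar>x - a\<bar>)" "d > 0"
  shows "norm (LINT x|lborel. g x) \<le> C * (LINT x|lborel. exp (- d * \<bar>x\<bar>))"
proof -
  have eq: "(LINT x|lborel. exp (- d * \<bar>x - a\<bar>)) = (LINT x|lborel. exp (- d * \<bar>x\<bar>))"
    by (rule lborel_integral_shift)
  show ?thesis
  proof (cases "integrable lborel g")
    case True
    have "norm (LINT x|lborel. g x) \<le> (LINT x|lborel. norm (g x))" by (rule integral_norm_bound)
    also have "\<dots> \<le> (LINT x|lborel. C * exp (- d * \<bar>x - a\<bar>))"
      using integrable_exp_abs[OF assms(2), of a] True assms(1) by (intro integral_mono) auto
    finally show ?thesis using eq by simp
  next
    case False
    have "C \<ge> 0" using order_trans[OF norm_ge_zero assms(1)[of a]] by simp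
    then have "C * (LINT x|lborel. exp (- d * \<bar>x\<bar>)) \<ge> 0" by (intro mult_nonneg_nonneg integral_nonneg_AE) auto
    then show ?thesis using False by (simp add: not_integrable_integral_eq)
  qed
qed

text \<open>\<open>Fstar\<close> is a restricted function, undefined off \<open>Pdual\<close>, so
  membership has to be known before it can be evaluated at a boundary value.\<close>

lemma bv_dual_Pdual:
  assumes F: "F \<in> Oexp UNIV" shows "bv_dual (cls (Oexp UNIV) Oexp_entire F) \<in> Pdual"
proof -
  let ?T = "bv_dual (cls (Oexp UNIV) Oexp_entire F)"
  have "?T \<in> extensional Pstar" by (simp add: bv_dual_def)
  moreover have "?T (qadd Pall Pnull \<Phi> \<Psi>) = ?T \<Phi> + ?T \<Psi>" if P: "\<Phi> \<in> Pstar" "\<Psi> \<in> Pstar" for \<Phi> \<Psi>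
  proof -
    obtain \<phi> \<psi> where r: "\<phi> \<in> Pall" "\<psi> \<in> Pall" "\<Phi> = cls Pall Pnull \<phi>" "\<Psi> = cls Pall Pnull \<psi>"
      using P by (auto simp: Pstar_def quot_iff)
    obtain n where n: "1 \<le> n" "\<phi> \<in> Pstep n" "\<psi> \<in> Pstep n" using Pall_obtain_two[OF r(1,2)] .
    define c where "c = 1 / (2 * real n)"
    have c: "0 < c" "c < 1 / real n" using n(1) by (auto simp: c_def field_simps)
    have i: "integrable lborel (\<lambda>x. F (Complex x e) * \<phi> (Complex x e))" if "\<phi> \<in> Pstep n" "e \<in> {c,-c}" for \<phi> e
      using that c by (intro Oexp_line_integrable[OF F _ n(1)]) auto
    have "?T (qadd Pall Pnull \<Phi> \<Psi>) = ?T (cls Pall Pnull (\<lambda>z. \<phi> z + \<psi> z))"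
      unfolding r(3,4) by (simp add: qadd_cls[OF fsubspace_Pall fsubspace_Pnull r(1,2)])
    also have "\<dots> = strip_integral c (\<lambda>\<zeta>. F \<zeta> * \<phi> \<zeta> + F \<zeta> * \<psi> \<zeta>)"
      unfolding bv_dual_eq[OF F Pstep_add[OF n(2,3)] n(1) c] by (simp add: ring_distribs)
    also have "\<dots> = ?T \<Phi> + ?T \<Psi>"
      unfolding r(3,4) bv_dual_eq[OF F n(2) n(1) c] bv_dual_eq[OF F n(3) n(1) c]
      by (rule strip_integral_diff(2)) (use i n in auto)
    finally show ?thesis .
  qed
  moreover have "?T (qscale Pall Pnull a \<Phi>) = a * ?T \<Phi>" if P: "\<Phi> \<in> Pstar" for a \<Phi>
  proof -
    obtain n \<phi> where n: "1 \<le> n" "\<phi> \<in> Pstep n" "\<Phi> = cls Pall Pnull \<phi>" using Pstar_cases[OF P] .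
    define c where "c = 1 / (2 * real n)"
    have c: "0 < c" "c < 1 / real n" using n(1) by (auto simp: c_def field_simps)
    have "?T (qscale Pall Pnull a \<Phi>) = ?T (cls Pall Pnull (\<lambda>z. a * \<phi> z))"
      unfolding n(3) by (simp add: qscale_cls[OF fsubspace_Pall fsubspace_Pnull Pstep_Pall[OF n(1,2)]])
    also have "\<dots> = strip_integral c (\<lambda>\<zeta>. a * (F \<zeta> * \<phi> \<zeta>))"
      unfolding bv_dual_eq[OF F Pstep_cmult[OF n(2)] n(1) c] by (simp add: mult_ac)
    also have "\<dots> = a * ?T \<Phi>" unfolding n(3) bv_dual_eq[OF F n(2) n(1) c] by (rule strip_integral_cmult)
    finally show ?thesis .
  qed
  moreover have "\<exists>C. \<forall>\<phi>\<in>Pstep n. cmod (?T (cls Pall Pnull \<phi>)) \<le> C * Pnorm n \<phi>" if n: "n \<ge> 1" for n :: nat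
  proof -
    define c where "c = 1 / (2 * real n)"
    have c: "0 < c" "c < 1 / real n" using n(1) by (auto simp: c_def field_simps)
    obtain K where K: "K \<ge> 0" "\<And>\<phi> z. \<phi> \<in> Pstep n \<Longrightarrow> c \<le> \<bar>Im z\<bar> \<Longrightarrow> \<bar>Im z\<bar> \<le> c \<Longrightarrow>
      norm (F z * \<phi> z) \<le> (K * Pnorm n \<phi>) * exp (- c * \<bar>Re z\<bar>)"
      using Oexp_times_Pstep_bound[OF F n c] unfolding c_def by blast
    define I where "I = (LINT x|lborel. exp (- c * \<bar>x\<bar>))"
    have "cmod (?T (cls Pall Pnull \<phi>)) \<le> (2 * K * I) * Pnorm n \<phi>" if \<phi>: "\<phi> \<in> Pstep n" for \<phi>
    proof -
      have l: "norm (line_int e (\<lambda>\<zeta>. F \<zeta> * \<phi> \<zeta>)) \<le> (K * Pnorm n \<phi>) * I" if "e \<in> {c, -c}" for e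
        unfolding I_def by (rule norm_line_int_le[OF _ c(1)]) (use K(2)[OF \<phi>, of "Complex _ e"] that c in auto)
      have "norm (strip_integral c (\<lambda>\<zeta>. F \<zeta> * \<phi> \<zeta>)) \<le> (K * Pnorm n \<phi>) * I + (K * Pnorm n \<phi>) * I"
        unfolding strip_integral_eq using l[of c] l[of "-c"] by (intro order_trans[OF norm_triangle_ineq4] add_mono) auto
      then show ?thesis unfolding bv_dual_eq[OF F \<phi> n c] by (simp add: mult_ac)
    qed
    then show ?thesis by blast
  qed
  ultimately show ?thesis unfolding Pdual_def by blast
qed

text \<open>Two representatives agree on a strip around the real line, and the Fourier integral
  reads only the values on the real line.\<close>

lemma Pfourier_cls:
  assumes n: "1 \<le> n" and \<phi>: "\<phi> \<in> Pstep n"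
  shows "Pfourier (cls Pall Pnull \<phi>) = cls Pall Pnull (Pfourier_fun \<phi>)"
  unfolding Pfourier_def
proof (rule the_elem_image[where x=\<phi>])
  show "\<phi> \<in> cls Pall Pnull \<phi>" by (rule cls_self[OF fsubspace_Pnull Pstep_Pall[OF n \<phi>]])
  fix \<psi> assume "\<psi> \<in> cls Pall Pnull \<phi>"
  then obtain d where "d > 0" "\<And>z. z \<in> ostrip d \<Longrightarrow> \<phi> z - \<psi> z = 0" by (auto simp: cls_iff Pnull_iff)
  then have "\<psi> (of_real x) = \<phi> (of_real x)" for x by (simp add: ostrip_def)
  then have "Pfourier_fun \<psi> = Pfourier_fun \<phi>" by (simp add: Pfourier_fun_def[abs_def])
  then show "cls Pall Pnull (Pfourier_fun \<psi>) = cls Pall Pnull (Pfourier_fun \<phi>)" by simp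
qed

section \<open>Injectivity by means of a Gaussian Cauchy kernel\<close>

text \<open>On a strip the Gaussian dominates every linear exponential: -u^2 \<le> M^2/4 - M u by
  completing the square, and the imaginary parts contribute at most (2B)^2.\<close>

lemma norm_gauss_le:
  assumes "\<bar>Im w\<bar> \<le> B" "\<bar>Im \<zeta>\<bar> \<le> B"
  shows "norm (exp (- ((w - \<zeta>) ^ 2))) \<le> exp (4 * B\<^sup>2 + M\<^sup>2 / 4) * exp (- M * \<bar>Re \<zeta> - Re w\<bar>)"
proof -
  let ?u = "\<bar>Re \<zeta> - Re w\<bar>"
  have "\<bar>Im w - Im \<zeta>\<bar> \<le> 2 * B" using assms by linarith
  then have "(Im w - Im \<zeta>)\<^sup>2 \<le> (2 * B)\<^sup>2" by (metis abs_ge_zero power2_abs power_mono)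
  moreover have "0 \<le> (?u - M / 2)\<^sup>2" by simp
  then have "- (?u\<^sup>2) \<le> M\<^sup>2 / 4 + - M * ?u" by (simp add: power2_diff power_divide mult.commute)
  moreover have "?u\<^sup>2 = (Re w - Re \<zeta>)\<^sup>2" by (simp add: power2_commute)
  ultimately have "Re (- ((w - \<zeta>) ^ 2)) \<le> (4 * B\<^sup>2 + M\<^sup>2 / 4) + - M * ?u" by (simp add: Re_power2 power_mult_distrib)
  then show ?thesis by (simp only: norm_exp_eq_Re flip: exp_add) simp
qed

lemma exp_shift_le:
  fixes M s x \<xi> :: real assumes "0 \<le> s"
  shows "exp (s * \<bar>\<xi>\<bar>) * exp (- (s + M) * \<bar>\<xi> - x\<bar>) \<le> exp (s * \<bar>x\<bar>) * exp (- M * \<bar>\<xi> - x\<bar>)"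
proof -
  have "s * \<bar>\<xi>\<bar> \<le> s * (\<bar>x\<bar> + \<bar>\<xi> - x\<bar>)" using assms by (intro mult_left_mono) auto
  then have "s * \<bar>\<xi>\<bar> + - (s + M) * \<bar>\<xi> - x\<bar> \<le> s * \<bar>x\<bar> + - M * \<bar>\<xi> - x\<bar>" by (simp add: algebra_simps)
  then show ?thesis by (simp only: exp_le_cancel_iff flip: exp_add)
qed

text \<open>Divided by \<zeta> - w this is D times, up to sign, the kernel of the explicit inverse
  of the boundary value map. The Gaussian equals 1 at \<zeta> = w, so the residue there is D
  w.\<close>

definition gauss_kernel :: "(complex \<Rightarrow> complex) \<Rightarrow> complex \<Rightarrow> complex \<Rightarrow> complex" where
  "gauss_kernel D w \<zeta> = D \<zeta> * exp (- ((w - \<zeta>) ^ 2))"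

text \<open>The Gaussian is used at rate s + 1: the part s transfers the growth of D from \<zeta> to
  w, and the remaining 1 makes the integral over \<zeta> bounded uniformly in w.\<close>

lemma gauss_kernel_bound:
  assumes D: "D \<in> Oexp UNIV" and c: "0 < c" and s: "s > 0"
  obtains K where "K \<ge> 0" "\<And>w \<zeta>. \<bar>Im w\<bar> \<le> C \<Longrightarrow> c \<le> \<bar>Im \<zeta>\<bar> \<Longrightarrow> \<bar>Im \<zeta>\<bar> \<le> C \<Longrightarrow>
    norm (gauss_kernel D w \<zeta>) \<le> K * exp (s * \<bar>Re w\<bar>) * exp (- 1 * \<bar>Re \<zeta> - Re w\<bar>)"
proof -
  have "grow_on c C s D" using D c s by (auto simp: Oexp_UNIV_iff grow_def)
  then obtain K where K: "K \<ge> 0" "\<And>z. c \<le> \<bar>Im z\<bar> \<Longrightarrow> \<bar>Im z\<bar> \<le> C \<Longrightarrow> norm (D z) \<le> K * exp (s * \<bar>Re z\<bar>)"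
    using grow_onD by blast
  define E where "E = exp (4 * C\<^sup>2 + (s + 1)\<^sup>2 / 4)"
  show thesis
  proof (rule that[of "K * E"])
    show "K * E \<ge> 0" using K(1) by (simp add: E_def)
    fix w \<zeta> assume *: "\<bar>Im w\<bar> \<le> C" "c \<le> \<bar>Im \<zeta>\<bar>" "\<bar>Im \<zeta>\<bar> \<le> C"
    have "norm (gauss_kernel D w \<zeta>) \<le> (K * exp (s * \<bar>Re \<zeta>\<bar>)) * (E * exp (- (s + 1) * \<bar>Re \<zeta> - Re w\<bar>))"
      unfolding gauss_kernel_def norm_mult E_def using K(1) * by (intro mult_mono K(2) norm_gauss_le) auto
    also have "\<dots> = (K * E) * (exp (s * \<bar>Re \<zeta>\<bar>) * exp (- (s + 1) * \<bar>Re \<zeta> - Re w\<bar>))" by (simp only: mult_ac)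
    also have "\<dots> \<le> (K * E) * (exp (s * \<bar>Re w\<bar>) * exp (- 1 * \<bar>Re \<zeta> - Re w\<bar>))"
      using exp_shift_le[of s "Re \<zeta>" 1 "Re w"] s K(1) by (intro mult_left_mono) (auto simp: E_def)
    finally show "norm (gauss_kernel D w \<zeta>) \<le> K * E * exp (s * \<bar>Re w\<bar>) * exp (- 1 * \<bar>Re \<zeta> - Re w\<bar>)" by (simp only: mult_ac)
  qed
qed

lemma gauss_kernel_hol: "D \<in> Oexp UNIV \<Longrightarrow> A \<subseteq> - \<real> \<Longrightarrow> gauss_kernel D w holomorphic_on A"
  unfolding gauss_kernel_def
  by (intro holomorphic_intros holomorphic_on_subset[OF Oexp_holD])

lemma exp_recentre: "exp (- 1 * \<bar>\<xi> - x\<bar>) \<le> exp \<bar>x\<bar> * exp (- 1 * \<bar>\<xi>\<bar>)" for \<xi> x :: real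
  by (simp flip: exp_add)

text \<open>The heights c and C bound two strips, one on each side of the real axis. The one that
  contains w contributes the residue, the other only shifts its line; the orientation of the contour
  gives both cases the same sign.\<close>

lemma gauss_cauchy:
  assumes D: "D \<in> Oexp UNIV" and c: "0 < c" "c < \<bar>Im w\<bar>" "\<bar>Im w\<bar> < C"
  shows "strip_integral c (\<lambda>\<zeta>. gauss_kernel D w \<zeta> / (\<zeta> - w)) - strip_integral C (\<lambda>\<zeta>. gauss_kernel D w \<zeta> / (\<zeta> - w))
     = 2 * of_real pi * \<i> * D w"
proof -
  let ?f = "gauss_kernel D w"
  let ?q = "\<lambda>\<zeta>. ?f \<zeta> / (\<zeta> - w)"
  obtain K where K: "K \<ge> 0" "\<And>w \<zeta>. \<bar>Im w\<bar> \<le> C \<Longrightarrow> c \<le> \<bar>Im \<zeta>\<bar> \<Longrightarrow> \<bar>Im \<zeta>\<bar> \<le> C \<Longrightarrow>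
    norm (gauss_kernel D w \<zeta>) \<le> K * exp (1 * \<bar>Re w\<bar>) * exp (- 1 * \<bar>Re \<zeta> - Re w\<bar>)"
    using gauss_kernel_bound[OF D c(1) zero_less_one] by blast
  define L where "L = K * exp (1 * \<bar>Re w\<bar>) * exp \<bar>Re w\<bar>"
  have L0: "L \<ge> 0" using K(1) by (simp add: L_def)
  have fb: "norm (?f \<zeta>) \<le> L * exp (- 1 * \<bar>Re \<zeta>\<bar>)" if "c \<le> \<bar>Im \<zeta>\<bar>" "\<bar>Im \<zeta>\<bar> \<le> C" for \<zeta>
  proof -
    have "norm (?f \<zeta>) \<le> K * exp (1 * \<bar>Re w\<bar>) * exp (- 1 * \<bar>Re \<zeta> - Re w\<bar>)" using K(2)[of w \<zeta>] that c by simp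
    also have "\<dots> \<le> K * exp (1 * \<bar>Re w\<bar>) * (exp \<bar>Re w\<bar> * exp (- 1 * \<bar>Re \<zeta>\<bar>))"
      using K(1) by (intro mult_left_mono exp_recentre) auto
    finally show ?thesis by (simp only: L_def mult_ac)
  qed
  have qb: "norm (?q \<zeta>) \<le> L / c * exp (- 1 * \<bar>Re \<zeta>\<bar>)" if "c \<le> \<bar>Im \<zeta>\<bar>" "\<bar>Im \<zeta>\<bar> \<le> C" "Im \<zeta> * Im w < 0" for \<zeta>
  proof -
    have "c \<le> \<bar>Im (\<zeta> - w)\<bar>" using that c by (auto simp: mult_less_0_iff)
    also have "\<dots> \<le> norm (\<zeta> - w)" by (rule abs_Im_le_cmod)
    finally have "norm (?f \<zeta>) / norm (\<zeta> - w) \<le> (L * exp (- 1 * \<bar>Re \<zeta>\<bar>)) / c"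
      using fb[OF that(1,2)] c L0 by (intro frac_le) auto
    then show ?thesis by (simp add: norm_divide)
  qed
  have fw: "?f w = D w" by (simp add: gauss_kernel_def)
  have up: "{z. 0 < Im z \<and> Im z < C + 1} \<subseteq> - \<real>" and lo: "{z. - (C + 1) < Im z \<and> Im z < 0} \<subseteq> - \<real>"
    by (auto simp: complex_is_Real_iff)
  note S1 = open_convex_strip(2,1)[of 0 "C + 1"] and S2 = open_convex_strip(2,1)[of "- (C + 1)" 0]
  show ?thesis
  proof (cases "Im w > 0")
    case True
    have "line_int c ?q - line_int C ?q = 2 * of_real pi * \<i> * ?f w"
      by (rule line_int_cauchy[OF S1 gauss_kernel_hol[OF D up], where C=L and \<delta>=1]) (use c True fb in auto)
    moreover have "line_int (- C) ?q = line_int (- c) ?q"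
    proof (rule line_int_shift[OF S2, where C="L / c" and \<delta>=1])
      show "?q holomorphic_on {z. - (C + 1) < Im z \<and> Im z < 0}"
        by (intro holomorphic_intros gauss_kernel_hol D lo) (use True in auto)
      show "norm (?q z) \<le> L / c * exp (- 1 * \<bar>Re z\<bar>)" if "- C \<le> Im z" "Im z \<le> - c" for z
        by (rule qb) (use that c True in \<open>auto simp: mult_less_0_iff\<close>)
    qed (use c in auto)
    ultimately show ?thesis by (simp add: strip_integral_eq fw)
  next
    case False
    have "line_int (- C) ?q - line_int (- c) ?q = 2 * of_real pi * \<i> * ?f w"
      by (rule line_int_cauchy[OF S2 gauss_kernel_hol[OF D lo], where C=L and \<delta>=1]) (use c False fb in auto)
    moreover have "line_int c ?q = line_int C ?q"
    proof (rule line_int_shift[OF S1, where C="L / c" and \<delta>=1])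
      show "?q holomorphic_on {z. 0 < Im z \<and> Im z < C + 1}"
        by (intro holomorphic_intros gauss_kernel_hol D up) (use False in auto)
      show "norm (?q z) \<le> L / c * exp (- 1 * \<bar>Re z\<bar>)" if "c \<le> Im z" "Im z \<le> C" for z
        by (rule qb) (use that c False in \<open>auto simp: mult_less_0_iff\<close>)
    qed (use c in auto)
    ultimately show ?thesis by (simp add: strip_integral_eq fw)
  qed
qed

text \<open>For w outside the closed strip the kernel is itself a test function, so a vanishing
  functional can be evaluated on it.\<close>

lemma gauss_test_function:
  assumes n: "1 \<le> n" and w: "1 / real n < \<bar>Im w\<bar>"
  shows "(\<lambda>\<zeta>. exp (- ((w - \<zeta>) ^ 2)) / (\<zeta> - w)) \<in> Pstep n"
proof -
  define h where "h = 1 / real n"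
  have h: "0 < h" "h < \<bar>Im w\<bar>" using n w by (auto simp: h_def)
  define E where "E = exp (4 * \<bar>Im w\<bar>\<^sup>2 + h\<^sup>2 / 4)"
  show ?thesis
  proof (rule PstepI[where d="\<bar>Im w\<bar>" and C="E * exp (h * \<bar>Re w\<bar>) / (\<bar>Im w\<bar> - h)"])
    show "(\<lambda>\<zeta>. exp (- ((w - \<zeta>) ^ 2)) / (\<zeta> - w)) holomorphic_on ostrip \<bar>Im w\<bar>"
      by (intro holomorphic_intros) (auto simp: ostrip_def)
    fix \<zeta> assume "\<bar>Im \<zeta>\<bar> \<le> 1 / real n"
    then have \<zeta>: "\<bar>Im \<zeta>\<bar> \<le> h" by (simp add: h_def)
    have "\<bar>Im w\<bar> - h \<le> \<bar>Im (\<zeta> - w)\<bar>" using \<zeta> by auto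
    then have 1: "\<bar>Im w\<bar> - h \<le> norm (\<zeta> - w)" using abs_Im_le_cmod[of "\<zeta> - w"] by linarith
    have "norm (exp (- ((w - \<zeta>) ^ 2))) \<le> E * exp (- h * \<bar>Re \<zeta> - Re w\<bar>)"
      unfolding E_def by (rule norm_gauss_le) (use \<zeta> h in auto)
    also have "\<dots> \<le> E * (exp (h * \<bar>Re w\<bar>) * exp (- h * \<bar>Re \<zeta>\<bar>))"
    proof (rule mult_left_mono)
      have "h * \<bar>Re \<zeta>\<bar> \<le> h * (\<bar>Re w\<bar> + \<bar>Re \<zeta> - Re w\<bar>)" using h by (intro mult_left_mono) auto
      then show "exp (- h * \<bar>Re \<zeta> - Re w\<bar>) \<le> exp (h * \<bar>Re w\<bar>) * exp (- h * \<bar>Re \<zeta>\<bar>)"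
        by (simp add: ring_distribs flip: exp_add)
    qed (simp add: E_def)
    finally have "norm (exp (- ((w - \<zeta>) ^ 2))) / norm (\<zeta> - w) \<le> (E * (exp (h * \<bar>Re w\<bar>) * exp (- h * \<bar>Re \<zeta>\<bar>))) / (\<bar>Im w\<bar> - h)"
      using 1 h by (intro frac_le) (auto simp: E_def)
    then show "norm (exp (- ((w - \<zeta>) ^ 2)) / (\<zeta> - w)) \<le> E * exp (h * \<bar>Re w\<bar>) / (\<bar>Im w\<bar> - h) * exp (- (1 / real n) * \<bar>Re \<zeta>\<bar>)"
      by (simp add: norm_divide h_def mult.assoc)
  qed (use w in auto)
qed

text \<open>Since the kernel is a test function, the integral over the inner contour in Cauchy's
  formula vanishes. The integral over the contour at height 1 then represents D near the real axis
  and is holomorphic for all |Im w| < 1, so it continues D across the real line.\<close>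

lemma strip_annihilator:
  assumes D: "D \<in> Oexp UNIV"
    and ann: "\<And>n \<phi> c. 1 \<le> n \<Longrightarrow> \<phi> \<in> Pstep n \<Longrightarrow> 0 < c \<Longrightarrow> c < 1 / real n \<Longrightarrow> strip_integral c (\<lambda>\<zeta>. D \<zeta> * \<phi> \<zeta>) = 0"
  shows "D \<in> Oexp_entire"
proof -
  define J where "J w = - strip_integral 1 (\<lambda>\<zeta>. gauss_kernel D w \<zeta> / (\<zeta> - w)) / (2 * of_real pi * \<i>)" for w
  have JD: "J w = D w" if w: "Im w \<noteq> 0" "\<bar>Im w\<bar> < 1" for w
  proof -
    have "0 < \<bar>Im w\<bar>" using w by simp
    then obtain n :: nat where n: "n \<ge> 1" "1 / real n < \<bar>Im w\<bar>"
      using ex_large_nat[OF _ zero_less_one] by blast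
    define c where "c = 1 / (2 * real n)"
    have c: "0 < c" "c < 1 / real n" using n(1) by (auto simp: c_def field_simps)
    have "strip_integral c (\<lambda>\<zeta>. gauss_kernel D w \<zeta> / (\<zeta> - w)) = 0"
      using ann[OF n(1) gauss_test_function[OF n] c] by (simp add: gauss_kernel_def)
    then show ?thesis using gauss_cauchy[OF D c(1), of w 1] c n w by (simp add: J_def field_simps)
  qed
  \<comment> \<open>Holomorphy is available on the open strip, the growth bound only for |Im w|
    \<le> 1/2, where the denominator is at least 1/2; the remaining heights are covered by the
    growth of D itself.\<close>
  have line: "(\<lambda>w. LINT x|lborel. gauss_kernel D w (Complex x e) / (Complex x e - w)) holomorphic_on ostrip 1"
    and bnd: "\<exists>C. \<forall>w. \<bar>Im w\<bar> \<le> 1/2 \<longrightarrow> norm (LINT x|lborel. gauss_kernel D w (Complex x e) / (Complex x e - w)) \<le> C * exp (s * \<bar>Re w\<bar>)"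
    if e: "e \<in> {1, -1}" and s: "s > 0" for e s
  proof -
    obtain K where K: "K \<ge> 0" "\<And>w \<zeta>. \<bar>Im w\<bar> \<le> 1 \<Longrightarrow> 1 \<le> \<bar>Im \<zeta>\<bar> \<Longrightarrow> \<bar>Im \<zeta>\<bar> \<le> 1 \<Longrightarrow>
      norm (gauss_kernel D w \<zeta>) \<le> K * exp (s * \<bar>Re w\<bar>) * exp (- 1 * \<bar>Re \<zeta> - Re w\<bar>)"
      using gauss_kernel_bound[OF D zero_less_one s] by blast
    have quot: "norm (gauss_kernel D w (Complex x e) / (Complex x e - w)) \<le> K * exp (s * \<bar>Re w\<bar>) / r * exp (- 1 * \<bar>x - Re w\<bar>)"
      if r: "r > 0" "\<bar>Im w\<bar> \<le> 1 - r" for w x r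
    proof -
      have "r \<le> \<bar>Im (Complex x e - w)\<bar>" using r e by auto
      then have 1: "r \<le> norm (Complex x e - w)" using abs_Im_le_cmod[of "Complex x e - w"] by linarith
      have "norm (gauss_kernel D w (Complex x e)) \<le> K * exp (s * \<bar>Re w\<bar>) * exp (- 1 * \<bar>x - Re w\<bar>)"
        using K(2)[of w "Complex x e"] r e by auto
      then have "norm (gauss_kernel D w (Complex x e)) / norm (Complex x e - w) \<le> K * exp (s * \<bar>Re w\<bar>) * exp (- 1 * \<bar>x - Re w\<bar>) / r"
        using 1 r K(1) by (intro frac_le) auto
      then show ?thesis by (simp add: norm_divide)
    qed
    have De: "continuous_on UNIV (\<lambda>x. D (Complex x e))"
      by (rule continuous_on_horizontal[OF holomorphic_on_imp_continuous_on[OF Oexp_holD[OF D]]])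
         (use e in \<open>auto simp: complex_is_Real_iff\<close>)
    have ne: "Complex x e - w \<noteq> 0" if "w \<in> ostrip 1" for x w using that e by (auto simp: ostrip_def complex_eq_iff)
    show "(\<lambda>w. LINT x|lborel. gauss_kernel D w (Complex x e) / (Complex x e - w)) holomorphic_on ostrip 1"
    proof (rule holomorphic_integral[OF ostrip_open_convex(1)])
      show "(\<lambda>x. gauss_kernel D w (Complex x e) / (Complex x e - w)) \<in> borel_measurable lborel" if "w \<in> ostrip 1" for w
      proof -
        have "continuous_on UNIV (\<lambda>x. Complex x e)" by (simp add: Complex_eq continuous_intros)
        then have "continuous_on UNIV (\<lambda>x. gauss_kernel D w (Complex x e) / (Complex x e - w))"
          unfolding gauss_kernel_def using ne[OF that] by (intro continuous_intros De) auto
        then show ?thesis using borel_measurable_continuous_onI by auto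
      qed
      show "(\<lambda>w. gauss_kernel D w (Complex x e) / (Complex x e - w)) holomorphic_on ostrip 1" for x
        unfolding gauss_kernel_def by (intro holomorphic_intros) (use ne in auto)
      fix z0 assume "z0 \<in> ostrip 1"
      then have z0: "\<bar>Im z0\<bar> < 1" by (simp add: ostrip_def)
      define r where "r = (1 - \<bar>Im z0\<bar>) / 2"
      have r: "r > 0" using z0 by (simp add: r_def)
      define B where "B = \<bar>Re z0\<bar> + r"
      define g where "g = (\<lambda>x. K * exp (s * B) / r * exp B * exp (- 1 * \<bar>x\<bar>))"
      have "norm (gauss_kernel D w (Complex x e) / (Complex x e - w)) \<le> g x" if w: "w \<in> ball z0 r" for w x
      proof -
        have "\<bar>Im w - Im z0\<bar> \<le> norm (w - z0)" "\<bar>Re w - Re z0\<bar> \<le> norm (w - z0)"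
          using abs_Im_le_cmod[of "w - z0"] abs_Re_le_cmod[of "w - z0"] by auto
        moreover have "norm (w - z0) < r" using w by (simp add: dist_norm norm_minus_commute)
        ultimately have "\<bar>Im w - Im z0\<bar> < r" and wB: "\<bar>Re w\<bar> \<le> B" by (auto simp: B_def)
        then have wr: "\<bar>Im w\<bar> \<le> 1 - r" by (simp add: r_def abs_if field_simps split: if_splits)
        have "norm (gauss_kernel D w (Complex x e) / (Complex x e - w)) \<le> K * exp (s * \<bar>Re w\<bar>) / r * exp (- 1 * \<bar>x - Re w\<bar>)"
          by (rule quot[OF r wr])
        also have "\<dots> \<le> K * exp (s * B) / r * (exp \<bar>Re w\<bar> * exp (- 1 * \<bar>x\<bar>))"
          using K(1) r s wB exp_recentre[of x "Re w"] by (intro mult_mono divide_right_mono) auto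
        also have "\<dots> \<le> K * exp (s * B) / r * (exp B * exp (- 1 * \<bar>x\<bar>))"
          using K(1) r wB by (intro mult_left_mono mult_right_mono) auto
        finally show ?thesis by (simp only: g_def mult.assoc)
      qed
      moreover have "integrable lborel g" unfolding g_def using integrable_exp_abs[of 1 0] by simp
      ultimately show "\<exists>r>0. \<exists>g. integrable lborel g \<and> (\<forall>z\<in>ball z0 r. \<forall>x\<in>space lborel. norm (gauss_kernel D z (Complex x e) / (Complex x e - z)) \<le> g x)"
        using r by blast
    qed
    have "norm (LINT x|lborel. gauss_kernel D w (Complex x e) / (Complex x e - w))
        \<le> (K / (1/2) * (LINT x|lborel. exp (- 1 * \<bar>x\<bar>))) * exp (s * \<bar>Re w\<bar>)" if w: "\<bar>Im w\<bar> \<le> 1/2" for w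
    proof -
      have "norm (LINT x|lborel. gauss_kernel D w (Complex x e) / (Complex x e - w))
          \<le> (K * exp (s * \<bar>Re w\<bar>) / (1/2)) * (LINT x|lborel. exp (- 1 * \<bar>x\<bar>))"
        by (rule norm_integral_exp_le[where a="Re w"], rule quot) (use w in auto)
      then show ?thesis by (simp only: mult_ac times_divide_eq_right times_divide_eq_left)
    qed
    then show "\<exists>C. \<forall>w. \<bar>Im w\<bar> \<le> 1/2 \<longrightarrow> norm (LINT x|lborel. gauss_kernel D w (Complex x e) / (Complex x e - w)) \<le> C * exp (s * \<bar>Re w\<bar>)"
      by blast
  qed
  have Jhol: "J holomorphic_on ostrip 1"
    unfolding J_def strip_integral_def by (intro holomorphic_intros line) (auto intro: zero_less_one)
  have Jb: "\<exists>C. \<forall>w. \<bar>Im w\<bar> \<le> 1/2 \<longrightarrow> norm (J w) \<le> C * exp (s * \<bar>Re w\<bar>)" if s: "s > 0" for s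
  proof -
    obtain C1 where C1: "\<And>w. \<bar>Im w\<bar> \<le> 1/2 \<Longrightarrow> norm (LINT x|lborel. gauss_kernel D w (Complex x 1) / (Complex x 1 - w)) \<le> C1 * exp (s * \<bar>Re w\<bar>)"
      using bnd[of 1 s] s by blast
    obtain C2 where C2: "\<And>w. \<bar>Im w\<bar> \<le> 1/2 \<Longrightarrow> norm (LINT x|lborel. gauss_kernel D w (Complex x (-1)) / (Complex x (-1) - w)) \<le> C2 * exp (s * \<bar>Re w\<bar>)"
      using bnd[of "-1" s] s by blast
    have "norm (J w) \<le> ((C1 + C2) / (2 * pi)) * exp (s * \<bar>Re w\<bar>)" if w: "\<bar>Im w\<bar> \<le> 1/2" for w
    proof -
      have "norm (strip_integral 1 (\<lambda>\<zeta>. gauss_kernel D w \<zeta> / (\<zeta> - w))) \<le> C1 * exp (s * \<bar>Re w\<bar>) + C2 * exp (s * \<bar>Re w\<bar>)"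
        unfolding strip_integral_def by (intro order_trans[OF norm_triangle_ineq4] add_mono C1 C2 w)
      then have "norm (strip_integral 1 (\<lambda>\<zeta>. gauss_kernel D w \<zeta> / (\<zeta> - w))) / (2 * pi) \<le> ((C1 + C2) * exp (s * \<bar>Re w\<bar>)) / (2 * pi)"
        by (intro divide_right_mono) (auto simp: ring_distribs)
      then show ?thesis by (simp add: J_def norm_divide norm_mult)
    qed
    then show ?thesis by blast
  qed
  define H where "H w = (if \<bar>Im w\<bar> < 1 then J w else D w)" for w
  have HD: "H w = D w" if "Im w \<noteq> 0" for w using JD[OF that] by (simp add: H_def)
  have "H holomorphic_on ostrip 1" using Jhol by (rule holomorphic_transform) (simp add: H_def ostrip_def)
  moreover have "H holomorphic_on - \<real>"
    using Oexp_holD[OF D] by (rule holomorphic_transform) (simp add: HD complex_is_Real_iff)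
  ultimately have "H holomorphic_on ostrip 1 \<union> - \<real>" by (intro holomorphic_on_Un ostrip_open_convex open_nonreal)
  moreover have "ostrip 1 \<union> - \<real> = (UNIV :: complex set)" by (auto simp: ostrip_def complex_is_Real_iff)
  ultimately have Hh: "H holomorphic_on UNIV" by simp
  have "grow_on 0 d s H" if s: "s > 0" for s d
  proof -
    have "grow_on (1/2) d s D" using D s by (auto simp: Oexp_UNIV_iff grow_def)
    then obtain C1 where C1: "C1 \<ge> 0" "\<And>z. 1/2 \<le> \<bar>Im z\<bar> \<Longrightarrow> \<bar>Im z\<bar> \<le> d \<Longrightarrow> norm (D z) \<le> C1 * exp (s * \<bar>Re z\<bar>)"
      using grow_onD by blast
    obtain C2 where C2: "\<And>w. \<bar>Im w\<bar> \<le> 1/2 \<Longrightarrow> norm (J w) \<le> C2 * exp (s * \<bar>Re w\<bar>)" using Jb[OF s] by blast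
    show ?thesis
    proof (rule grow_onI[where C="max C1 C2"])
      fix z assume z: "\<bar>Im z\<bar> \<le> d"
      show "norm (H z) \<le> max C1 C2 * exp (s * \<bar>Re z\<bar>)"
      proof (cases "\<bar>Im z\<bar> \<le> 1/2")
        case True
        then have "norm (H z) \<le> C2 * exp (s * \<bar>Re z\<bar>)" using C2[of z] by (simp add: H_def)
        then show ?thesis by (rule order_trans) (auto intro: mult_right_mono)
      next
        case False
        then have "norm (H z) \<le> C1 * exp (s * \<bar>Re z\<bar>)" using C1(2)[of z] z HD[of z] by auto
        then show ?thesis by (rule order_trans) (auto intro: mult_right_mono)
      qed
    qed
  qed
  then have "H \<in> Oexp {}" using Hh by (simp add: Oexp_empty_iff)
  moreover have "D = restr (- \<real>) H"
    using D HD by (auto simp: restr_def Oexp_UNIV_iff hol_def complex_is_Real_iff)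
  ultimately show ?thesis by (simp add: Oexp_entire_def)
qed

lemma bv_dual_inj: "inj_on bv_dual bv_Rbar"
proof (rule inj_onI)
  fix X Y assume XY: "X \<in> bv_Rbar" "Y \<in> bv_Rbar" and eq: "bv_dual X = bv_dual Y"
  obtain F G where F: "F \<in> Oexp UNIV" "X = cls (Oexp UNIV) Oexp_entire F" and G: "G \<in> Oexp UNIV" "Y = cls (Oexp UNIV) Oexp_entire G"
    using XY by (auto simp: bv_Rbar_def quot_iff)
  have "(\<lambda>z. F z - G z) \<in> Oexp_entire"
  proof (rule strip_annihilator)
    show "(\<lambda>z. F z - G z) \<in> Oexp UNIV" by (rule fsubspaceD(4)[OF fsubspaces(1) F(1) G(1)])
    fix n \<phi> c assume n: "1 \<le> n" and \<phi>: "\<phi> \<in> Pstep n" and c: "0 < c" "c < 1 / real n"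
    have i: "integrable lborel (\<lambda>x. H (Complex x e) * \<phi> (Complex x e))" if "H \<in> Oexp UNIV" "e \<in> {c, -c}" for H e
      using that c by (intro Oexp_line_integrable[OF _ \<phi> n]) auto
    have "strip_integral c (\<lambda>\<zeta>. (F \<zeta> - G \<zeta>) * \<phi> \<zeta>) = strip_integral c (\<lambda>\<zeta>. F \<zeta> * \<phi> \<zeta>) - strip_integral c (\<lambda>\<zeta>. G \<zeta> * \<phi> \<zeta>)"
      unfolding left_diff_distrib by (rule strip_integral_diff(1)) (auto intro: i F(1) G(1))
    also have "\<dots> = 0"
      using eq bv_dual_eq[OF F(1) \<phi> n c] bv_dual_eq[OF G(1) \<phi> n c] F(2) G(2) by simp
    finally show "strip_integral c (\<lambda>\<zeta>. (F \<zeta> - G \<zeta>) * \<phi> \<zeta>) = 0" .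
  qed
  then show "X = Y" unfolding F(2) G(2) by (subst cls_eq_iff[OF fsubspaces'(1) F(1) G(1)])
qed

section \<open>The transform of boundary values as an adjoint relation\<close>

lemma Oexp_strip_indep:
  assumes F: "F \<in> Oexp UNIV" and \<phi>: "\<phi> \<in> Pstep n" and n: "1 \<le> n" and c: "0 < c" "c < 1 / real n" "0 < d" "d < 1 / real n"
  shows "strip_integral c (\<lambda>\<zeta>. F \<zeta> * \<phi> \<zeta>) = strip_integral d (\<lambda>\<zeta>. F \<zeta> * \<phi> \<zeta>)"
proof (cases "c \<le> d")
  case True
  show ?thesis by (rule Oexp_strip_shift[OF F \<phi> n c(1) True c(4)])
next
  case False
  then have "d \<le> c" by simp
  show ?thesis by (rule Oexp_strip_shift[OF F \<phi> n c(3) \<open>d \<le> c\<close> c(2), symmetric])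
qed

text \<open>\<open>G\<close> represents the image of the boundary value represented by \<open>F\<close> under \<open>F_Rbar\<close>.\<close>

definition Ftrans :: "(complex \<Rightarrow> complex) \<Rightarrow> (complex \<Rightarrow> complex) \<Rightarrow> bool" where
  "Ftrans F G \<longleftrightarrow> F \<in> Oexp UNIV \<and> G \<in> Oexp UNIV \<and>
    (\<forall>n\<ge>1. \<forall>\<phi>\<in>Pstep n. \<forall>c c'. 0 < c \<longrightarrow> c < 1 / real n \<longrightarrow> 0 < c' \<longrightarrow> c' < 1 / real (2 * n) \<longrightarrow>
      strip_integral c (\<lambda>\<zeta>. G \<zeta> * \<phi> \<zeta>) = strip_integral c' (\<lambda>\<zeta>. F \<zeta> * Pfourier_fun \<phi> \<zeta>))"

text \<open>By independence of the contour, one pair of heights for each test function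
  suffices.\<close>

lemma FtransI:
  assumes F: "F \<in> Oexp UNIV" and G: "G \<in> Oexp UNIV"
    and ex: "\<And>n \<phi>. 1 \<le> n \<Longrightarrow> \<phi> \<in> Pstep n \<Longrightarrow> \<exists>c c'. 0 < c \<and> c < 1 / real n \<and> 0 < c' \<and> c' < 1 / real (2 * n) \<and>
      strip_integral c (\<lambda>\<zeta>. G \<zeta> * \<phi> \<zeta>) = strip_integral c' (\<lambda>\<zeta>. F \<zeta> * Pfourier_fun \<phi> \<zeta>)"
  shows "Ftrans F G"
  unfolding Ftrans_def
proof (intro conjI F G allI ballI impI)
  fix n \<phi> and c c' :: real assume n: "1 \<le> n" and \<phi>: "\<phi> \<in> Pstep n" and c: "0 < c" "c < 1 / real n" "0 < c'" "c' < 1 / real (2 * n)"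
  obtain d d' where d: "0 < d" "d < 1 / real n" "0 < d'" "d' < 1 / real (2 * n)"
    "strip_integral d (\<lambda>\<zeta>. G \<zeta> * \<phi> \<zeta>) = strip_integral d' (\<lambda>\<zeta>. F \<zeta> * Pfourier_fun \<phi> \<zeta>)" using ex[OF n \<phi>] by blast
  have "strip_integral c (\<lambda>\<zeta>. G \<zeta> * \<phi> \<zeta>) = strip_integral d (\<lambda>\<zeta>. G \<zeta> * \<phi> \<zeta>)"
    by (rule Oexp_strip_indep[OF G \<phi> n c(1,2) d(1,2)])
  moreover have "strip_integral c' (\<lambda>\<zeta>. F \<zeta> * Pfourier_fun \<phi> \<zeta>) = strip_integral d' (\<lambda>\<zeta>. F \<zeta> * Pfourier_fun \<phi> \<zeta>)"
    by (rule Oexp_strip_indep[OF F Pfourier_Pstep[OF \<phi> n] _ c(3,4) d(3,4)]) (use n in simp)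
  ultimately show "strip_integral c (\<lambda>\<zeta>. G \<zeta> * \<phi> \<zeta>) = strip_integral c' (\<lambda>\<zeta>. F \<zeta> * Pfourier_fun \<phi> \<zeta>)" using d(5) by simp
qed

text \<open>The adjoint identity says that \<open>Fstar\<close> maps the functional of F to that of
  G. As \<open>bv_dual\<close> is injective, this already determines the inverse image.\<close>

lemma F_Rbar_Ftrans:
  assumes FG: "Ftrans F G"
  shows "F_Rbar (cls (Oexp UNIV) Oexp_entire F) = cls (Oexp UNIV) Oexp_entire G"
proof -
  have F: "F \<in> Oexp UNIV" and G: "G \<in> Oexp UNIV" using FG by (auto simp: Ftrans_def)
  let ?X = "cls (Oexp UNIV) Oexp_entire F" and ?Y = "cls (Oexp UNIV) Oexp_entire G"
  have "Fstar (bv_dual ?X) = bv_dual ?Y"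
  proof
    fix \<Phi>
    show "Fstar (bv_dual ?X) \<Phi> = bv_dual ?Y \<Phi>"
    proof (cases "\<Phi> \<in> Pstar")
      case True
      obtain n \<phi> where n: "1 \<le> n" "\<phi> \<in> Pstep n" "\<Phi> = cls Pall Pnull \<phi>" using Pstar_cases[OF True] .
      \<comment> \<open>A common height for \<phi>, which lives in step n, and for its transform,
        which lives in step 2n.\<close>
      define c where "c = 1 / (4 * real n)"
      have c: "0 < c" "c < 1 / real n" "c < 1 / real (2 * n)" using n(1) by (auto simp: c_def field_simps)
      have n2: "1 \<le> 2 * n" using n(1) by simp
      have "Fstar (bv_dual ?X) \<Phi> = bv_dual ?X (Pfourier \<Phi>)"
        using True bv_dual_Pdual[OF F] by (simp add: Fstar_def)
      also have "\<dots> = strip_integral c (\<lambda>\<zeta>. F \<zeta> * Pfourier_fun \<phi> \<zeta>)"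
        unfolding n(3) Pfourier_cls[OF n(1,2)] by (rule bv_dual_eq[OF F Pfourier_Pstep[OF n(2,1)] n2 c(1,3)])
      also have "\<dots> = strip_integral c (\<lambda>\<zeta>. G \<zeta> * \<phi> \<zeta>)" using FG n c by (simp add: Ftrans_def)
      also have "\<dots> = bv_dual ?Y \<Phi>" unfolding n(3) by (rule bv_dual_eq[OF G n(2,1) c(1,2), symmetric])
      finally show ?thesis .
    next
      case False
      then show ?thesis using bv_dual_Pdual[OF F] by (simp add: Fstar_def bv_dual_def)
    qed
  qed
  then show ?thesis unfolding F_Rbar_def
    using the_inv_into_f_f[OF bv_dual_inj, of ?Y] cls_quot[OF G] by (simp add: bv_Rbar_def)
qed

lemma Ftrans_unique:
  assumes "Ftrans F G" "Ftrans F G'" shows "(\<lambda>z. G z - G' z) \<in> Oexp_entire"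
  using F_Rbar_Ftrans[OF assms(1)] F_Rbar_Ftrans[OF assms(2)] cls_eq_iff[OF fsubspaces'(1), of G "Oexp UNIV" G'] assms
  by (auto simp: Ftrans_def)

lemma Ftrans_add:
  assumes A: "Ftrans F G" and B: "Ftrans F' G'" shows "Ftrans (\<lambda>z. F z + F' z) (\<lambda>z. G z + G' z)"
proof (rule FtransI)
  have m: "F \<in> Oexp UNIV" "G \<in> Oexp UNIV" "F' \<in> Oexp UNIV" "G' \<in> Oexp UNIV" using A B by (auto simp: Ftrans_def)
  then show "(\<lambda>z. F z + F' z) \<in> Oexp UNIV" "(\<lambda>z. G z + G' z) \<in> Oexp UNIV"
    by (auto intro: fsubspaceD(2)[OF fsubspaces(1)])
  fix n \<phi> assume n: "1 \<le> n" and \<phi>: "\<phi> \<in> Pstep n"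
  define c where "c = 1 / (4 * real n)"
  have c: "0 < c" "c < 1 / real n" "c < 1 / real (2 * n)" using n(1) by (auto simp: c_def field_simps)
  have n2: "1 \<le> 2 * n" using n(1) by simp
  have i: "strip_integral c (\<lambda>\<zeta>. (H \<zeta> + H' \<zeta>) * \<psi> \<zeta>) = strip_integral c (\<lambda>\<zeta>. H \<zeta> * \<psi> \<zeta>) + strip_integral c (\<lambda>\<zeta>. H' \<zeta> * \<psi> \<zeta>)"
    if "H \<in> Oexp UNIV" "H' \<in> Oexp UNIV" "\<psi> \<in> Pstep k" "1 \<le> k" "c < 1 / real k" for H H' \<psi> k
    unfolding ring_distribs using that c by (intro strip_integral_diff(2) Oexp_line_integrable[OF _ that(3,4)]) auto
  have "strip_integral c (\<lambda>\<zeta>. (G \<zeta> + G' \<zeta>) * \<phi> \<zeta>) = strip_integral c (\<lambda>\<zeta>. (F \<zeta> + F' \<zeta>) * Pfourier_fun \<phi> \<zeta>)"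
    unfolding i[OF m(2,4) \<phi> n c(2)] i[OF m(1,3) Pfourier_Pstep[OF \<phi> n] n2 c(3)]
    using A B n \<phi> c by (simp add: Ftrans_def)
  then show "\<exists>c c'. 0 < c \<and> c < 1 / real n \<and> 0 < c' \<and> c' < 1 / real (2 * n) \<and>
      strip_integral c (\<lambda>\<zeta>. (G \<zeta> + G' \<zeta>) * \<phi> \<zeta>) = strip_integral c' (\<lambda>\<zeta>. (F \<zeta> + F' \<zeta>) * Pfourier_fun \<phi> \<zeta>)"
    using c by blast
qed

text \<open>Reflection exchanges the lines at heights c and -c, which enter with opposite
  signs.\<close>

lemma strip_integral_reflect: "strip_integral c (\<lambda>\<zeta>. f (- \<zeta>)) = - strip_integral c f"
proof -
  have "(LINT x|lborel. f (- Complex x e)) = (LINT x|lborel. f (Complex x (- e)))" for e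
    using lborel_integral_reflect[of "\<lambda>x. f (Complex x (- e))"] by (simp add: complex_eq_iff Complex_eq)
  from this[of c] this[of "-c"] show ?thesis by (simp add: strip_integral_def)
qed

lemma Oexp_reflect: assumes "F \<in> Oexp UNIV" shows "(\<lambda>z. F (- z)) \<in> Oexp UNIV"
proof -
  have "uminus ` (- \<real>) = (- \<real> :: complex set)"
    by (auto simp: image_iff intro!: bexI[of _ "- x" for x])
  then show ?thesis using assms hol_reflect[of F "- \<real>"] grow_reflect by (auto simp: Oexp_UNIV_iff)
qed

text \<open>By Fourier inversion a preimage is obtained by transforming the reflected function.\<close>

lemma Ftrans_surj:
  assumes G: "G \<in> Oexp UNIV" and F: "Ftrans (\<lambda>z. G (- z)) F"
  shows "Ftrans (\<lambda>z. - (1 / (2 * of_real pi)) * F z) G"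
proof (rule FtransI[OF _ G])
  have FO: "F \<in> Oexp UNIV" using F by (simp add: Ftrans_def)
  then show "(\<lambda>z. - (1 / (2 * of_real pi)) * F z) \<in> Oexp UNIV" by (rule fsubspaceD(3)[OF fsubspaces(1)])
  fix n \<phi> assume n: "1 \<le> n" and \<phi>: "\<phi> \<in> Pstep n"
  let ?\<psi> = "Pfourier_fun \<phi>"
  have n2: "1 \<le> 2 * n" using n(1) by simp
  have \<psi>: "?\<psi> \<in> Pstep (2 * n)" by (rule Pfourier_Pstep[OF \<phi> n])
  define c where "c = 1 / (8 * real n)"
  have c: "0 < c" "c < 1 / real n" "c < 1 / real (2 * n)" "c < 1 / real (2 * (2 * n))" using n(1) by (auto simp: c_def field_simps)
  have "strip_integral c (\<lambda>\<zeta>. F \<zeta> * ?\<psi> \<zeta>) = strip_integral c (\<lambda>\<zeta>. G (- \<zeta>) * Pfourier_fun ?\<psi> \<zeta>)"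
    using F n2 \<psi> c unfolding Ftrans_def by blast
  also have "\<dots> = strip_integral c (\<lambda>\<zeta>. (2 * of_real pi) * (G (- \<zeta>) * \<phi> (- \<zeta>)))"
    by (rule strip_integral_cong) (use c fourier_inversion[OF \<phi> n] in auto)
  \<comment> \<open>The factor 2\<pi> comes from the inversion formula, the sign from the reflected
    contour; together they are the origin of the factor -1/(2\<pi>) in the claim.\<close>
  also have "\<dots> = - (2 * of_real pi) * strip_integral c (\<lambda>\<zeta>. G \<zeta> * \<phi> \<zeta>)"
    unfolding strip_integral_cmult strip_integral_reflect[of c "\<lambda>\<zeta>. G \<zeta> * \<phi> \<zeta>"] by simp
  finally have "strip_integral c (\<lambda>\<zeta>. G \<zeta> * \<phi> \<zeta>) = - (1 / (2 * of_real pi)) * strip_integral c (\<lambda>\<zeta>. F \<zeta> * ?\<psi> \<zeta>)"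
    by simp
  also have "\<dots> = strip_integral c (\<lambda>\<zeta>. - (1 / (2 * of_real pi)) * F \<zeta> * ?\<psi> \<zeta>)"
    unfolding mult.assoc by (rule strip_integral_cmult[symmetric])
  finally show "\<exists>c c'. 0 < c \<and> c < 1 / real n \<and> 0 < c' \<and> c' < 1 / real (2 * n) \<and>
      strip_integral c (\<lambda>\<zeta>. G \<zeta> * \<phi> \<zeta>) = strip_integral c' (\<lambda>\<zeta>. - (1 / (2 * of_real pi)) * F \<zeta> * Pfourier_fun \<phi> \<zeta>)"
    using c by blast
qed

section \<open>Langenbruch's transform\<close>

text \<open>A superposition of exponentials with density p along a parametrised curve \<zeta>. Full
  lines, half-lines and vertical segments are all treated by this one form.\<close>

definition superpose :: "(real \<Rightarrow> complex) \<Rightarrow> (real \<Rightarrow> complex) \<Rightarrow> complex \<Rightarrow> complex" where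
  "superpose p \<zeta> z = (LINT u|lborel. p u * exp (- \<i> * z * \<zeta> u))"

lemma norm_superpose_integrand:
  assumes "p u \<noteq> 0 \<Longrightarrow> \<bar>Im (\<zeta> u)\<bar> \<le> c"
  shows "norm (p u * exp (- \<i> * z * \<zeta> u)) \<le> exp (c * \<bar>Re z\<bar>) * (norm (p u) * exp (Im z * Re (\<zeta> u)))"
proof (cases "p u = 0")
  case False
  have "norm (p u * exp (- \<i> * z * \<zeta> u)) \<le> norm (p u) * exp (c * \<bar>Re z\<bar> + Im z * Re (\<zeta> u))"
    unfolding norm_mult by (intro mult_left_mono norm_exp_kernel_le assms False) auto
  then show ?thesis by (simp add: exp_add mult_ac)
qed auto

lemma superpose_bound:
  assumes im: "\<And>u. p u \<noteq> 0 \<Longrightarrow> \<bar>Im (\<zeta> u)\<bar> \<le> c" and int: "integrable lborel (\<lambda>u. norm (p u) * exp (Im z * Re (\<zeta> u)))"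
  shows "norm (superpose p \<zeta> z) \<le> exp (c * \<bar>Re z\<bar>) * (LINT u|lborel. norm (p u) * exp (Im z * Re (\<zeta> u)))"
proof (cases "integrable lborel (\<lambda>u. p u * exp (- \<i> * z * \<zeta> u))")
  case True
  have "norm (superpose p \<zeta> z) \<le> (LINT u|lborel. norm (p u * exp (- \<i> * z * \<zeta> u)))"
    unfolding superpose_def by (rule integral_norm_bound)
  also have "\<dots> \<le> (LINT u|lborel. exp (c * \<bar>Re z\<bar>) * (norm (p u) * exp (Im z * Re (\<zeta> u))))"
    by (intro integral_mono integrable_norm True integrable_mult_right int norm_superpose_integrand im)
  finally show ?thesis by simp
next
  case False
  then show ?thesis by (simp add: superpose_def not_integrable_integral_eq)
qed

lemma superpose_holomorphic:
  assumes p[measurable]: "p \<in> borel_measurable borel" and \<zeta>[measurable]: "\<zeta> \<in> borel_measurable borel"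
    and im: "\<And>u. p u \<noteq> 0 \<Longrightarrow> \<bar>Im (\<zeta> u)\<bar> \<le> c" and c: "c \<ge> 0" and I: "open I"
    and int: "\<And>t. t \<in> I \<Longrightarrow> integrable lborel (\<lambda>u. norm (p u) * exp (t * Re (\<zeta> u)))"
  shows "superpose p \<zeta> holomorphic_on {z. Im z \<in> I}"
proof -
  have op: "open {z. Im z \<in> I}"
    using open_vimage[OF I, of Im] by (simp add: vimage_def continuous_intros)
  have "(\<lambda>z. LINT u|lborel. p u * exp (- \<i> * z * \<zeta> u)) holomorphic_on {z. Im z \<in> I}"
  proof (rule holomorphic_integral[OF op])
    show "(\<lambda>u. p u * exp (- \<i> * z * \<zeta> u)) \<in> borel_measurable lborel" for z by measurable
    show "(\<lambda>z. p u * exp (- \<i> * z * \<zeta> u)) holomorphic_on {z. Im z \<in> I}" for u by (intro holomorphic_intros)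
    fix z0 assume "z0 \<in> {z. Im z \<in> I}"
    then obtain r where r: "r > 0" "cball (Im z0) r \<subseteq> I" using I open_contains_cball by blast
    \<comment> \<open>On the ball Im z lies between Im z0 - r and Im z0 + r, so exp(Im z Re \<zeta>)
      is at most the sum of its values at the two ends, whatever the sign of Re \<zeta>.\<close>
    define g where "g = (\<lambda>u. exp (c * (\<bar>Re z0\<bar> + r)) * (norm (p u) * exp ((Im z0 - r) * Re (\<zeta> u)) + norm (p u) * exp ((Im z0 + r) * Re (\<zeta> u))))"
    have "Im z0 - r \<in> I" "Im z0 + r \<in> I" using r by (auto simp: subset_iff dist_real_def)
    then have "integrable lborel g" unfolding g_def by (intro integrable_mult_right Bochner_Integration.integrable_add int)
    moreover have "norm (p u * exp (- \<i> * z * \<zeta> u)) \<le> g u" if z: "z \<in> ball z0 r" for z u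
    proof -
      have n: "norm (z - z0) < r" using z by (simp add: dist_norm norm_minus_commute)
      have b: "\<bar>Re z\<bar> \<le> \<bar>Re z0\<bar> + r" "Im z0 - r \<le> Im z" "Im z \<le> Im z0 + r"
        using abs_Re_le_cmod[of "z - z0"] abs_Im_le_cmod[of "z - z0"] n by auto
      have "exp (Im z * Re (\<zeta> u)) \<le> exp ((Im z0 - r) * Re (\<zeta> u)) + exp ((Im z0 + r) * Re (\<zeta> u))"
      proof (cases "Re (\<zeta> u) \<ge> 0")
        case True
        then have "Im z * Re (\<zeta> u) \<le> (Im z0 + r) * Re (\<zeta> u)" using b by (intro mult_right_mono) auto
        then show ?thesis by (intro add_increasing) auto
      next
        case False
        then have "Im z * Re (\<zeta> u) \<le> (Im z0 - r) * Re (\<zeta> u)" using b by (intro mult_right_mono_neg) auto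
        then show ?thesis by (intro add_increasing2) auto
      qed
      then have 1: "norm (p u) * exp (Im z * Re (\<zeta> u)) \<le> norm (p u) * exp ((Im z0 - r) * Re (\<zeta> u)) + norm (p u) * exp ((Im z0 + r) * Re (\<zeta> u))"
        using mult_left_mono[of _ _ "norm (p u)"] by (simp add: ring_distribs flip: distrib_left)
      have "norm (p u * exp (- \<i> * z * \<zeta> u)) \<le> exp (c * \<bar>Re z\<bar>) * (norm (p u) * exp (Im z * Re (\<zeta> u)))"
        by (rule norm_superpose_integrand) (rule im)
      also have "\<dots> \<le> g u" unfolding g_def using 1 b(1) c by (intro mult_mono) (auto intro: mult_left_mono)
      finally show ?thesis .
    qed
    ultimately show "\<exists>r>0. \<exists>g. integrable lborel g \<and> (\<forall>z\<in>ball z0 r. \<forall>u\<in>space lborel. norm (p u * exp (- \<i> * z * \<zeta> u)) \<le> g u)"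
      using r(1) by blast
  qed
  then show ?thesis by (simp add: superpose_def[abs_def])
qed

lemma superpose_line_integrable:
  assumes \<phi>: "\<phi> \<in> Pstep n" and n: "1 \<le> n" and t: "\<bar>t\<bar> < 1 / real n"
    and p: "p \<in> borel_measurable borel" and \<zeta>: "\<zeta> \<in> borel_measurable borel"
    and im: "\<And>u. p u \<noteq> 0 \<Longrightarrow> \<bar>Im (\<zeta> u)\<bar> \<le> c" and c: "0 \<le> c" "c < 1 / real n" and I: "open I" "t \<in> I"
    and int: "\<And>t. t \<in> I \<Longrightarrow> integrable lborel (\<lambda>u. norm (p u) * exp (t * Re (\<zeta> u)))"
  shows "integrable lborel (\<lambda>x. \<phi> (Complex x t) * superpose p \<zeta> (Complex x t))"
proof -
  define J where "J = (LINT u|lborel. norm (p u) * exp (t * Re (\<zeta> u)))"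
  have J0: "J \<ge> 0" unfolding J_def by (intro integral_nonneg_AE) auto
  have P0: "Pnorm n \<phi> \<ge> 0" by (rule Pnorm_nonneg[OF \<phi> n])
  show ?thesis
  proof (rule integrable_line[where C="Pnorm n \<phi> * J" and d="1 / real n - c"])
    show "continuous_on UNIV (\<lambda>x. \<phi> (Complex x t) * superpose p \<zeta> (Complex x t))"
      by (intro continuous_on_mult Pstep_line_measurable(1)[OF \<phi> t]
          continuous_on_horizontal[OF holomorphic_on_imp_continuous_on[OF superpose_holomorphic[OF p \<zeta> im c(1) I(1) int]]])
         (use I in auto)
    fix x
    have "norm (\<phi> (Complex x t) * superpose p \<zeta> (Complex x t)) \<le> (Pnorm n \<phi> * exp (- (1 / real n) * \<bar>x\<bar>)) * (exp (c * \<bar>x\<bar>) * J)"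
      unfolding norm_mult J_def
      using Pstep_bound'[OF \<phi>, of "Complex x t"] t superpose_bound[OF im, where z="Complex x t"] int[OF I(2)] P0
      by (intro mult_mono) auto
    also have "\<dots> = (Pnorm n \<phi> * J) * (exp (- (1 / real n) * \<bar>x\<bar>) * exp (c * \<bar>x\<bar>))" by (simp only: mult_ac)
    also have "exp (- (1 / real n) * \<bar>x\<bar>) * exp (c * \<bar>x\<bar>) = exp (- (1 / real n - c) * \<bar>x\<bar>)"
      by (simp add: left_diff_distrib flip: exp_add)
    finally show "norm (\<phi> (Complex x t) * superpose p \<zeta> (Complex x t)) \<le> Pnorm n \<phi> * J * exp (- (1 / real n - c) * \<bar>x\<bar>)" .
  qed (use c in auto)
qed

lemma superpose_pairing:
  assumes "\<phi> \<in> Pstep n" "1 \<le> n" "\<bar>t\<bar> < 1 / real n" "p \<in> borel_measurable borel" "\<zeta> \<in> borel_measurable borel"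
    "\<And>u. p u \<noteq> 0 \<Longrightarrow> \<bar>Im (\<zeta> u)\<bar> \<le> c" "c < 1 / real n" "integrable lborel (\<lambda>u. norm (p u) * exp (t * Re (\<zeta> u)))"
  shows "line_int t (\<lambda>z. \<phi> z * superpose p \<zeta> z) = (LINT u|lborel. p u * Pfourier_fun \<phi> (\<zeta> u))"
  unfolding superpose_def by (rule fubini_line[OF assms])

section \<open>The transform of a rapidly decreasing representative\<close>

definition lap :: "real \<Rightarrow> (complex \<Rightarrow> complex) \<Rightarrow> complex \<Rightarrow> complex" where
  "lap c F z = strip_integral c (\<lambda>\<zeta>. exp (- \<i> * z * \<zeta>) * F \<zeta>)"

lemma lap_eq_superpose:
  "lap c F z = superpose (\<lambda>u. F (Complex u c)) (\<lambda>u. Complex u c) z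
    - superpose (\<lambda>u. F (Complex u (- c))) (\<lambda>u. Complex u (- c)) z"
  by (simp add: lap_def superpose_def strip_integral_def mult.commute)

lemma Complex_measurable: "(\<lambda>u. Complex u e) \<in> borel_measurable borel" "(\<lambda>u. Complex a u) \<in> borel_measurable borel"
  unfolding Complex_eq by measurable

lemma nonreal_line_continuous:
  assumes "F holomorphic_on - \<real>" "e \<noteq> 0" shows "continuous_on UNIV (\<lambda>x. F (Complex x e))"
  by (rule continuous_on_horizontal[OF holomorphic_on_imp_continuous_on[OF assms(1)]])
     (use assms(2) in \<open>auto simp: complex_is_Real_iff\<close>)

lemma integrable_exp_bound:
  fixes g :: "real \<Rightarrow> real"
  assumes "g \<in> borel_measurable borel" "\<And>x. \<bar>g x\<bar> \<le> C * exp (- d * \<bar>x\<bar>)" "d > 0"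
  shows "integrable lborel g"
proof (rule Bochner_Integration.integrable_bound)
  show "integrable lborel (\<lambda>x. C * exp (- d * \<bar>x - 0\<bar>))" by (intro integrable_mult_right integrable_exp_abs assms)
  show "AE x in lborel. norm (g x) \<le> norm (C * exp (- d * \<bar>x - 0\<bar>))"
  proof (rule AE_I2)
    fix x show "norm (g x) \<le> norm (C * exp (- d * \<bar>x - 0\<bar>))"
      using assms(2)[of x] abs_ge_self[of "C * exp (- d * \<bar>x\<bar>)"] by simp
  qed
qed (use assms(1) in simp)

lemma Hminf_line_weight_integrable:
  assumes F: "F \<in> Hminf UNIV" and e: "e \<noteq> 0"
  shows "integrable lborel (\<lambda>u. norm (F (Complex u e)) * exp (t * Re (Complex u e)))"
proof -
  have Fh: "F holomorphic_on - \<real>" and "grow_on \<bar>e\<bar> \<bar>e\<bar> (- (\<bar>t\<bar> + 1)) F"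
    using F e by (auto simp: Hminf_UNIV_iff hol_def grow_def)
  then obtain K where K: "K \<ge> 0" "\<And>z. \<bar>e\<bar> \<le> \<bar>Im z\<bar> \<Longrightarrow> \<bar>Im z\<bar> \<le> \<bar>e\<bar> \<Longrightarrow> norm (F z) \<le> K * exp (- (\<bar>t\<bar> + 1) * \<bar>Re z\<bar>)"
    using grow_onD by blast
  show ?thesis
  proof (rule integrable_exp_bound[where C=K and d=1])
    show "(\<lambda>u. norm (F (Complex u e)) * exp (t * Re (Complex u e))) \<in> borel_measurable borel"
      by (intro borel_measurable_continuous_onI continuous_intros nonreal_line_continuous Fh e) simp
    fix u
    have "t * u \<le> \<bar>t\<bar> * \<bar>u\<bar>" by (simp flip: abs_mult)
    then have "norm (F (Complex u e)) * exp (t * u) \<le> (K * exp (- (\<bar>t\<bar> + 1) * \<bar>u\<bar>)) * exp (\<bar>t\<bar> * \<bar>u\<bar>)"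
      using K(1) K(2)[of "Complex u e"] by (intro mult_mono) auto
    also have "\<dots> = K * exp (- 1 * \<bar>u\<bar>)" by (simp add: mult.assoc algebra_simps flip: exp_add)
    finally show "\<bar>norm (F (Complex u e)) * exp (t * Re (Complex u e))\<bar> \<le> K * exp (- 1 * \<bar>u\<bar>)" by simp
  qed simp
qed

lemma Hminf_line_measurable:
  assumes F: "F \<in> Hminf UNIV" and e: "e \<noteq> 0" shows "(\<lambda>u. F (Complex u e)) \<in> borel_measurable borel"
  using F by (intro borel_measurable_continuous_onI nonreal_line_continuous e) (simp add: Hminf_UNIV_iff hol_def)

text \<open>Decay of F at rate |Im z| + 1 absorbs the growth exp(|Im z| |Re \<zeta>|) of the kernel
  and leaves the rate 1.\<close>

lemma kernel_shift_bound:
  assumes "grow_on c d (- (\<bar>Im z\<bar> + 1)) F" "d \<ge> 0"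
  obtains K where "K \<ge> 0" "\<And>\<zeta>. c \<le> \<bar>Im \<zeta>\<bar> \<Longrightarrow> \<bar>Im \<zeta>\<bar> \<le> d \<Longrightarrow> norm (exp (- \<i> * z * \<zeta>) * F \<zeta>) \<le> K * exp (- 1 * \<bar>Re \<zeta>\<bar>)"
proof -
  obtain K where K: "K \<ge> 0" "\<And>\<zeta>. c \<le> \<bar>Im \<zeta>\<bar> \<Longrightarrow> \<bar>Im \<zeta>\<bar> \<le> d \<Longrightarrow> norm (F \<zeta>) \<le> K * exp (- (\<bar>Im z\<bar> + 1) * \<bar>Re \<zeta>\<bar>)"
    using grow_onD[OF assms(1)] by blast
  show thesis
  proof (rule that[of "exp (d * \<bar>Re z\<bar>) * K"])
    fix \<zeta> assume \<zeta>: "c \<le> \<bar>Im \<zeta>\<bar>" "\<bar>Im \<zeta>\<bar> \<le> d"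
    have "Im z * Re \<zeta> \<le> \<bar>Im z\<bar> * \<bar>Re \<zeta>\<bar>" by (simp flip: abs_mult)
    then have "norm (exp (- \<i> * z * \<zeta>)) \<le> exp (d * \<bar>Re z\<bar> + \<bar>Im z\<bar> * \<bar>Re \<zeta>\<bar>)"
      by (intro order_trans[OF norm_exp_kernel_le[OF \<zeta>(2)]]) simp
    then have "norm (exp (- \<i> * z * \<zeta>) * F \<zeta>) \<le> exp (d * \<bar>Re z\<bar> + \<bar>Im z\<bar> * \<bar>Re \<zeta>\<bar>) * (K * exp (- (\<bar>Im z\<bar> + 1) * \<bar>Re \<zeta>\<bar>))"
      unfolding norm_mult using K(1) by (intro mult_mono K(2) \<zeta>) auto
    also have "\<dots> = exp (d * \<bar>Re z\<bar>) * K * (exp (\<bar>Im z\<bar> * \<bar>Re \<zeta>\<bar>) * exp (- (\<bar>Im z\<bar> + 1) * \<bar>Re \<zeta>\<bar>))"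
      by (simp only: exp_add mult_ac)
    also have "exp (\<bar>Im z\<bar> * \<bar>Re \<zeta>\<bar>) * exp (- (\<bar>Im z\<bar> + 1) * \<bar>Re \<zeta>\<bar>) = exp (- 1 * \<bar>Re \<zeta>\<bar>)"
      by (simp add: algebra_simps flip: exp_add)
    finally show "norm (exp (- \<i> * z * \<zeta>) * F \<zeta>) \<le> exp (d * \<bar>Re z\<bar>) * K * exp (- 1 * \<bar>Re \<zeta>\<bar>)" .
  qed (use K(1) in simp)
qed

lemma lap_shift:
  assumes F: "F \<in> Hminf UNIV" and c: "0 < c" "c \<le> d" shows "lap c F z = lap d F z"
proof -
  let ?f = "\<lambda>\<zeta>. exp (- \<i> * z * \<zeta>) * F \<zeta>"
  have Fh: "F holomorphic_on - \<real>" and "grow_on c d (- (\<bar>Im z\<bar> + 1)) F"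
    using F c by (auto simp: Hminf_UNIV_iff hol_def grow_def)
  then obtain K where K: "K \<ge> 0" "\<And>\<zeta>. c \<le> \<bar>Im \<zeta>\<bar> \<Longrightarrow> \<bar>Im \<zeta>\<bar> \<le> d \<Longrightarrow> norm (?f \<zeta>) \<le> K * exp (- 1 * \<bar>Re \<zeta>\<bar>)"
    using kernel_shift_bound[of c d z F] c by auto
  have hol: "?f holomorphic_on A" if "A \<subseteq> - \<real>" for A
    by (intro holomorphic_intros holomorphic_on_subset[OF Fh] that)
  have "line_int c ?f = line_int d ?f"
  proof (rule line_int_shift[OF open_convex_strip(2,1)[of 0 "d + 1"] _ c(2), where C=K and \<delta>=1])
    show "?f holomorphic_on {z. 0 < Im z \<and> Im z < d + 1}" by (rule hol) (auto simp: complex_is_Real_iff)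
    show "norm (?f \<zeta>) \<le> K * exp (- 1 * \<bar>Re \<zeta>\<bar>)" if "c \<le> Im \<zeta>" "Im \<zeta> \<le> d" for \<zeta>
      by (rule K(2)) (use that c in auto)
  qed (use c in auto)
  moreover have "line_int (- d) ?f = line_int (- c) ?f"
  proof (rule line_int_shift[OF open_convex_strip(2,1)[of "- (d + 1)" 0], where C=K and \<delta>=1])
    show "?f holomorphic_on {z. - (d + 1) < Im z \<and> Im z < 0}" by (rule hol) (auto simp: complex_is_Real_iff)
    show "norm (?f \<zeta>) \<le> K * exp (- 1 * \<bar>Re \<zeta>\<bar>)" if "- d \<le> Im \<zeta>" "Im \<zeta> \<le> - c" for \<zeta>
      by (rule K(2)) (use that c in auto)
  qed (use c in auto)
  ultimately show ?thesis by (simp add: lap_def strip_integral_eq)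
qed

lemma lap_indep: assumes F: "F \<in> Hminf UNIV" and c: "0 < c" "0 < d" shows "lap c F = lap d F"
proof
  fix z show "lap c F z = lap d F z"
  proof (cases "c \<le> d")
    case True show ?thesis by (rule lap_shift[OF F c(1) True])
  next
    case False
    then have "d \<le> c" by simp
    show ?thesis by (rule lap_shift[OF F c(2) \<open>d \<le> c\<close>, symmetric])
  qed
qed

lemma lap_entire_zero:
  assumes F: "F \<in> Hminf {}" and c: "0 < c" shows "lap c F z = 0"
proof -
  obtain K where K: "K \<ge> 0" "\<And>\<zeta>. 0 \<le> \<bar>Im \<zeta>\<bar> \<Longrightarrow> \<bar>Im \<zeta>\<bar> \<le> c \<Longrightarrow> norm (exp (- \<i> * z * \<zeta>) * F \<zeta>) \<le> K * exp (- 1 * \<bar>Re \<zeta>\<bar>)"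
    using kernel_shift_bound[OF Hminf_emptyD(2)[OF F] less_imp_le[OF c]] by blast
  have "line_int (- c) (\<lambda>\<zeta>. exp (- \<i> * z * \<zeta>) * F \<zeta>) = line_int c (\<lambda>\<zeta>. exp (- \<i> * z * \<zeta>) * F \<zeta>)"
  proof (rule line_int_shift[where S=UNIV and C=K and \<delta>=1])
    show "(\<lambda>\<zeta>. exp (- \<i> * z * \<zeta>) * F \<zeta>) holomorphic_on UNIV"
      by (intro holomorphic_intros Hminf_emptyD(1)[OF F])
    show "norm (exp (- \<i> * z * \<zeta>) * F \<zeta>) \<le> K * exp (- 1 * \<bar>Re \<zeta>\<bar>)" if "- c \<le> Im \<zeta>" "Im \<zeta> \<le> c" for \<zeta>
      by (rule K(2)) (use that in auto)
  qed (use c in auto)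
  then show ?thesis by (simp add: lap_def strip_integral_eq)
qed

text \<open>At height s the kernel grows only like exp(s |Re z|), and the value does not depend on
  the height. Computing at height s therefore gives the growth rate s, for every s > 0.\<close>

lemma lap_FG:
  assumes F: "F \<in> Hminf UNIV" and c: "0 < c" shows "lap c F \<in> FG_Rbar"
proof -
  have hol: "superpose (\<lambda>u. F (Complex u e)) (\<lambda>u. Complex u e) holomorphic_on UNIV" if "e \<in> {c, -c}" for e
    using superpose_holomorphic[OF Hminf_line_measurable[OF F] Complex_measurable(1), of e e c UNIV]
      Hminf_line_weight_integrable[OF F, of e] that c by auto
  have h: "lap c F holomorphic_on UNIV"
    unfolding lap_eq_superpose[abs_def] by (intro holomorphic_intros hol) auto
  have "grow_on 0 d s (lap c F)" if s: "s > 0" for d s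
  proof -
    have sb: "\<exists>J. \<forall>z. \<bar>Im z\<bar> \<le> d \<longrightarrow> norm (superpose (\<lambda>u. F (Complex u e)) (\<lambda>u. Complex u e) z) \<le> J * exp (s * \<bar>Re z\<bar>)"
      if e: "e \<in> {s, -s}" for e
    proof -
      define J where "J = (LINT u|lborel. norm (F (Complex u e)) * exp (d * Re (Complex u e)) + norm (F (Complex u e)) * exp (- d * Re (Complex u e)))"
      have e0: "e \<noteq> 0" using e s by auto
      note wi = Hminf_line_weight_integrable[OF F e0]
      have "norm (superpose (\<lambda>u. F (Complex u e)) (\<lambda>u. Complex u e) z) \<le> J * exp (s * \<bar>Re z\<bar>)" if z: "\<bar>Im z\<bar> \<le> d" for z
      proof -
        have "norm (superpose (\<lambda>u. F (Complex u e)) (\<lambda>u. Complex u e) z)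
            \<le> exp (s * \<bar>Re z\<bar>) * (LINT u|lborel. norm (F (Complex u e)) * exp (Im z * Re (Complex u e)))"
          by (rule superpose_bound[OF _ wi]) (use e s in auto)
        also have "\<dots> \<le> exp (s * \<bar>Re z\<bar>) * J"
        proof (rule mult_left_mono)
          show "(LINT u|lborel. norm (F (Complex u e)) * exp (Im z * Re (Complex u e))) \<le> J"
            unfolding J_def
          proof (rule integral_mono[OF wi Bochner_Integration.integrable_add[OF wi wi]])
            fix u
            have "exp (Im z * u) \<le> exp (d * u) + exp (- d * u)"
            proof (cases "u \<ge> 0")
              case True
              then have "Im z * u \<le> d * u" using z by (intro mult_right_mono) auto
              then show ?thesis by (intro add_increasing2) auto
            next
              case False
              then have "Im z * u \<le> - d * u" using z by (intro mult_right_mono_neg) auto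
              then show ?thesis by (intro add_increasing) auto
            qed
            then have "norm (F (Complex u e)) * exp (Im z * u) \<le> norm (F (Complex u e)) * (exp (d * u) + exp (- d * u))"
              by (rule mult_left_mono) simp
            then show "norm (F (Complex u e)) * exp (Im z * Re (Complex u e))
               \<le> norm (F (Complex u e)) * exp (d * Re (Complex u e)) + norm (F (Complex u e)) * exp (- d * Re (Complex u e))"
              by (simp add: ring_distribs)
          qed
        qed simp
        finally show ?thesis by (simp only: mult.commute)
      qed
      then show ?thesis by blast
    qed
    obtain J1 where J1: "\<And>z. \<bar>Im z\<bar> \<le> d \<Longrightarrow> norm (superpose (\<lambda>u. F (Complex u s)) (\<lambda>u. Complex u s) z) \<le> J1 * exp (s * \<bar>Re z\<bar>)"
      using sb[of s] by auto
    obtain J2 where J2: "\<And>z. \<bar>Im z\<bar> \<le> d \<Longrightarrow> norm (superpose (\<lambda>u. F (Complex u (-s))) (\<lambda>u. Complex u (-s)) z) \<le> J2 * exp (s * \<bar>Re z\<bar>)"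
      using sb[of "-s"] by auto
    show ?thesis unfolding lap_indep[OF F c s]
    proof (rule grow_onI[where C="J1 + J2"])
      fix z assume z: "\<bar>Im z\<bar> \<le> d"
      have "norm (lap s F z) \<le> J1 * exp (s * \<bar>Re z\<bar>) + J2 * exp (s * \<bar>Re z\<bar>)"
        unfolding lap_eq_superpose by (intro order_trans[OF norm_triangle_ineq4] add_mono J1 J2 z)
      then show "norm (lap s F z) \<le> (J1 + J2) * exp (s * \<bar>Re z\<bar>)" by (simp only: distrib_right)
    qed
  qed
  then show ?thesis using h by (simp add: FG_Rbar_def Oexp_empty_iff)
qed

text \<open>Another representative differs by an entire rapidly decreasing function, whose two lines
  can be moved onto each other; the height is immaterial by the shift of contours.\<close>

lemma L_fourier_eq:
  assumes F: "F \<in> Hminf UNIV" and c: "0 < c"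
  shows "L_fourier (cls (Hminf UNIV) Hminf_entire F) = lap c F"
proof
  fix z
  have same: "lap d g z = lap c F z" if g: "g \<in> cls (Hminf UNIV) Hminf_entire F" and d: "0 < d" for g d
  proof -
    have gH: "g \<in> Hminf UNIV" using g by (simp add: cls_iff)
    obtain H where H: "H \<in> Hminf {}" "(\<lambda>z. F z - g z) = restr (- \<real>) H" using g by (auto simp: cls_iff Hminf_entire_def)
    let ?e = "\<lambda>\<zeta>. exp (- \<i> * z * \<zeta>)"
    have int: "integrable lborel (\<lambda>x. ?e (Complex x e) * f (Complex x e))" if f: "f \<in> Hminf UNIV" and e: "e \<in> {c, -c}" for f e
    proof -
      have e0: "e \<noteq> 0" using e c by auto
      have fh: "f holomorphic_on - \<real>" and "grow_on \<bar>e\<bar> \<bar>e\<bar> (- (\<bar>Im z\<bar> + 1)) f"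
        using f e0 by (auto simp: Hminf_UNIV_iff hol_def grow_def)
      then obtain K where K: "K \<ge> 0" "\<And>\<zeta>. \<bar>e\<bar> \<le> \<bar>Im \<zeta>\<bar> \<Longrightarrow> \<bar>Im \<zeta>\<bar> \<le> \<bar>e\<bar> \<Longrightarrow> norm (?e \<zeta> * f \<zeta>) \<le> K * exp (- 1 * \<bar>Re \<zeta>\<bar>)"
        using kernel_shift_bound[of "\<bar>e\<bar>" "\<bar>e\<bar>" z f] by auto
      show ?thesis
      proof (rule integrable_line[where C=K and d=1])
        show "continuous_on UNIV (\<lambda>x. ?e (Complex x e) * f (Complex x e))"
          by (rule nonreal_line_continuous[where F="\<lambda>\<zeta>. ?e \<zeta> * f \<zeta>"]) (intro holomorphic_intros fh e0)+
        show "norm (?e (Complex x e) * f (Complex x e)) \<le> K * exp (- 1 * \<bar>x\<bar>)" for x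
          using K(2)[of "Complex x e"] by simp
      qed simp
    qed
    have "lap d g z = lap c g z" using lap_indep[OF gH d c] by simp
    also have "\<dots> = lap c F z - lap c (\<lambda>\<zeta>. F \<zeta> - g \<zeta>) z"
      unfolding lap_def right_diff_distrib by (subst strip_integral_diff(1)) (use int F gH in auto)
    also have "lap c (\<lambda>\<zeta>. F \<zeta> - g \<zeta>) z = lap c H z"
      unfolding lap_def H(2) by (rule strip_integral_cong) (use c in \<open>auto simp: restr_def complex_is_Real_iff\<close>)
    also have "\<dots> = 0" by (rule lap_entire_zero[OF H(1) c])
    finally show ?thesis by simp
  qed
  have self: "F \<in> cls (Hminf UNIV) Hminf_entire F" by (rule cls_self[OF fsubspaces'(3) F])
  show "L_fourier (cls (Hminf UNIV) Hminf_entire F) z = lap c F z"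
    unfolding L_fourier_def
  proof (rule the_elem_unique)
    show "{strip_integral c (\<lambda>\<zeta>. exp (- \<i> * z * \<zeta>) * g \<zeta>) |g c. g \<in> cls (Hminf UNIV) Hminf_entire F \<and> 0 < c} \<noteq> {}"
      using self c by blast
  qed (use same in \<open>auto simp: lap_def\<close>)
qed

text \<open>The plus part vanishes on the lower line, and the upper line moves to the real axis
  because the transform is entire. There it is a difference of superpositions over the lines at
  heights c and -c, so interchanging the integrals turns the pairing with \<phi> into the strip
  integral of F against the Fourier transform of \<phi>.\<close>

lemma Ftrans_lap:
  assumes F: "F \<in> Hminf UNIV" shows "Ftrans F (plus_part (lap 1 F))"
proof (rule FtransI)
  show FO: "F \<in> Oexp UNIV" using F Hminf_subset_Oexp by blast
  have lF: "lap 1 F \<in> FG_Rbar" by (rule lap_FG[OF F zero_less_one])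
  then show "plus_part (lap 1 F) \<in> Oexp UNIV" by (rule plus_part_Oexp)
  fix n \<phi> assume n: "1 \<le> n" and \<phi>: "\<phi> \<in> Pstep n"
  define c where "c = 1 / (4 * real n)"
  have c: "0 < c" "c < 1 / real n" "c < 1 / real (2 * n)" using n(1) by (auto simp: c_def field_simps)
  have t0: "\<bar>0\<bar> < 1 / real n" using n by simp
  have pair: "line_int 0 (\<lambda>z. \<phi> z * superpose (\<lambda>u. F (Complex u e)) (\<lambda>u. Complex u e) z) = line_int e (\<lambda>\<zeta>. F \<zeta> * Pfourier_fun \<phi> \<zeta>)"
    and int: "integrable lborel (\<lambda>x. \<phi> (Complex x 0) * superpose (\<lambda>u. F (Complex u e)) (\<lambda>u. Complex u e) (Complex x 0))"
    if e: "e \<in> {c, -c}" for e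
  proof -
    have e0: "e \<noteq> 0" using e c by auto
    show "line_int 0 (\<lambda>z. \<phi> z * superpose (\<lambda>u. F (Complex u e)) (\<lambda>u. Complex u e) z) = line_int e (\<lambda>\<zeta>. F \<zeta> * Pfourier_fun \<phi> \<zeta>)"
      unfolding line_int_def[of e]
      by (rule superpose_pairing[OF \<phi> n t0 Hminf_line_measurable[OF F e0] Complex_measurable(1) _ c(2) Hminf_line_weight_integrable[OF F e0]])
         (use e c in auto)
    show "integrable lborel (\<lambda>x. \<phi> (Complex x 0) * superpose (\<lambda>u. F (Complex u e)) (\<lambda>u. Complex u e) (Complex x 0))"
      by (rule superpose_line_integrable[OF \<phi> n t0 Hminf_line_measurable[OF F e0] Complex_measurable(1) _ _ c(2) open_UNIV UNIV_I Hminf_line_weight_integrable[OF F e0]])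
         (use e c in auto)
  qed
  have "strip_integral c (\<lambda>\<zeta>. plus_part (lap 1 F) \<zeta> * \<phi> \<zeta>) = line_int c (\<lambda>\<zeta>. lap 1 F \<zeta> * \<phi> \<zeta>)"
    using c by (simp add: strip_integral_eq line_int_def plus_part_def restr_def upper_def)
  also have "\<dots> = line_int 0 (\<lambda>\<zeta>. lap 1 F \<zeta> * \<phi> \<zeta>)"
    using entire_line_int_shift[of "lap 1 F" \<phi> n 0 c c] lF \<phi> n c by (simp add: FG_Rbar_def)
  also have "\<dots> = line_int 0 (\<lambda>z. \<phi> z * superpose (\<lambda>u. F (Complex u c)) (\<lambda>u. Complex u c) z
       - \<phi> z * superpose (\<lambda>u. F (Complex u (-c))) (\<lambda>u. Complex u (-c)) z)"
    unfolding lap_indep[OF F zero_less_one c(1)] lap_eq_superpose by (simp add: algebra_simps)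
  also have "\<dots> = line_int c (\<lambda>\<zeta>. F \<zeta> * Pfourier_fun \<phi> \<zeta>) - line_int (-c) (\<lambda>\<zeta>. F \<zeta> * Pfourier_fun \<phi> \<zeta>)"
    unfolding pair[of c, OF insertI1, symmetric] pair[of "-c", OF insertI2[OF singletonI], symmetric]
    unfolding line_int_def by (rule Bochner_Integration.integral_diff) (auto intro!: int)
  finally have "strip_integral c (\<lambda>\<zeta>. plus_part (lap 1 F) \<zeta> * \<phi> \<zeta>) = strip_integral c (\<lambda>\<zeta>. F \<zeta> * Pfourier_fun \<phi> \<zeta>)"
    by (simp add: strip_integral_eq)
  then show "\<exists>c c'. 0 < c \<and> c < 1 / real n \<and> 0 < c' \<and> c' < 1 / real (2 * n) \<and>
      strip_integral c (\<lambda>\<zeta>. plus_part (lap 1 F) \<zeta> * \<phi> \<zeta>) = strip_integral c' (\<lambda>\<zeta>. F \<zeta> * Pfourier_fun \<phi> \<zeta>)"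
    using c by blast
qed

section \<open>Boundary values supported at infinity\<close>

text \<open>For an integrand without singularities, the boundary of the half-strip \<open>Re \<zeta> \<ge> a\<close>, \<open>\<bar>Im \<zeta>\<bar> \<le> c\<close>
  replaces the right half of the strip contour.\<close>

definition wedge_int :: "real \<Rightarrow> real \<Rightarrow> (complex \<Rightarrow> complex) \<Rightarrow> complex" where
  "wedge_int a c f = (LINT u:{a..}|lborel. f (Complex u c)) - (LINT u:{a..}|lborel. f (Complex u (- c)))
     + \<i> * (LINT u:{- c..c}|lborel. f (Complex a u))"

definition right_int :: "real \<Rightarrow> real \<Rightarrow> (complex \<Rightarrow> complex) \<Rightarrow> complex \<Rightarrow> complex" where
  "right_int a c P z = wedge_int a c (\<lambda>\<zeta>. P \<zeta> * exp (- \<i> * z * \<zeta>))"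

definition hpart :: "real \<Rightarrow> real \<Rightarrow> (complex \<Rightarrow> complex) \<Rightarrow> real \<Rightarrow> complex" where
  "hpart a e P u = indicator {a..} u *\<^sub>R P (Complex u e)"

definition vpart :: "real \<Rightarrow> real \<Rightarrow> (complex \<Rightarrow> complex) \<Rightarrow> real \<Rightarrow> complex" where
  "vpart a c P u = indicator {- c..c} u *\<^sub>R P (Complex a u)"

lemma right_int_eq:
  "right_int a c P z = superpose (hpart a c P) (\<lambda>u. Complex u c) z - superpose (hpart a (- c) P) (\<lambda>u. Complex u (- c)) z
    + \<i> * superpose (vpart a c P) (\<lambda>u. Complex a u) z"
  by (simp add: right_int_def wedge_int_def superpose_def hpart_def vpart_def set_lebesgue_integral_def)

lemma entire_linepath_primitive:
  assumes "f holomorphic_on UNIV" shows "\<exists>g. \<forall>a b. (f has_contour_integral (g b - g a)) (linepath a b)"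
proof (rule contour_integral_linepath_primitive[OF convex_UNIV open_UNIV assms])
  fix g assume "\<And>a b. a \<in> UNIV \<Longrightarrow> b \<in> UNIV \<Longrightarrow> (f has_contour_integral (g b - g a)) (linepath a b)"
  then show "\<exists>g. \<forall>a b. (f has_contour_integral (g b - g a)) (linepath a b)" by (intro exI[of _ g]) simp
qed

section \<open>One-sided contours for entire integrands of prescribed growth\<close>

text \<open>The rate s is a parameter because the one-sided integral converges exactly on the safe
  side Im z < -s. Arbitrarily small s > 0 yields the whole lower half-plane, and arbitrarily
  negative s the whole plane.\<close>

locale entire_growth =
  fixes P :: "complex \<Rightarrow> complex" and s :: real
  assumes hol: "P holomorphic_on UNIV" and grow: "grow s P"
begin

lemma cont: "continuous_on A P"
  using holomorphic_on_imp_continuous_on[OF hol] continuous_on_subset by blast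

lemma cont_h: "continuous_on A (\<lambda>u. P (Complex u e))"
  by (rule continuous_on_horizontal[OF cont, where A=A and S=UNIV]) auto

lemma cont_v: "continuous_on A (\<lambda>u. P (Complex a u))"
  by (rule continuous_on_vertical[OF cont, where A=A and S=UNIV]) auto

lemma hpart_measurable: "hpart a e P \<in> borel_measurable borel"
  unfolding hpart_def[abs_def] by (intro borel_measurable_continuous_on_indicator cont_h) auto

lemma vpart_measurable: "vpart a c P \<in> borel_measurable borel"
  unfolding vpart_def[abs_def] by (intro borel_measurable_continuous_on_indicator cont_v) auto

text \<open>The exponent (s+t)u is split as (s+t)a + (s+t)(u-a): the second part gives
  integrability, the first a decay in t whose rate is the abscissa a. K depends only on the height
  e, so a, b and t remain free.\<close>

lemma hpart_bound:
  assumes "e \<noteq> 0"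
  obtains K where "K \<ge> 0" "\<And>a b t u. 0 \<le> a \<Longrightarrow> t \<le> - s - b \<Longrightarrow> norm (hpart a e P u) * exp (t * u) \<le> K * exp ((s + t) * a) * exp (- b * \<bar>u - a\<bar>)"
proof -
  have "grow_on \<bar>e\<bar> \<bar>e\<bar> s P" using grow assms by (simp add: grow_def)
  then obtain K where K: "K \<ge> 0" "\<And>z. \<bar>e\<bar> \<le> \<bar>Im z\<bar> \<Longrightarrow> \<bar>Im z\<bar> \<le> \<bar>e\<bar> \<Longrightarrow> norm (P z) \<le> K * exp (s * \<bar>Re z\<bar>)"
    using grow_onD by blast
  show thesis
  proof (rule that[OF K(1)])
    fix a b t u :: real assume a: "0 \<le> a" and t: "t \<le> - s - b"
    show "norm (hpart a e P u) * exp (t * u) \<le> K * exp ((s + t) * a) * exp (- b * \<bar>u - a\<bar>)"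
    proof (cases "u \<ge> a")
      case True
      have "norm (hpart a e P u) \<le> K * exp (s * u)"
        using K(2)[of "Complex u e"] True a by (simp add: hpart_def)
      then have "norm (hpart a e P u) * exp (t * u) \<le> K * exp (s * u) * exp (t * u)"
        by (rule mult_right_mono) simp
      also have "\<dots> = K * exp ((s + t) * a + (s + t) * (u - a))"
        by (simp add: mult.assoc algebra_simps flip: exp_add)
      also have "\<dots> \<le> K * exp ((s + t) * a + - b * \<bar>u - a\<bar>)"
      proof -
        have "(s + t) * (u - a) \<le> - b * (u - a)" using t True by (intro mult_right_mono) auto
        then show ?thesis using K(1) True by (intro mult_left_mono) auto
      qed
      finally show ?thesis by (simp only: exp_add mult.assoc)
    next
      case False
      then show ?thesis using K(1) by (simp add: hpart_def)
    qed
  qed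
qed

lemma hpart_integrable:
  assumes a: "0 \<le> a" and e: "e \<noteq> 0" and t: "t < - s"
  shows "integrable lborel (\<lambda>u. norm (hpart a e P u) * exp (t * Re (Complex u e)))"
proof -
  define b where "b = - s - t"
  obtain K where K: "K \<ge> 0" "\<And>a b t u. 0 \<le> a \<Longrightarrow> t \<le> - s - b \<Longrightarrow> norm (hpart a e P u) * exp (t * u) \<le> K * exp ((s + t) * a) * exp (- b * \<bar>u - a\<bar>)"
    using hpart_bound[OF e] by blast
  have [measurable]: "hpart a e P \<in> borel_measurable borel" by (rule hpart_measurable)
  show ?thesis
  proof (rule Bochner_Integration.integrable_bound)
    show "integrable lborel (\<lambda>u. K * exp ((s + t) * a) * exp (- b * \<bar>u - a\<bar>))"
      using t by (intro integrable_mult_right integrable_exp_abs) (simp add: b_def)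
    show "(\<lambda>u. norm (hpart a e P u) * exp (t * Re (Complex u e))) \<in> borel_measurable lborel" by simp
    have "norm (norm (hpart a e P u) * exp (t * Re (Complex u e))) \<le> norm (K * exp ((s + t) * a) * exp (- b * \<bar>u - a\<bar>))" for u
      using K(2)[OF a, of t b u] K(1) by (simp add: b_def)
    then show "AE u in lborel. norm (norm (hpart a e P u) * exp (t * Re (Complex u e))) \<le> norm (K * exp ((s + t) * a) * exp (- b * \<bar>u - a\<bar>))"
      by blast
  qed
qed

text \<open>The density has support in [-c, c]; the factor exp(-|u|) is introduced at the price exp
  |c|, so that the estimates for decaying densities apply.\<close>

lemma vpart_bound:
  obtains M where "M \<ge> 0" "\<And>t u. norm (vpart a c P u) * exp (t * a) \<le> M * exp (t * a) * exp (- 1 * \<bar>u\<bar>)"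
proof -
  have "compact ((\<lambda>u. P (Complex a u)) ` {- c..c})" by (intro compact_continuous_image cont_v) auto
  then obtain M where "\<forall>u\<in>{- c..c}. norm (P (Complex a u)) \<le> M"
    unfolding compact_eq_bounded_closed bounded_iff by blast
  then have M: "\<And>u. - c \<le> u \<Longrightarrow> u \<le> c \<Longrightarrow> norm (P (Complex a u)) \<le> M" by simp
  define M' where "M' = \<bar>M\<bar> * exp \<bar>c\<bar>"
  show thesis
  proof (rule that[of M'])
    show "M' \<ge> 0" by (simp add: M'_def)
    fix t u :: real
    have "norm (vpart a c P u) \<le> M' * exp (- 1 * \<bar>u\<bar>)"
    proof (cases "u \<in> {- c..c}")
      case True
      have "norm (vpart a c P u) \<le> \<bar>M\<bar> * 1" using M[of u] True by (simp add: vpart_def)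
      also have "\<dots> \<le> \<bar>M\<bar> * exp (\<bar>c\<bar> - \<bar>u\<bar>)" using True by (intro mult_left_mono) auto
      finally show ?thesis by (simp add: M'_def exp_diff exp_minus field_simps)
    qed (simp add: vpart_def M'_def)
    then have "norm (vpart a c P u) * exp (t * a) \<le> M' * exp (- 1 * \<bar>u\<bar>) * exp (t * a)" by (rule mult_right_mono) simp
    then show "norm (vpart a c P u) * exp (t * a) \<le> M' * exp (t * a) * exp (- 1 * \<bar>u\<bar>)" by (simp only: mult_ac)
  qed
qed

lemma vpart_integrable: "integrable lborel (\<lambda>u. norm (vpart a c P u) * exp (t * Re (Complex a u)))"
proof -
  obtain M where M: "M \<ge> 0" "\<And>t u. norm (vpart a c P u) * exp (t * a) \<le> M * exp (t * a) * exp (- 1 * \<bar>u\<bar>)"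
    using vpart_bound[of a c] by blast
  have [measurable]: "vpart a c P \<in> borel_measurable borel" by (rule vpart_measurable)
  show ?thesis
    by (rule integrable_exp_bound[where C="M * exp (t * a)" and d=1]) (use M(2)[of _ t] in auto)
qed

lemma parts_im:
  "hpart a e P u \<noteq> 0 \<Longrightarrow> \<bar>Im (Complex u e)\<bar> \<le> \<bar>e\<bar>" "vpart a c P u \<noteq> 0 \<Longrightarrow> \<bar>Im (Complex a u)\<bar> \<le> c"
  by (auto simp: vpart_def indicator_def abs_le_iff)

lemma right_int_holomorphic:
  assumes a: "0 \<le> a" and c: "0 < c" shows "right_int a c P holomorphic_on {z. Im z < - s}"
proof -
  have h: "superpose (hpart a e P) (\<lambda>u. Complex u e) holomorphic_on {z. Im z \<in> {..< - s}}" if "e \<noteq> 0" for e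
    by (rule superpose_holomorphic[OF hpart_measurable Complex_measurable(1) parts_im(1)])
       (auto intro: hpart_integrable[OF a that, simplified])
  have v: "superpose (vpart a c P) (\<lambda>u. Complex a u) holomorphic_on {z. Im z \<in> {..< - s}}"
    by (rule superpose_holomorphic[OF vpart_measurable Complex_measurable(2) parts_im(2)])
       (use c vpart_integrable in auto)
  show ?thesis unfolding right_int_eq[abs_def]
    by (intro holomorphic_intros) (use h[of c] h[of "-c"] v c in auto)
qed

text \<open>The base a becomes the decay rate in the lower half-plane and the half-height c the
  growth rate in |Re z|. As the value does not depend on the wedge, both can be chosen to suit the
  desired estimate.\<close>

lemma right_int_bound:
  assumes a: "0 \<le> a" and c: "0 < c" and b: "0 < b"
  obtains C where "C \<ge> 0" "\<And>z. Im z \<le> - s - b \<Longrightarrow> norm (right_int a c P z) \<le> C * exp (c * \<bar>Re z\<bar> + a * Im z)"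
proof -
  have h: "\<exists>C\<ge>0. \<forall>z. Im z \<le> - s - b \<longrightarrow> norm (superpose (hpart a e P) (\<lambda>u. Complex u e) z) \<le> C * exp (c * \<bar>Re z\<bar> + a * Im z)"
    if e: "\<bar>e\<bar> = c" for e
  proof -
    have e0: "e \<noteq> 0" using e c by auto
    obtain K where K: "K \<ge> 0" "\<And>a b t u. 0 \<le> a \<Longrightarrow> t \<le> - s - b \<Longrightarrow> norm (hpart a e P u) * exp (t * u) \<le> K * exp ((s + t) * a) * exp (- b * \<bar>u - a\<bar>)"
      using hpart_bound[OF e0] by blast
    define I where "I = (LINT x|lborel. exp (- b * \<bar>x\<bar>))"
    have I0: "I \<ge> 0" unfolding I_def by (intro integral_nonneg_AE) auto
    have "norm (superpose (hpart a e P) (\<lambda>u. Complex u e) z) \<le> (K * exp (s * a) * I) * exp (c * \<bar>Re z\<bar> + a * Im z)"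
      if z: "Im z \<le> - s - b" for z
    proof -
      have "norm (superpose (hpart a e P) (\<lambda>u. Complex u e) z) \<le> (exp (c * \<bar>Re z\<bar>) * (K * exp ((s + Im z) * a))) * I"
        unfolding superpose_def I_def
      proof (rule norm_integral_exp_le[where a=a, OF _ b])
        fix u
        have "norm (hpart a e P u * exp (- \<i> * z * Complex u e)) \<le> exp (c * \<bar>Re z\<bar>) * (norm (hpart a e P u) * exp (Im z * Re (Complex u e)))"
          by (rule norm_superpose_integrand[where \<zeta>="\<lambda>u. Complex u e"]) (use e in simp)
        also have "\<dots> \<le> exp (c * \<bar>Re z\<bar>) * (K * exp ((s + Im z) * a) * exp (- b * \<bar>u - a\<bar>))"
          using K(2)[OF a z, of u] by (intro mult_left_mono) auto
        finally show "norm (hpart a e P u * exp (- \<i> * z * Complex u e)) \<le> exp (c * \<bar>Re z\<bar>) * (K * exp ((s + Im z) * a)) * exp (- b * \<bar>u - a\<bar>)"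
          by (simp only: mult_ac)
      qed
      also have "\<dots> = (K * exp (s * a) * I) * exp (c * \<bar>Re z\<bar> + a * Im z)"
      proof -
        have "exp ((s + Im z) * a) = exp (s * a) * exp (a * Im z)" by (simp add: algebra_simps flip: exp_add)
        then show ?thesis by (simp only: exp_add mult_ac)
      qed
      finally show ?thesis .
    qed
    then show ?thesis using K(1) I0 by (intro exI[of _ "K * exp (s * a) * I"]) auto
  qed
  obtain C1 where C1: "C1 \<ge> 0" "\<And>z. Im z \<le> - s - b \<Longrightarrow> norm (superpose (hpart a c P) (\<lambda>u. Complex u c) z) \<le> C1 * exp (c * \<bar>Re z\<bar> + a * Im z)"
    using h[of c] c by auto
  obtain C2 where C2: "C2 \<ge> 0" "\<And>z. Im z \<le> - s - b \<Longrightarrow> norm (superpose (hpart a (-c) P) (\<lambda>u. Complex u (-c)) z) \<le> C2 * exp (c * \<bar>Re z\<bar> + a * Im z)"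
    using h[of "-c"] c by auto
  obtain M where M: "M \<ge> 0" "\<And>t u. norm (vpart a c P u) * exp (t * a) \<le> M * exp (t * a) * exp (- 1 * \<bar>u\<bar>)"
    using vpart_bound[of a c] by blast
  define I where "I = (LINT x|lborel. exp (- 1 * \<bar>x::real\<bar>))"
  have I0: "I \<ge> 0" unfolding I_def by (intro integral_nonneg_AE) auto
  have V: "norm (superpose (vpart a c P) (\<lambda>u. Complex a u) z) \<le> (M * I) * exp (c * \<bar>Re z\<bar> + a * Im z)" for z
  proof -
    have "norm (superpose (vpart a c P) (\<lambda>u. Complex a u) z) \<le> (exp (c * \<bar>Re z\<bar>) * (M * exp (Im z * a))) * I"
      unfolding superpose_def I_def
    proof (rule norm_integral_exp_le[where a=0])
      fix u
      have "norm (vpart a c P u * exp (- \<i> * z * Complex a u)) \<le> exp (c * \<bar>Re z\<bar>) * (norm (vpart a c P u) * exp (Im z * Re (Complex a u)))"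
        by (rule norm_superpose_integrand[where \<zeta>="\<lambda>u. Complex a u"]) (rule parts_im(2))
      also have "\<dots> \<le> exp (c * \<bar>Re z\<bar>) * (M * exp (Im z * a) * exp (- 1 * \<bar>u\<bar>))"
        using M(2)[of u "Im z"] by (intro mult_left_mono) auto
      finally show "norm (vpart a c P u * exp (- \<i> * z * Complex a u)) \<le> exp (c * \<bar>Re z\<bar>) * (M * exp (Im z * a)) * exp (- 1 * \<bar>u - 0\<bar>)"
        by (simp only: mult_ac diff_zero)
    qed simp
    also have "\<dots> = (M * I) * exp (c * \<bar>Re z\<bar> + a * Im z)" by (simp add: exp_add mult_ac)
    finally show ?thesis .
  qed
  show thesis
  proof (rule that[of "C1 + C2 + M * I"])
    show "0 \<le> C1 + C2 + M * I" using C1(1) C2(1) M(1) I0 by simp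
    fix z assume z: "Im z \<le> - s - b"
    let ?E = "exp (c * \<bar>Re z\<bar> + a * Im z)"
    have "norm (right_int a c P z) \<le> C1 * ?E + C2 * ?E + (M * I) * ?E"
      unfolding right_int_eq
      by (intro order_trans[OF norm_triangle_ineq] add_mono order_trans[OF norm_triangle_ineq4] C1(2)[OF z] C2(2)[OF z])
         (simp add: norm_mult V)
    then show "norm (right_int a c P z) \<le> (C1 + C2 + M * I) * ?E" by (simp only: distrib_right)
  qed
qed

lemma right_int_pairing:
  assumes \<phi>: "\<phi> \<in> Pstep n" and n: "1 \<le> n" and c: "0 < c" "c < 1 / real n" and t: "\<bar>t\<bar> < 1 / real n" "t < - s"
  shows "line_int t (\<lambda>z. right_int 0 c P z * \<phi> z) = wedge_int 0 c (\<lambda>\<zeta>. P \<zeta> * Pfourier_fun \<phi> \<zeta>)"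
proof -
  let ?H = "\<lambda>e. superpose (hpart 0 e P) (\<lambda>u. Complex u e)" and ?V = "superpose (vpart 0 c P) (\<lambda>u. Complex 0 u)"
  have H: "line_int t (\<lambda>z. \<phi> z * ?H e z) = (LINT u:{0..}|lborel. P (Complex u e) * Pfourier_fun \<phi> (Complex u e))"
    and Hi: "integrable lborel (\<lambda>x. \<phi> (Complex x t) * ?H e (Complex x t))" if e: "\<bar>e\<bar> = c" for e
  proof -
    have e0: "e \<noteq> 0" using e c by auto
    have ec: "\<bar>e\<bar> < 1 / real n" using e c by simp
    have "line_int t (\<lambda>z. \<phi> z * ?H e z) = (LINT u|lborel. hpart 0 e P u * Pfourier_fun \<phi> (Complex u e))"
      by (rule superpose_pairing[OF \<phi> n t(1) hpart_measurable Complex_measurable(1) parts_im(1) ec hpart_integrable[OF order_refl e0 t(2)]])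
    then show "line_int t (\<lambda>z. \<phi> z * ?H e z) = (LINT u:{0..}|lborel. P (Complex u e) * Pfourier_fun \<phi> (Complex u e))"
      by (simp add: hpart_def set_lebesgue_integral_def)
    show "integrable lborel (\<lambda>x. \<phi> (Complex x t) * ?H e (Complex x t))"
      by (rule superpose_line_integrable[OF \<phi> n t(1) hpart_measurable Complex_measurable(1) parts_im(1) _ ec open_lessThan[of "- s"]])
         (use t hpart_integrable[OF order_refl e0] in auto)
  qed
  have V: "line_int t (\<lambda>z. \<phi> z * ?V z) = (LINT u:{-c..c}|lborel. P (Complex 0 u) * Pfourier_fun \<phi> (Complex 0 u))"
  proof -
    have "line_int t (\<lambda>z. \<phi> z * ?V z) = (LINT u|lborel. vpart 0 c P u * Pfourier_fun \<phi> (Complex 0 u))"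
      by (rule superpose_pairing[OF \<phi> n t(1) vpart_measurable Complex_measurable(2) parts_im(2) c(2) vpart_integrable])
    then show ?thesis by (simp add: vpart_def set_lebesgue_integral_def)
  qed
  have Vi: "integrable lborel (\<lambda>x. \<phi> (Complex x t) * ?V (Complex x t))"
    by (rule superpose_line_integrable[OF \<phi> n t(1) vpart_measurable Complex_measurable(2) parts_im(2) _ c(2) open_UNIV UNIV_I vpart_integrable])
       (use c in auto)
  have "line_int t (\<lambda>z. right_int 0 c P z * \<phi> z) = line_int t (\<lambda>z. \<phi> z * ?H c z - \<phi> z * ?H (-c) z + \<i> * (\<phi> z * ?V z))"
    unfolding right_int_eq by (simp add: algebra_simps)
  also have "\<dots> = line_int t (\<lambda>z. \<phi> z * ?H c z) - line_int t (\<lambda>z. \<phi> z * ?H (-c) z) + \<i> * line_int t (\<lambda>z. \<phi> z * ?V z)"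
    unfolding line_int_def using Hi[of c] Hi[of "-c"] Vi c by simp
  also have "\<dots> = wedge_int 0 c (\<lambda>\<zeta>. P \<zeta> * Pfourier_fun \<phi> \<zeta>)"
    using H[of c] H[of "-c"] V c by (simp add: wedge_int_def)
  finally show ?thesis .
qed

lemma kernel_bound_right:
  assumes c: "0 < c" "c \<le> d" and a: "0 \<le> a"
  obtains K where "\<And>\<zeta>. a \<le> Re \<zeta> \<Longrightarrow> c \<le> \<bar>Im \<zeta>\<bar> \<Longrightarrow> \<bar>Im \<zeta>\<bar> \<le> d \<Longrightarrow> norm (P \<zeta> * exp (- \<i> * z * \<zeta>)) \<le> K * exp (- (- s - Im z) * Re \<zeta>)"
proof -
  have "grow_on c d s P" using grow c by (simp add: grow_def)
  then obtain K where K: "K \<ge> 0" "\<And>z. c \<le> \<bar>Im z\<bar> \<Longrightarrow> \<bar>Im z\<bar> \<le> d \<Longrightarrow> norm (P z) \<le> K * exp (s * \<bar>Re z\<bar>)"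
    using grow_onD by blast
  show thesis
  proof (rule that[of "K * exp (d * \<bar>Re z\<bar>)"])
    fix \<zeta> assume \<zeta>: "a \<le> Re \<zeta>" "c \<le> \<bar>Im \<zeta>\<bar>" "\<bar>Im \<zeta>\<bar> \<le> d"
    have "norm (P \<zeta> * exp (- \<i> * z * \<zeta>)) \<le> (K * exp (s * Re \<zeta>)) * exp (d * \<bar>Re z\<bar> + Im z * Re \<zeta>)"
      unfolding norm_mult using K(1) K(2)[OF \<zeta>(2,3)] \<zeta>(1) a by (intro mult_mono norm_exp_kernel_le \<zeta>(3)) auto
    also have "\<dots> = K * exp (d * \<bar>Re z\<bar>) * exp (- (- s - Im z) * Re \<zeta>)"
      by (simp add: mult.assoc algebra_simps flip: exp_add)
    finally show "norm (P \<zeta> * exp (- \<i> * z * \<zeta>)) \<le> K * exp (d * \<bar>Re z\<bar>) * exp (- (- s - Im z) * Re \<zeta>)" .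
  qed
qed

lemma vertical_LINT:
  assumes "c < d" "continuous_on {c..d} (\<lambda>y. f (Complex a y))"
  shows "contour_integral (linepath (Complex a c) (Complex a d)) f = \<i> * (LINT y:{c..d}|lborel. f (Complex a y))"
proof -
  have "(LINT y:{c..d}|lborel. f (Complex a y)) = integral {c..d} (\<lambda>y. f (Complex a y))"
    by (rule set_borel_integral_eq_integral(2))
       (simp add: set_integrable_def borel_integrable_compact assms(2))
  then show ?thesis using contour_integral_linepath_same_Re[of "Complex a c" a "Complex a d" c d f] assms(1) by simp
qed

text \<open>Raising the upper and lowering the lower half-line changes each by a vertical segment at
  abscissa a; precisely these two segments are added to the base of the wedge. A primitive reduces
  the comparison to endpoint values.\<close>

lemma right_int_height:
  assumes a: "0 \<le> a" and c: "0 < c" "c \<le> d" and z: "Im z < - s"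
  shows "right_int a c P z = right_int a d P z"
proof (cases "c = d")
  case False
  let ?f = "\<lambda>\<zeta>. P \<zeta> * exp (- \<i> * z * \<zeta>)"
  have h: "?f holomorphic_on UNIV" by (intro holomorphic_intros hol)
  obtain K where K: "\<And>\<zeta>. a \<le> Re \<zeta> \<Longrightarrow> c \<le> \<bar>Im \<zeta>\<bar> \<Longrightarrow> \<bar>Im \<zeta>\<bar> \<le> d \<Longrightarrow> norm (?f \<zeta>) \<le> K * exp (- (- s - Im z) * Re \<zeta>)"
    using kernel_bound_right[OF c a] by blast
  have up: "(LINT x:{a..}|lborel. ?f (Complex x c)) - (LINT x:{a..}|lborel. ?f (Complex x d)) = contour_integral (linepath (Complex a c) (Complex a d)) ?f"
  proof (rule half_strip_shift[OF convex_UNIV open_UNIV h c(2)])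
    show "norm (?f \<zeta>) \<le> K * exp (- (- s - Im z) * Re \<zeta>)" if "a \<le> Re \<zeta>" "c \<le> Im \<zeta>" "Im \<zeta> \<le> d" for \<zeta>
      by (rule K) (use that c in auto)
  qed (use z in auto)
  have lo: "(LINT x:{a..}|lborel. ?f (Complex x (-d))) - (LINT x:{a..}|lborel. ?f (Complex x (-c))) = contour_integral (linepath (Complex a (-d)) (Complex a (-c))) ?f"
  proof (rule half_strip_shift[OF convex_UNIV open_UNIV h])
    show "norm (?f \<zeta>) \<le> K * exp (- (- s - Im z) * Re \<zeta>)" if "a \<le> Re \<zeta>" "- d \<le> Im \<zeta>" "Im \<zeta> \<le> - c" for \<zeta>
      by (rule K) (use that c in auto)
  qed (use c z in auto)
  obtain g where g: "\<And>a b. (?f has_contour_integral (g b - g a)) (linepath a b)"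
    using entire_linepath_primitive[OF h] by blast
  have cv: "continuous_on A (\<lambda>y. ?f (Complex a y))" for A
    by (rule continuous_on_vertical[OF holomorphic_on_imp_continuous_on[OF h]]) auto
  have V: "\<i> * (LINT y:{-e..e}|lborel. ?f (Complex a y)) = g (Complex a e) - g (Complex a (-e))" if "e > 0" for e
  proof -
    have "- e < e" using that by simp
    from vertical_LINT[OF this cv] show ?thesis unfolding g[THEN contour_integral_unique] by (rule sym)
  qed
  define U where "U e = (LINT x:{a..}|lborel. ?f (Complex x e))" for e
  have r: "right_int a e P z = U e - U (- e) + (g (Complex a e) - g (Complex a (- e)))" if "e > 0" for e
    unfolding right_int_def wedge_int_def V[OF that] U_def ..
  have up': "U c - U d = g (Complex a d) - g (Complex a c)"
    using up unfolding U_def g[THEN contour_integral_unique] .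
  have lo': "U (- d) - U (- c) = g (Complex a (- c)) - g (Complex a (- d))"
    using lo unfolding U_def g[THEN contour_integral_unique] .
  have "right_int a c P z = U c - U (- c) + (g (Complex a c) - g (Complex a (- c)))" by (rule r[OF c(1)])
  also have "\<dots> = U d - U (- d) + (g (Complex a d) - g (Complex a (- d)))" using up' lo' by algebra
  also have "\<dots> = right_int a d P z" by (rule r[symmetric]) (use c in simp)
  finally show ?thesis .
qed simp

text \<open>Moving the base cuts a rectangle off the wedge. Its sides are finite, so a primitive of
  the entire integrand makes their total vanish.\<close>

lemma right_int_base:
  assumes a: "0 \<le> a" "a \<le> a'" and c: "0 < c" and z: "Im z < - s"
  shows "right_int a c P z = right_int a' c P z"
proof (cases "a = a'")
  case False
  let ?f = "\<lambda>\<zeta>. P \<zeta> * exp (- \<i> * z * \<zeta>)"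
  have h: "?f holomorphic_on UNIV" by (intro holomorphic_intros hol)
  have cv: "continuous_on A (\<lambda>y. ?f (Complex x y))" for A x
    by (rule continuous_on_vertical[OF holomorphic_on_imp_continuous_on[OF h]]) auto
  have ch: "continuous_on A (\<lambda>x. ?f (Complex x y))" for A y
    by (rule continuous_on_horizontal[OF holomorphic_on_imp_continuous_on[OF h]]) auto
  have split: "(LINT x:{a..}|lborel. ?f (Complex x e)) = contour_integral (linepath (Complex a e) (Complex a' e)) ?f + (LINT x:{a'..}|lborel. ?f (Complex x e))"
    if e: "\<bar>e\<bar> = c" for e
  proof -
    obtain K where K: "\<And>\<zeta>. a \<le> Re \<zeta> \<Longrightarrow> c \<le> \<bar>Im \<zeta>\<bar> \<Longrightarrow> \<bar>Im \<zeta>\<bar> \<le> c \<Longrightarrow> norm (?f \<zeta>) \<le> K * exp (- (- s - Im z) * Re \<zeta>)"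
      using kernel_bound_right[OF c order_refl a(1)] by blast
    have si: "set_integrable lborel {a..} (\<lambda>x. ?f (Complex x e))"
      by (rule set_integrable_line[OF _ ch, where C=K and d="- s - Im z"]) (use K[of "Complex _ e"] a e z in auto)
    have "AE x in lborel. x \<noteq> a'" by (rule AE_lborel_singleton)
    then have "AE x in lborel. \<not> (x \<in> {a..a'} \<and> x \<in> {a'..})" by eventually_elim auto
    then have "(LINT x:{a..a'} \<union> {a'..}|lborel. ?f (Complex x e)) = (LINT x:{a..a'}|lborel. ?f (Complex x e)) + (LINT x:{a'..}|lborel. ?f (Complex x e))"
      by (rule set_integral_Un_AE[OF _ _ _ set_integrable_subset[OF si] set_integrable_subset[OF si]]) (use a in auto)
    moreover have "{a..a'} \<union> {a'..} = {a..}" using a by auto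
    moreover have "contour_integral (linepath (Complex a e) (Complex a' e)) ?f = (LINT x:{a..a'}|lborel. ?f (Complex x e))"
      by (rule linepath_horizontal[OF _ ch]) (use a False in simp)
    ultimately show ?thesis by simp
  qed
  obtain g where g: "\<And>a b. (?f has_contour_integral (g b - g a)) (linepath a b)"
    using entire_linepath_primitive[OF h] by blast
  have V: "\<i> * (LINT y:{-c..c}|lborel. ?f (Complex x y)) = g (Complex x c) - g (Complex x (-c))" for x
  proof -
    have "- c < c" using c by simp
    from vertical_LINT[OF this cv] show ?thesis unfolding g[THEN contour_integral_unique] by (rule sym)
  qed
  define U where "U x e = (LINT x:{x..}|lborel. ?f (Complex x e))" for x e
  have r: "right_int x c P z = U x c - U x (- c) + (g (Complex x c) - g (Complex x (- c)))" for x
    unfolding right_int_def wedge_int_def V U_def ..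
  have sp: "U a e = g (Complex a' e) - g (Complex a e) + U a' e" if "\<bar>e\<bar> = c" for e
    using split[OF that] unfolding U_def g[THEN contour_integral_unique] .
  show ?thesis unfolding r using sp[of c] sp[of "- c"] c by simp
qed simp

lemma right_int_indep:
  assumes a: "0 \<le> a" "0 \<le> a'" and c: "0 < c" "0 < c'" and z: "Im z < - s"
  shows "right_int a c P z = right_int a' c' P z"
proof -
  have "right_int a c P z = right_int (max a a') c P z" by (rule right_int_base) (use assms in auto)
  also have "\<dots> = right_int (max a a') (max c c') P z" by (rule right_int_height) (use assms in auto)
  also have "\<dots> = right_int (max a a') c' P z" by (rule right_int_height[symmetric]) (use assms in auto)
  also have "\<dots> = right_int a' c' P z" by (rule right_int_base[symmetric]) (use assms in auto)
  finally show ?thesis .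
qed

end

section \<open>Cutting the strip contour into two wedges\<close>

text \<open>The left half of the contour is reflected into the right half-plane. Both wedges contain
  the same segment of the imaginary axis, which cancels in the difference.\<close>

lemma wedge_split:
  assumes "integrable lborel (\<lambda>x. f (Complex x c))" "integrable lborel (\<lambda>x. f (Complex x (- c)))"
  shows "strip_integral c f = wedge_int 0 c f - wedge_int 0 c (\<lambda>\<zeta>. f (- \<zeta>))"
proof -
  have neg: "- Complex u e = Complex (- u) (- e)" for u e by (simp add: complex_eq_iff)
  have L: "(LINT x:{..0}|lborel. f (Complex x e)) = (LINT x:{0..}|lborel. f (Complex (- x) e))" for e
    by (subst set_integral_reflect) (simp add: atLeast_def)
  have V: "(LINT u:{-c..c}|lborel. f (Complex 0 (- u))) = (LINT u:{-c..c}|lborel. f (Complex 0 u))"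
    by (subst set_integral_reflect) (auto intro: arg_cong[where f="\<lambda>A. set_lebesgue_integral lborel A _"])
  show ?thesis
    unfolding strip_integral_def wedge_int_def lborel_integral_split[OF assms(1), of 0] lborel_integral_split[OF assms(2), of 0] L
    by (simp add: neg V)
qed

lemma holomorphic_on_halfplanes:
  assumes "\<And>s. s \<in> T \<Longrightarrow> f holomorphic_on {z. Im z < - s}" "\<And>z. z \<in> A \<Longrightarrow> \<exists>s\<in>T. Im z < - s"
  shows "f holomorphic_on A"
proof (rule holomorphic_on_subset)
  show "f holomorphic_on (\<Union>s\<in>T. {z. Im z < - s})"
    by (intro holomorphic_on_UN_open assms(1)) (auto intro!: open_Collect_less continuous_intros)
  show "A \<subseteq> (\<Union>s\<in>T. {z. Im z < - s})" using assms(2) by auto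
qed

text \<open>For given s and K the wedge is replaced by one with half-height s and base max K 0,
  which converts its geometry into the required growth and decay.\<close>

lemma right_int_FO:
  assumes P: "P holomorphic_on UNIV" and g: "\<And>s. s > 0 \<Longrightarrow> grow s P"
  shows "restr lower (\<lambda>z. - right_int 0 1 P z) \<in> FO_pinf"
  unfolding FO_pinf_iff
proof (intro conjI allI impI)
  have "right_int 0 1 P holomorphic_on lower"
  proof (rule holomorphic_on_halfplanes[where T="{0<..}"])
    show "right_int 0 1 P holomorphic_on {z. Im z < - s}" if "s \<in> {0<..}" for s
    proof -
      interpret entire_growth P s by unfold_locales (use P g that in auto)
      show ?thesis by (rule right_int_holomorphic) auto
    qed
    show "\<exists>s\<in>{0<..}. Im z < - s" if "z \<in> lower" for z
      using that by (intro bexI[of _ "- Im z / 2"]) (auto simp: lower_def)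
  qed
  then show "restr lower (\<lambda>z. - right_int 0 1 P z) \<in> hol lower"
    by (intro restr_hol holomorphic_intros)
  fix s K b :: real assume s: "s > 0" and b: "b > 0"
  define a where "a = max K 0"
  \<comment> \<open>Half of the distance b pays for the growth of P, the other half is the margin
    that \<open>right_int_bound\<close> requires.\<close>
  interpret entire_growth P "b / 2" by unfold_locales (use P g b in auto)
  obtain C where C: "C \<ge> 0" "\<And>z. Im z \<le> - (b / 2) - b / 2 \<Longrightarrow> norm (right_int a s P z) \<le> C * exp (s * \<bar>Re z\<bar> + a * Im z)"
    using right_int_bound[of a s "b / 2"] s b by (auto simp: a_def)
  have "norm (restr lower (\<lambda>z. - right_int 0 1 P z) z) \<le> C * exp (s * \<bar>Re z\<bar> - K * \<bar>Im z\<bar>)" if z: "Im z \<le> - b" for z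
  proof -
    have "K * \<bar>Im z\<bar> \<le> a * \<bar>Im z\<bar>" by (intro mult_right_mono) (auto simp: a_def)
    then have e: "s * \<bar>Re z\<bar> + a * Im z \<le> s * \<bar>Re z\<bar> - K * \<bar>Im z\<bar>" using z b by simp
    have "norm (restr lower (\<lambda>z. - right_int 0 1 P z) z) \<le> norm (right_int 0 1 P z)" by (simp add: restr_def)
    also have "right_int 0 1 P z = right_int a s P z" by (rule right_int_indep) (use s z b in \<open>auto simp: a_def\<close>)
    also have "norm \<dots> \<le> C * exp (s * \<bar>Re z\<bar> + a * Im z)" by (rule C(2)) (use z in simp)
    also have "\<dots> \<le> C * exp (s * \<bar>Re z\<bar> - K * \<bar>Im z\<bar>)" using e C(1) by (intro mult_left_mono) auto
    finally show ?thesis .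
  qed
  then show "\<exists>C. \<forall>z. Im z \<le> - b \<longrightarrow> norm (restr lower (\<lambda>z. - right_int 0 1 P z) z) \<le> C * exp (s * \<bar>Re z\<bar> - K * \<bar>Im z\<bar>)"
    by blast
qed

lemma right_int_H1:
  assumes P: "P holomorphic_on UNIV" and g: "\<And>s. grow s P"
  shows "right_int 0 1 P \<in> H1 1"
proof -
  have h: "right_int 0 1 P holomorphic_on UNIV"
  proof (rule holomorphic_on_halfplanes[where T=UNIV])
    show "right_int 0 1 P holomorphic_on {z. Im z < - s}" for s
    proof -
      interpret entire_growth P s by unfold_locales (use P g in auto)
      show ?thesis by (rule right_int_holomorphic) auto
    qed
    show "\<exists>s\<in>UNIV. Im z < - s" for z by (intro bexI[of _ "- Im z - 1"]) auto
  qed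
  have "\<exists>C. \<forall>z. 1 * Im z \<le> b \<longrightarrow> norm (right_int 0 1 P z) \<le> C * exp (\<epsilon> * \<bar>Re z\<bar> - K * \<bar>Im z\<bar>)" if \<epsilon>: "\<epsilon> > 0" for \<epsilon> K b
  proof -
    define a where "a = max K 0"
    \<comment> \<open>P decays at every rate, so the rate -(b+1) is available; together with the
      margin 1 it admits all z with Im z \<le> b.\<close>
    interpret entire_growth P "- (b + 1)" by unfold_locales (use P g in auto)
    obtain C where C: "C \<ge> 0" "\<And>z. Im z \<le> - (- (b + 1)) - 1 \<Longrightarrow> norm (right_int a \<epsilon> P z) \<le> C * exp (\<epsilon> * \<bar>Re z\<bar> + a * Im z)"
      using right_int_bound[of a \<epsilon> 1] \<epsilon> by (auto simp: a_def)
    have "norm (right_int 0 1 P z) \<le> (C * exp (2 * a * \<bar>b\<bar>)) * exp (\<epsilon> * \<bar>Re z\<bar> - K * \<bar>Im z\<bar>)" if z: "Im z \<le> b" for z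
    proof -
      have a0: "a \<ge> 0" by (simp add: a_def)
      have "K * \<bar>Im z\<bar> \<le> a * \<bar>Im z\<bar>" by (intro mult_right_mono) (auto simp: a_def)
      \<comment> \<open>For 0 < Im z \<le> b the factor exp(a Im z) grows rather than decays; on
        this bounded range of heights the discrepancy is the constant exp(2 a |b|).\<close>
      moreover have "a * Im z + a * \<bar>Im z\<bar> \<le> 2 * a * \<bar>b\<bar>"
      proof (cases "Im z \<le> 0")
        case False
        then have "a * Im z \<le> a * \<bar>b\<bar>" using z a0 by (intro mult_left_mono) auto
        then show ?thesis using False by simp
      qed (use a0 in simp)
      ultimately have e: "\<epsilon> * \<bar>Re z\<bar> + a * Im z \<le> 2 * a * \<bar>b\<bar> + (\<epsilon> * \<bar>Re z\<bar> - K * \<bar>Im z\<bar>)" by simp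
      have "right_int 0 1 P z = right_int a \<epsilon> P z" by (rule right_int_indep) (use \<epsilon> z in \<open>auto simp: a_def\<close>)
      also have "norm \<dots> \<le> C * exp (\<epsilon> * \<bar>Re z\<bar> + a * Im z)" by (rule C(2)) (use z in simp)
      also have "\<dots> \<le> C * exp (2 * a * \<bar>b\<bar> + (\<epsilon> * \<bar>Re z\<bar> - K * \<bar>Im z\<bar>))" using e C(1) by (intro mult_left_mono) auto
      finally show ?thesis by (simp only: exp_add mult.assoc)
    qed
    then show ?thesis by (intro exI[of _ "C * exp (2 * a * \<bar>b\<bar>)"]) simp
  qed
  with h show ?thesis using H1_iff[of 1] by simp
qed

lemma H1_reflect: assumes "f \<in> H1 1" shows "(\<lambda>z. f (- z)) \<in> H1 (-1)"
proof -
  have fh: "f holomorphic_on UNIV" and fb: "\<And>\<epsilon> K b. \<epsilon> > 0 \<Longrightarrow> \<exists>C. \<forall>z. 1 * Im z \<le> b \<longrightarrow> norm (f z) \<le> C * exp (\<epsilon> * \<bar>Re z\<bar> - K * \<bar>Im z\<bar>)"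
    using assms H1_iff[of 1] by auto
  have "(\<lambda>z. f (- z)) holomorphic_on UNIV"
    by (rule holomorphic_on_compose_gen[of uminus UNIV f UNIV, unfolded comp_def]) (auto intro!: holomorphic_intros fh)
  moreover have "\<exists>C. \<forall>z. (-1) * Im z \<le> b \<longrightarrow> norm (f (- z)) \<le> C * exp (\<epsilon> * \<bar>Re z\<bar> - K * \<bar>Im z\<bar>)" if e: "\<epsilon> > 0" for \<epsilon> K b
  proof -
    obtain C where C: "\<And>z. 1 * Im z \<le> b \<Longrightarrow> norm (f z) \<le> C * exp (\<epsilon> * \<bar>Re z\<bar> - K * \<bar>Im z\<bar>)" using fb[OF e] by blast
    have "norm (f (- z)) \<le> C * exp (\<epsilon> * \<bar>Re z\<bar> - K * \<bar>Im z\<bar>)" if "(-1) * Im z \<le> b" for z using C[of "- z"] that by simp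
    then show ?thesis by blast
  qed
  ultimately show ?thesis using H1_iff[of "-1"] by simp
qed

lemma entire_reflect: "P holomorphic_on UNIV \<Longrightarrow> (\<lambda>z. P (- z)) holomorphic_on UNIV" for P :: "complex \<Rightarrow> complex"
  by (rule holomorphic_on_compose_gen[of uminus UNIV P UNIV, unfolded comp_def]) (auto intro!: holomorphic_intros)

text \<open>The integrand extends to an entire function, so the contour splits into two wedges. The
  right one gives an element of \<open>H1 1\<close>, the reflected left one an element of
  \<open>H1 (-1)\<close>.\<close>

lemma lap_Hminf_pm: assumes "F \<in> Hminf_pm" shows "lap 1 F \<in> FG_pm"
proof -
  obtain p where F: "F = restr (- \<real>) p" and p: "p holomorphic_on UNIV" "\<And>s. grow s p"
    using assms by (auto simp: Hminf_pm_def Hminf_pm_iff)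
  let ?q = "\<lambda>z. p (- z)"
  have q: "?q holomorphic_on UNIV" "\<And>s. grow s ?q" using p entire_reflect grow_reflect by auto
  have "lap 1 F z = - right_int 0 1 ?q (- z) + right_int 0 1 p z" for z
  proof -
    let ?f = "\<lambda>\<zeta>. p \<zeta> * exp (- \<i> * z * \<zeta>)"
    have fh: "?f holomorphic_on UNIV" by (intro holomorphic_intros p)
    have "grow_on 1 1 (- (\<bar>Im z\<bar> + 1)) p" using p(2) by (simp add: grow_def)
    then obtain K where K: "K \<ge> 0" "\<And>\<zeta>. 1 \<le> \<bar>Im \<zeta>\<bar> \<Longrightarrow> \<bar>Im \<zeta>\<bar> \<le> 1 \<Longrightarrow> norm (exp (- \<i> * z * \<zeta>) * p \<zeta>) \<le> K * exp (- 1 * \<bar>Re \<zeta>\<bar>)"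
      by (rule kernel_shift_bound) auto
    have int: "integrable lborel (\<lambda>x. ?f (Complex x e))" if "e \<in> {1,-1}" for e
    proof (rule integrable_line[where C=K and d=1])
      show "continuous_on UNIV (\<lambda>x. ?f (Complex x e))"
        by (rule continuous_on_horizontal[OF holomorphic_on_imp_continuous_on[OF fh]]) auto
      show "norm (?f (Complex x e)) \<le> K * exp (- 1 * \<bar>x\<bar>)" for x
        using K(2)[of "Complex x e"] that by (auto simp: norm_mult mult.commute)
    qed simp
    have "lap 1 F z = strip_integral 1 ?f"
      unfolding lap_def F by (rule strip_integral_cong) (auto simp: restr_def complex_is_Real_iff)
    also have "\<dots> = wedge_int 0 1 ?f - wedge_int 0 1 (\<lambda>\<zeta>. ?f (- \<zeta>))"
      by (rule wedge_split) (use int in auto)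
    finally show ?thesis by (simp add: right_int_def)
  qed
  then have "lap 1 F = (\<lambda>z. - right_int 0 1 ?q (- z) + right_int 0 1 p z)" by auto
  also have "\<dots> \<in> FG_pm" unfolding FG_pm_def
    by (intro fsum_spaceI fsubspaceD(5)[OF fsubspaces(5)] H1_reflect[OF right_int_H1[OF q]] right_int_H1[OF p])
  finally show ?thesis .
qed

lemma Pfourier_reflect: "Pfourier_fun (\<lambda>z. \<phi> (- z)) \<zeta> = Pfourier_fun \<phi> (- \<zeta>)"
  unfolding Pfourier_fun_def
  using lborel_integral_reflect[of "\<lambda>x. \<phi> (complex_of_real x) * exp (- \<i> * complex_of_real x * (- \<zeta>))"] by simp

lemma Pstep_reflect:
  assumes \<phi>: "\<phi> \<in> Pstep n" and n: "1 \<le> n" shows "(\<lambda>z. \<phi> (- z)) \<in> Pstep (2 * n)"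
proof (rule PstepI[where d="1 / real n"])
  show lt: "1 / real (2 * n) < 1 / real n" using n by (intro divide_strict_left_mono) auto
  show "(\<lambda>z. \<phi> (- z)) holomorphic_on ostrip (1 / real n)"
    by (rule holomorphic_on_compose_gen[OF _ Pstep_hol[OF \<phi>], unfolded comp_def]) (auto intro!: holomorphic_intros simp: ostrip_def)
  fix z assume z: "\<bar>Im z\<bar> \<le> 1 / real (2 * n)"
  then have "norm (\<phi> (- z)) \<le> Pnorm n \<phi> * exp (- (1 / real n) * \<bar>Re z\<bar>)"
    using Pstep_bound'[OF \<phi>, of "- z"] lt by simp
  also have "\<dots> \<le> Pnorm n \<phi> * exp (- (1 / real (2 * n)) * \<bar>Re z\<bar>)"
    using mult_right_mono[OF less_imp_le[OF lt], of "\<bar>Re z\<bar>"] Pnorm_nonneg[OF \<phi> n] by (intro mult_left_mono) auto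
  finally show "norm (\<phi> (- z)) \<le> Pnorm n \<phi> * exp (- (1 / real (2 * n)) * \<bar>Re z\<bar>)" .
qed

lemma line_int_reflect: "line_int c (\<lambda>z. f (- z)) = line_int (- c) f"
proof -
  have "- Complex x c = Complex (- x) (- c)" for x by (simp add: complex_eq_iff)
  then show ?thesis unfolding line_int_def
    using lborel_integral_reflect[of "\<lambda>x. f (Complex x (- c))"] by simp
qed

lemma line_int_cong: "(\<And>z. Im z = c \<Longrightarrow> f z = g z) \<Longrightarrow> line_int c f = line_int c g"
  by (simp add: line_int_def)

lemma line_int_uminus: "line_int c (\<lambda>z. - f z) = - line_int c f"
  by (simp add: line_int_def)

text \<open>A boundary value supported at \<open>\<plusminus>\<infinity>\<close> is represented by an entire function, so the integration
  contour can be cut at the imaginary axis into a right and a left part.\<close>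

lemma Ftrans_Oexp_pm:
  assumes F: "F \<in> Oexp_pm" obtains G where "G \<in> FO_pm" "Ftrans F G"
proof -
  obtain P where FP: "F = restr (- \<real>) P" and P: "P holomorphic_on UNIV" "\<And>s. s > 0 \<Longrightarrow> grow s P"
    using F by (auto simp: Oexp_pm_def Oexp_pm_iff)
  let ?q = "\<lambda>z. P (- z)"
  have q: "?q holomorphic_on UNIV" "\<And>s. s > 0 \<Longrightarrow> grow s ?q" using P entire_reflect grow_reflect by auto
  \<comment> \<open>The strip contour enters the lower line with a minus sign and
    \<open>wedge_split\<close> enters the reflected wedge with a minus sign; hence the sign in R
    fits the lower half-plane and, after reflection, the upper one.\<close>
  define R where "R p = restr lower (\<lambda>z. - right_int 0 1 p z)" for p
  define G where "G = (\<lambda>z. R ?q (- z) + R P z)"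
  have "(\<lambda>z. R ?q (- z)) \<in> FO_minf" unfolding FO_minf_iff R_def using right_int_FO[OF q] by simp
  moreover have "R P \<in> FO_pinf" unfolding R_def by (rule right_int_FO[OF P])
  ultimately have GF: "G \<in> FO_pm" unfolding G_def FO_pm_def by (rule fsum_spaceI)
  have FO: "F \<in> Oexp UNIV" using F Oexp_pm_subset by blast
  have "Ftrans F G"
  proof (rule FtransI[OF FO])
    show "G \<in> Oexp UNIV" using GF FO_pm_subset by blast
    fix n \<phi> assume n: "1 \<le> n" and \<phi>: "\<phi> \<in> Pstep n"
    let ?m = "2 * n"
    have m: "1 \<le> ?m" using n by simp
    define c where "c = 1 / (8 * real n)"
    have c: "0 < c" "c < 1 / real n" "c < 1 / real ?m" "\<bar>- c\<bar> < 1 / real ?m" using n(1) by (auto simp: c_def field_simps)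
    have \<phi>m: "\<phi> \<in> Pstep ?m" by (rule Pstep_mono[OF n _ \<phi>]) simp
    have \<phi>r: "(\<lambda>z. \<phi> (- z)) \<in> Pstep ?m" by (rule Pstep_reflect[OF \<phi> n])
    have pair: "line_int (- c) (\<lambda>z. right_int 0 1 p z * \<psi> z) = wedge_int 0 c (\<lambda>\<zeta>. p \<zeta> * Pfourier_fun \<psi> \<zeta>)"
      if p: "p holomorphic_on UNIV" "\<And>s. s > 0 \<Longrightarrow> grow s p" and \<psi>: "\<psi> \<in> Pstep ?m" for p \<psi>
    proof -
      \<comment> \<open>The rate c/2 puts the line at height -c inside the half-plane Im z < -c/2 of
        convergence.\<close>
      interpret entire_growth p "c / 2" by unfold_locales (use p c in auto)
      have "line_int (- c) (\<lambda>z. right_int 0 1 p z * \<psi> z) = line_int (- c) (\<lambda>z. right_int 0 c p z * \<psi> z)"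
      proof (rule line_int_cong)
        fix z assume "Im z = - c"
        then have "right_int 0 1 p z = right_int 0 c p z" by (intro right_int_indep) (use c in auto)
        then show "right_int 0 1 p z * \<psi> z = right_int 0 c p z * \<psi> z" by simp
      qed
      also have "\<dots> = wedge_int 0 c (\<lambda>\<zeta>. p \<zeta> * Pfourier_fun \<psi> \<zeta>)"
        by (rule right_int_pairing[OF \<psi> m c(1,3,4)]) (use c in simp)
      finally show ?thesis .
    qed
    let ?f = "\<lambda>\<zeta>. P \<zeta> * Pfourier_fun \<phi> \<zeta>"
    have "line_int c (\<lambda>\<zeta>. G \<zeta> * \<phi> \<zeta>) = line_int c (\<lambda>\<zeta>. (\<lambda>z. - (right_int 0 1 ?q z * \<phi> (- z))) (- \<zeta>))"
      by (rule line_int_cong) (use c in \<open>auto simp: G_def R_def restr_def lower_def\<close>)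
    also have "\<dots> = - line_int (- c) (\<lambda>z. right_int 0 1 ?q z * \<phi> (- z))"
      using line_int_reflect[of c "\<lambda>z. - (right_int 0 1 ?q z * \<phi> (- z))"] by (simp add: line_int_uminus)
    also have "\<dots> = - wedge_int 0 c (\<lambda>\<zeta>. ?f (- \<zeta>))"
      using pair[OF q \<phi>r] by (simp add: Pfourier_reflect)
    finally have 1: "line_int c (\<lambda>\<zeta>. G \<zeta> * \<phi> \<zeta>) = - wedge_int 0 c (\<lambda>\<zeta>. ?f (- \<zeta>))" .
    have "line_int (- c) (\<lambda>\<zeta>. G \<zeta> * \<phi> \<zeta>) = line_int (- c) (\<lambda>\<zeta>. - (right_int 0 1 P \<zeta> * \<phi> \<zeta>))"
      by (rule line_int_cong) (use c in \<open>auto simp: G_def R_def restr_def lower_def\<close>)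
    also have "\<dots> = - wedge_int 0 c ?f" unfolding line_int_uminus using pair[OF P \<phi>m] by simp
    finally have 2: "line_int (- c) (\<lambda>\<zeta>. G \<zeta> * \<phi> \<zeta>) = - wedge_int 0 c ?f" .
    have int: "integrable lborel (\<lambda>x. ?f (Complex x e))" if e: "e \<in> {c, -c}" for e
    proof -
      have "e \<noteq> 0" "\<bar>e\<bar> < 1 / real ?m" using e c by auto
      from Oexp_line_integrable[OF FO Pfourier_Pstep[OF \<phi> n] m this]
      show ?thesis using \<open>e \<noteq> 0\<close> by (simp add: FP restr_def complex_is_Real_iff)
    qed
    have "strip_integral c (\<lambda>\<zeta>. G \<zeta> * \<phi> \<zeta>) = wedge_int 0 c ?f - wedge_int 0 c (\<lambda>\<zeta>. ?f (- \<zeta>))"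
      unfolding strip_integral_eq 1 2 by simp
    also have "\<dots> = strip_integral c ?f" by (rule wedge_split[symmetric]) (use int in auto)
    also have "\<dots> = strip_integral c (\<lambda>\<zeta>. F \<zeta> * Pfourier_fun \<phi> \<zeta>)"
      by (rule strip_integral_cong) (use c in \<open>auto simp: FP restr_def complex_is_Real_iff\<close>)
    finally show "\<exists>c c'. 0 < c \<and> c < 1 / real n \<and> 0 < c' \<and> c' < 1 / real (2 * n) \<and>
        strip_integral c (\<lambda>\<zeta>. G \<zeta> * \<phi> \<zeta>) = strip_integral c' (\<lambda>\<zeta>. F \<zeta> * Pfourier_fun \<phi> \<zeta>)"
      using c by blast
  qed
  with GF show thesis by (rule that)
qed

section \<open>Decomposition of representatives and surjectivity modulo
  \<open>Oexp_FO\<close>\<close>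

lemma hol_nonreal_split:
  assumes "G \<in> hol (- \<real>)"
  obtains F h where "F \<in> Hminf UNIV" "h holomorphic_on UNIV" "G = (\<lambda>z. F z + restr (- \<real>) h z)" "\<And>s. grow s (\<lambda>z. G z - h z)"
proof -
  have Gh: "G holomorphic_on - \<real>" and G0: "\<And>z. z \<in> \<real> \<Longrightarrow> G z = 0" using assms by (auto simp: hol_def)
  obtain h where h: "h holomorphic_on UNIV" "\<And>s. grow s (\<lambda>z. G z - h z)" using rapid_approx[OF Gh] by blast
  let ?F = "restr (- \<real>) (\<lambda>z. G z - h z)"
  have "?F \<in> hol (- \<real>)" by (intro restr_hol holomorphic_intros Gh holomorphic_on_subset[OF h(1)]) auto
  then have "?F \<in> Hminf UNIV" using h(2) grow_restr by (auto simp: Hminf_UNIV_iff)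
  moreover have "G = (\<lambda>z. ?F z + restr (- \<real>) h z)" using G0 by (auto simp: restr_def)
  ultimately show thesis using that h by blast
qed

text \<open>The entire correction h is G minus a rapidly decreasing function, so it inherits the
  growth of G and represents a boundary value supported at infinity.\<close>

lemma Oexp_decompose:
  assumes G: "G \<in> Oexp UNIV"
  obtains F P where "F \<in> Hminf UNIV" "P \<in> Oexp_pm" "G = (\<lambda>z. F z + P z)"
proof -
  have "G \<in> hol (- \<real>)" and Gg: "\<And>s. s > 0 \<Longrightarrow> grow s G" using G by (auto simp: Oexp_UNIV_iff)
  then obtain F h where Fh: "F \<in> Hminf UNIV" "h holomorphic_on UNIV" "G = (\<lambda>z. F z + restr (- \<real>) h z)" "\<And>s. grow s (\<lambda>z. G z - h z)"
    using hol_nonreal_split by blast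
  have "grow s h" if "s > 0" for s
    using grow_add[OF Gg[OF that] grow_cmult[OF Fh(4)[of s], of "-1"]] by simp
  then have "restr (- \<real>) h \<in> Oexp_pm" using Fh(2) by (auto simp: Oexp_pm_def Oexp_pm_iff)
  with Fh that show thesis by blast
qed

lemma Ftrans_decompose:
  assumes "F \<in> Hminf UNIV" "P \<in> Oexp_pm"
  obtains G where "G \<in> FO_pm" "Ftrans (\<lambda>z. F z + P z) (\<lambda>z. plus_part (lap 1 F) z + G z)"
  using Ftrans_Oexp_pm[OF assms(2)] Ftrans_add[OF Ftrans_lap[OF assms(1)]] by metis

lemma Ftrans_ex: assumes "F \<in> Oexp UNIV" shows "\<exists>G. Ftrans F G"
proof -
  obtain F' P where FP: "F' \<in> Hminf UNIV" "P \<in> Oexp_pm" "F = (\<lambda>z. F' z + P z)" using Oexp_decompose[OF assms] .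
  obtain G where "Ftrans (\<lambda>z. F' z + P z) (\<lambda>z. plus_part (lap 1 F') z + G z)" using Ftrans_decompose[OF FP(1,2)] .
  then show ?thesis unfolding FP(3) by blast
qed

text \<open>G and the transform computed from the decomposition are transforms of the same function,
  so they differ only by an element of \<open>Oexp_entire\<close>; the contribution from infinity
  lies in \<open>FO_pm\<close>.\<close>

lemma Oexp_mod_FO:
  assumes G: "G \<in> Oexp UNIV"
  obtains E where "E \<in> FG_Rbar" "(\<lambda>z. G z - plus_part E z) \<in> Oexp_FO"
proof -
  obtain F where F: "Ftrans (\<lambda>z. G (- z)) F" using Ftrans_ex[OF Oexp_reflect[OF G]] by blast
  define F' where "F' = (\<lambda>z. - (1 / (2 * of_real pi)) * F z)"
  have F': "Ftrans F' G" unfolding F'_def by (rule Ftrans_surj[OF G F])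
  then have F'O: "F' \<in> Oexp UNIV" by (simp add: Ftrans_def)
  obtain H P where HP: "H \<in> Hminf UNIV" "P \<in> Oexp_pm" "F' = (\<lambda>z. H z + P z)" using Oexp_decompose[OF F'O] .
  obtain Q where Q: "Q \<in> FO_pm" "Ftrans F' (\<lambda>z. plus_part (lap 1 H) z + Q z)" using Ftrans_decompose[OF HP(1,2)] unfolding HP(3) .
  have "(\<lambda>z. G z - (plus_part (lap 1 H) z + Q z)) \<in> Oexp_entire" by (rule Ftrans_unique[OF F' Q(2)])
  then have "(\<lambda>z. (G z - (plus_part (lap 1 H) z + Q z)) + Q z) \<in> Oexp_FO"
    unfolding Oexp_FO_def by (rule fsum_spaceI[OF _ Q(1)])
  then have "(\<lambda>z. G z - plus_part (lap 1 H) z) \<in> Oexp_FO" by (simp add: algebra_simps)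
  with lap_FG[OF HP(1) zero_less_one] show thesis by (rule that)
qed

section \<open>Hyperfunctions and the isomorphism\<close>

lemma to_hyp_cls:
  assumes B: "fsubspace B" "B \<subseteq> hol_entire" and A: "A \<subseteq> hol (- \<real>)" and F: "F \<in> A"
  shows "to_hyp (cls A B F) = cls (hol (- \<real>)) hol_entire F"
  unfolding to_hyp_def
proof (rule the_elem_image[OF cls_self[OF B(1) F]])
  fix G assume "G \<in> cls A B F"
  then have "G \<in> cls (hol (- \<real>)) hol_entire F" using A B(2) by (auto simp: cls_iff)
  then show "cls (hol (- \<real>)) hol_entire G = cls (hol (- \<real>)) hol_entire F" by (rule cls_eq_of_mem[OF fsubspaces'(5)])
qed

text \<open>The hypothesis \<open>key\<close> isolates the only point at which the two growth
  conditions differ: an entire extension must satisfy the same growth as the function off the real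
  line.\<close>

lemma to_hyp_inj:
  assumes A: "fsubspace A" "A \<subseteq> hol (- \<real>)" and B: "fsubspace B" "B \<subseteq> hol_entire"
    and key: "\<And>F. F \<in> A \<Longrightarrow> F \<in> hol_entire \<Longrightarrow> F \<in> B"
  shows "inj_on to_hyp (quot A B)"
proof (rule inj_onI)
  fix X Y assume XY: "X \<in> quot A B" "Y \<in> quot A B" and eq: "to_hyp X = to_hyp Y"
  obtain F G where F: "F \<in> A" "X = cls A B F" and G: "G \<in> A" "Y = cls A B G" using XY by (auto simp: quot_iff)
  have "cls (hol (- \<real>)) hol_entire F = cls (hol (- \<real>)) hol_entire G"
    using eq unfolding F(2) G(2) to_hyp_cls[OF B A(2) F(1)] to_hyp_cls[OF B A(2) G(1)] .
  then have "(\<lambda>z. F z - G z) \<in> hol_entire"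
    using cls_eq_iff[OF fsubspaces'(5), of F "hol (- \<real>)" G] F(1) G(1) A(2) by blast
  then have "(\<lambda>z. F z - G z) \<in> B" by (intro key fsubspaceD(4)[OF A(1) F(1) G(1)])
  then show "X = Y" unfolding F(2) G(2) by (simp add: cls_eq_iff[OF B(1) F(1) G(1)])
qed

lemma pm_subset_hol_entire: "Oexp_pm \<subseteq> hol_entire" "Hminf_pm \<subseteq> hol_entire"
  by (auto simp: Oexp_pm_def Hminf_pm_def hol_entire_def Oexp_pm_iff Hminf_pm_iff hol_def)

lemma hol_entire_grow:
  assumes "F \<in> hol_entire" shows "\<exists>h. h holomorphic_on UNIV \<and> F = restr (- \<real>) h \<and> (\<forall>s. grow s F \<longrightarrow> grow s h)"
proof -
  obtain h where h: "h holomorphic_on UNIV" "F = restr (- \<real>) h" using assms by (auto simp: hol_entire_def hol_def)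
  have "grow s h" if "grow s F" for s
    using that by (rule grow_cong) (simp add: h(2) restr_def)
  with h show ?thesis by blast
qed

lemma to_hyp_inj_Oexp: "inj_on to_hyp (quot (Oexp UNIV) Oexp_pm)"
proof (rule to_hyp_inj[OF fsubspaces(1) _ fsubspaces'(2) pm_subset_hol_entire(1)])
  show "Oexp UNIV \<subseteq> hol (- \<real>)" by (auto simp: Oexp_UNIV_iff)
  fix F assume F: "F \<in> Oexp UNIV" "F \<in> hol_entire"
  obtain h where "h holomorphic_on UNIV" "F = restr (- \<real>) h" "\<And>s. grow s F \<Longrightarrow> grow s h" using hol_entire_grow[OF F(2)] by blast
  then show "F \<in> Oexp_pm" using F(1) by (auto simp: Oexp_pm_def Oexp_pm_iff Oexp_UNIV_iff)
qed

lemma to_hyp_inj_Hminf: "inj_on to_hyp (quot (Hminf UNIV) Hminf_pm)"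
proof (rule to_hyp_inj[OF fsubspaces(2) _ fsubspaces'(4) pm_subset_hol_entire(2)])
  show "Hminf UNIV \<subseteq> hol (- \<real>)" by (auto simp: Hminf_UNIV_iff)
  fix F assume F: "F \<in> Hminf UNIV" "F \<in> hol_entire"
  obtain h where "h holomorphic_on UNIV" "F = restr (- \<real>) h" "\<And>s. grow s F \<Longrightarrow> grow s h" using hol_entire_grow[OF F(2)] by blast
  then show "F \<in> Hminf_pm" using F(1) by (auto simp: Hminf_pm_def Hminf_pm_iff Hminf_UNIV_iff)
qed

text \<open>One rapidly decreasing F represents f in both quotients. Since \<open>to_hyp\<close> is
  injective on each of them, exhibiting this preimage evaluates both inverses.\<close>

lemma hyperfunction_representative:
  assumes f: "f \<in> hyperfunctions"
  obtains F where "F \<in> Hminf UNIV" "R_L_inv f = cls (Hminf UNIV) Hminf_pm F" "R_R_inv f = cls (Oexp UNIV) Oexp_pm F"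
proof -
  obtain G where G: "G \<in> hol (- \<real>)" "f = cls (hol (- \<real>)) hol_entire G" using f by (auto simp: hyperfunctions_def quot_iff)
  obtain F h where Fh: "F \<in> Hminf UNIV" "h holomorphic_on UNIV" "G = (\<lambda>z. F z + restr (- \<real>) h z)" "\<And>s. grow s (\<lambda>z. G z - h z)"
    using hol_nonreal_split[OF G(1)] by blast
  have F: "F \<in> hol (- \<real>)" "F \<in> Oexp UNIV" using Fh(1) Hminf_subset_Oexp by (auto simp: Hminf_UNIV_iff)
  have "(\<lambda>z. G z - F z) = restr (- \<real>) h" by (auto simp: Fh(3))
  also have "\<dots> \<in> hol_entire" using Fh(2) by (auto simp: hol_entire_def hol_def)
  finally have f_eq: "f = cls (hol (- \<real>)) hol_entire F"
    unfolding G(2) by (simp add: cls_eq_iff[OF fsubspaces'(5) G(1) F(1)])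
  have "R_L_inv f = cls (Hminf UNIV) Hminf_pm F"
    unfolding R_L_inv_def
  proof (rule the_inv_into_f_eq[OF to_hyp_inj_Hminf _ cls_quot[OF Fh(1)]])
    show "to_hyp (cls (Hminf UNIV) Hminf_pm F) = f" unfolding f_eq
      by (rule to_hyp_cls[OF fsubspaces'(4) pm_subset_hol_entire(2) _ Fh(1)]) (auto simp: Hminf_UNIV_iff)
  qed
  moreover have "R_R_inv f = cls (Oexp UNIV) Oexp_pm F"
    unfolding R_R_inv_def
  proof (rule the_inv_into_f_eq[OF to_hyp_inj_Oexp _ cls_quot[OF F(2)]])
    show "to_hyp (cls (Oexp UNIV) Oexp_pm F) = f" unfolding f_eq
      by (rule to_hyp_cls[OF fsubspaces'(2) pm_subset_hol_entire(1) _ F(2)]) (auto simp: Oexp_UNIV_iff)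
  qed
  ultimately show thesis using that Fh(1) by blast
qed

section \<open>The restriction map and the comparison of the two transforms\<close>

lemma plus_part_diff: "(\<lambda>z. plus_part F z - plus_part G z) = plus_part (\<lambda>z. F z - G z)"
  by (auto simp: plus_part_def restr_def)

lemma plus_part_add: "(\<lambda>z. plus_part F z + plus_part G z) = plus_part (\<lambda>z. F z + G z)"
  by (auto simp: plus_part_def restr_def)

lemma plus_part_cmult: "(\<lambda>z. a * plus_part F z) = plus_part (\<lambda>z. a * F z)"
  by (auto simp: plus_part_def restr_def)

lemma I_map_cls:
  assumes F: "F \<in> FG_Rbar" shows "I_map (cls FG_Rbar FG_pm F) = cls (Oexp UNIV) Oexp_FO (plus_part F)"
  unfolding I_map_def
proof (rule the_elem_image[OF cls_self[OF fsubspaces'(7) F]])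
  fix G assume "G \<in> cls FG_Rbar FG_pm F"
  then have G: "G \<in> FG_Rbar" "(\<lambda>z. G z - F z) \<in> FG_pm"
    using fsubspaceD(5)[OF fsubspaces'(7), of "\<lambda>z. F z - G z"] by (auto simp: cls_iff)
  then show "cls (Oexp UNIV) Oexp_FO (plus_part G) = cls (Oexp UNIV) Oexp_FO (plus_part F)"
    unfolding cls_eq_iff[OF fsubspaces'(8) plus_part_Oexp[OF G(1)] plus_part_Oexp[OF F]] plus_part_diff
    by (intro plus_part_FG_pm)
qed

lemma I_map_bij: "bij_betw I_map (quot FG_Rbar FG_pm) (quot (Oexp UNIV) Oexp_FO)"
proof (rule bij_betw_imageI)
  show "inj_on I_map (quot FG_Rbar FG_pm)"
  proof (rule inj_onI)
    fix X Y assume XY: "X \<in> quot FG_Rbar FG_pm" "Y \<in> quot FG_Rbar FG_pm" and eq: "I_map X = I_map Y"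
    obtain F G where F: "F \<in> FG_Rbar" "X = cls FG_Rbar FG_pm F" and G: "G \<in> FG_Rbar" "Y = cls FG_Rbar FG_pm G"
      using XY by (auto simp: quot_iff)
    have "plus_part (\<lambda>z. F z - G z) \<in> Oexp_FO"
      using eq unfolding F(2) G(2) I_map_cls[OF F(1)] I_map_cls[OF G(1)]
        cls_eq_iff[OF fsubspaces'(8) plus_part_Oexp[OF F(1)] plus_part_Oexp[OF G(1)]] plus_part_diff .
    then have "(\<lambda>z. F z - G z) \<in> FG_pm"
      by (rule FG_pm_of_plus_part[OF fsubspaceD(4)[OF fsubspaces'(9) F(1) G(1)]])
    then show "X = Y" unfolding F(2) G(2) by (simp add: cls_eq_iff[OF fsubspaces'(7) F(1) G(1)])
  qed
  show "I_map ` quot FG_Rbar FG_pm = quot (Oexp UNIV) Oexp_FO"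
  proof (intro equalityI subsetI)
    fix Y assume "Y \<in> I_map ` quot FG_Rbar FG_pm"
    then obtain F where F: "F \<in> FG_Rbar" "Y = I_map (cls FG_Rbar FG_pm F)" by (auto simp: quot_iff)
    show "Y \<in> quot (Oexp UNIV) Oexp_FO"
      unfolding F(2) I_map_cls[OF F(1)] by (rule cls_quot[OF plus_part_Oexp[OF F(1)]])
  next
    fix Y assume "Y \<in> quot (Oexp UNIV) Oexp_FO"
    then obtain G where G: "G \<in> Oexp UNIV" "Y = cls (Oexp UNIV) Oexp_FO G" by (auto simp: quot_iff)
    obtain E where E: "E \<in> FG_Rbar" "(\<lambda>z. G z - plus_part E z) \<in> Oexp_FO" using Oexp_mod_FO[OF G(1)] .
    have "Y = I_map (cls FG_Rbar FG_pm E)"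
      unfolding G(2) I_map_cls[OF E(1)] using E(2) by (simp add: cls_eq_iff[OF fsubspaces'(8) G(1) plus_part_Oexp[OF E(1)]])
    then show "Y \<in> I_map ` quot FG_Rbar FG_pm" using cls_quot[OF E(1)] by blast
  qed
qed

lemma I_map_linear_iso: "quot_linear_iso FG_Rbar FG_pm (Oexp UNIV) Oexp_FO I_map"
  unfolding quot_linear_iso_def
proof (intro conjI ballI allI)
  show "bij_betw I_map (quot FG_Rbar FG_pm) (quot (Oexp UNIV) Oexp_FO)" by (rule I_map_bij)
  fix X assume "X \<in> quot FG_Rbar FG_pm"
  then obtain F where F: "F \<in> FG_Rbar" "X = cls FG_Rbar FG_pm F" by (auto simp: quot_iff)
  show "I_map (qscale FG_Rbar FG_pm a X) = qscale (Oexp UNIV) Oexp_FO a (I_map X)" for a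
    unfolding F(2) I_map_cls[OF F(1)] qscale_cls[OF fsubspaces'(9,7) F(1)]
      I_map_cls[OF fsubspaceD(3)[OF fsubspaces'(9) F(1)]] qscale_cls[OF fsubspaces(1) fsubspaces'(8) plus_part_Oexp[OF F(1)]]
      plus_part_cmult ..
  fix Y assume "Y \<in> quot FG_Rbar FG_pm"
  then obtain G where G: "G \<in> FG_Rbar" "Y = cls FG_Rbar FG_pm G" by (auto simp: quot_iff)
  show "I_map (qadd FG_Rbar FG_pm X Y) = qadd (Oexp UNIV) Oexp_FO (I_map X) (I_map Y)"
    unfolding F(2) G(2) I_map_cls[OF F(1)] I_map_cls[OF G(1)] qadd_cls[OF fsubspaces'(9,7) F(1) G(1)]
      I_map_cls[OF fsubspaceD(2)[OF fsubspaces'(9) F(1) G(1)]]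
      qadd_cls[OF fsubspaces(1) fsubspaces'(8) plus_part_Oexp[OF F(1)] plus_part_Oexp[OF G(1)]] plus_part_add ..
qed

lemma lap_diff:
  assumes F: "F \<in> Hminf UNIV" and G: "G \<in> Hminf UNIV"
  shows "lap 1 (\<lambda>z. F z - G z) = (\<lambda>z. lap 1 F z - lap 1 G z)"
proof
  fix z
  have int: "integrable lborel (\<lambda>x. exp (- \<i> * z * Complex x e) * H (Complex x e))" if H: "H \<in> Hminf UNIV" and e: "e \<in> {1, -1}" for H e
  proof -
    have Hh: "H holomorphic_on - \<real>" and "grow_on 1 1 (- (\<bar>Im z\<bar> + 1)) H"
      using H by (auto simp: Hminf_UNIV_iff hol_def grow_def)
    then obtain K where K: "K \<ge> 0" "\<And>\<zeta>. 1 \<le> \<bar>Im \<zeta>\<bar> \<Longrightarrow> \<bar>Im \<zeta>\<bar> \<le> 1 \<Longrightarrow> norm (exp (- \<i> * z * \<zeta>) * H \<zeta>) \<le> K * exp (- 1 * \<bar>Re \<zeta>\<bar>)"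
      using kernel_shift_bound[of 1 1 z H] by auto
    show ?thesis
    proof (rule integrable_line[where C=K and d=1])
      show "continuous_on UNIV (\<lambda>x. exp (- \<i> * z * Complex x e) * H (Complex x e))"
        by (rule nonreal_line_continuous[where F="\<lambda>\<zeta>. exp (- \<i> * z * \<zeta>) * H \<zeta>"]) (use e Hh in \<open>auto intro!: holomorphic_intros\<close>)
      show "norm (exp (- \<i> * z * Complex x e) * H (Complex x e)) \<le> K * exp (- 1 * \<bar>x\<bar>)" for x
        using K(2)[of "Complex x e"] e by auto
    qed simp
  qed
  show "lap 1 (\<lambda>z. F z - G z) z = lap 1 F z - lap 1 G z"
    unfolding lap_def right_diff_distrib by (rule strip_integral_diff(1)) (use int F G in auto)
qed

lemma L_hyp_eq:
  assumes F: "F \<in> Hminf UNIV" and f: "R_L_inv f = cls (Hminf UNIV) Hminf_pm F"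
  shows "L_hyp f = cls FG_Rbar FG_pm (lap 1 F)"
  unfolding L_hyp_def f
proof (rule the_elem_image[OF cls_self[OF fsubspaces'(4) F]])
  fix g assume "g \<in> cls (Hminf UNIV) Hminf_pm F"
  then have g: "g \<in> Hminf UNIV" "(\<lambda>z. g z - F z) \<in> Hminf_pm"
    using fsubspaceD(5)[OF fsubspaces'(4), of "\<lambda>z. F z - g z"] by (auto simp: cls_iff)
  have "(\<lambda>z. lap 1 g z - lap 1 F z) \<in> FG_pm"
    using lap_Hminf_pm[OF g(2)] unfolding lap_diff[OF g(1) F] .
  then show "cls FG_Rbar FG_pm (L_fourier (cls (Hminf UNIV) Hminf_entire g)) = cls FG_Rbar FG_pm (lap 1 F)"
    unfolding L_fourier_eq[OF g(1) zero_less_one]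
    by (simp add: cls_eq_iff[OF fsubspaces'(7) lap_FG[OF g(1) zero_less_one] lap_FG[OF F zero_less_one]])
qed

text \<open>\<open>F_hyp\<close> ranges over all pairs of a representative and an element of its
  transform. The first choice alters the result by an element of \<open>FO_pm\<close>, the second by
  one of \<open>Oexp_entire\<close>, so a single class remains modulo
  \<open>Oexp_FO\<close>.\<close>

lemma F_hyp_eq:
  assumes F: "F \<in> Hminf UNIV" and f: "R_R_inv f = cls (Oexp UNIV) Oexp_pm F"
  shows "F_hyp f = cls (Oexp UNIV) Oexp_FO (plus_part (lap 1 F))"
  unfolding F_hyp_def f
proof (rule the_elem_unique)
  have FO: "F \<in> Oexp UNIV" using F Hminf_subset_Oexp by blast
  let ?L = "plus_part (lap 1 F)"
  have L: "?L \<in> Oexp UNIV" by (rule plus_part_Oexp[OF lap_FG[OF F zero_less_one]])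
  have "?L \<in> F_Rbar (cls (Oexp UNIV) Oexp_entire F)"
    unfolding F_Rbar_Ftrans[OF Ftrans_lap[OF F]] by (rule cls_self[OF fsubspaces'(1) L])
  then show "{cls (Oexp UNIV) Oexp_FO G |F' G. F' \<in> cls (Oexp UNIV) Oexp_pm F \<and> G \<in> F_Rbar (cls (Oexp UNIV) Oexp_entire F')} \<noteq> {}"
    using cls_self[OF fsubspaces'(2) FO] by blast
  fix X assume "X \<in> {cls (Oexp UNIV) Oexp_FO G |F' G. F' \<in> cls (Oexp UNIV) Oexp_pm F \<and> G \<in> F_Rbar (cls (Oexp UNIV) Oexp_entire F')}"
  then obtain F' G where X: "X = cls (Oexp UNIV) Oexp_FO G" and F': "F' \<in> cls (Oexp UNIV) Oexp_pm F"
    and G: "G \<in> F_Rbar (cls (Oexp UNIV) Oexp_entire F')" by blast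
  have P: "(\<lambda>z. F' z - F z) \<in> Oexp_pm"
    using F' fsubspaceD(5)[OF fsubspaces'(2), of "\<lambda>z. F z - F' z"] by (simp add: cls_iff)
  obtain Q where Q: "Q \<in> FO_pm" "Ftrans (\<lambda>z. F z + (F' z - F z)) (\<lambda>z. ?L z + Q z)" using Ftrans_decompose[OF F P] .
  then have "Ftrans F' (\<lambda>z. ?L z + Q z)" by simp
  then have "G \<in> cls (Oexp UNIV) Oexp_entire (\<lambda>z. ?L z + Q z)" using G F_Rbar_Ftrans by simp
  then have GO: "G \<in> Oexp UNIV" and "(\<lambda>z. (?L z + Q z) - G z) \<in> Oexp_entire" by (auto simp: cls_iff)
  then have "(\<lambda>z. - ((?L z + Q z) - G z) + Q z) \<in> Oexp_FO"
    unfolding Oexp_FO_def by (intro fsum_spaceI fsubspaceD(5)[OF fsubspaces'(1)] Q(1))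
  then have "(\<lambda>z. G z - ?L z) \<in> Oexp_FO" by (simp add: algebra_simps)
  then show "X = cls (Oexp UNIV) Oexp_FO ?L" unfolding X by (simp add: cls_eq_iff[OF fsubspaces'(8) GO L])
qed

theorem theorem6p5:
  shows "(\<forall>F\<in>FG_Rbar. I_map (cls FG_Rbar FG_pm F) = cls (Oexp UNIV) Oexp_FO (plus_part F)) \<and>
         quot_linear_iso FG_Rbar FG_pm (Oexp UNIV) Oexp_FO I_map \<and>
         (\<forall>f\<in>hyperfunctions. I_map (L_hyp f) = F_hyp f)"
proof (intro conjI ballI)
  show "I_map (cls FG_Rbar FG_pm F) = cls (Oexp UNIV) Oexp_FO (plus_part F)" if "F \<in> FG_Rbar" for F
    by (rule I_map_cls[OF that])
  show "quot_linear_iso FG_Rbar FG_pm (Oexp UNIV) Oexp_FO I_map" by (rule I_map_linear_iso)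
  fix f assume "f \<in> hyperfunctions"
  then obtain F where F: "F \<in> Hminf UNIV" "R_L_inv f = cls (Hminf UNIV) Hminf_pm F" "R_R_inv f = cls (Oexp UNIV) Oexp_pm F"
    by (rule hyperfunction_representative)
  show "I_map (L_hyp f) = F_hyp f"
    unfolding L_hyp_eq[OF F(1,2)] F_hyp_eq[OF F(1,3)] by (rule I_map_cls[OF lap_FG[OF F(1) zero_less_one]])
qed

end
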